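(* The weighted orbit space $X_n/G_n$, with all weights of facets equal to one, is a tropical orbit space.
   Context: **Tropical orbit spaces.** A general polyhedral complex $X$ is a topological space $|X|$ with a set $X$ of subsets (polyhedra/cones), each identified with a full-dimensional polyhedron in some $\mathbb{R}^m$, given by finitely many integral linear equalities, non-strict and strict inequalities (so some faces may be missing), compatible by integer affine linear maps, non-empty intersections being common faces, and such that the star of each polyhedron $\tau$ is identified, integer affine linearly, with an open neighbourhood of the origin in a general fan (a fan with some closed cones removed). $X^{(k)}$ is the set of $k$-dimensional polyhedra; $\tau<\sigma$ means $\tau\subsetneq\sigma$. $V_\tau$, $\Lambda_\tau$ are the linear span and its lattice in a local chart, and for $\tau<\sigma$ of codimension $1$, $u_{\sigma/\tau}\in\Lambda_\sigma/\Lambda_\tau$ is the primitive normal vector pointing towards $\sigma$ (also a representative). If a group $G$ acts on $|X|$ such that each $g$ induces an automorphism of $X$, the set $X/G$ of $G$-orbits of $X$ is an orbit space. It is weighted if $X$ is pure of dimension $m$ with $G$-invariant weights $\omega_X:X^{(m)}\to\mathbb{Q}$. Put $G_\tau=\{g\in G\mid g\text{ fixes every point of }\tau\}$, $X_{\sigma/\tau}=\{g(\sigma)\mid g\in G_\tau\}$, $[\omega]([\sigma])=\omega_X(\sigma)/|G_\sigma|$. A weighted orbit space with finitely many classes and $|G_\sigma|<\infty$ for $\sigma\in X^{(m)}$ is a tropical orbit space if for every $\tau\in X^{(m-1)}$ the set $\{\sigma>\tau\}$ is finite and there are $\lambda_{\sigma/\tau}\ge0$ for $\sigma>\tau$ with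 $\sum_{\tilde\sigma\in X_{\sigma/\tau}}\lambda_{\tilde\sigma/\tau}=1$ for every $\sigma>\tau$ and $\sum_{\sigma>\tau}\lambda_{\sigma/\tau}[\omega]([\sigma])u_{\sigma/\tau}\in V_\tau$. **The space $\mathcal{M}_{1,n}$.** An abstract tropical curve is a connected graph with a metric, where bounded edges have finite positive length and leaves have infinite length; $\mathcal{M}_{1,n}$ is the set of isomorphism classes (isometries respecting labels) of such curves $C$ with exactly $n$ leaves, labelled $x_1,\dots,x_n$, all vertices of valence at least $3$, and exactly one simple cycle. Curves with the same graph, or with a graph obtained from it by contracting bounded edges, form a combinatorial cone, with coordinates the lengths of the bounded edges; these are glued along faces representing the same curves, which gives the topology. **$V_n$, $G_n$, $X_n$.** Let $\mathcal{T}$ be the set of two-element subsets of $\{1,\dots,n+2\}$, and write $A=n+1$, $B=n+2$. Let $\Phi_n:\mathbb{R}^n\to\mathbb{R}^{\binom{n+2}{2}}$, $b\mapsto(\tilde b_i+\tilde b_j)_{\{i,j\}\in\mathcal{T}}$ with $\tilde b=(b,0,0)$, and let $s\in\mathbb{R}^{\binom{n+2}{2}}$ have $s_{\{m,A\}}=1$, $s_{\{m,B\}}=-1$ for $m\le n$ and all other entries $0$. Put $V_n=\mathbb{R}^{\binom{n+2}{2}}/(\Phi_n(\mathbb{R}^n)+\langle s\rangle)$. $G_n$ is the group generated by the maps (induced on $V_n$ by) $I$ and $M_p$, $p=1,\dots,n$: $I$ exchanges the coordinates $x_{\{m,A\}}$ and $x_{\{m,B\}}$ for all $m\le n$ and fixes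 all others; $M_p$ maps $x$ to $y$ with $y_{\{p,A\}}=x_{\{p,A\}}-x_{\{A,B\}}$, $y_{\{p,B\}}=x_{\{p,B\}}+x_{\{A,B\}}$, $y_{\{p,k\}}=x_{\{p,k\}}+x_{\{k,A\}}+x_{\{p,B\}}+x_{\{A,B\}}-x_{\{k,B\}}-x_{\{p,A\}}$ for $k\le n$, $k\ne p$, and $y_{\{k,l\}}=x_{\{k,l\}}$ otherwise. For $C\in\mathcal{M}_{1,n}$ choose a point $a$ on its cycle, cut $C$ at $a$ and attach leaves $A=x_{n+1}$, $B=x_{n+2}$ at the two resulting ends (if $a$ is a vertex, decide for each non-cycle edge at it whether it is attached on the $A$- or $B$-side). For the resulting tree $\tilde C$ let $\operatorname{dist}_\Gamma(x_i,x_j)$ be the sum of the lengths of the bounded edges on the path from $x_i$ to $x_j$. The class $\operatorname{dist}_n(C)=[(\operatorname{dist}_\Gamma(x_i,x_j))_{\{i,j\}\in\mathcal{T}}]\in V_n/G_n$ is well defined. With $\Psi_n:V_n\to V_n/G_n$ the quotient map, $X_n=\Psi_n^{-1}(\operatorname{dist}_n(\mathcal{M}_{1,n}))$, with general polyhedra the cones induced by the combinatorial cones of $\mathcal{M}_{1,n}$, and integral structure on each cone given by the edge lengths. $G_n$ acts on $X_n$. All facets have weight one. *)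

theory Defs
  imports
    "HOL-Analysis.Analysis"
    "HOL-Algebra.Bij"
    "HOL-Algebra.Generated_Groups"
    "HOL-Algebra.Group_Action"
begin

section \<open>Lattices, general polyhedra and general fans\<close>

text \<open>
  Instead of the pair consisting of \<open>\<real>\<^sup>m\<close> and its standard lattice we use a lattice \<open>L\<close> in a
  real vector space, together with the space \<open>span L\<close>; a basis of \<open>L\<close> identifies the two.
\<close>

definition is_lattice :: "'v::real_vector set \<Rightarrow> bool" where
  "is_lattice L \<longleftrightarrow> (\<exists>B. finite B \<and> independent B \<and>
     L = {\<Sum>b\<in>B. of_int (k b) *\<^sub>R b | k :: 'v \<Rightarrow> int. True})"

definition int_form :: "'v::real_vector set \<Rightarrow> ('v \<Rightarrow> real) \<Rightarrow> bool" where
  "int_form L f \<longleftrightarrow> linear f \<and> f ` L \<subseteq> \<int>"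

text \<open>As usual for rational polyhedra, the linear forms are integral and the constants are real.\<close>

definition general_polyhedron :: "'v::real_vector set \<Rightarrow> 'v set \<Rightarrow> bool" where
  "general_polyhedron L P \<longleftrightarrow>
     (\<exists>E N S :: (('v \<Rightarrow> real) \<times> real) set.
        finite E \<and> finite N \<and> finite S \<and> (\<forall>(f, c) \<in> E \<union> N \<union> S. int_form L f) \<and>
        P = {x \<in> span L. (\<forall>(f, c) \<in> E. f x = c) \<and> (\<forall>(f, c) \<in> N. f x \<ge> c) \<and> (\<forall>(f, c) \<in> S. f x > c)})"

definition rational_cone :: "'v::real_vector set \<Rightarrow> 'v set \<Rightarrow> bool" where
  "rational_cone L C \<longleftrightarrow>
     (\<exists>N. finite N \<and> (\<forall>f\<in>N. int_form L f) \<and> C = {x \<in> span L. \<forall>f\<in>N. f x \<ge> 0})"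

definition fan :: "'v::real_vector set \<Rightarrow> 'v set set \<Rightarrow> bool" where
  "fan L F \<longleftrightarrow> finite F \<and> (\<forall>C\<in>F. rational_cone L C) \<and>
     (\<forall>C\<in>F. \<forall>D. D face_of C \<and> D \<noteq> {} \<longrightarrow> D \<in> F) \<and>
     (\<forall>C\<in>F. \<forall>D\<in>F. C \<inter> D face_of C \<and> C \<inter> D face_of D)"

definition general_fan :: "'v::real_vector set \<Rightarrow> 'v set set \<Rightarrow> bool" where
  "general_fan L F \<longleftrightarrow> (\<exists>F0 R. fan L F0 \<and> R \<subseteq> F0 \<and> F = {C - \<Union>R | C. C \<in> F0} - {{}})"

text \<open>
  The initial topology with respect to all linear functionals. It induces the usual Euclidean
  topology on every finite-dimensional subspace.
\<close>

definition lin_topology :: "'v::real_vector topology" where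
  "lin_topology = topology_generated_by {f -` U | (f :: 'v \<Rightarrow> real) U. linear f \<and> open U}"

text \<open>
  The coordinate change from \<open>\<phi>\<close> to \<open>\<psi>\<close> on \<open>D\<close> is an injective integer affine linear map,
  identifying \<open>L\<close> with all lattice points of \<open>L'\<close> in the corresponding subspace.
\<close>

definition int_affine_embedding ::
  "'v::real_vector set \<Rightarrow> 'v set \<Rightarrow> 'a set \<Rightarrow> ('a \<Rightarrow> 'v) \<Rightarrow> ('a \<Rightarrow> 'v) \<Rightarrow> bool" where
  "int_affine_embedding L L' D \<phi> \<psi> \<longleftrightarrow>
     (\<exists>A b. linear A \<and> inj_on A (span L) \<and> A ` L = L' \<inter> A ` span L \<and>
        (\<forall>x\<in>D. \<psi> x = A (\<phi> x) + b))"


section \<open>General polyhedral complexes\<close>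

record ('a, 'v) gpc =
  gtop :: "'a topology"
  polys :: "'a set set"
  chart :: "'a set \<Rightarrow> 'a \<Rightarrow> 'v"
  lat :: "'a set \<Rightarrow> 'v set"
  star_chart :: "'a set \<Rightarrow> 'a \<Rightarrow> 'v"
  star_lat :: "'a set \<Rightarrow> 'v set"

definition rel_int :: "('a, 'v) gpc \<Rightarrow> 'a set \<Rightarrow> 'a set" where
  "rel_int X \<sigma> = \<sigma> - \<Union>{\<rho> \<in> polys X. \<rho> \<subset> \<sigma>}"

definition star :: "('a, 'v) gpc \<Rightarrow> 'a set \<Rightarrow> 'a set" where
  "star X \<tau> = \<Union>{rel_int X \<sigma> | \<sigma>. \<sigma> \<in> polys X \<and> \<tau> \<subseteq> \<sigma>}"

definition poly_dim :: "('a, 'v::real_vector) gpc \<Rightarrow> 'a set \<Rightarrow> nat" where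
  "poly_dim X \<sigma> = dim (lat X \<sigma>)"

definition polyhedral_charts :: "('a, 'v::real_vector) gpc \<Rightarrow> bool" where
  "polyhedral_charts X \<longleftrightarrow> (\<forall>\<sigma> \<in> polys X.
     is_lattice (lat X \<sigma>) \<and>
     general_polyhedron (lat X \<sigma>) (chart X \<sigma> ` \<sigma>) \<and>
     affine hull (chart X \<sigma> ` \<sigma>) = span (lat X \<sigma>) \<and>
     homeomorphic_map (subtopology (gtop X) \<sigma>) (subtopology lin_topology (chart X \<sigma> ` \<sigma>)) (chart X \<sigma>))"

definition star_is_fan :: "('a, 'v::real_vector) gpc \<Rightarrow> 'a set \<Rightarrow> bool" where
  "star_is_fan X \<tau> \<longleftrightarrow> is_lattice (star_lat X \<tau>) \<and>
     (let \<theta> = star_chart X \<tau>; U = \<theta> ` star X \<tau> in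
       homeomorphic_map (subtopology (gtop X) (star X \<tau>)) (subtopology lin_topology U) \<theta> \<and>
       (\<exists>F. general_fan (star_lat X \<tau>) F \<and> 0 \<in> U \<and>
          openin (subtopology lin_topology (\<Union>F)) U \<and>
          {\<theta> ` (\<sigma> \<inter> star X \<tau>) | \<sigma>. \<sigma> \<in> polys X \<and> \<tau> \<subseteq> \<sigma>} = {U \<inter> C | C. C \<in> F}) \<and>
       (\<forall>\<sigma>\<in>polys X. \<tau> \<subseteq> \<sigma> \<longrightarrow>
          int_affine_embedding (lat X \<sigma>) (star_lat X \<tau>) (\<sigma> \<inter> star X \<tau>) (chart X \<sigma>) \<theta>))"

definition general_polyhedral_complex :: "('a, 'v::real_vector) gpc \<Rightarrow> bool" where
  "general_polyhedral_complex X \<longleftrightarrow>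
     \<Union>(polys X) = topspace (gtop X) \<and> {} \<notin> polys X \<and>
     polyhedral_charts X \<and>
     (\<forall>\<sigma>\<in>polys X. \<forall>F. F face_of (chart X \<sigma> ` \<sigma>) \<and> F \<noteq> {} \<longrightarrow> {x\<in>\<sigma>. chart X \<sigma> x \<in> F} \<in> polys X) \<and>
     (\<forall>\<sigma>\<in>polys X. \<forall>\<tau>\<in>polys X. \<sigma> \<inter> \<tau> \<noteq> {} \<longrightarrow> chart X \<sigma> ` (\<sigma> \<inter> \<tau>) face_of chart X \<sigma> ` \<sigma>) \<and>
     (\<forall>\<sigma>\<in>polys X. \<forall>\<tau>\<in>polys X. \<tau> \<subseteq> \<sigma> \<longrightarrow>
        int_affine_embedding (lat X \<tau>) (lat X \<sigma>) \<tau> (chart X \<tau>) (chart X \<sigma>)) \<and>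
     (\<forall>\<tau>\<in>polys X. star_is_fan X \<tau>)"

definition pure_dim :: "('a, 'v::real_vector) gpc \<Rightarrow> nat \<Rightarrow> bool" where
  "pure_dim X m \<longleftrightarrow> (\<forall>\<sigma>\<in>polys X. poly_dim X \<sigma> \<le> m \<and>
     (\<exists>\<rho>\<in>polys X. \<sigma> \<subseteq> \<rho> \<and> poly_dim X \<rho> = m))"

text \<open>An automorphism respects the topology, the polyhedra, and both kinds of charts.\<close>

definition gpc_automorphism :: "('a, 'v::real_vector) gpc \<Rightarrow> ('a \<Rightarrow> 'a) \<Rightarrow> bool" where
  "gpc_automorphism X h \<longleftrightarrow> homeomorphic_map (gtop X) (gtop X) h \<and>
     (\<lambda>\<sigma>. h ` \<sigma>) ` polys X = polys X \<and>
     (\<forall>\<sigma>\<in>polys X.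
        int_affine_embedding (lat X \<sigma>) (lat X (h ` \<sigma>)) \<sigma> (chart X \<sigma>) (chart X (h ` \<sigma>) \<circ> h) \<and>
        int_affine_embedding (star_lat X \<sigma>) (star_lat X (h ` \<sigma>)) (star X \<sigma>)
          (star_chart X \<sigma>) (star_chart X (h ` \<sigma>) \<circ> h))"


section \<open>Tropical orbit spaces\<close>

definition orbit_classes ::
  "('a, 'v) gpc \<Rightarrow> ('g, 'b) monoid_scheme \<Rightarrow> ('g \<Rightarrow> 'a \<Rightarrow> 'a) \<Rightarrow> 'a set set set" where
  "orbit_classes X G act = orbits G (polys X) (\<lambda>g \<sigma>. act g ` \<sigma>)"

definition orbit_space ::
  "('a, 'v::real_vector) gpc \<Rightarrow> ('g, 'b) monoid_scheme \<Rightarrow> ('g \<Rightarrow> 'a \<Rightarrow> 'a) \<Rightarrow> bool" where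
  "orbit_space X G act \<longleftrightarrow> general_polyhedral_complex X \<and>
     group_action G (topspace (gtop X)) act \<and> (\<forall>g\<in>carrier G. gpc_automorphism X (act g))"

definition weighted_orbit_space ::
  "('a, 'v::real_vector) gpc \<Rightarrow> ('g, 'b) monoid_scheme \<Rightarrow> ('g \<Rightarrow> 'a \<Rightarrow> 'a) \<Rightarrow>
     nat \<Rightarrow> ('a set \<Rightarrow> rat) \<Rightarrow> bool" where
  "weighted_orbit_space X G act m \<omega> \<longleftrightarrow> orbit_space X G act \<and> pure_dim X m \<and>
     (\<forall>g\<in>carrier G. \<forall>\<sigma>\<in>polys X. poly_dim X \<sigma> = m \<longrightarrow> \<omega> (act g ` \<sigma>) = \<omega> \<sigma>)"

text \<open>The group \<open>G\<^sub>\<tau>\<close> (pointwise, unlike the library's \<^const>\<open>stabilizer\<close> of \<open>\<tau>\<close>).\<close>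

definition fixer :: "('g, 'b) monoid_scheme \<Rightarrow> ('g \<Rightarrow> 'a \<Rightarrow> 'a) \<Rightarrow> 'a set \<Rightarrow> 'g set" where
  "fixer G act \<tau> = {g \<in> carrier G. \<forall>x\<in>\<tau>. act g x = x}"

definition fixer_orbit ::
  "('g, 'b) monoid_scheme \<Rightarrow> ('g \<Rightarrow> 'a \<Rightarrow> 'a) \<Rightarrow> 'a set \<Rightarrow> 'a set \<Rightarrow> 'a set set" where
  "fixer_orbit G act \<sigma> \<tau> = {act g ` \<sigma> | g. g \<in> fixer G act \<tau>}"

definition orbit_weight ::
  "('g, 'b) monoid_scheme \<Rightarrow> ('g \<Rightarrow> 'a \<Rightarrow> 'a) \<Rightarrow> ('a set \<Rightarrow> rat) \<Rightarrow> 'a set \<Rightarrow> rat" where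
  "orbit_weight G act \<omega> \<sigma> = \<omega> \<sigma> / of_nat (card (fixer G act \<sigma>))"

definition above :: "('a, 'v) gpc \<Rightarrow> 'a set \<Rightarrow> 'a set set" where
  "above X \<tau> = {\<sigma> \<in> polys X. \<tau> \<subset> \<sigma>}"

text \<open>
  \<open>V\<^sub>\<sigma>\<close> and \<open>\<Lambda>\<^sub>\<sigma>\<close> in the chart at \<open>\<tau>\<close>, for \<open>\<tau> \<subseteq> \<sigma>\<close>. The image of every such \<open>\<sigma>\<close> contains the
  origin, so that its linear span is its space of directions.
\<close>

definition loc_span :: "('a, 'v::real_vector) gpc \<Rightarrow> 'a set \<Rightarrow> 'a set \<Rightarrow> 'v set" where
  "loc_span X \<tau> \<sigma> = span (star_chart X \<tau> ` (\<sigma> \<inter> star X \<tau>))"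

definition loc_lat :: "('a, 'v::real_vector) gpc \<Rightarrow> 'a set \<Rightarrow> 'a set \<Rightarrow> 'v set" where
  "loc_lat X \<tau> \<sigma> = star_lat X \<tau> \<inter> loc_span X \<tau> \<sigma>"

text \<open>\<open>u\<close> represents the primitive normal vector \<open>u\<^bsub>\<sigma>/\<tau>\<^esub> \<in> \<Lambda>\<^sub>\<sigma> / \<Lambda>\<^sub>\<tau>\<close>.\<close>

definition primitive_normal ::
  "('a, 'v::real_vector) gpc \<Rightarrow> 'a set \<Rightarrow> 'a set \<Rightarrow> 'v \<Rightarrow> bool" where
  "primitive_normal X \<tau> \<sigma> u \<longleftrightarrow> u \<in> loc_lat X \<tau> \<sigma> \<and>
     (\<forall>v\<in>loc_lat X \<tau> \<sigma>. \<exists>k::int. v - of_int k *\<^sub>R u \<in> loc_lat X \<tau> \<tau>) \<and>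
     (\<forall>x\<in>\<sigma> \<inter> star X \<tau>. \<exists>c\<ge>0. star_chart X \<tau> x - c *\<^sub>R u \<in> loc_span X \<tau> \<tau>)"

definition balanced_at ::
  "('a, 'v::real_vector) gpc \<Rightarrow> ('g, 'b) monoid_scheme \<Rightarrow> ('g \<Rightarrow> 'a \<Rightarrow> 'a) \<Rightarrow>
     ('a set \<Rightarrow> rat) \<Rightarrow> 'a set \<Rightarrow> bool" where
  "balanced_at X G act \<omega> \<tau> \<longleftrightarrow>
     (\<exists>(lam :: 'a set \<Rightarrow> real) u.
        (\<forall>\<sigma>\<in>above X \<tau>. lam \<sigma> \<ge> 0 \<and> primitive_normal X \<tau> \<sigma> (u \<sigma>) \<and>
           (\<Sum>\<sigma>'\<in>fixer_orbit G act \<sigma> \<tau>. lam \<sigma>') = 1) \<and>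
        (\<Sum>\<sigma>\<in>above X \<tau>. (lam \<sigma> * of_rat (orbit_weight G act \<omega> \<sigma>)) *\<^sub>R u \<sigma>) \<in> loc_span X \<tau> \<tau>)"

definition tropical_orbit_space ::
  "('a, 'v::real_vector) gpc \<Rightarrow> ('g, 'b) monoid_scheme \<Rightarrow> ('g \<Rightarrow> 'a \<Rightarrow> 'a) \<Rightarrow>
     ('a set \<Rightarrow> rat) \<Rightarrow> bool" where
  "tropical_orbit_space X G act \<omega> \<longleftrightarrow>
     (\<exists>m. weighted_orbit_space X G act m \<omega> \<and> finite (orbit_classes X G act) \<and>
        (\<forall>\<sigma>\<in>polys X. poly_dim X \<sigma> = m \<longrightarrow> finite (fixer G act \<sigma>)) \<and>
        (\<forall>\<tau>\<in>polys X. poly_dim X \<tau> + 1 = m \<longrightarrow> finite (above X \<tau>) \<and> balanced_at X G act \<omega> \<tau>))"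


section \<open>Graphs and elliptic tropical curves\<close>

text \<open>
  A finite graph with labelled leaves; loops and multiple edges are allowed. The orientation of a
  bounded edge, given by \<open>tail\<close> and \<open>head\<close>, is auxiliary. \<open>leaf l\<close> is the vertex carrying leaf \<open>l\<close>.
\<close>

record 'l graph =
  verts :: "nat set"
  edges :: "nat set"
  tail :: "nat \<Rightarrow> nat"
  head :: "nat \<Rightarrow> nat"
  leaf :: "'l \<Rightarrow> nat"

definition wf_graph :: "'l graph \<Rightarrow> bool" where
  "wf_graph G \<longleftrightarrow> finite (verts G) \<and> finite (edges G) \<and>
     (\<forall>e\<in>edges G. tail G e \<in> verts G \<and> head G e \<in> verts G) \<and> (\<forall>l. leaf G l \<in> verts G)"

definition joins :: "'l graph \<Rightarrow> nat \<Rightarrow> nat \<Rightarrow> nat \<Rightarrow> bool" where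
  "joins G e u v \<longleftrightarrow> e \<in> edges G \<and>
     (tail G e = u \<and> head G e = v \<or> tail G e = v \<and> head G e = u)"

definition connected_graph :: "'l graph \<Rightarrow> bool" where
  "connected_graph G \<longleftrightarrow> verts G \<noteq> {} \<and>
     (\<forall>u\<in>verts G. \<forall>v\<in>verts G. (u, v) \<in> {(a, b). \<exists>e. joins G e a b}\<^sup>*)"

text \<open>A loop contributes two to the valence of its vertex.\<close>

definition valence :: "'l graph \<Rightarrow> nat \<Rightarrow> nat" where
  "valence G v = card {e \<in> edges G. tail G e = v} + card {e \<in> edges G. head G e = v} +
     card {l. leaf G l = v}"

definition simple_path :: "'l graph \<Rightarrow> nat list \<Rightarrow> nat list \<Rightarrow> bool" where
  "simple_path G vs es \<longleftrightarrow> set vs \<subseteq> verts G \<and> distinct vs \<and> length vs = Suc (length es) \<and>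
     (\<forall>i<length es. joins G (es ! i) (vs ! i) (vs ! Suc i))"

definition simple_cycle :: "'l graph \<Rightarrow> nat list \<Rightarrow> nat list \<Rightarrow> bool" where
  "simple_cycle G vs es \<longleftrightarrow> es \<noteq> [] \<and> distinct vs \<and> distinct es \<and> length vs = length es \<and>
     (\<forall>i<length es. joins G (es ! i) (vs ! i) (vs ! (Suc i mod length es)))"

definition cycle_edges :: "'l graph \<Rightarrow> nat set" where
  "cycle_edges G = \<Union>{set es | vs es. simple_cycle G vs es}"

definition elliptic_graph :: "'l::finite graph \<Rightarrow> bool" where
  "elliptic_graph G \<longleftrightarrow> wf_graph G \<and> connected_graph G \<and> (\<forall>v\<in>verts G. valence G v \<ge> 3) \<and>
     (\<exists>!C. \<exists>vs es. simple_cycle G vs es \<and> C = set es)"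

type_synonym 'l metric_graph = "'l graph \<times> (nat \<Rightarrow> real)"

definition elliptic_curve :: "'l::finite metric_graph \<Rightarrow> bool" where
  "elliptic_curve = (\<lambda>(G, len). elliptic_graph G \<and> (\<forall>e\<in>edges G. len e > 0))"

text \<open>
  Since all vertices have valence at least three, a label-preserving isometry is the same as an
  isomorphism of the labelled graphs preserving the edge lengths.
\<close>

definition curve_iso :: "('l::finite metric_graph \<times> 'l metric_graph) set" where
  "curve_iso = {((G, len), (G', len')). elliptic_curve (G, len) \<and> elliptic_curve (G', len') \<and>
     (\<exists>f h. bij_betw f (verts G) (verts G') \<and> bij_betw h (edges G) (edges G') \<and>
        (\<forall>e\<in>edges G. {tail G' (h e), head G' (h e)} = f ` {tail G e, head G e}) \<and>
        (\<forall>e\<in>edges G. len' (h e) = len e) \<and> (\<forall>l. leaf G' l = f (leaf G l)))}"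

text \<open>\<open>\<M>\<^bsub>1,n\<^esub>\<close>, with the leaves labelled by a type \<open>'n\<close> with \<open>n\<close> elements.\<close>

definition M1 :: "'n::finite metric_graph set set" where
  "M1 = {C. elliptic_curve C} // curve_iso"


section \<open>Cutting the cycle\<close>

datatype 'n leaf = Leg 'n | LA | LB

text \<open>
  Split the vertex \<open>v\<close>: \<open>v\<close> receives the leaf \<open>A\<close> and a new vertex \<open>v'\<close> receives \<open>B\<close>. The ends of
  edges that move to \<open>v'\<close> are the tails of the edges in \<open>St\<close> and the heads of those in \<open>Sh\<close>, and
  the leaves in \<open>Sl\<close> move as well.
\<close>

definition split_vertex ::
  "'n graph \<Rightarrow> nat \<Rightarrow> nat \<Rightarrow> nat set \<Rightarrow> nat set \<Rightarrow> 'n set \<Rightarrow> 'n leaf graph" where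
  "split_vertex G v v' St Sh Sl =
     \<lparr> verts = insert v' (verts G), edges = edges G,
       tail = (\<lambda>e. if e \<in> St then v' else tail G e),
       head = (\<lambda>e. if e \<in> Sh then v' else head G e),
       leaf = (\<lambda>l. case l of Leg p \<Rightarrow> if p \<in> Sl then v' else leaf G p | LA \<Rightarrow> v | LB \<Rightarrow> v') \<rparr>"

text \<open>
  Of the two ends of cycle edges at \<open>v\<close>, exactly one has to move. In particular \<open>v\<close> lies on the
  cycle.
\<close>

definition vertex_cut :: "'n graph \<Rightarrow> nat \<Rightarrow> 'n leaf graph \<Rightarrow> bool" where
  "vertex_cut G v T \<longleftrightarrow> v \<in> verts G \<and>
     (\<exists>v' St Sh Sl. v' \<notin> verts G \<and>
        St \<subseteq> {e \<in> edges G. tail G e = v} \<and> Sh \<subseteq> {e \<in> edges G. head G e = v} \<and>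
        Sl \<subseteq> {l. leaf G l = v} \<and>
        card (cycle_edges G \<inter> St) + card (cycle_edges G \<inter> Sh) = 1 \<and>
        T = split_vertex G v v' St Sh Sl)"

definition subdivide :: "'l graph \<Rightarrow> nat \<Rightarrow> nat \<Rightarrow> nat \<Rightarrow> 'l graph" where
  "subdivide G e w e' =
     G \<lparr> verts := insert w (verts G), edges := insert e' (edges G),
         tail := (tail G)(e' := w), head := (head G)(e' := head G e, e := w) \<rparr>"

text \<open>
  The metric trees obtained from a curve by cutting at a point of its cycle: either a vertex, or a
  point in the interior of an edge \<open>e\<close>, which is first made a two-valent vertex.
\<close>

definition curve_cut :: "'n metric_graph \<Rightarrow> 'n leaf metric_graph \<Rightarrow> bool" where
  "curve_cut = (\<lambda>(G, len) (T, len').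
     (\<exists>v. vertex_cut G v T \<and> len' = len) \<or>
     (\<exists>e t w e'. e \<in> cycle_edges G \<and> 0 < t \<and> t < len e \<and> w \<notin> verts G \<and> e' \<notin> edges G \<and>
        vertex_cut (subdivide G e w e') w T \<and> len' = len(e := t, e' := len e - t)))"


section \<open>The vector space \<open>V\<^sub>n\<close>\<close>

typedef 'n pairs = "{S :: 'n leaf set. card S = 2}"
proof
  show "{LA, LB} \<in> {S :: 'n leaf set. card S = 2}" by simp
qed

instance leaf :: (finite) finite
proof
  have "(UNIV :: 'a leaf set) = range Leg \<union> {LA, LB}"
    by (auto intro: leaf.exhaust)
  then show "finite (UNIV :: 'a leaf set)" by (metis finite.emptyI finite.insertI finite_UnI finite_imageI finite)
qed

instance pairs :: (finite) finite
proof
  have "inj (Rep_pairs :: 'a pairs \<Rightarrow> 'a leaf set)" by (simp add: Rep_pairs_inject inj_def)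
  then show "finite (UNIV :: 'a pairs set)" by (rule finite_imageD[rotated]) simp
qed

definition pr :: "'n leaf \<Rightarrow> 'n leaf \<Rightarrow> 'n pairs" where
  "pr i j = Abs_pairs {i, j}"

primrec ext_zero :: "real ^ 'n \<Rightarrow> 'n leaf \<Rightarrow> real" where
  "ext_zero b (Leg m) = b $ m" | "ext_zero b LA = 0" | "ext_zero b LB = 0"

definition Phi :: "real ^ 'n \<Rightarrow> real ^ 'n::finite pairs" where
  "Phi b = (\<chi> S. \<Sum>i\<in>Rep_pairs S. ext_zero b i)"

definition s_vec :: "real ^ 'n::finite pairs" where
  "s_vec = (\<chi> S. if \<exists>m. S = pr (Leg m) LA then 1 else if \<exists>m. S = pr (Leg m) LB then - 1 else 0)"

definition vn_rel :: "real ^ 'n::finite pairs \<Rightarrow> real ^ 'n pairs \<Rightarrow> bool" where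
  "vn_rel x y \<longleftrightarrow> (\<exists>b c. x - y = Phi b + c *\<^sub>R s_vec)"

lemma Phi_add: "Phi (a + b) = Phi a + Phi b"
proof -
  have "ext_zero (a + b) i = ext_zero a i + ext_zero b i" for i by (cases i) auto
  then show ?thesis by (simp add: Phi_def vec_eq_iff sum.distrib)
qed

lemma Phi_scale: "Phi (c *\<^sub>R a) = c *\<^sub>R Phi a"
proof -
  have "ext_zero (c *\<^sub>R a) i = c * ext_zero a i" for i by (cases i) auto
  then show ?thesis by (simp add: Phi_def vec_eq_iff sum_distrib_left)
qed

lemma vn_rel_refl: "vn_rel x x"
  unfolding vn_rel_def by (rule exI[of _ 0], rule exI[of _ 0]) (use Phi_scale[of 0 0] in simp)

lemma vn_rel_scale: "vn_rel x y \<Longrightarrow> vn_rel (r *\<^sub>R x) (r *\<^sub>R y)"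
  unfolding vn_rel_def by (metis Phi_scale scaleR_diff_right scaleR_right_distrib scaleR_scaleR)

lemma vn_rel_add: 
  assumes "vn_rel x y" "vn_rel x' y'" shows "vn_rel (x + x') (y + y')"
proof -
  obtain b c b' c' where "x - y = Phi b + c *\<^sub>R s_vec" "x' - y' = Phi b' + c' *\<^sub>R s_vec"
    using assms unfolding vn_rel_def by blast
  then have "(x + x') - (y + y') = Phi (b + b') + (c + c') *\<^sub>R s_vec"
    by (simp add: Phi_add scaleR_left_distrib algebra_simps)
  then show ?thesis unfolding vn_rel_def by blast
qed

lemma equivp_vn_rel: "equivp vn_rel"
proof (rule equivpI)
  show "reflp vn_rel" by (simp add: reflp_def vn_rel_refl)
  show "symp vn_rel"
  proof (rule sympI)
    fix x y assume "vn_rel x y"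
    from vn_rel_add[OF vn_rel_scale[OF this, of "-1"] vn_rel_refl[of "x + y"]]
    show "vn_rel y x" by simp
  qed
  show "transp vn_rel"
  proof (rule transpI)
    fix x y z assume "vn_rel x y" "vn_rel y z"
    from vn_rel_add[OF vn_rel_add[OF this] vn_rel_refl[of "- y"]]
    show "vn_rel x z" by simp
  qed
qed

quotient_type 'n vn = "real ^ 'n::finite pairs" / vn_rel
  morphisms rep_vn cls
  by (rule equivp_vn_rel)

instantiation vn :: (finite) real_vector
begin

lift_definition zero_vn :: "'a vn" is 0 .
lift_definition plus_vn :: "'a vn \<Rightarrow> 'a vn \<Rightarrow> 'a vn" is "(+)" by (rule vn_rel_add)
lift_definition scaleR_vn :: "real \<Rightarrow> 'a vn \<Rightarrow> 'a vn" is "(*\<^sub>R)" by (rule vn_rel_scale)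
lift_definition uminus_vn :: "'a vn \<Rightarrow> 'a vn" is uminus
  by (metis scaleR_minus1_left vn_rel_scale)
lift_definition minus_vn :: "'a vn \<Rightarrow> 'a vn \<Rightarrow> 'a vn" is "(-)"
  by (metis scaleR_minus1_left vn_rel_scale vn_rel_add diff_conv_add_uminus)

instance
  by standard (transfer; simp add: algebra_simps vn_rel_refl)+

end


section \<open>The group \<open>G\<^sub>n\<close>\<close>

definition I_coord :: "real ^ 'n::finite pairs \<Rightarrow> real ^ 'n pairs" where
  "I_coord x = (\<chi> S.
     if \<exists>m. S = pr (Leg m) LA then x $ pr (Leg (THE m. S = pr (Leg m) LA)) LB
     else if \<exists>m. S = pr (Leg m) LB then x $ pr (Leg (THE m. S = pr (Leg m) LB)) LA
     else x $ S)"

definition M_coord :: "'n \<Rightarrow> real ^ 'n::finite pairs \<Rightarrow> real ^ 'n pairs" where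
  "M_coord p x = (\<chi> S.
     if S = pr (Leg p) LA then x $ S - x $ pr LA LB
     else if S = pr (Leg p) LB then x $ S + x $ pr LA LB
     else if \<exists>k. k \<noteq> p \<and> S = pr (Leg p) (Leg k) then
       (let k = (THE k. k \<noteq> p \<and> S = pr (Leg p) (Leg k)) in
          x $ S + x $ pr (Leg k) LA + x $ pr (Leg p) LB + x $ pr LA LB
            - x $ pr (Leg k) LB - x $ pr (Leg p) LA)
     else x $ S)"

lemma pr_eq_iff: "i \<noteq> j \<Longrightarrow> k \<noteq> l \<Longrightarrow> pr i j = pr k l \<longleftrightarrow> i = k \<and> j = l \<or> i = l \<and> j = k"
  unfolding pr_def by (subst Abs_pairs_inject) (auto simp: doubleton_eq_iff)

lemma pr_commute: "pr i j = pr j i"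
  by (simp add: pr_def insert_commute)

lemma pairs_cases:
  obtains m where "S = pr (Leg m) LA" | m where "S = pr (Leg m) LB" | "S = pr LA LB"
    | k l where "k \<noteq> l" "S = pr (Leg k) (Leg l)"
proof -
  obtain i j where "i \<noteq> j" "Rep_pairs S = {i, j}"
    using Rep_pairs[of S] by (auto simp: card_2_iff)
  then have "S = pr i j" by (metis Rep_pairs_inverse pr_def)
  with \<open>i \<noteq> j\<close> show thesis
    by (cases i; cases j) (auto simp: pr_commute intro: that)
qed

lemma Phi_nth: "i \<noteq> j \<Longrightarrow> Phi b $ pr i j = ext_zero b i + ext_zero b j"
  by (simp add: Phi_def pr_def Abs_pairs_inverse)

lemma s_vec_nth:
  "s_vec $ pr (Leg m) LA = 1" "s_vec $ pr (Leg m) LB = - 1" "s_vec $ pr LA LB = 0"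
  "k \<noteq> l \<Longrightarrow> s_vec $ pr (Leg k) (Leg l) = 0"
  by (auto simp: s_vec_def pr_eq_iff)

lemma I_coord_nth:
  "I_coord x $ pr (Leg m) LA = x $ pr (Leg m) LB" "I_coord x $ pr (Leg m) LB = x $ pr (Leg m) LA"
  "I_coord x $ pr LA LB = x $ pr LA LB"
  "k \<noteq> l \<Longrightarrow> I_coord x $ pr (Leg k) (Leg l) = x $ pr (Leg k) (Leg l)"
  by (auto simp: I_coord_def pr_eq_iff)

lemma M_coord_nth:
  "M_coord p x $ pr (Leg p) LA = x $ pr (Leg p) LA - x $ pr LA LB"
  "M_coord p x $ pr (Leg p) LB = x $ pr (Leg p) LB + x $ pr LA LB"
  "k \<noteq> p \<Longrightarrow> M_coord p x $ pr (Leg p) (Leg k) =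
     x $ pr (Leg p) (Leg k) + x $ pr (Leg k) LA + x $ pr (Leg p) LB + x $ pr LA LB
       - x $ pr (Leg k) LB - x $ pr (Leg p) LA"
  "k \<noteq> p \<Longrightarrow> M_coord p x $ pr (Leg k) LA = x $ pr (Leg k) LA"
  "k \<noteq> p \<Longrightarrow> M_coord p x $ pr (Leg k) LB = x $ pr (Leg k) LB"
  "M_coord p x $ pr LA LB = x $ pr LA LB"
  "k \<noteq> p \<Longrightarrow> l \<noteq> p \<Longrightarrow> k \<noteq> l \<Longrightarrow> M_coord p x $ pr (Leg k) (Leg l) = x $ pr (Leg k) (Leg l)"
proof -
  assume "k \<noteq> p"
  then have "(THE k'. k' \<noteq> p \<and> pr (Leg p) (Leg k) = pr (Leg p) (Leg k')) = k"
    by (intro the_equality) (auto simp: pr_eq_iff)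
  then show "M_coord p x $ pr (Leg p) (Leg k) =
     x $ pr (Leg p) (Leg k) + x $ pr (Leg k) LA + x $ pr (Leg p) LB + x $ pr LA LB
       - x $ pr (Leg k) LB - x $ pr (Leg p) LA"
    using \<open>k \<noteq> p\<close> by (auto simp: M_coord_def pr_eq_iff)
qed (auto simp: M_coord_def pr_eq_iff)

lemma pairs_vec_eqI:
  assumes "\<And>m. x $ pr (Leg m) LA = y $ pr (Leg m) LA" "\<And>m. x $ pr (Leg m) LB = y $ pr (Leg m) LB"
    "x $ pr LA LB = y $ pr LA LB" "\<And>k l. k \<noteq> l \<Longrightarrow> x $ pr (Leg k) (Leg l) = y $ pr (Leg k) (Leg l)"
  shows "x = y"
  unfolding vec_eq_iff using assms by (metis pairs_cases)

lemma M_coord_eqI: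
  assumes "y $ pr (Leg p) LA = x $ pr (Leg p) LA - x $ pr LA LB"
    "y $ pr (Leg p) LB = x $ pr (Leg p) LB + x $ pr LA LB"
    "\<And>k. k \<noteq> p \<Longrightarrow> y $ pr (Leg p) (Leg k) =
       x $ pr (Leg p) (Leg k) + x $ pr (Leg k) LA + x $ pr (Leg p) LB + x $ pr LA LB
         - x $ pr (Leg k) LB - x $ pr (Leg p) LA"
    "\<And>k. k \<noteq> p \<Longrightarrow> y $ pr (Leg k) LA = x $ pr (Leg k) LA"
    "\<And>k. k \<noteq> p \<Longrightarrow> y $ pr (Leg k) LB = x $ pr (Leg k) LB"
    "y $ pr LA LB = x $ pr LA LB"
    "\<And>k l. k \<noteq> p \<Longrightarrow> l \<noteq> p \<Longrightarrow> k \<noteq> l \<Longrightarrow> y $ pr (Leg k) (Leg l) = x $ pr (Leg k) (Leg l)"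
  shows "M_coord p x = y"
proof (rule pairs_vec_eqI)
  fix m show "M_coord p x $ pr (Leg m) LA = y $ pr (Leg m) LA"
    using assms by (cases "m = p") (simp_all add: M_coord_nth)
next
  fix m show "M_coord p x $ pr (Leg m) LB = y $ pr (Leg m) LB"
    using assms by (cases "m = p") (simp_all add: M_coord_nth)
next
  show "M_coord p x $ pr LA LB = y $ pr LA LB" using assms by (simp add: M_coord_nth)
next
  fix k l :: 'a assume "k \<noteq> l"
  consider "k = p" | "l = p" | "k \<noteq> p" "l \<noteq> p" by blast
  then show "M_coord p x $ pr (Leg k) (Leg l) = y $ pr (Leg k) (Leg l)"
  proof cases
    case 2
    have "M_coord p x $ pr (Leg p) (Leg k) = y $ pr (Leg p) (Leg k)"
      using assms \<open>k \<noteq> l\<close> 2 by (simp add: M_coord_nth)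
    with 2 show ?thesis by (simp add: pr_commute)
  qed (use assms \<open>k \<noteq> l\<close> in \<open>simp_all add: M_coord_nth\<close>)
qed

lemma I_coord_respects: "vn_rel x y \<Longrightarrow> vn_rel (I_coord x) (I_coord y)"
proof -
  assume "vn_rel x y"
  then obtain b c where xy: "x = y + Phi b + c *\<^sub>R s_vec"
    unfolding vn_rel_def by (metis add.commute diff_eq_eq group_cancel.add1)
  have "I_coord x = I_coord y + Phi b + (- c) *\<^sub>R s_vec"
    unfolding xy by (rule pairs_vec_eqI) (simp_all add: I_coord_nth Phi_nth s_vec_nth)
  then show ?thesis unfolding vn_rel_def by (metis add.assoc add_diff_cancel_left')
qed

lemma M_coord_respects: "vn_rel x y \<Longrightarrow> vn_rel (M_coord p x) (M_coord p y)"
proof -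
  assume "vn_rel x y"
  then obtain b c where xy: "x = y + Phi b + c *\<^sub>R s_vec"
    unfolding vn_rel_def by (metis add.commute diff_eq_eq group_cancel.add1)
  have "M_coord p x = M_coord p y + Phi b + c *\<^sub>R s_vec"
    unfolding xy by (rule M_coord_eqI) (simp_all add: M_coord_nth Phi_nth s_vec_nth)
  then show ?thesis unfolding vn_rel_def by (metis add.assoc add_diff_cancel_left')
qed

lift_definition I_map :: "'n::finite vn \<Rightarrow> 'n vn" is I_coord by (rule I_coord_respects)

lift_definition M_map :: "'n::finite \<Rightarrow> 'n vn \<Rightarrow> 'n vn" is M_coord by (rule M_coord_respects)

definition Gn :: "('n::finite vn \<Rightarrow> 'n vn) monoid" where
  "Gn = (BijGroup UNIV) \<lparr>carrier := generate (BijGroup UNIV) (insert I_map (range M_map))\<rparr>"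


section \<open>The polyhedral complex \<open>X\<^sub>n\<close>\<close>

definition path_edges :: "'l graph \<Rightarrow> 'l set \<Rightarrow> nat set" where
  "path_edges T S = {e. \<exists>i j vs es. S = {i, j} \<and> simple_path T vs es \<and>
     hd vs = leaf T i \<and> last vs = leaf T j \<and> e \<in> set es}"

definition dist_vec :: "'n leaf graph \<Rightarrow> (nat \<Rightarrow> real) \<Rightarrow> real ^ 'n::finite pairs" where
  "dist_vec T len = (\<chi> S. \<Sum>e\<in>path_edges T (Rep_pairs S). len e)"

definition Psi :: "'n::finite vn \<Rightarrow> 'n vn set" where
  "Psi = orbit Gn (\<lambda>g. g)"

text \<open>
  All values in \<open>V\<^sub>n / G\<^sub>n\<close> of \<open>dist\<^sub>n\<close>, over all representatives of an isomorphism class and all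
  ways to cut it. As \<open>dist\<^sub>n\<close> is well defined, this is a singleton.
\<close>

definition dist_n :: "'n::finite metric_graph set \<Rightarrow> 'n vn set set" where
  "dist_n c = {Psi (cls (dist_vec T len)) | C T len. C \<in> c \<and> curve_cut C (T, len)}"

definition Xn_set :: "'n::finite vn set" where
  "Xn_set = {x. Psi x \<in> (\<Union>c\<in>M1. dist_n c)}"

text \<open>
  The combinatorial cone of a graph \<open>G\<close> has the edge lengths as coordinates, where length zero
  means that the edge is contracted; the cycle must not be contracted entirely. A cut \<open>T\<close> of \<open>G\<close> at
  a vertex lifts this cone linearly to \<open>V\<^sub>n\<close> (cutting inside an edge yields no other cones, since
  moving the cut point along an edge changes the distances by a multiple of \<open>s_vec\<close>), and
  the polyhedra of \<open>X\<^sub>n\<close> are the translates of such lifts.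
\<close>

definition curve_cone :: "'n graph \<Rightarrow> 'n::finite leaf graph \<Rightarrow> 'n vn set" where
  "curve_cone G T = {cls (dist_vec T len) | len.
     (\<forall>e\<in>edges G. len e \<ge> 0) \<and> (\<Sum>e\<in>cycle_edges G. len e) > 0}"

definition Xn_polys :: "'n::finite vn set set" where
  "Xn_polys = {g ` curve_cone G T | g G T v.
     g \<in> carrier Gn \<and> elliptic_graph G \<and> vertex_cut G v T}"

definition Xn_lat :: "'n::finite vn set \<Rightarrow> 'n vn set" where
  "Xn_lat \<sigma> = {g (cls (dist_vec T (\<lambda>e. of_int (k e)))) | g G T v k.
     g \<in> carrier Gn \<and> elliptic_graph G \<and> vertex_cut G v T \<and> \<sigma> = g ` curve_cone G T}"

definition Vn_lat :: "'n::finite vn set" where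
  "Vn_lat = {\<Sum>b\<in>B. of_int (k b) *\<^sub>R b | B k. finite B \<and> B \<subseteq> (\<Union>\<sigma>\<in>Xn_polys. Xn_lat \<sigma>)}"

text \<open>
  The polyhedra are cones in \<open>V\<^sub>n\<close>, so the inclusion serves as chart. For the star of \<open>\<tau>\<close>, a point in
  the relative interior of \<open>\<tau>\<close> is translated to the origin.
\<close>

definition Xn :: "('n::finite vn, 'n vn) gpc" where
  "Xn = \<lparr> gtop = subtopology lin_topology Xn_set, polys = Xn_polys,
          chart = (\<lambda>\<sigma> x. x), lat = Xn_lat,
          star_chart = (\<lambda>\<tau> x. x - (SOME b. b \<in> \<tau> - \<Union>{\<rho> \<in> Xn_polys. \<rho> \<subset> \<tau>})),
          star_lat = (\<lambda>\<tau>. Vn_lat) \<rparr>"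

definition Gn_act :: "('n::finite vn \<Rightarrow> 'n vn) \<Rightarrow> 'n vn \<Rightarrow> 'n vn" where
  "Gn_act g = restrict g Xn_set"

end

theory Submission
  imports Defs
begin

text \<open>
  A point of \<open>V\<^sub>n\<close> is determined by three families of linear coordinates: the length \<open>circ\<close> of the
  cycle, the signed distances \<open>offset k l\<close> of the leaves along the cycle, and the remaining distances
  \<open>rdist k l\<close>. In these coordinates \<open>G\<^sub>n\<close> acts by a sign and by winding the leaves around the cycle:
  an element changes \<open>offset k l\<close> by an integral multiple of \<open>circ\<close> (\<open>acts_as_Gn\<close>).

  A curve that is cut at a vertex is a tree with root \<open>A\<close>. Each bounded edge \<open>e\<close> is given by the
  set \<open>F\<close> of the leaves beyond it, and the distance vector is the sum of the edge lengths times the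
  vectors \<open>ray F\<close>. Hence the polyhedra of \<open>X\<^sub>n\<close> are simplicial cones without the faces on which \<open>circ\<close>
  vanishes, and they are known once the sets of rays which span a cone are known. These sets are
  characterized without reference to curves (\<open>simplices\<close>): they consist of rays of cycle edges and
  rays of tree edges, subject to conditions on pairs of rays which \<open>G\<^sub>n\<close> visibly preserves. If two
  such cones have a common interior point, the coordinates of this point force the union of the
  two sets to satisfy the conditions again, so that the sets agree by linear independence
  (\<open>common_point.same_simplex\<close>); this is why polyhedra meet in common faces. For questions about a
  single cone, one may move a ray of a cycle edge to \<open>ray {B}\<close> by an element of \<open>G\<^sub>n\<close>. Then the rays
  are those of a laminar family of sets of leaves (\<open>simplex_normal_form\<close>), and independence,
  integrality, purity and the structure in codimension one become statements about trees.

  In codimension one, exactly one vertex of the tree has three children instead of two. The three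
  facets are its resolutions, and the sum of the three new rays lies in the span of the old ones
  (\<open>ray_resolutions\<close>): without weights, the complex is balanced. The factors
  \<open>\<lambda>\<^bsub>\<sigma>/\<tau>\<^esub> = |G\<^sub>\<sigma>| / |G\<^sub>\<tau>|\<close> cancel the denominators of the weights \<open>1 / |G\<^sub>\<sigma>|\<close>, and they add up to one on
  every orbit of \<open>G\<^sub>\<tau>\<close> by the orbit-stabilizer theorem.

  The proof therefore has three parts. Complexes of half-open simplicial cones with a group action
  are tropical orbit spaces if they are pure and balanced without weights
  (\<open>cone_complex_action.tropical_orbit_space_X\<close>). The combinatorial complex \<open>simplices\<close> with the
  group \<open>G\<^sub>n\<close> has these properties (\<open>cone_complex_simplices\<close>, \<open>simplex_in_facet\<close>,
  \<open>balance_codimension_one\<close>). Finally, its cones are the polyhedra of \<open>X\<^sub>n\<close>: a cut of a curve gives a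
  point of a cone, and the cuts at vertices give whole cones (\<open>curve_cut_in_simplex\<close>, \<open>vertex_cut_simplex\<close>), and every laminar
  family comes from a curve (\<open>cluster_family_curve\<close>).
\<close>

section \<open>The topology of linear functionals\<close>

lemma topspace_lin_topology [simp]: "topspace (lin_topology :: 'v::real_vector topology) = UNIV"
proof -
  have "(UNIV :: 'v set) \<in> {f -` U | (f :: 'v \<Rightarrow> real) U. linear f \<and> open U}"
    by (rule CollectI, rule exI[of _ "\<lambda>_. 0"], rule exI[of _ UNIV]) (auto simp: linear_0 intro!: linearI)
  then show ?thesis
    unfolding lin_topology_def topology_generated_by_topspace by blast
qed

lemma openin_lin_vimage: "linear f \<Longrightarrow> open U \<Longrightarrow> openin lin_topology (f -` U)"
  for f :: "'v::real_vector \<Rightarrow> real"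
  unfolding lin_topology_def by (rule topology_generated_by_Basis) blast

lemma openin_lin_pos: "linear f \<Longrightarrow> openin lin_topology {x. f x > c}"
  for f :: "'v::real_vector \<Rightarrow> real"
  using openin_lin_vimage[of f "{c<..}"] by (simp add: vimage_def)

lemma openin_lin_neg: "linear f \<Longrightarrow> openin lin_topology {x. f x < c}"
  for f :: "'v::real_vector \<Rightarrow> real"
  using openin_lin_vimage[of f "{..<c}"] by (simp add: vimage_def)

text \<open>
  The preimage of \<open>f -` U\<close> is \<open>(f \<circ> A) -` (U - f b)\<close>, which is again a generator of the topology.
\<close>

lemma continuous_map_lin_affine:
  fixes A :: "'v::real_vector \<Rightarrow> 'v"
  assumes "linear A"
  shows "continuous_map lin_topology lin_topology (\<lambda>x. A x + b)"
  unfolding lin_topology_def[where 'v = 'v]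
proof (subst continuous_on_generated_topo_iff, intro conjI allI impI; fold lin_topology_def)
  fix W assume "W \<in> {f -` U | (f :: 'v \<Rightarrow> real) U. linear f \<and> open U}"
  then obtain f :: "'v \<Rightarrow> real" and U where W: "W = f -` U" "linear f" "open U" by blast
  have "(\<lambda>x. A x + b) -` W = (f \<circ> A) -` ((\<lambda>t. t + f b) -` U)"
    unfolding W(1) using W(2) by (simp add: linear_add vimage_def)
  moreover have "linear (f \<circ> A)" using W assms linear_compose by blast
  moreover have "open ((\<lambda>t. t + f b) -` U)" using W(3) by (intro open_vimage continuous_intros)
  ultimately show "openin lin_topology ((\<lambda>x. A x + b) -` W \<inter> topspace lin_topology)"
    by (simp add: openin_lin_vimage)
next
  show "(\<lambda>x. A x + b) ` topspace lin_topology \<subseteq> \<Union>{f -` U |(f :: 'v \<Rightarrow> real) U. linear f \<and> open U}"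
    using topspace_lin_topology[where 'v='v]
    unfolding lin_topology_def topology_generated_by_topspace by blast
qed

lemma homeomorphic_map_lin_affine:
  fixes A A' :: "'v::real_vector \<Rightarrow> 'v"
  assumes "linear A" "linear A'" "\<And>x. A' (A x) = x" "\<And>x. A (A' x) = x"
  shows "homeomorphic_map (subtopology lin_topology S)
           (subtopology lin_topology ((\<lambda>x. A x + b) ` S)) (\<lambda>x. A x + b)"
proof -
  have "homeomorphic_maps (subtopology lin_topology S)
          (subtopology lin_topology ((\<lambda>x. A x + b) ` S)) (\<lambda>x. A x + b) (\<lambda>y. A' y + - A' b)"
    unfolding homeomorphic_maps_def
    using continuous_map_lin_affine[OF assms(1), of b] continuous_map_lin_affine[OF assms(2), of "- A' b"]
      assms
    by (auto simp: continuous_map_in_subtopology continuous_map_from_subtopology linear_add image_iff)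
  then show ?thesis using homeomorphic_map_maps by blast
qed

section \<open>Lattices and integral forms\<close>

definition int_span :: "'v::real_vector set \<Rightarrow> 'v set" where
  "int_span B = {\<Sum>b\<in>B. of_int (k b) *\<^sub>R b | k :: 'v \<Rightarrow> int. True}"

lemma is_lattice_int_span: "finite B \<Longrightarrow> independent B \<Longrightarrow> is_lattice (int_span B)"
  unfolding is_lattice_def int_span_def by blast

lemma int_span_superset: "finite B \<Longrightarrow> B \<subseteq> int_span B"
proof
  fix b assume "finite B" "b \<in> B"
  have "(\<Sum>x\<in>B. of_int (if x = b then 1 else 0) *\<^sub>R x) = b"
    using \<open>finite B\<close> \<open>b \<in> B\<close> sum.remove[OF \<open>finite B\<close> \<open>b \<in> B\<close>, of "\<lambda>x. of_int (if x = b then 1 else 0) *\<^sub>R x"]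
    by simp
  then show "b \<in> int_span B" unfolding int_span_def
    by (intro CollectI exI[of _ "\<lambda>x. if x = b then 1 else 0"]) simp
qed

lemma int_span_subset_span: "int_span B \<subseteq> span B"
  unfolding int_span_def by (auto intro: span_sum span_scale span_base)

lemma span_int_span: "finite B \<Longrightarrow> span (int_span B) = span B"
  by (metis int_span_superset int_span_subset_span span_mono span_span subset_antisym)

lemma dim_int_span: "finite B \<Longrightarrow> independent B \<Longrightarrow> dim (int_span B) = card B"
  by (metis dim_eq_card_independent dim_span span_int_span)

lemma int_span_image:
  assumes "linear g" "inj_on g B"
  shows "g ` int_span B = int_span (g ` B)"
proof
  show "g ` int_span B \<subseteq> int_span (g ` B)"
  proof
    fix y assume "y \<in> g ` int_span B"
    then obtain k :: "_ \<Rightarrow> int" where y: "y = g (\<Sum>b\<in>B. of_int (k b) *\<^sub>R b)"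
      unfolding int_span_def by blast
    have "y = (\<Sum>b\<in>B. of_int (k b) *\<^sub>R g b)"
      unfolding y by (simp add: linear_sum[OF assms(1)] linear_scale[OF assms(1)])
    also have "\<dots> = (\<Sum>c\<in>g ` B. of_int (k (inv_into B g c)) *\<^sub>R c)"
      using assms(2) by (simp add: sum.reindex)
    finally show "y \<in> int_span (g ` B)"
      unfolding int_span_def by (intro CollectI exI[of _ "\<lambda>c. k (inv_into B g c)"]) simp
  qed
  show "int_span (g ` B) \<subseteq> g ` int_span B"
  proof
    fix y assume "y \<in> int_span (g ` B)"
    then obtain k :: "_ \<Rightarrow> int" where y: "y = (\<Sum>c\<in>g ` B. of_int (k c) *\<^sub>R c)"
      unfolding int_span_def by blast
    have "y = g (\<Sum>b\<in>B. of_int (k (g b)) *\<^sub>R b)"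
      unfolding y using assms(2)
      by (simp add: sum.reindex linear_sum[OF assms(1)] linear_scale[OF assms(1)])
    then show "y \<in> g ` int_span B"
      by (rule image_eqI) (auto simp: int_span_def)
  qed
qed

lemma int_form_sub: "int_form L f \<Longrightarrow> L' \<subseteq> L \<Longrightarrow> int_form L' f"
  unfolding int_form_def by blast

lemma int_form_uminus: "int_form L f \<Longrightarrow> int_form L (\<lambda>x. - f x)"
  unfolding int_form_def by (auto simp: linear_iff image_subset_iff)

text \<open>
  By induction on \<open>B\<close>: if the forms \<open>F\<close> cut out \<open>span B\<close> and \<open>f\<^sub>0 \<in> F\<close> does not vanish at a further
  lattice vector \<open>b\<close>, the integral forms \<open>f\<^sub>0(b) f - f(b) f\<^sub>0\<close> cut out \<open>span (B \<union> {b})\<close>.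
\<close>

lemma integral_forms_cut_out_span:
  fixes L :: "'v::real_vector set"
  assumes L: "is_lattice L" and "finite B" "B \<subseteq> L"
  shows "\<exists>F. finite F \<and> (\<forall>f\<in>F. int_form L f) \<and> span B = {x \<in> span L. \<forall>f\<in>F. f x = 0}"
  using assms(2,3)
proof (induction B rule: finite_induct)
  case empty
  obtain E where E: "finite E" "independent E" "L = int_span E"
    using L unfolding is_lattice_def int_span_def by blast
  have "\<exists>f :: 'v \<Rightarrow> real. linear f \<and> (\<forall>x\<in>E. f x = (if x = e then 1 else 0))" for e
    using linear_independent_extend[OF E(2), of "\<lambda>x. if x = e then 1 else 0"] by blast
  then obtain f :: "'v \<Rightarrow> 'v \<Rightarrow> real" where
    f: "\<And>e. linear (f e)" "\<And>e x. x \<in> E \<Longrightarrow> f e x = (if x = e then 1 else 0)" by metis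
  have val: "f e (\<Sum>b\<in>E. c b *\<^sub>R b) = c e" if "e \<in> E" for e c
  proof -
    have "f e (\<Sum>b\<in>E. c b *\<^sub>R b) = (\<Sum>b\<in>E. c b * f e b)"
      by (simp add: linear_sum[OF f(1)] linear_scale[OF f(1)])
    also have "\<dots> = (\<Sum>b\<in>E. if b = e then c b else 0)"
      by (intro sum.cong) (auto simp: f(2))
    finally show ?thesis using E(1) that by simp
  qed
  have "int_form L (f e)" if "e \<in> E" for e
    unfolding int_form_def E(3) int_span_def using f(1) val[OF that] by auto
  moreover have "{x \<in> span L. \<forall>g\<in>f ` E. g x = 0} = {0}"
  proof -
    have "x = 0" if x: "x \<in> span L" "\<forall>g\<in>f ` E. g x = 0" for x
    proof -
      have "x \<in> span E" using x(1) E span_int_span by blast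
      then obtain c where c: "x = (\<Sum>b\<in>E. c b *\<^sub>R b)"
        using span_finite[OF E(1)] by auto
      have "c b = 0" if "b \<in> E" for b using x(2) val[OF that, of c] c that by simp
      then show "x = 0" unfolding c by simp
    qed
    moreover have "0 \<in> {x \<in> span L. \<forall>g\<in>f ` E. g x = 0}"
      using f(1) by (simp add: span_0 linear_0)
    ultimately show ?thesis by blast
  qed
  ultimately show ?case using E(1) by (intro exI[of _ "f ` E"]) simp
next
  case (insert b B)
  have "B \<subseteq> L" using insert.prems by blast
  from insert.IH[OF this] obtain F where
    F: "finite F" "\<forall>f\<in>F. int_form L f" "span B = {x \<in> span L. \<forall>f\<in>F. f x = 0}"
    by blast
  have lin: "linear f" if "f \<in> F" for f using F(2) that int_form_def by blast
  show ?case
  proof (cases "b \<in> span B")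
    case True
    then have "span (insert b B) = span B" by (rule span_redundant)
    then show ?thesis using F by auto
  next
    case False
    have bL: "b \<in> L" using insert by blast
    then obtain f0 where f0: "f0 \<in> F" "f0 b \<noteq> 0"
      using False F(3) span_base[of b L] by blast
    define F' where "F' = (\<lambda>f x. f0 b * f x - f b * f0 x) ` F"
    have int: "f x \<in> \<int>" if "f \<in> F" "x \<in> L" for f x
      using that F(2) unfolding int_form_def by blast
    have linF': "linear (\<lambda>x. f0 b * f x - f b * f0 x)" if "f \<in> F" for f
      using lin[OF that] lin[OF f0(1)] by (simp add: linear_iff algebra_simps)
    have "int_form L g" if "g \<in> F'" for g
      using that linF' int f0(1) bL unfolding F'_def int_form_def by auto
    moreover have "span (insert b B) = {x \<in> span L. \<forall>g\<in>F'. g x = 0}"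
    proof (intro equalityI subsetI)
      fix x assume "x \<in> span (insert b B)"
      then obtain k where k: "x - k *\<^sub>R b \<in> span B" using span_breakdown_eq by blast
      then have *: "x - k *\<^sub>R b \<in> span L" "\<forall>f\<in>F. f (x - k *\<^sub>R b) = 0" using F(3) by auto
      have "x \<in> span L" using *(1) bL by (metis diff_add_cancel span_add span_base span_scale)
      have eq: "f x = k * f b" if "f \<in> F" for f
        using bspec[OF *(2) that] by (simp add: linear_diff[OF lin[OF that]] linear_scale[OF lin[OF that]])
      have "f0 b * f x - f b * f0 x = 0" if "f \<in> F" for f
        by (simp add: eq[OF that] eq[OF f0(1)])
      then show "x \<in> {x \<in> span L. \<forall>g\<in>F'. g x = 0}"
        using \<open>x \<in> span L\<close> by (auto simp: F'_def)
    next
      fix x assume x: "x \<in> {x \<in> span L. \<forall>g\<in>F'. g x = 0}"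
      define k where "k = f0 x / f0 b"
      have "f (x - k *\<^sub>R b) = 0" if "f \<in> F" for f
      proof -
        have "f0 b * f x - f b * f0 x = 0" using x that by (auto simp: F'_def)
        then show ?thesis
          using lin[OF that] f0(2) by (simp add: linear_diff linear_scale k_def field_simps)
      qed
      moreover have "x - k *\<^sub>R b \<in> span L" using x bL by (intro span_diff span_scale) (auto intro: span_base)
      ultimately have "x - k *\<^sub>R b \<in> span B" using F(3) by blast
      then show "x \<in> span (insert b B)" using span_breakdown_eq by blast
    qed
    ultimately show ?thesis using F(1) by (intro exI[of _ F']) (auto simp: F'_def)
  qed
qed

text \<open>Up to a positive factor, the coordinates with respect to lattice vectors are integral.\<close>

lemma integral_dual_forms:
  assumes L: "is_lattice L" and B: "finite B" "B \<subseteq> L" "independent B"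
  obtains f where "\<And>b. b \<in> B \<Longrightarrow> int_form L (f b)" "\<And>b. b \<in> B \<Longrightarrow> f b b > 0"
    "\<And>b b'. b \<in> B \<Longrightarrow> b' \<in> B \<Longrightarrow> b' \<noteq> b \<Longrightarrow> f b b' = 0"
proof -
  have "\<exists>f. int_form L f \<and> f b > 0 \<and> (\<forall>b'\<in>B. b' \<noteq> b \<longrightarrow> f b' = 0)" if b: "b \<in> B" for b
  proof -
    obtain F where F: "\<forall>f\<in>F. int_form L f" "span (B - {b}) = {x \<in> span L. \<forall>f\<in>F. f x = 0}"
      using integral_forms_cut_out_span[OF L, of "B - {b}"] B by auto
    have "b \<notin> span (B - {b})" using B(3) b by (auto simp: dependent_def)
    moreover have "b \<in> span L" using b B(2) span_base by blast
    ultimately obtain f where f: "f \<in> F" "f b \<noteq> 0" using F(2) by auto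
    have 0: "f b' = 0" if "b' \<in> B" "b' \<noteq> b" for b'
      using span_base[of b' "B - {b}"] that F(2) f(1) by blast
    show ?thesis
    proof (cases "f b > 0")
      case True then show ?thesis using f F(1) 0 by blast
    next
      case False
      then show ?thesis using f F(1) 0 int_form_uminus[of L f]
        by (intro exI[of _ "\<lambda>x. - f x"]) auto
    qed
  qed
  then have "\<forall>b\<in>B. \<exists>f. int_form L f \<and> f b > 0 \<and> (\<forall>b'\<in>B. b' \<noteq> b \<longrightarrow> f b' = 0)" by blast
  from bchoice[OF this] obtain f where
    f: "\<forall>b\<in>B. int_form L (f b) \<and> f b b > 0 \<and> (\<forall>b'\<in>B. b' \<noteq> b \<longrightarrow> f b b' = 0)" by blast
  show ?thesis by (rule that[of f]) (use f in auto)
qed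

section \<open>Stratified convex sets and their faces\<close>

text \<open>
  Abstracts what the cones of a complex and the cones of one of its stars have in common:
  \<open>stratum S x\<close> says that \<open>x\<close> lies in the relative interior of the cone with index \<open>S\<close>.
\<close>

locale strata =
  fixes I :: "'v::real_vector set set" and stratum :: "'v set \<Rightarrow> 'v \<Rightarrow> bool"
  assumes finite_index: "B \<in> I \<Longrightarrow> finite B"
    and index: "stratum S x \<Longrightarrow> S \<in> I"
    and index_between: "B \<in> I \<Longrightarrow> S \<in> I \<Longrightarrow> S \<subseteq> C \<Longrightarrow> C \<subseteq> B \<Longrightarrow> C \<in> I"
    and nonempty: "S \<in> I \<Longrightarrow> \<exists>x. stratum S x"
    and unique: "stratum S x \<Longrightarrow> stratum S' x \<Longrightarrow> S = S'"
    and combine: "B \<in> I \<Longrightarrow> S \<subseteq> B \<Longrightarrow> S' \<subseteq> B \<Longrightarrow> stratum S x \<Longrightarrow> stratum S' y \<Longrightarrow>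
       0 < s \<Longrightarrow> 0 < t \<Longrightarrow> s + t = 1 \<Longrightarrow> stratum (S \<union> S') (s *\<^sub>R x + t *\<^sub>R y)"
    and extend: "S' \<subseteq> S \<Longrightarrow> stratum S x \<Longrightarrow> stratum S' y \<Longrightarrow>
       \<exists>\<epsilon>>0. stratum S (x + \<epsilon> *\<^sub>R (x - y))"
begin

definition closed_stratum :: "'v set \<Rightarrow> 'v set" where
  "closed_stratum B = {x. \<exists>S\<subseteq>B. stratum S x}"

lemma closed_stratum_subset_iff:
  assumes "B \<in> I" shows "closed_stratum B \<subseteq> closed_stratum C \<longleftrightarrow> B \<subseteq> C"
proof
  assume *: "closed_stratum B \<subseteq> closed_stratum C"
  obtain x where x: "stratum B x" using nonempty assms by blast
  then have "x \<in> closed_stratum C" using * unfolding closed_stratum_def by blast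
  then show "B \<subseteq> C" using unique[OF x] unfolding closed_stratum_def by blast
qed (auto simp: closed_stratum_def)

lemma closed_stratum_inject:
  "B \<in> I \<Longrightarrow> C \<in> I \<Longrightarrow> closed_stratum B = closed_stratum C \<longleftrightarrow> B = C"
  using closed_stratum_subset_iff by (metis subset_antisym order_refl)

lemma closed_stratum_Int:
  "closed_stratum B \<inter> closed_stratum C = closed_stratum (B \<inter> C)"
proof (intro equalityI subsetI)
  fix x assume "x \<in> closed_stratum B \<inter> closed_stratum C"
  then obtain S S' where "S \<subseteq> B" "stratum S x" "S' \<subseteq> C" "stratum S' x"
    unfolding closed_stratum_def by blast
  moreover from this have "S = S'" using unique by blast
  ultimately show "x \<in> closed_stratum (B \<inter> C)" unfolding closed_stratum_def by blast
qed (auto simp: closed_stratum_def)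

lemma stratum_open_segment:
  assumes "B \<in> I" "S \<subseteq> B" "S' \<subseteq> B" "stratum S a" "stratum S' b" "x \<in> open_segment a b"
  shows "stratum (S \<union> S') x"
proof -
  obtain u where "0 < u" "u < 1" "x = (1 - u) *\<^sub>R a + u *\<^sub>R b"
    using assms(6) by (auto simp: in_segment)
  then show ?thesis using combine[OF assms(1-5), of "1 - u" u] by simp
qed

lemma convex_closed_stratum:
  assumes "B \<in> I" shows "convex (closed_stratum B)"
  unfolding convex_contains_open_segment
proof (intro ballI subsetI)
  fix a b x assume "a \<in> closed_stratum B" "b \<in> closed_stratum B" "x \<in> open_segment a b"
  then show "x \<in> closed_stratum B"
    using stratum_open_segment[OF assms] unfolding closed_stratum_def by (smt (verit) Un_least mem_Collect_eq)
qed

text \<open>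
  An inner point of a segment lies in the stratum whose index is the union of the indices at the
  two ends. If this union is contained in \<open>C\<close>, then so are both indices.
\<close>

lemma closed_stratum_face:
  assumes "B \<in> I" "C \<subseteq> B" shows "closed_stratum C face_of closed_stratum B"
proof (cases "C \<in> I")
  case True
  show ?thesis unfolding face_of_def
  proof (intro conjI ballI impI)
    show "closed_stratum C \<subseteq> closed_stratum B" using assms(2) by (auto simp: closed_stratum_def)
    show "convex (closed_stratum C)" using True by (rule convex_closed_stratum)
    fix a b x assume ab: "a \<in> closed_stratum B" "b \<in> closed_stratum B"
      and x: "x \<in> closed_stratum C" "x \<in> open_segment a b"
    obtain S S' S'' where S: "S \<subseteq> B" "stratum S a" "S' \<subseteq> B" "stratum S' b" "S'' \<subseteq> C" "stratum S'' x"
      using ab x(1) unfolding closed_stratum_def by blast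
    have "stratum (S \<union> S') x" using stratum_open_segment[OF assms(1)] S x(2) by blast
    then have "S \<union> S' \<subseteq> C" using unique S by blast
    then show "a \<in> closed_stratum C" "b \<in> closed_stratum C"
      using S unfolding closed_stratum_def by blast+
  qed
next
  case False
  have "closed_stratum C = {}"
  proof (rule ccontr)
    assume "closed_stratum C \<noteq> {}"
    then obtain S x where "S \<subseteq> C" "stratum S x" unfolding closed_stratum_def by blast
    then show False using index_between[OF assms(1) index _ assms(2)] False by blast
  qed
  then show ?thesis by (simp add: empty_face_of)
qed

text \<open>
  A nonempty face contains a point whose stratum is largest; every other point of the
  corresponding closed stratum lies on a segment through it that stays in the convex set.
\<close>

lemma face_of_closed_stratum:
  assumes B: "B \<in> I" and D: "D face_of closed_stratum B" "D \<noteq> {}"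
  obtains S where "S \<in> I" "S \<subseteq> B" "D = closed_stratum S"
proof -
  have DB: "D \<subseteq> closed_stratum B" using D(1) face_of_imp_subset by blast
  define \<S> where "\<S> = {S. S \<subseteq> B \<and> (\<exists>x\<in>D. stratum S x)}"
  have "finite \<S>" unfolding \<S>_def using finite_index[OF B] by auto
  moreover have "\<S> \<noteq> {}" using D(2) DB unfolding \<S>_def closed_stratum_def by blast
  ultimately obtain S where S: "S \<in> \<S>" "\<And>S'. S' \<in> \<S> \<Longrightarrow> S \<subseteq> S' \<Longrightarrow> S = S'"
    using finite_has_maximal[of \<S>] by blast
  obtain x where x: "x \<in> D" "stratum S x" "S \<subseteq> B" using S(1) unfolding \<S>_def by blast
  have "S' \<subseteq> S" if "S' \<subseteq> B" "y \<in> D" "stratum S' y" for S' y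
  proof -
    have "stratum (S \<union> S') ((1/2) *\<^sub>R x + (1/2) *\<^sub>R y)"
      using combine[OF B x(3) that(1) x(2) that(3)] by simp
    moreover have "(1/2) *\<^sub>R x + (1/2) *\<^sub>R y \<in> D"
      using face_of_imp_convex[OF D(1)] x(1) that(2) by (intro convexD) auto
    ultimately have "S \<union> S' \<in> \<S>"
      using x(3) that(1) unfolding \<S>_def by (intro CollectI conjI bexI) auto
    then show ?thesis using S(2)[of "S \<union> S'"] by blast
  qed
  note largest = this
  have "D \<subseteq> closed_stratum S"
  proof
    fix y assume "y \<in> D"
    then obtain S' where "S' \<subseteq> B" "stratum S' y" using DB unfolding closed_stratum_def by blast
    then show "y \<in> closed_stratum S" using largest \<open>y \<in> D\<close> unfolding closed_stratum_def by blast
  qed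
  moreover have "closed_stratum S \<subseteq> D"
  proof
    fix y assume y: "y \<in> closed_stratum S"
    show "y \<in> D"
    proof (cases "y = x")
      case False
      obtain S' where S': "S' \<subseteq> S" "stratum S' y" using y unfolding closed_stratum_def by blast
      obtain \<epsilon> where \<epsilon>: "\<epsilon> > 0" "stratum S (x + \<epsilon> *\<^sub>R (x - y))" using extend[OF S'(1) x(2) S'(2)] by blast
      define z where "z = x + \<epsilon> *\<^sub>R (x - y)"
      have "z \<in> closed_stratum B" "y \<in> closed_stratum B"
        using \<epsilon>(2) x(3) S' unfolding z_def closed_stratum_def by blast+
      moreover have "x \<in> open_segment y z"
      proof -
        define u where "u = 1 / (1 + \<epsilon>)"
        have u: "0 < u" "u < 1" "u * (1 + \<epsilon>) = 1" using \<epsilon>(1) by (auto simp: u_def)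
        have "(1 - u) *\<^sub>R y + u *\<^sub>R z = (u * (1 + \<epsilon>)) *\<^sub>R x + (1 - u * (1 + \<epsilon>)) *\<^sub>R y"
          unfolding z_def by (simp add: algebra_simps)
        also have "\<dots> = x" using u(3) by simp
        finally have "x = (1 - u) *\<^sub>R y + u *\<^sub>R z" by simp
        moreover have "y \<noteq> z"
        proof
          assume "y = z"
          then have "x + \<epsilon> *\<^sub>R (x - y) - y = 0" by (simp add: z_def)
          then have "(1 + \<epsilon>) *\<^sub>R (x - y) = 0" by (simp add: algebra_simps)
          then show False using \<epsilon>(1) False by simp
        qed
        ultimately show ?thesis using u by (auto simp: in_segment)
      qed
      ultimately show ?thesis using D(1) x(1) unfolding face_of_def by blast
    qed (use x in blast)
  qed
  ultimately show thesis using that[of S] x(3) index[OF x(2)] by blast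
qed

end

section \<open>Complexes of half-open simplicial cones\<close>

text \<open>For \<open>X\<^sub>n\<close> the form \<open>ell\<close> is the length of the cycle, which must not be contracted.\<close>

definition half_open_cone :: "('v::real_vector \<Rightarrow> real) \<Rightarrow> 'v set \<Rightarrow> 'v set" where
  "half_open_cone ell B = {x. \<exists>c. (\<forall>b\<in>B. 0 \<le> c b) \<and> x = (\<Sum>b\<in>B. c b *\<^sub>R b) \<and> 0 < ell x}"

definition positive_on :: "'v::real_vector set \<Rightarrow> 'v \<Rightarrow> bool" where
  "positive_on S x \<longleftrightarrow> (\<exists>c. (\<forall>b\<in>S. 0 < c b) \<and> x = (\<Sum>b\<in>S. c b *\<^sub>R b))"

lemma positive_on_sum: "positive_on S (\<Sum>S)"
  unfolding positive_on_def by (rule exI[of _ "\<lambda>_. 1"]) simp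

lemma positive_on_combine:
  assumes "finite S" "finite S'" "positive_on S x" "positive_on S' y" "0 < s" "0 < t"
  shows "positive_on (S \<union> S') (s *\<^sub>R x + t *\<^sub>R y)"
proof -
  obtain c c' where c: "\<forall>b\<in>S. 0 < c b" "x = (\<Sum>b\<in>S. c b *\<^sub>R b)"
    "\<forall>b\<in>S'. 0 < c' b" "y = (\<Sum>b\<in>S'. c' b *\<^sub>R b)" using assms unfolding positive_on_def by blast
  define d where "d = (\<lambda>b. s * (if b \<in> S then c b else 0) + t * (if b \<in> S' then c' b else 0))"
  have "x = (\<Sum>b\<in>S \<union> S'. (if b \<in> S then c b else 0) *\<^sub>R b)"
    unfolding c(2) using assms(1,2) by (intro sum.mono_neutral_cong_left) auto
  moreover have "y = (\<Sum>b\<in>S \<union> S'. (if b \<in> S' then c' b else 0) *\<^sub>R b)"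
    unfolding c(4) using assms(1,2) by (intro sum.mono_neutral_cong_left) auto
  ultimately have "s *\<^sub>R x + t *\<^sub>R y = (\<Sum>b\<in>S \<union> S'. d b *\<^sub>R b)"
    by (simp add: d_def scaleR_sum_right sum.distrib scaleR_left_distrib)
  moreover have "\<forall>b\<in>S \<union> S'. 0 < d b"
    unfolding d_def using c(1,3) assms(5,6) by (auto simp: add_pos_pos)
  ultimately show ?thesis unfolding positive_on_def by blast
qed

lemma positive_on_scale: "0 < s \<Longrightarrow> positive_on S x \<Longrightarrow> positive_on S (s *\<^sub>R x)"
  unfolding positive_on_def
proof (elim exE conjE)
  fix c assume "0 < s" "\<forall>b\<in>S. 0 < c b" "x = (\<Sum>b\<in>S. c b *\<^sub>R b)"
  then show "\<exists>c. (\<forall>b\<in>S. 0 < c b) \<and> s *\<^sub>R x = (\<Sum>b\<in>S. c b *\<^sub>R b)"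
    by (intro exI[of _ "\<lambda>b. s * c b"]) (simp add: scaleR_sum_right)
qed

text \<open>Relative interiors are open in the span.\<close>

lemma positive_on_perturb:
  assumes "finite S" "positive_on S x" "y \<in> span S"
  shows "\<exists>\<epsilon>>0. positive_on S (x + \<epsilon> *\<^sub>R y)"
proof -
  obtain c where c: "\<forall>b\<in>S. 0 < c b" "x = (\<Sum>b\<in>S. c b *\<^sub>R b)" using assms unfolding positive_on_def by blast
  obtain d where d: "y = (\<Sum>b\<in>S. d b *\<^sub>R b)" using assms(3) span_finite[OF assms(1)] by auto
  define \<epsilon> where "\<epsilon> = Min (insert 1 ((\<lambda>b. c b / (1 + \<bar>d b\<bar>)) ` S))"
  have pos: "\<epsilon> > 0" unfolding \<epsilon>_def using assms(1) c(1)
    by (subst Min_gr_iff) (auto intro!: divide_pos_pos simp: add_pos_nonneg)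
  have "0 < c b + \<epsilon> * d b" if "b \<in> S" for b
  proof -
    have "\<epsilon> \<le> c b / (1 + \<bar>d b\<bar>)" unfolding \<epsilon>_def using assms(1) that by (intro Min_le) auto
    then have "\<epsilon> * (1 + \<bar>d b\<bar>) \<le> c b" by (simp add: pos_le_divide_eq add_pos_nonneg)
    moreover have "\<epsilon> * (1 + \<bar>d b\<bar>) = \<epsilon> + \<epsilon> * \<bar>d b\<bar>" by (simp add: algebra_simps)
    moreover have "- (\<epsilon> * \<bar>d b\<bar>) \<le> \<epsilon> * d b"
      using pos by (metis abs_ge_minus_self abs_mult abs_of_pos minus_le_iff)
    ultimately show ?thesis using pos by linarith
  qed
  moreover have "x + \<epsilon> *\<^sub>R y = (\<Sum>b\<in>S. (c b + \<epsilon> * d b) *\<^sub>R b)"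
    unfolding c(2) d by (simp add: scaleR_sum_right sum.distrib scaleR_left_distrib)
  ultimately show ?thesis using pos unfolding positive_on_def
    by (intro exI[of _ \<epsilon>]) (auto intro!: exI[of _ "\<lambda>b. c b + \<epsilon> * d b"])
qed

lemma positive_on_span: "positive_on S x \<Longrightarrow> x \<in> span S"
  unfolding positive_on_def by (auto intro: span_sum span_scale span_base)

lemma half_open_cone_image:
  assumes g: "linear g" "inj_on g B" and ell: "\<And>x. ell (g x) = ell x"
  shows "g ` half_open_cone ell B = half_open_cone ell (g ` B)"
proof (intro equalityI subsetI)
  fix y assume "y \<in> g ` half_open_cone ell B"
  then obtain c where c: "\<forall>b\<in>B. 0 \<le> c b" "y = g (\<Sum>b\<in>B. c b *\<^sub>R b)" "0 < ell (\<Sum>b\<in>B. c b *\<^sub>R b)"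
    unfolding half_open_cone_def by blast
  define d where "d = c \<circ> inv_into B g"
  have d: "d (g b) = c b" if "b \<in> B" for b using that g(2) by (simp add: d_def)
  have "y = (\<Sum>b\<in>B. d (g b) *\<^sub>R g b)"
    unfolding c(2) linear_sum[OF g(1)] linear_scale[OF g(1)] by (intro sum.cong) (simp_all add: d)
  also have "\<dots> = (\<Sum>b\<in>g ` B. d b *\<^sub>R b)" by (simp add: sum.reindex[OF g(2)])
  finally have "y = (\<Sum>b\<in>g ` B. d b *\<^sub>R b)" .
  moreover have "\<forall>b\<in>g ` B. 0 \<le> d b" using c(1) d by simp
  moreover have "0 < ell y" using c(3) ell unfolding c(2) by simp
  ultimately show "y \<in> half_open_cone ell (g ` B)" unfolding half_open_cone_def by blast
next
  fix y assume "y \<in> half_open_cone ell (g ` B)"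
  then obtain c where c: "\<forall>b\<in>g ` B. 0 \<le> c b" "y = (\<Sum>b\<in>g ` B. c b *\<^sub>R b)" "0 < ell y"
    unfolding half_open_cone_def by blast
  define x where "x = (\<Sum>b\<in>B. c (g b) *\<^sub>R b)"
  have y: "y = g x"
    unfolding c(2) x_def linear_sum[OF g(1)] linear_scale[OF g(1)] by (simp add: sum.reindex[OF g(2)])
  have "\<forall>b\<in>B. 0 \<le> c (g b)" "0 < ell x" using c(1,3) ell y by auto
  then have "x \<in> half_open_cone ell B" unfolding half_open_cone_def x_def
    by (intro CollectI exI[of _ "\<lambda>b. c (g b)"]) simp
  then show "y \<in> g ` half_open_cone ell B" using y by blast
qed

text \<open>
  A simplex is a set of rays; \<open>saturated\<close> says that the rays of a simplex form a basis of the
  lattice of its cone. Neither faces nor intersections of cones are mentioned: since every point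
  has at most one simplex with positive coordinates, both are governed by inclusion of simplices.
\<close>

locale cone_complex =
  fixes ell :: "'v::real_vector \<Rightarrow> real" and \<Lambda> :: "'v set" and \<Delta> :: "'v set set"
  assumes linear_ell: "linear ell"
    and ell_lattice: "ell ` \<Lambda> \<subseteq> \<int>"
    and lattice: "is_lattice \<Lambda>"
    and finite_simplex: "B \<in> \<Delta> \<Longrightarrow> finite B"
    and independent_simplex: "B \<in> \<Delta> \<Longrightarrow> independent B"
    and saturated: "B \<in> \<Delta> \<Longrightarrow> \<Lambda> \<inter> span B = int_span B"
    and ell_nonneg: "B \<in> \<Delta> \<Longrightarrow> b \<in> B \<Longrightarrow> 0 \<le> ell b"
    and ell_pos: "B \<in> \<Delta> \<Longrightarrow> \<exists>b\<in>B. 0 < ell b"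
    and subsimplex: "B \<in> \<Delta> \<Longrightarrow> C \<subseteq> B \<Longrightarrow> b \<in> C \<Longrightarrow> 0 < ell b \<Longrightarrow> C \<in> \<Delta>"
    and disjoint_interiors: "B \<in> \<Delta> \<Longrightarrow> B' \<in> \<Delta> \<Longrightarrow> positive_on B x \<Longrightarrow> positive_on B' x \<Longrightarrow> B = B'"
    and locally_finite: "B \<in> \<Delta> \<Longrightarrow> finite {C \<in> \<Delta>. B \<subseteq> C}"
begin

abbreviation "K \<equiv> half_open_cone ell"

definition interior_point :: "'v set \<Rightarrow> 'v \<Rightarrow> bool" where
  "interior_point S x \<longleftrightarrow> S \<in> \<Delta> \<and> positive_on S x"

lemma simplex_lattice: "B \<in> \<Delta> \<Longrightarrow> B \<subseteq> \<Lambda>"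
  using saturated int_span_superset finite_simplex by blast

lemma ell_sum: "ell (\<Sum>b\<in>B. c b *\<^sub>R b) = (\<Sum>b\<in>B. c b * ell b)"
  by (simp add: linear_sum[OF linear_ell] linear_scale[OF linear_ell])

text \<open>
  Dropping the rays with coefficient zero leaves a simplex: a ray with \<open>ell > 0\<close> remains, because
  \<open>ell\<close> is positive at the point.
\<close>

lemma K_iff_interior:
  assumes B: "B \<in> \<Delta>"
  shows "x \<in> K B \<longleftrightarrow> (\<exists>S\<subseteq>B. interior_point S x)"
proof
  assume "x \<in> K B"
  then obtain c where c: "\<forall>b\<in>B. 0 \<le> c b" "x = (\<Sum>b\<in>B. c b *\<^sub>R b)" "0 < ell x"
    unfolding half_open_cone_def by blast
  define S where "S = {b \<in> B. c b > 0}"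
  have "x = (\<Sum>b\<in>S. c b *\<^sub>R b)"
    unfolding c(2) S_def using c(1) finite_simplex[OF B] by (intro sum.mono_neutral_right) force+
  then have "positive_on S x" unfolding positive_on_def S_def by blast
  moreover have "\<exists>b\<in>B. c b * ell b > 0"
  proof (rule ccontr)
    assume "\<not> ?thesis"
    then have "(\<Sum>b\<in>B. c b * ell b) \<le> 0" by (intro sum_nonpos) force
    then show False using c(2,3) ell_sum by simp
  qed
  then obtain b where b: "b \<in> B" "c b * ell b > 0" by blast
  then have "b \<in> S" "0 < ell b"
    using bspec[OF c(1) b(1)] ell_nonneg[OF B b(1)] unfolding S_def
    by (auto simp: zero_less_mult_iff)
  then have "S \<in> \<Delta>" using subsimplex[OF B, of S b] unfolding S_def by blast
  moreover have "S \<subseteq> B" unfolding S_def by blast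
  ultimately show "\<exists>S\<subseteq>B. interior_point S x" unfolding interior_point_def by blast
next
  assume "\<exists>S\<subseteq>B. interior_point S x"
  then obtain S c where S: "S \<subseteq> B" "S \<in> \<Delta>" "\<forall>b\<in>S. 0 < c b" "x = (\<Sum>b\<in>S. c b *\<^sub>R b)"
    unfolding interior_point_def positive_on_def by blast
  have "x = (\<Sum>b\<in>B. (if b \<in> S then c b else 0) *\<^sub>R b)"
    unfolding S(4) using finite_simplex[OF B] S(1) by (intro sum.mono_neutral_cong_left) auto
  moreover have "0 < ell x"
  proof -
    obtain b where b: "b \<in> S" "0 < ell b" using ell_pos[OF S(2)] by blast
    have "0 < (\<Sum>b\<in>S. c b * ell b)"
      using b S(3) ell_nonneg[OF S(2)] finite_simplex[OF S(2)]
      by (intro sum_pos2[of _ b]) (auto intro: mult_nonneg_nonneg less_imp_le)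
    then show ?thesis unfolding S(4) ell_sum .
  qed
  ultimately show "x \<in> K B" using S(3) unfolding half_open_cone_def
    by (intro CollectI exI[of _ "\<lambda>b. if b \<in> S then c b else 0"]) (auto intro: less_imp_le)
qed

sublocale cones: strata \<Delta> interior_point
proof
  fix B S S' C :: "'v set" and x y :: 'v and s t :: real
  show "B \<in> \<Delta> \<Longrightarrow> finite B" by (rule finite_simplex)
  show "interior_point S x \<Longrightarrow> S \<in> \<Delta>" by (simp add: interior_point_def)
  show "B \<in> \<Delta> \<Longrightarrow> S \<in> \<Delta> \<Longrightarrow> S \<subseteq> C \<Longrightarrow> C \<subseteq> B \<Longrightarrow> C \<in> \<Delta>"
    using ell_pos subsimplex by blast
  show "S \<in> \<Delta> \<Longrightarrow> \<exists>x. interior_point S x" using positive_on_sum interior_point_def by blast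
  show "interior_point S x \<Longrightarrow> interior_point S' x \<Longrightarrow> S = S'"
    using disjoint_interiors unfolding interior_point_def by blast
  show "interior_point (S \<union> S') (s *\<^sub>R x + t *\<^sub>R y)"
    if "B \<in> \<Delta>" "S \<subseteq> B" "S' \<subseteq> B" "interior_point S x" "interior_point S' y" "0 < s" "0 < t"
  proof -
    have S: "S \<in> \<Delta>" "S' \<in> \<Delta>" "positive_on S x" "positive_on S' y"
      using that by (auto simp: interior_point_def)
    obtain b where "b \<in> S" "0 < ell b" using ell_pos[OF S(1)] by blast
    then have "S \<union> S' \<in> \<Delta>" using subsimplex[OF that(1), of "S \<union> S'" b] that by blast
    moreover have "positive_on (S \<union> S') (s *\<^sub>R x + t *\<^sub>R y)"
      using finite_simplex S that by (intro positive_on_combine) auto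
    ultimately show ?thesis by (simp add: interior_point_def)
  qed
  show "\<exists>\<epsilon>>0. interior_point S (x + \<epsilon> *\<^sub>R (x - y))"
    if "S' \<subseteq> S" "interior_point S x" "interior_point S' y"
  proof -
    have S: "S \<in> \<Delta>" "positive_on S x" "positive_on S' y"
      using that by (auto simp: interior_point_def)
    have "y \<in> span S" using positive_on_span[OF S(3)] span_mono[OF that(1)] by blast
    then have "x - y \<in> span S" using positive_on_span[OF S(2)] span_diff by blast
    from positive_on_perturb[OF finite_simplex[OF S(1)] S(2) this] S(1)
    show ?thesis by (auto simp: interior_point_def)
  qed
qed

lemma K_closed_stratum: "B \<in> \<Delta> \<Longrightarrow> K B = cones.closed_stratum B"
  using K_iff_interior unfolding cones.closed_stratum_def by blast

lemma K_subset_iff: "B \<in> \<Delta> \<Longrightarrow> C \<in> \<Delta> \<Longrightarrow> K B \<subseteq> K C \<longleftrightarrow> B \<subseteq> C"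
  using cones.closed_stratum_subset_iff K_closed_stratum by simp

lemma K_eq_iff: "B \<in> \<Delta> \<Longrightarrow> C \<in> \<Delta> \<Longrightarrow> K B = K C \<longleftrightarrow> B = C"
  using cones.closed_stratum_inject K_closed_stratum by simp

lemma K_subset_span: "B \<in> \<Delta> \<Longrightarrow> K B \<subseteq> span B"
  unfolding half_open_cone_def by (auto intro: span_sum span_scale span_base)

lemma sum_in_K: "B \<in> \<Delta> \<Longrightarrow> \<Sum>B \<in> K B"
  using K_iff_interior positive_on_sum unfolding interior_point_def by blast

lemma sum_plus_in_K:
  assumes "B \<in> \<Delta>" "b \<in> B" shows "\<Sum>B + b \<in> K B"
proof -
  have "positive_on B (\<Sum>c\<in>B. (if c = b then 2 else 1) *\<^sub>R c)"
    unfolding positive_on_def by (intro exI[of _ "\<lambda>c. if c = b then 2 else 1"]) simp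
  moreover have "(\<Sum>c\<in>B. (if c = b then 2 else 1) *\<^sub>R c) = \<Sum>B + b"
    using finite_simplex[OF assms(1)] assms(2)
    by (simp add: sum.remove[of B b] scaleR_2)
  ultimately show ?thesis using assms K_iff_interior unfolding interior_point_def by auto
qed

lemma span_K: assumes B: "B \<in> \<Delta>" shows "span (K B) = span B"
proof (rule subset_antisym)
  show "span (K B) \<subseteq> span B" using K_subset_span[OF B] by (simp add: span_minimal)
  have "b \<in> span (K B)" if "b \<in> B" for b
    using span_diff[OF span_base span_base, OF sum_plus_in_K[OF B that] sum_in_K[OF B]] by simp
  then show "span B \<subseteq> span (K B)" by (metis span_mono span_span subsetI)
qed

lemma affine_hull_K: assumes B: "B \<in> \<Delta>" shows "affine hull (K B) = span B"
proof -
  have "2 *\<^sub>R \<Sum>B \<in> K B"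
    using sum_in_K[OF B] positive_on_scale[of 2] positive_on_sum K_iff_interior[OF B] B
    unfolding interior_point_def by auto
  then have "2 *\<^sub>R \<Sum>B + (- 1) *\<^sub>R (2 *\<^sub>R \<Sum>B) \<in> affine hull (K B)"
    using mem_affine[OF affine_affine_hull, of "\<Sum>B" "K B" "2 *\<^sub>R \<Sum>B" 2 "-1"]
      hull_subset[of "K B" affine] sum_in_K[OF B] by auto
  then have "0 \<in> affine hull (K B)" by simp
  then show ?thesis using affine_hull_span_0 span_K[OF B] by blast
qed

lemma dual_forms:
  assumes "B \<in> \<Delta>"
  obtains f where "\<And>b. b \<in> B \<Longrightarrow> int_form \<Lambda> (f b)" "\<And>b. b \<in> B \<Longrightarrow> f b b > 0"
    "\<And>b c. b \<in> B \<Longrightarrow> f b (\<Sum>x\<in>B. c x *\<^sub>R x) = c b * f b b"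
proof -
  obtain f where f: "\<And>b. b \<in> B \<Longrightarrow> int_form \<Lambda> (f b)" "\<And>b. b \<in> B \<Longrightarrow> f b b > 0"
    "\<And>b b'. b \<in> B \<Longrightarrow> b' \<in> B \<Longrightarrow> b' \<noteq> b \<Longrightarrow> f b b' = 0"
    using integral_dual_forms[OF lattice finite_simplex[OF assms] simplex_lattice[OF assms]
        independent_simplex[OF assms]] by blast
  have "f b (\<Sum>x\<in>B. c x *\<^sub>R x) = c b * f b b" if b: "b \<in> B" for b c
  proof -
    have lin: "linear (f b)" using f(1)[OF b] int_form_def by blast
    have "f b (\<Sum>x\<in>B. c x *\<^sub>R x) = (\<Sum>x\<in>B. c x * f b x)"
      by (simp add: linear_sum[OF lin] linear_scale[OF lin])
    also have "\<dots> = (\<Sum>x\<in>B. if x = b then c b * f b b else 0)"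
      by (intro sum.cong) (auto simp: f(3)[OF b])
    finally show ?thesis using b finite_simplex[OF assms] by simp
  qed
  then show thesis using that f by blast
qed

text \<open>
  The dual forms of the rays give the non-strict inequalities, and \<open>ell\<close> gives the strict one.
\<close>

lemma general_polyhedron_K:
  assumes B: "B \<in> \<Delta>" shows "general_polyhedron (int_span B) (K B)"
proof -
  obtain f where f: "\<And>b. b \<in> B \<Longrightarrow> int_form \<Lambda> (f b)" "\<And>b. b \<in> B \<Longrightarrow> f b b > 0"
    "\<And>b c. b \<in> B \<Longrightarrow> f b (\<Sum>x\<in>B. c x *\<^sub>R x) = c b * f b b" using dual_forms[OF B] by blast
  have sub: "int_span B \<subseteq> \<Lambda>" using saturated[OF B] by blast
  have "K B = {x \<in> span B. (\<forall>b\<in>B. f b x \<ge> 0) \<and> ell x > 0}"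
  proof (intro equalityI subsetI)
    fix x assume "x \<in> K B"
    then obtain c where c: "\<forall>b\<in>B. 0 \<le> c b" "x = (\<Sum>b\<in>B. c b *\<^sub>R b)" "0 < ell x"
      unfolding half_open_cone_def by blast
    have "0 \<le> f b x" if "b \<in> B" for b
      unfolding c(2) f(3)[OF that]
      using mult_nonneg_nonneg[OF bspec[OF c(1) that] less_imp_le[OF f(2)[OF that]]] .
    then show "x \<in> {x \<in> span B. (\<forall>b\<in>B. f b x \<ge> 0) \<and> ell x > 0}"
      using K_subset_span[OF B] \<open>x \<in> K B\<close> c(3) by blast
  next
    fix x assume x: "x \<in> {x \<in> span B. (\<forall>b\<in>B. f b x \<ge> 0) \<and> ell x > 0}"
    then obtain c where c: "x = (\<Sum>b\<in>B. c b *\<^sub>R b)" using span_finite[OF finite_simplex[OF B]] by auto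
    have "0 \<le> c b" if "b \<in> B" for b
      using x f(3)[OF that, of c] f(2)[OF that] c that by (auto simp: zero_le_mult_iff)
    then show "x \<in> K B" using x c unfolding half_open_cone_def by blast
  qed
  then have "K B = {x \<in> span (int_span B). (\<forall>(g, c)\<in>{}. g x = c) \<and>
      (\<forall>(g, c)\<in>(\<lambda>b. (f b, 0)) ` B. g x \<ge> c) \<and> (\<forall>(g, c)\<in>{(ell, 0)}. g x > c)}"
    by (auto simp: span_int_span finite_simplex[OF B])
  moreover have "\<forall>(g, c)\<in>{} \<union> (\<lambda>b. (f b, 0)) ` B \<union> {(ell, 0::real)}. int_form (int_span B) g"
  proof -
    have "int_form \<Lambda> ell" using linear_ell ell_lattice by (simp add: int_form_def)
    then show ?thesis using f(1) int_form_sub[OF _ sub] by auto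
  qed
  ultimately show ?thesis unfolding general_polyhedron_def
    by (intro exI[of _ "{}"] exI[of _ "(\<lambda>b. (f b, 0)) ` B"] exI[of _ "{(ell, 0)}"])
      (use finite_simplex[OF B] in simp)
qed

end

section \<open>The star of a cone\<close>

text \<open>
  The star of the cone with rays \<open>T\<close>, seen from a point \<open>b0\<close> of its relative interior, which will
  be moved to the origin.
\<close>

locale cone_star = cone_complex +
  fixes T :: "'a set" and b0 :: 'a
  assumes centre: "interior_point T b0"
begin

text \<open>\<open>germ S v\<close>: from \<open>b0\<close>, the direction \<open>v\<close> leads into the relative interior of the cone of \<open>S\<close>.\<close>

definition germ :: "'a set \<Rightarrow> 'a \<Rightarrow> bool" where
  "germ S v \<longleftrightarrow> T \<subseteq> S \<and> (\<exists>\<epsilon>>0. interior_point S (b0 + \<epsilon> *\<^sub>R v))"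

lemma T: "T \<in> \<Delta>" "positive_on T b0"
  using centre by (auto simp: interior_point_def)

lemma interior_point_span: "interior_point S x \<Longrightarrow> x \<in> span \<Lambda>"
  using positive_on_span[of S x] span_mono[OF simplex_lattice[of S]] unfolding interior_point_def by blast

text \<open>
  The point \<open>b0 + \<delta> v\<close> lies on the segment from \<open>b0\<close> to \<open>b0 + \<epsilon> v\<close>, and the strata at its ends are
  \<open>T\<close> and \<open>S\<close> with \<open>T \<subseteq> S\<close>.
\<close>

lemma germ_shrink:
  assumes "T \<subseteq> S" "0 < \<delta>" "\<delta> \<le> \<epsilon>" "interior_point S (b0 + \<epsilon> *\<^sub>R v)"
  shows "interior_point S (b0 + \<delta> *\<^sub>R v)"
proof (cases "\<delta> = \<epsilon>")
  case False
  have S: "S \<in> \<Delta>" using assms(4) interior_point_def by blast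
  have "interior_point (T \<union> S) ((1 - \<delta> / \<epsilon>) *\<^sub>R b0 + (\<delta> / \<epsilon>) *\<^sub>R (b0 + \<epsilon> *\<^sub>R v))"
    using assms False by (intro cones.combine[OF S] centre) auto
  moreover have "(1 - \<delta> / \<epsilon>) *\<^sub>R b0 + (\<delta> / \<epsilon>) *\<^sub>R (b0 + \<epsilon> *\<^sub>R v) = b0 + \<delta> *\<^sub>R v"
    using assms by (simp add: algebra_simps)
  ultimately show ?thesis using assms(1) by (simp add: Un_absorb1)
qed (use assms in simp)

lemma germ_witness:
  assumes "germ S x" "germ S' y"
  obtains \<delta> where "\<delta> > 0" "interior_point S (b0 + \<delta> *\<^sub>R x)" "interior_point S' (b0 + \<delta> *\<^sub>R y)"
proof -
  obtain \<epsilon> \<epsilon>' where *: "T \<subseteq> S" "T \<subseteq> S'" "\<epsilon> > 0" "\<epsilon>' > 0"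
    "interior_point S (b0 + \<epsilon> *\<^sub>R x)" "interior_point S' (b0 + \<epsilon>' *\<^sub>R y)"
    using assms unfolding germ_def by blast
  show thesis
    using that[of "min \<epsilon> \<epsilon>'"] germ_shrink[OF *(1) _ _ *(5), of "min \<epsilon> \<epsilon>'"]
      germ_shrink[OF *(2) _ _ *(6), of "min \<epsilon> \<epsilon>'"] *(3,4) by simp
qed

sublocale star: strata "{B \<in> \<Delta>. T \<subseteq> B}" germ
proof
  fix B S S' C :: "'a set" and x y :: 'a and s t :: real
  show "finite B" if "B \<in> {B \<in> \<Delta>. T \<subseteq> B}" using that finite_simplex by blast
  show "S \<in> {B \<in> \<Delta>. T \<subseteq> B}" if "germ S x"
    using that by (auto simp: germ_def interior_point_def)
  show "C \<in> {B \<in> \<Delta>. T \<subseteq> B}" if "B \<in> {B \<in> \<Delta>. T \<subseteq> B}" "S \<in> {B \<in> \<Delta>. T \<subseteq> B}" "S \<subseteq> C" "C \<subseteq> B"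
    using that cones.index_between by blast
  show "\<exists>x. germ S x" if "S \<in> {B \<in> \<Delta>. T \<subseteq> B}"
  proof
    show "germ S (\<Sum>S - b0)"
      using that positive_on_sum unfolding germ_def interior_point_def
      by (auto intro!: exI[of _ 1])
  qed
  show "S = S'" if "germ S x" "germ S' x"
    using germ_witness[OF that] cones.unique by blast
  show "germ (S \<union> S') (s *\<^sub>R x + t *\<^sub>R y)"
    if *: "B \<in> {B \<in> \<Delta>. T \<subseteq> B}" "S \<subseteq> B" "S' \<subseteq> B" "germ S x" "germ S' y" "0 < s" "0 < t" "s + t = 1"
  proof -
    obtain \<delta> where \<delta>: "\<delta> > 0" "interior_point S (b0 + \<delta> *\<^sub>R x)" "interior_point S' (b0 + \<delta> *\<^sub>R y)"
      using germ_witness[OF *(4,5)] .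
    have "interior_point (S \<union> S') (s *\<^sub>R (b0 + \<delta> *\<^sub>R x) + t *\<^sub>R (b0 + \<delta> *\<^sub>R y))"
      using *(1) by (intro cones.combine[OF _ *(2,3) \<delta>(2,3) *(6-8)]) simp
    moreover have "s *\<^sub>R (b0 + \<delta> *\<^sub>R x) + t *\<^sub>R (b0 + \<delta> *\<^sub>R y) = (s + t) *\<^sub>R b0 + \<delta> *\<^sub>R (s *\<^sub>R x + t *\<^sub>R y)"
      by (simp add: algebra_simps)
    ultimately show ?thesis using *(4,8) \<delta>(1) unfolding germ_def by auto
  qed
  show "\<exists>\<epsilon>>0. germ S (x + \<epsilon> *\<^sub>R (x - y))" if S: "S' \<subseteq> S" "germ S x" "germ S' y"
  proof -
    obtain \<delta> where \<delta>: "\<delta> > 0" "interior_point S (b0 + \<delta> *\<^sub>R x)" "interior_point S' (b0 + \<delta> *\<^sub>R y)"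
      using germ_witness[OF S(2,3)] .
    obtain \<epsilon> where \<epsilon>: "\<epsilon> > 0"
      "interior_point S (b0 + \<delta> *\<^sub>R x + \<epsilon> *\<^sub>R (b0 + \<delta> *\<^sub>R x - (b0 + \<delta> *\<^sub>R y)))"
      using cones.extend[OF S(1) \<delta>(2,3)] by blast
    moreover have "b0 + \<delta> *\<^sub>R x + \<epsilon> *\<^sub>R (b0 + \<delta> *\<^sub>R x - (b0 + \<delta> *\<^sub>R y)) = b0 + \<delta> *\<^sub>R (x + \<epsilon> *\<^sub>R (x - y))"
      by (simp add: algebra_simps)
    ultimately have "interior_point S (b0 + \<delta> *\<^sub>R (x + \<epsilon> *\<^sub>R (x - y)))" by metis
    then have "germ S (x + \<epsilon> *\<^sub>R (x - y))" using S(2) \<delta>(1) unfolding germ_def by blast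
    then show ?thesis using \<epsilon>(1) by blast
  qed
qed

text \<open>
  The tangent cone at \<open>b0\<close>: the coefficients at \<open>T\<close> are positive there, hence unrestricted for
  directions.
\<close>

definition local_cone :: "'a set \<Rightarrow> 'a set" where
  "local_cone B = {\<Sum>b\<in>B. c b *\<^sub>R b | c. \<forall>b\<in>B - T. (0::real) \<le> c b}"

lemma local_cone_iff_germ:
  assumes B: "B \<in> \<Delta>" "T \<subseteq> B"
  shows "v \<in> local_cone B \<longleftrightarrow> (\<exists>S\<subseteq>B. germ S v)"
proof
  have fin: "finite B" "finite T" using finite_simplex B(1) T(1) by auto
  assume "v \<in> local_cone B"
  then obtain c where c: "v = (\<Sum>b\<in>B. c b *\<^sub>R b)" "\<forall>b\<in>B - T. 0 \<le> c b"
    unfolding local_cone_def by blast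
  have "(\<Sum>b\<in>T. c b *\<^sub>R b) \<in> span T" by (intro span_sum span_scale span_base)
  then obtain \<epsilon> where \<epsilon>: "\<epsilon> > 0" "positive_on T (b0 + \<epsilon> *\<^sub>R (\<Sum>b\<in>T. c b *\<^sub>R b))"
    using positive_on_perturb[OF fin(2) T(2)] by blast
  define P where "P = {b \<in> B - T. c b > 0}"
  have "positive_on P (\<Sum>b\<in>P. c b *\<^sub>R b)" unfolding positive_on_def P_def by blast
  moreover have "finite P" using fin by (simp add: P_def)
  ultimately have "positive_on (T \<union> P) (1 *\<^sub>R (b0 + \<epsilon> *\<^sub>R (\<Sum>b\<in>T. c b *\<^sub>R b)) + \<epsilon> *\<^sub>R (\<Sum>b\<in>P. c b *\<^sub>R b))"
    using fin(2) \<epsilon> by (intro positive_on_combine) auto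
  moreover have "v = (\<Sum>b\<in>T. c b *\<^sub>R b) + (\<Sum>b\<in>P. c b *\<^sub>R b)"
  proof -
    have "(\<Sum>b\<in>P. c b *\<^sub>R b) = (\<Sum>b\<in>B - T. c b *\<^sub>R b)"
      using c(2) fin by (intro sum.mono_neutral_left) (force simp: P_def)+
    then show ?thesis
      unfolding c(1) using sum.subset_diff[OF B(2) fin(1), of "\<lambda>b. c b *\<^sub>R b"] by simp
  qed
  ultimately have "positive_on (T \<union> P) (b0 + \<epsilon> *\<^sub>R v)" by (simp add: algebra_simps)
  moreover have "T \<union> P \<in> \<Delta>"
    using cones.index_between[OF B(1) T(1), of "T \<union> P"] B(2) by (auto simp: P_def)
  ultimately have "germ (T \<union> P) v" using \<epsilon>(1) unfolding germ_def interior_point_def by blast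
  then show "\<exists>S\<subseteq>B. germ S v" using B(2) by (intro exI[of _ "T \<union> P"]) (auto simp: P_def)
next
  have fin: "finite B" "finite T" using finite_simplex B(1) T(1) by auto
  assume "\<exists>S\<subseteq>B. germ S v"
  then obtain S \<epsilon> where S: "S \<subseteq> B" "T \<subseteq> S" "\<epsilon> > 0" "positive_on S (b0 + \<epsilon> *\<^sub>R v)"
    unfolding germ_def interior_point_def by blast
  obtain a d where a: "\<forall>b\<in>T. 0 < a b" "b0 = (\<Sum>b\<in>T. a b *\<^sub>R b)"
    and d: "\<forall>b\<in>S. 0 < d b" "b0 + \<epsilon> *\<^sub>R v = (\<Sum>b\<in>S. d b *\<^sub>R b)"
    using S(4) T(2) unfolding positive_on_def by blast
  define e where "e = (\<lambda>b. (1 / \<epsilon>) * ((if b \<in> S then d b else 0) - (if b \<in> T then a b else 0)))"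
  have "b0 = (\<Sum>b\<in>B. (if b \<in> T then a b else 0) *\<^sub>R b)"
    unfolding a(2) using B(2) fin by (intro sum.mono_neutral_cong_left) auto
  moreover have "b0 + \<epsilon> *\<^sub>R v = (\<Sum>b\<in>B. (if b \<in> S then d b else 0) *\<^sub>R b)"
    unfolding d(2) using S(1) fin by (intro sum.mono_neutral_cong_left) auto
  ultimately have "\<epsilon> *\<^sub>R v = (\<Sum>b\<in>B. (if b \<in> S then d b else 0) *\<^sub>R b) - (\<Sum>b\<in>B. (if b \<in> T then a b else 0) *\<^sub>R b)"
    by (metis add_diff_cancel_left')
  then have "(1 / \<epsilon>) *\<^sub>R (\<epsilon> *\<^sub>R v) = (\<Sum>b\<in>B. e b *\<^sub>R b)"
    by (simp only: e_def scaleR_scaleR[symmetric] scaleR_sum_right[symmetric] sum_subtractf[symmetric]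
        scaleR_left_diff_distrib[symmetric])
  then have "v = (\<Sum>b\<in>B. e b *\<^sub>R b)" using S(3) by simp
  moreover have "\<forall>b\<in>B - T. 0 \<le> e b" using d(1) S(3) by (auto simp: e_def less_imp_le)
  ultimately show "v \<in> local_cone B" unfolding local_cone_def by blast
qed

lemma local_cone_closed_stratum:
  "B \<in> \<Delta> \<Longrightarrow> T \<subseteq> B \<Longrightarrow> local_cone B = star.closed_stratum B"
  using local_cone_iff_germ unfolding star.closed_stratum_def by blast

lemma zero_in_local_cone: "0 \<in> local_cone B"
  unfolding local_cone_def by (intro CollectI exI[of _ "\<lambda>_. 0"]) simp

lemma local_cone_span: "local_cone B \<subseteq> span B"
  unfolding local_cone_def by (auto intro: span_sum span_scale span_base)

text \<open>
  The dual forms of the rays outside \<open>T\<close>, together with the forms cutting out the span, taken with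
  both signs since a rational cone is given by inequalities.
\<close>

lemma local_cone_forms:
  assumes B: "B \<in> \<Delta>" "T \<subseteq> B"
  shows "\<exists>N. finite N \<and> (\<forall>f\<in>N. int_form \<Lambda> f) \<and> local_cone B = {x \<in> span \<Lambda>. \<forall>f\<in>N. 0 \<le> f x}"
proof -
  obtain f where f: "\<And>b. b \<in> B \<Longrightarrow> int_form \<Lambda> (f b)" "\<And>b. b \<in> B \<Longrightarrow> f b b > 0"
    "\<And>b c. b \<in> B \<Longrightarrow> f b (\<Sum>x\<in>B. c x *\<^sub>R x) = c b * f b b" using dual_forms[OF B(1)] by blast
  obtain F where F: "finite F" "\<forall>f\<in>F. int_form \<Lambda> f" "span B = {x \<in> span \<Lambda>. \<forall>f\<in>F. f x = 0}"
    using integral_forms_cut_out_span[OF lattice finite_simplex[OF B(1)] simplex_lattice[OF B(1)]] by blast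
  define N where "N = F \<union> (\<lambda>f x. - f x) ` F \<union> f ` (B - T)"
  have "local_cone B = {x \<in> span \<Lambda>. \<forall>f\<in>N. 0 \<le> f x}"
  proof (intro equalityI subsetI)
    fix x assume x: "x \<in> local_cone B"
    then obtain c where c: "x = (\<Sum>b\<in>B. c b *\<^sub>R b)" "\<forall>b\<in>B - T. 0 \<le> c b"
      unfolding local_cone_def by blast
    have "0 \<le> f b x" if "b \<in> B - T" for b
      using that f(2)[of b] f(3)[of b c] c by (auto intro!: mult_nonneg_nonneg less_imp_le)
    moreover have "x \<in> span \<Lambda>" "\<forall>f\<in>F. f x = 0" using x local_cone_span F(3) by blast+
    ultimately show "x \<in> {x \<in> span \<Lambda>. \<forall>f\<in>N. 0 \<le> f x}" by (auto simp: N_def)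
  next
    fix x assume x: "x \<in> {x \<in> span \<Lambda>. \<forall>f\<in>N. 0 \<le> f x}"
    have "g x = 0" if "g \<in> F" for g
    proof -
      have "g \<in> N" "(\<lambda>x. - g x) \<in> N" using that by (auto simp: N_def)
      moreover have "\<forall>f\<in>N. 0 \<le> f x" using x by simp
      ultimately have "0 \<le> g x" "0 \<le> (\<lambda>x. - g x) x" by (metis (no_types, lifting))+
      then show ?thesis by simp
    qed
    then have "x \<in> span B" using x F(3) by blast
    then obtain c where c: "x = (\<Sum>b\<in>B. c b *\<^sub>R b)" using span_finite[OF finite_simplex[OF B(1)]] by auto
    have "0 \<le> c b" if "b \<in> B - T" for b
    proof -
      have "0 \<le> f b x" using x that by (auto simp: N_def)
      then show ?thesis using f(2,3)[of b] that c by (auto simp: zero_le_mult_iff)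
    qed
    then show "x \<in> local_cone B" unfolding local_cone_def c by blast
  qed
  moreover have "finite N" using F(1) finite_simplex[OF B(1)] by (simp add: N_def)
  moreover have "\<forall>f\<in>N. int_form \<Lambda> f" using F(2) f(1) int_form_uminus by (auto simp: N_def)
  ultimately show ?thesis by blast
qed

definition local_fan :: "'a set set" where
  "local_fan = local_cone ` {B \<in> \<Delta>. T \<subseteq> B}"

lemma fan_local_fan: "fan \<Lambda> local_fan"
  unfolding fan_def
proof (intro conjI ballI allI impI)
  show "finite local_fan" unfolding local_fan_def using locally_finite[OF T(1)] by simp
next
  fix C assume "C \<in> local_fan"
  then show "rational_cone \<Lambda> C"
    using local_cone_forms unfolding local_fan_def rational_cone_def by auto
next
  fix C D assume "C \<in> local_fan" and D: "D face_of C \<and> D \<noteq> {}"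
  then obtain B where B: "B \<in> \<Delta>" "T \<subseteq> B" "C = star.closed_stratum B"
    using local_cone_closed_stratum unfolding local_fan_def by auto
  obtain S where "S \<in> \<Delta>" "T \<subseteq> S" "D = star.closed_stratum S"
    using star.face_of_closed_stratum[of B D] B D by auto
  then show "D \<in> local_fan" using local_cone_closed_stratum unfolding local_fan_def by blast
next
  fix C D assume "C \<in> local_fan" "D \<in> local_fan"
  then obtain B B' where B: "B \<in> \<Delta>" "T \<subseteq> B" "C = star.closed_stratum B"
    "B' \<in> \<Delta>" "T \<subseteq> B'" "D = star.closed_stratum B'"
    using local_cone_closed_stratum unfolding local_fan_def by auto
  have "C \<inter> D = star.closed_stratum (B \<inter> B')" unfolding B star.closed_stratum_Int ..
  then show "C \<inter> D face_of C" "C \<inter> D face_of D"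
    using star.closed_stratum_face[of B "B \<inter> B'"] star.closed_stratum_face[of B' "B \<inter> B'"] B by auto
qed

lemma general_fan_local_fan: "general_fan \<Lambda> local_fan"
proof -
  have "{} \<notin> local_fan" unfolding local_fan_def using zero_in_local_cone by blast
  then show ?thesis unfolding general_fan_def
    by (intro exI[of _ local_fan] exI[of _ "{}"]) (auto simp: fan_local_fan)
qed

definition open_star :: "'a set" where
  "open_star = {x. \<exists>S. T \<subseteq> S \<and> interior_point S x}"

definition star_image :: "'a set" where
  "star_image = (\<lambda>x. x - b0) ` open_star"

lemma star_image_iff: "v \<in> star_image \<longleftrightarrow> (\<exists>S. T \<subseteq> S \<and> interior_point S (b0 + v))"
  unfolding star_image_def open_star_def by (force simp: image_iff algebra_simps)

lemma star_image_Int_local_cone: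
  assumes B: "B \<in> \<Delta>" "T \<subseteq> B"
  shows "(\<lambda>x. x - b0) ` (K B \<inter> open_star) = star_image \<inter> local_cone B"
proof (intro equalityI subsetI)
  fix v assume "v \<in> (\<lambda>x. x - b0) ` (K B \<inter> open_star)"
  then obtain x where x: "x \<in> K B" "x \<in> open_star" "v = x - b0" by blast
  obtain S where S: "T \<subseteq> S" "interior_point S x" using x(2) unfolding open_star_def by blast
  obtain S' where S': "S' \<subseteq> B" "interior_point S' x" using x(1) K_iff_interior[OF B(1)] by blast
  have "S = S'" using cones.unique S(2) S'(2) by blast
  moreover have "germ S v" unfolding germ_def using S x(3) by (auto intro!: exI[of _ 1])
  ultimately have "v \<in> local_cone B" using local_cone_iff_germ[OF B] S'(1) by blast
  moreover have "v \<in> star_image" using x unfolding star_image_def by blast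
  ultimately show "v \<in> star_image \<inter> local_cone B" by blast
next
  fix v assume v: "v \<in> star_image \<inter> local_cone B"
  then obtain S where S: "T \<subseteq> S" "interior_point S (b0 + v)" using star_image_iff by blast
  have "germ S v" unfolding germ_def using S by (auto intro!: exI[of _ 1])
  moreover obtain S' where "S' \<subseteq> B" "germ S' v" using v local_cone_iff_germ[OF B] by blast
  ultimately have "S \<subseteq> B" using star.unique by blast
  then have "b0 + v \<in> K B" using S(2) K_iff_interior[OF B(1)] by blast
  moreover have "b0 + v \<in> open_star" using S unfolding open_star_def by blast
  ultimately show "v \<in> (\<lambda>x. x - b0) ` (K B \<inter> open_star)"
    by (intro image_eqI[of _ _ "b0 + v"]) auto
qed

text \<open>
  Outside the star, either the facet inequalities of \<open>local_cone B\<close> fail or one of the coordinates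
  belonging to \<open>T\<close> is not positive.
\<close>

lemma star_image_open_near_cone:
  assumes B: "B \<in> \<Delta>" "T \<subseteq> B"
  shows "\<exists>Q. openin lin_topology Q \<and> star_image \<subseteq> Q \<and> Q \<inter> local_cone B \<subseteq> star_image"
proof -
  obtain N where N: "finite N" "\<forall>f\<in>N. int_form \<Lambda> f" "local_cone B = {x \<in> span \<Lambda>. \<forall>f\<in>N. 0 \<le> f x}"
    using local_cone_forms[OF B] by blast
  obtain f where f: "\<And>b. b \<in> B \<Longrightarrow> int_form \<Lambda> (f b)" "\<And>b. b \<in> B \<Longrightarrow> f b b > 0"
    "\<And>b c. b \<in> B \<Longrightarrow> f b (\<Sum>x\<in>B. c x *\<^sub>R x) = c b * f b b" using dual_forms[OF B(1)] by blast
  have lin: "linear (f b)" if "b \<in> T" for b using f(1) B(2) that int_form_def by blast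
  define Q where "Q = (\<Union>g\<in>N. {v. g v < 0}) \<union> (\<Inter>b\<in>T. {v. f b v > - f b b0})"
  have "T \<noteq> {}" using ell_pos[OF T(1)] by blast
  then have "openin lin_topology Q" unfolding Q_def
    using finite_simplex[OF T(1)] N(2) lin
    by (intro openin_Un openin_Union openin_Inter) (auto simp: int_form_def intro: openin_lin_pos openin_lin_neg)
  moreover have "star_image \<subseteq> Q"
  proof
    fix v assume v: "v \<in> star_image"
    show "v \<in> Q"
    proof (cases "v \<in> local_cone B")
      case True
      then have "v \<in> (\<lambda>x. x - b0) ` (K B \<inter> open_star)" using v star_image_Int_local_cone[OF B] by blast
      then have bv: "b0 + v \<in> K B" "b0 + v \<in> open_star" by auto
      obtain S where S: "T \<subseteq> S" "interior_point S (b0 + v)" using bv(2) unfolding open_star_def by blast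
      obtain S' where S': "S' \<subseteq> B" "interior_point S' (b0 + v)" using bv(1) K_iff_interior[OF B(1)] by blast
      have "S = S'" using cones.unique S(2) S'(2) by blast
      obtain c where c: "\<forall>b\<in>S. 0 < c b" "b0 + v = (\<Sum>b\<in>S. c b *\<^sub>R b)"
        using S(2) unfolding interior_point_def positive_on_def by blast
      have "b0 + v = (\<Sum>b\<in>B. (if b \<in> S then c b else 0) *\<^sub>R b)"
        unfolding c(2) using S'(1) \<open>S = S'\<close> finite_simplex[OF B(1)]
        by (intro sum.mono_neutral_cong_left) auto
      then have pos: "f b (b0 + v) > 0" if "b \<in> T" for b
        using f(2,3)[of b] that B(2) S(1) c(1) by (auto simp: subset_iff)
      have "f b v > - f b b0" if "b \<in> T" for b
        using pos[OF that] linear_add[OF lin[OF that], of b0 v] by simp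
      then show ?thesis unfolding Q_def by blast
    next
      case False
      obtain S where "interior_point S (b0 + v)" using v star_image_iff by blast
      then have "b0 + v \<in> span \<Lambda>" by (rule interior_point_span)
      moreover have "b0 \<in> span \<Lambda>" using centre by (rule interior_point_span)
      ultimately have "v \<in> span \<Lambda>" by (metis add_diff_cancel_left' span_diff)
      then obtain g where "g \<in> N" "g v < 0" using False N(3) by force
      then show ?thesis unfolding Q_def by blast
    qed
  qed
  moreover have "Q \<inter> local_cone B \<subseteq> star_image"
  proof
    fix v assume v: "v \<in> Q \<inter> local_cone B"
    then have "\<not> (\<exists>g\<in>N. g v < 0)" using N(3) by force
    then have pos: "f b v > - f b b0" if "b \<in> T" for b using v that unfolding Q_def by auto
    obtain c where c: "v = (\<Sum>b\<in>B. c b *\<^sub>R b)" "\<forall>b\<in>B - T. 0 \<le> c b"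
      using v unfolding local_cone_def by blast
    obtain a where a: "\<forall>b\<in>T. 0 < a b" "b0 = (\<Sum>b\<in>T. a b *\<^sub>R b)"
      using T(2) unfolding positive_on_def by blast
    define e where "e = (\<lambda>b. (if b \<in> T then a b else 0) + c b)"
    have "b0 = (\<Sum>b\<in>B. (if b \<in> T then a b else 0) *\<^sub>R b)"
      unfolding a(2) using B(2) finite_simplex[OF B(1)] by (intro sum.mono_neutral_cong_left) auto
    then have bv: "b0 + v = (\<Sum>b\<in>B. e b *\<^sub>R b)"
      unfolding c(1) by (simp add: e_def sum.distrib scaleR_left_distrib)
    have "e b > 0" if "b \<in> T" for b
    proof -
      have "f b (b0 + v) > 0" using pos[OF that] linear_add[OF lin[OF that], of b0 v] by simp
      then show ?thesis using f(2,3)[of b] that B(2) bv by (auto simp: zero_less_mult_iff)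
    qed
    define S where "S = {b \<in> B. e b > 0}"
    have "b0 + v = (\<Sum>b\<in>S. e b *\<^sub>R b)"
      unfolding bv S_def using finite_simplex[OF B(1)] c(2) \<open>\<And>b. b \<in> T \<Longrightarrow> e b > 0\<close>
      by (intro sum.mono_neutral_right) (force simp: e_def)+
    then have "positive_on S (b0 + v)" unfolding positive_on_def S_def by blast
    moreover have "T \<subseteq> S" using B(2) \<open>\<And>b. b \<in> T \<Longrightarrow> e b > 0\<close> unfolding S_def by blast
    moreover have "S \<subseteq> B" unfolding S_def by blast
    ultimately show "v \<in> star_image"
      using cones.index_between[OF B(1) T(1)] unfolding star_image_iff interior_point_def by blast
  qed
  ultimately show ?thesis by blast
qed

text \<open>
  Only finitely many cones contain \<open>T\<close>, so the neighbourhoods of the star that are good near one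
  cone can be intersected.
\<close>

lemma openin_star_image: "openin (subtopology lin_topology (\<Union>local_fan)) star_image"
proof -
  have "\<forall>B\<in>{B \<in> \<Delta>. T \<subseteq> B}. \<exists>Q. openin lin_topology Q \<and> star_image \<subseteq> Q \<and> Q \<inter> local_cone B \<subseteq> star_image"
    using star_image_open_near_cone by blast
  from bchoice[OF this] obtain Q where
    Q: "\<And>B. B \<in> \<Delta> \<Longrightarrow> T \<subseteq> B \<Longrightarrow> openin lin_topology (Q B) \<and> star_image \<subseteq> Q B \<and> Q B \<inter> local_cone B \<subseteq> star_image"
    by blast
  define W where "W = \<Inter>(Q ` {B \<in> \<Delta>. T \<subseteq> B})"
  have "openin lin_topology W" unfolding W_def
    using locally_finite[OF T(1)] T(1) Q by (intro openin_Inter) auto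
  moreover have "star_image = W \<inter> \<Union>local_fan"
  proof (intro equalityI subsetI)
    fix v assume v: "v \<in> star_image"
    then obtain S where S: "T \<subseteq> S" "interior_point S (b0 + v)" using star_image_iff by blast
    then have "germ S v" unfolding germ_def by (auto intro!: exI[of _ 1])
    moreover have "S \<in> \<Delta>" using S(2) interior_point_def by blast
    ultimately have "v \<in> local_cone S" using local_cone_iff_germ S(1) by blast
    then show "v \<in> W \<inter> \<Union>local_fan"
      using v Q S(1) \<open>S \<in> \<Delta>\<close> unfolding W_def local_fan_def by blast
  next
    fix v assume "v \<in> W \<inter> \<Union>local_fan"
    then show "v \<in> star_image" using Q unfolding W_def local_fan_def by blast
  qed
  ultimately show ?thesis unfolding openin_subtopology by blast
qed

lemma span_star_directions:
  assumes B: "B \<in> \<Delta>" "T \<subseteq> B"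
  shows "span ((\<lambda>x. x - b0) ` (K B \<inter> open_star)) = span B"
proof (rule subset_antisym)
  have "(\<lambda>x. x - b0) ` (K B \<inter> open_star) \<subseteq> span B"
    using star_image_Int_local_cone[OF B] local_cone_span by blast
  then show "span ((\<lambda>x. x - b0) ` (K B \<inter> open_star)) \<subseteq> span B" by (simp add: span_minimal)
  have "b \<in> (\<lambda>x. x - b0) ` (K B \<inter> open_star)" if b: "b \<in> B" for b
  proof -
    have "positive_on (T \<union> {b}) (1 *\<^sub>R b0 + 1 *\<^sub>R b)"
      using T finite_simplex positive_on_sum[of "{b}"] by (intro positive_on_combine) auto
    moreover have "T \<union> {b} \<in> \<Delta>" using cones.index_between[OF B(1) T(1)] B(2) b by blast
    ultimately have *: "interior_point (T \<union> {b}) (b0 + b)" unfolding interior_point_def by simp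
    have "b0 + b \<in> K B" unfolding K_iff_interior[OF B(1)]
      by (intro exI[of _ "T \<union> {b}"] conjI *) (use B(2) b in auto)
    moreover have "b0 + b \<in> open_star" unfolding open_star_def
      by (intro CollectI exI[of _ "T \<union> {b}"] conjI *) auto
    ultimately show ?thesis by (intro image_eqI[of _ _ "b0 + b"]) auto
  qed
  then show "span B \<subseteq> span ((\<lambda>x. x - b0) ` (K B \<inter> open_star))" by (meson span_mono subsetI)
qed

end

section \<open>The general polyhedral complex of a cone complex\<close>

text \<open>
  All charts are inclusions, or translations that move an interior point to the origin; all affine
  maps between charts are therefore restrictions of translations.
\<close>

locale cone_complex_gpc = cone_complex +
  fixes X :: "('a, 'a) gpc"
  assumes gtop_X: "gtop X = subtopology lin_topology (\<Union>(half_open_cone ell ` \<Delta>))"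
    and polys_X: "polys X = half_open_cone ell ` \<Delta>"
    and chart_X: "chart X = (\<lambda>\<sigma> x. x)"
    and lat_X: "B \<in> \<Delta> \<Longrightarrow> lat X (half_open_cone ell B) = int_span B"
    and star_chart_X: "B \<in> \<Delta> \<Longrightarrow>
      \<exists>b\<in>rel_int X (half_open_cone ell B). star_chart X (half_open_cone ell B) = (\<lambda>x. x - b)"
    and star_lat_X: "star_lat X = (\<lambda>\<sigma>. \<Lambda>)"
begin

lemma topspace_X: "topspace (gtop X) = \<Union>(polys X)"
  unfolding gtop_X polys_X by simp

lemma rel_int_K:
  assumes B: "B \<in> \<Delta>" shows "rel_int X (K B) = {x. interior_point B x}"
proof (intro equalityI subsetI)
  fix x assume x: "x \<in> rel_int X (K B)"
  then obtain S where S: "S \<subseteq> B" "interior_point S x"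
    using K_iff_interior[OF B] unfolding rel_int_def by blast
  have "S \<in> \<Delta>" using S interior_point_def by blast
  then have "x \<in> K S" using S K_iff_interior by blast
  then have "\<not> K S \<subset> K B" using x \<open>S \<in> \<Delta>\<close> unfolding rel_int_def polys_X by blast
  then have "S = B" using K_subset_iff[OF \<open>S \<in> \<Delta>\<close> B] K_eq_iff[OF \<open>S \<in> \<Delta>\<close> B] S(1) by blast
  then show "x \<in> {x. interior_point B x}" using S by simp
next
  fix x assume "x \<in> {x. interior_point B x}"
  then have x: "interior_point B x" by simp
  have "x \<notin> K C" if C: "C \<in> \<Delta>" "K C \<subset> K B" for C
  proof
    assume "x \<in> K C"
    then obtain S where "S \<subseteq> C" "interior_point S x" using K_iff_interior[OF C(1)] by blast
    then have "B \<subseteq> C" using cones.unique[OF x] by blast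
    then show False using C K_subset_iff[OF B C(1)] by blast
  qed
  moreover have "x \<in> K B" using x K_iff_interior[OF B] by blast
  ultimately show "x \<in> rel_int X (K B)" unfolding rel_int_def polys_X by blast
qed

lemma star_K:
  assumes B: "B \<in> \<Delta>" shows "star X (K B) = {x. \<exists>S. B \<subseteq> S \<and> interior_point S x}"
proof (intro equalityI subsetI)
  fix x assume "x \<in> star X (K B)"
  then obtain S where S: "S \<in> \<Delta>" "K B \<subseteq> K S" "x \<in> rel_int X (K S)"
    unfolding star_def polys_X by blast
  then show "x \<in> {x. \<exists>S. B \<subseteq> S \<and> interior_point S x}"
    using K_subset_iff[OF B S(1)] rel_int_K[OF S(1)] by blast
next
  fix x assume "x \<in> {x. \<exists>S. B \<subseteq> S \<and> interior_point S x}"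
  then obtain S where S: "B \<subseteq> S" "interior_point S x" by blast
  have "S \<in> \<Delta>" using S(2) interior_point_def by blast
  then have "x \<in> rel_int X (K S)" "K B \<subseteq> K S"
    using rel_int_K[of S] S K_subset_iff[OF B, of S] by auto
  then show "x \<in> star X (K B)" unfolding star_def polys_X using \<open>S \<in> \<Delta>\<close> by blast
qed

lemma star_chart_at:
  assumes "T \<in> \<Delta>"
  obtains b where "cone_star ell \<Lambda> \<Delta> T b" "star_chart X (K T) = (\<lambda>x. x - b)"
proof -
  obtain b where b: "b \<in> rel_int X (K T)" "star_chart X (K T) = (\<lambda>x. x - b)"
    using star_chart_X[OF assms] by blast
  have "cone_star ell \<Lambda> \<Delta> T b"
    by standard (use b(1) rel_int_K[OF assms] in simp)
  then show thesis using that b(2) by blast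
qed

lemma star_subset: assumes "B \<in> \<Delta>" shows "star X (K B) \<subseteq> \<Union>(K ` \<Delta>)"
  unfolding star_def polys_X rel_int_def by blast

lemma saturated_int_span:
  assumes "B \<in> \<Delta>" shows "int_span B = \<Lambda> \<inter> span (int_span B)"
  using saturated[OF assms] span_int_span[OF finite_simplex[OF assms]] by simp

lemma star_is_fan_K:
  assumes T: "T \<in> \<Delta>" shows "star_is_fan X (K T)"
proof -
  obtain b where b: "cone_star ell \<Lambda> \<Delta> T b" "star_chart X (K T) = (\<lambda>x. x - b)"
    using star_chart_at[OF T] .
  interpret S: cone_star ell \<Lambda> \<Delta> T b by (rule b(1))
  have star: "star X (K T) = S.open_star" using star_K[OF T] unfolding S.open_star_def .
  have U: "(\<lambda>x. x - b) ` S.open_star = S.star_image" unfolding S.star_image_def ..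
  have sub: "S.open_star \<subseteq> \<Union>(K ` \<Delta>)" using star_subset[OF T] star by simp
  have "homeomorphic_map (subtopology lin_topology S.open_star)
      (subtopology lin_topology ((\<lambda>x. id x + - b) ` S.open_star)) (\<lambda>x. id x + - b)"
    by (rule homeomorphic_map_lin_affine[of id id]) (auto simp: linear_id)
  then have homeo: "homeomorphic_map (subtopology (gtop X) (star X (K T)))
      (subtopology lin_topology S.star_image) (\<lambda>x. x - b)"
    using sub by (simp add: gtop_X subtopology_subtopology star U Int_absorb1)
  have "0 \<in> S.star_image" using S.star_image_iff S.centre by auto
  moreover have "{(\<lambda>x. x - b) ` (\<sigma> \<inter> S.open_star) | \<sigma>. \<sigma> \<in> K ` \<Delta> \<and> K T \<subseteq> \<sigma>} = {S.star_image \<inter> C | C. C \<in> S.local_fan}"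
  proof (intro equalityI subsetI)
    fix A assume "A \<in> {(\<lambda>x. x - b) ` (\<sigma> \<inter> S.open_star) | \<sigma>. \<sigma> \<in> K ` \<Delta> \<and> K T \<subseteq> \<sigma>}"
    then obtain B where B: "B \<in> \<Delta>" "K T \<subseteq> K B" "A = (\<lambda>x. x - b) ` (K B \<inter> S.open_star)" by blast
    have "T \<subseteq> B" using B K_subset_iff[OF T] by blast
    then have "A = S.star_image \<inter> S.local_cone B" "S.local_cone B \<in> S.local_fan"
      using B S.star_image_Int_local_cone unfolding S.local_fan_def by auto
    then show "A \<in> {S.star_image \<inter> C | C. C \<in> S.local_fan}" by blast
  next
    fix A assume "A \<in> {S.star_image \<inter> C | C. C \<in> S.local_fan}"
    then obtain B where B: "B \<in> \<Delta>" "T \<subseteq> B" "A = S.star_image \<inter> S.local_cone B"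
      unfolding S.local_fan_def by blast
    then have "A = (\<lambda>x. x - b) ` (K B \<inter> S.open_star)" "K T \<subseteq> K B"
      using S.star_image_Int_local_cone K_subset_iff[OF T] by auto
    then show "A \<in> {(\<lambda>x. x - b) ` (\<sigma> \<inter> S.open_star) | \<sigma>. \<sigma> \<in> K ` \<Delta> \<and> K T \<subseteq> \<sigma>}" using B(1) by blast
  qed
  ultimately have fan: "\<exists>F. general_fan \<Lambda> F \<and> 0 \<in> S.star_image \<and>
      openin (subtopology lin_topology (\<Union>F)) S.star_image \<and>
      {(\<lambda>x. x - b) ` (\<sigma> \<inter> S.open_star) | \<sigma>. \<sigma> \<in> K ` \<Delta> \<and> K T \<subseteq> \<sigma>} = {S.star_image \<inter> C | C. C \<in> F}"
    using S.general_fan_local_fan S.openin_star_image by blast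
  have "int_affine_embedding (lat X \<sigma>) \<Lambda> (\<sigma> \<inter> S.open_star) (\<lambda>x. x) (\<lambda>x. x - b)"
    if "\<sigma> \<in> K ` \<Delta>" for \<sigma>
  proof -
    obtain B where B: "B \<in> \<Delta>" "\<sigma> = K B" using \<open>\<sigma> \<in> K ` \<Delta>\<close> by blast
    show ?thesis unfolding int_affine_embedding_def B(2) lat_X[OF B(1)]
      using saturated_int_span[OF B(1)] by (intro exI[of _ id] exI[of _ "- b"]) (auto simp: linear_id)
  qed
  then show ?thesis
    unfolding star_is_fan_def Let_def b(2) star star_lat_X polys_X chart_X U
    using homeo fan lattice unfolding star by auto
qed

lemma general_polyhedral_complex_X: "general_polyhedral_complex X"
  unfolding general_polyhedral_complex_def
proof (intro conjI ballI allI impI)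
  show "\<Union>(polys X) = topspace (gtop X)" using topspace_X by simp
  show "{} \<notin> polys X" unfolding polys_X using sum_in_K by blast
  show "polyhedral_charts X" unfolding polyhedral_charts_def
  proof
    fix \<sigma> assume "\<sigma> \<in> polys X"
    then obtain B where B: "B \<in> \<Delta>" "\<sigma> = K B" unfolding polys_X by blast
    have "homeomorphic_map (subtopology (gtop X) \<sigma>) (subtopology lin_topology \<sigma>) (\<lambda>x. x)"
    proof -
      have "\<sigma> \<subseteq> \<Union>(K ` \<Delta>)" using B by blast
      then have "subtopology (gtop X) \<sigma> = subtopology lin_topology \<sigma>"
        by (simp add: gtop_X subtopology_subtopology Int_absorb1)
      then show ?thesis using homeomorphic_map_id by (metis eq_id_iff)
    qed
    then show "is_lattice (lat X \<sigma>) \<and> general_polyhedron (lat X \<sigma>) (chart X \<sigma> ` \<sigma>) \<and>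
      affine hull chart X \<sigma> ` \<sigma> = span (lat X \<sigma>) \<and>
      homeomorphic_map (subtopology (gtop X) \<sigma>) (subtopology lin_topology (chart X \<sigma> ` \<sigma>)) (chart X \<sigma>)"
      using B(2) general_polyhedron_K[OF B(1)] affine_hull_K[OF B(1)]
        is_lattice_int_span[OF finite_simplex[OF B(1)] independent_simplex[OF B(1)]]
        span_int_span[OF finite_simplex[OF B(1)]]
      by (simp add: chart_X lat_X[OF B(1)])
  qed
next
  fix \<sigma> F assume "\<sigma> \<in> polys X" and F: "F face_of chart X \<sigma> ` \<sigma> \<and> F \<noteq> {}"
  then obtain B where B: "B \<in> \<Delta>" "\<sigma> = K B" unfolding polys_X by blast
  then have "F face_of cones.closed_stratum B" using F K_closed_stratum by (simp add: chart_X)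
  then obtain S where S: "S \<in> \<Delta>" "F = cones.closed_stratum S"
    using cones.face_of_closed_stratum[OF B(1)] F by blast
  have "F = K S" using S K_closed_stratum by simp
  moreover have "{x \<in> \<sigma>. chart X \<sigma> x \<in> F} = F"
    using F face_of_imp_subset[of F \<sigma>] by (auto simp: chart_X)
  ultimately show "{x \<in> \<sigma>. chart X \<sigma> x \<in> F} \<in> polys X" using S(1) unfolding polys_X by simp
next
  fix \<sigma> \<tau> assume "\<sigma> \<in> polys X" "\<tau> \<in> polys X"
  then obtain B C where B: "B \<in> \<Delta>" "\<sigma> = K B" "C \<in> \<Delta>" "\<tau> = K C" unfolding polys_X by blast
  have "\<sigma> \<inter> \<tau> = cones.closed_stratum (B \<inter> C)"
    using B K_closed_stratum cones.closed_stratum_Int by simp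
  then show "chart X \<sigma> ` (\<sigma> \<inter> \<tau>) face_of chart X \<sigma> ` \<sigma>"
    using cones.closed_stratum_face[OF B(1), of "B \<inter> C"] B K_closed_stratum by (simp add: chart_X)
next
  fix \<sigma> \<tau> assume "\<sigma> \<in> polys X" "\<tau> \<in> polys X" and sub: "\<tau> \<subseteq> \<sigma>"
  then obtain B C where B: "B \<in> \<Delta>" "\<sigma> = K B" "C \<in> \<Delta>" "\<tau> = K C" unfolding polys_X by blast
  have "C \<subseteq> B" using sub K_subset_iff B by blast
  then have "span C \<subseteq> span B" by (rule span_mono)
  then have "int_span C = int_span B \<inter> span (int_span C)"
    using saturated[OF B(1)] saturated[OF B(3)] span_int_span[OF finite_simplex[OF B(3)]] by auto
  then show "int_affine_embedding (lat X \<tau>) (lat X \<sigma>) \<tau> (chart X \<tau>) (chart X \<sigma>)"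
    unfolding int_affine_embedding_def chart_X B lat_X[OF B(1)] lat_X[OF B(3)]
    by (intro exI[of _ id] exI[of _ 0]) (auto simp: linear_id)
next
  fix \<tau> assume "\<tau> \<in> polys X"
  then show "star_is_fan X \<tau>" using star_is_fan_K unfolding polys_X by blast
qed

lemma poly_dim_K: "B \<in> \<Delta> \<Longrightarrow> poly_dim X (K B) = card B"
  unfolding poly_dim_def by (simp add: lat_X dim_int_span[OF finite_simplex independent_simplex])

lemma above_K:
  assumes "T \<in> \<Delta>" shows "above X (K T) = K ` {B \<in> \<Delta>. T \<subset> B}"
  unfolding above_def polys_X using K_subset_iff[OF assms] K_eq_iff[OF assms] by auto

lemma loc_span_K:
  assumes T: "T \<in> \<Delta>" and B: "B \<in> \<Delta>" "T \<subseteq> B" shows "loc_span X (K T) (K B) = span B"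
proof -
  obtain b where b: "cone_star ell \<Lambda> \<Delta> T b" "star_chart X (K T) = (\<lambda>x. x - b)"
    using star_chart_at[OF T] .
  interpret S: cone_star ell \<Lambda> \<Delta> T b by (rule b(1))
  have "star X (K T) = S.open_star" using star_K[OF T] unfolding S.open_star_def .
  then show ?thesis unfolding loc_span_def b(2) using S.span_star_directions[OF B] by simp
qed

lemma loc_lat_K:
  assumes "T \<in> \<Delta>" "B \<in> \<Delta>" "T \<subseteq> B" shows "loc_lat X (K T) (K B) = int_span B"
  unfolding loc_lat_def loc_span_K[OF assms] star_lat_X using saturated[OF assms(2)] by simp

text \<open>
  The primitive normal vector is the new ray itself, since the rays of \<open>insert u T\<close> form a lattice
  basis.
\<close>

lemma primitive_normal_K:
  assumes T: "T \<in> \<Delta>" and u: "u \<notin> T" "insert u T \<in> \<Delta>"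
  shows "primitive_normal X (K T) (K (insert u T)) u"
proof -
  let ?B = "insert u T"
  have fin: "finite T" using finite_simplex T by blast
  have lat: "loc_lat X (K T) (K ?B) = int_span ?B" "loc_lat X (K T) (K T) = int_span T"
    "loc_span X (K T) (K T) = span T"
    using loc_lat_K[OF T u(2)] loc_lat_K[OF T T] loc_span_K[OF T T] by auto
  obtain b where b: "cone_star ell \<Lambda> \<Delta> T b" "star_chart X (K T) = (\<lambda>x. x - b)"
    using star_chart_at[OF T] .
  interpret S: cone_star ell \<Lambda> \<Delta> T b by (rule b(1))
  have star: "star X (K T) = S.open_star" using star_K[OF T] unfolding S.open_star_def .
  have "u \<in> int_span ?B" using int_span_superset finite_simplex[OF u(2)] by blast
  moreover have "\<exists>k::int. v - of_int k *\<^sub>R u \<in> int_span T" if v: "v \<in> int_span ?B" for v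
  proof -
    obtain k :: "'a \<Rightarrow> int" where k: "v = (\<Sum>b\<in>?B. of_int (k b) *\<^sub>R b)"
      using v unfolding int_span_def by blast
    have "v - of_int (k u) *\<^sub>R u = (\<Sum>b\<in>T. of_int (k b) *\<^sub>R b)"
      unfolding k using u(1) fin by simp
    then show ?thesis unfolding int_span_def by blast
  qed
  moreover have "\<exists>c\<ge>0. x - b - c *\<^sub>R u \<in> span T" if x: "x \<in> K ?B \<inter> S.open_star" for x
  proof -
    have "x - b \<in> S.local_cone ?B" using S.star_image_Int_local_cone[OF u(2)] x by blast
    then obtain c where c: "x - b = (\<Sum>b\<in>?B. c b *\<^sub>R b)" "\<forall>b\<in>?B - T. 0 \<le> c b"
      unfolding S.local_cone_def by blast
    have "x - b - c u *\<^sub>R u = (\<Sum>b\<in>T. c b *\<^sub>R b)" unfolding c(1) using u(1) fin by simp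
    moreover have "(\<Sum>b\<in>T. c b *\<^sub>R b) \<in> span T" by (intro span_sum span_scale span_base)
    ultimately show ?thesis using c(2) u(1) by (intro exI[of _ "c u"]) simp
  qed
  ultimately show ?thesis unfolding primitive_normal_def lat star b(2) by blast
qed

end

section \<open>Group actions on cone complexes\<close>

lemma int_affine_embedding_linear:
  assumes "linear A" "inj A" "A ` L = L' \<inter> A ` span L" "\<And>x. x \<in> D \<Longrightarrow> \<psi> x = A (\<phi> x) + b"
  shows "int_affine_embedding L L' D \<phi> \<psi>"
  unfolding int_affine_embedding_def using assms inj_on_subset by blast

lemma subgroup_BijGroup_comp:
  assumes H: "subgroup H (BijGroup UNIV)" and "g \<in> H" "h \<in> H" shows "g \<circ> h \<in> H"
proof -
  have "g \<otimes>\<^bsub>BijGroup UNIV\<^esub> h \<in> H" using subgroup.m_closed[OF assms] .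
  moreover have "g \<in> Bij UNIV" "h \<in> Bij UNIV"
    using assms subgroup.subset[OF H] by (auto simp: BijGroup_def)
  ultimately show ?thesis by (simp add: BijGroup_def compose_def comp_def restrict_UNIV)
qed

lemma subgroup_BijGroup_id: "subgroup H (BijGroup UNIV) \<Longrightarrow> id \<in> H"
  using subgroup.one_closed by (fastforce simp: BijGroup_def id_def restrict_UNIV)

lemma subgroup_BijGroup_inverse:
  assumes H: "subgroup H (BijGroup UNIV)" and g: "g \<in> H"
  obtains h where "h \<in> H" "\<And>x. h (g x) = x" "\<And>x. g (h x) = x"
proof -
  interpret B: group "BijGroup (UNIV :: 'a set)" by (rule group_BijGroup)
  have g': "g \<in> carrier (BijGroup UNIV)" using subgroup.subset[OF H] g by blast
  define h where "h = inv\<^bsub>BijGroup UNIV\<^esub> g"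
  have h: "h \<in> H" using subgroup.m_inv_closed[OF H g] h_def by simp
  then have h': "h \<in> carrier (BijGroup UNIV)" using subgroup.subset[OF H] by blast
  have "h \<otimes>\<^bsub>BijGroup UNIV\<^esub> g = \<one>\<^bsub>BijGroup UNIV\<^esub>" "g \<otimes>\<^bsub>BijGroup UNIV\<^esub> h = \<one>\<^bsub>BijGroup UNIV\<^esub>"
    using B.l_inv[OF g'] B.r_inv[OF g'] by (auto simp: h_def)
  then have "h \<circ> g = id" "g \<circ> h = id"
    using g' h' by (auto simp: BijGroup_def compose_def comp_def id_def restrict_UNIV)
  then show thesis using that[OF h] by (metis comp_apply id_apply)
qed

text \<open>
  The balancing condition \<open>balance\<close> has neither weights nor the factors \<open>\<lambda>\<close> of the orbit space.
\<close>

locale cone_complex_action = cone_complex_gpc +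
  fixes H :: "('a \<Rightarrow> 'a) set" and m :: nat
  assumes subgroup_H: "subgroup H (BijGroup UNIV)"
    and linear_H: "g \<in> H \<Longrightarrow> linear g"
    and lattice_H: "g \<in> H \<Longrightarrow> g ` \<Lambda> \<subseteq> \<Lambda>"
    and ell_H: "g \<in> H \<Longrightarrow> ell (g x) = ell x"
    and simplex_H: "g \<in> H \<Longrightarrow> B \<in> \<Delta> \<Longrightarrow> g ` B \<in> \<Delta>"
    and finite_stabilizer: "0 < ell x \<Longrightarrow> finite {g \<in> H. g x = x}"
    and finite_representatives: "\<exists>\<Delta>0. finite \<Delta>0 \<and> (\<forall>B\<in>\<Delta>. \<exists>g\<in>H. \<exists>C\<in>\<Delta>0. C \<in> \<Delta> \<and> B = g ` C)"
    and card_le: "B \<in> \<Delta> \<Longrightarrow> card B \<le> m"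
    and pure: "B \<in> \<Delta> \<Longrightarrow> \<exists>C\<in>\<Delta>. B \<subseteq> C \<and> card C = m"
    and balance: "B \<in> \<Delta> \<Longrightarrow> card B + 1 = m \<Longrightarrow> \<Sum>{u. u \<notin> B \<and> insert u B \<in> \<Delta>} \<in> span B"
begin

definition G :: "('a \<Rightarrow> 'a) monoid" where "G = (BijGroup UNIV)\<lparr>carrier := H\<rparr>"

definition act :: "('a \<Rightarrow> 'a) \<Rightarrow> 'a \<Rightarrow> 'a" where "act g = restrict g (\<Union>(K ` \<Delta>))"

lemma carrier_G [simp]: "carrier G = H"
  by (simp add: G_def)

lemma bij_H: "g \<in> H \<Longrightarrow> bij g"
  using subgroup.subset[OF subgroup_H] by (auto simp: BijGroup_def Bij_def)

lemmas comp_H = subgroup_BijGroup_comp[OF subgroup_H]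

lemmas id_H = subgroup_BijGroup_id[OF subgroup_H]

lemmas inverse_H = subgroup_BijGroup_inverse[OF subgroup_H]

lemma inj_H: "g \<in> H \<Longrightarrow> inj g"
  using bij_H bij_is_inj by blast

lemma image_K: assumes g: "g \<in> H" shows "g ` K B = K (g ` B)"
  by (intro half_open_cone_image linear_H[OF g] inj_on_subset[OF inj_H[OF g]] subset_UNIV ell_H[OF g])

lemma image_lattice: assumes g: "g \<in> H" shows "g ` \<Lambda> = \<Lambda>"
proof
  obtain h where h: "h \<in> H" "\<And>x. h (g x) = x" "\<And>x. g (h x) = x" using inverse_H[OF g] by blast
  show "\<Lambda> \<subseteq> g ` \<Lambda>" using lattice_H[OF h(1)] h(3) by (metis image_eqI image_subset_iff subsetI)
qed (rule lattice_H[OF g])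

lemma image_support: assumes g: "g \<in> H" shows "g ` \<Union>(K ` \<Delta>) = \<Union>(K ` \<Delta>)"
proof -
  have sub: "g ` \<Union>(K ` \<Delta>) \<subseteq> \<Union>(K ` \<Delta>)" if "g \<in> H" for g
    using image_K[OF that] simplex_H[OF that] by (auto simp: image_UN)
  obtain h where h: "h \<in> H" "\<And>x. h (g x) = x" "\<And>x. g (h x) = x" using inverse_H[OF g] by blast
  show ?thesis
  proof
    show "\<Union>(K ` \<Delta>) \<subseteq> g ` \<Union>(K ` \<Delta>)"
    proof
      fix x assume "x \<in> \<Union>(K ` \<Delta>)"
      then have "h x \<in> \<Union>(K ` \<Delta>)" using sub[OF h(1)] by blast
      then show "x \<in> g ` \<Union>(K ` \<Delta>)" using h(3) by (metis image_eqI)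
    qed
  qed (rule sub[OF g])
qed

lemma act_image: "A \<subseteq> \<Union>(K ` \<Delta>) \<Longrightarrow> act g ` A = g ` A"
  unfolding act_def by (intro image_cong) auto

lemma K_subset_support: "B \<in> \<Delta> \<Longrightarrow> K B \<subseteq> \<Union>(K ` \<Delta>)"
  by blast

lemma act_K: "g \<in> H \<Longrightarrow> B \<in> \<Delta> \<Longrightarrow> act g ` K B = K (g ` B)"
  using act_image[OF K_subset_support] image_K by simp

lemma group_G: "group G"
  unfolding G_def by (rule subgroup.subgroup_is_group[OF subgroup_H group_BijGroup])

lemma group_action_G: "group_action G (topspace (gtop X)) act"
proof -
  let ?E = "\<Union>(K ` \<Delta>)"
  have act_Bij: "act g \<in> Bij ?E" if "g \<in> H" for g
    unfolding Bij_def act_def using inj_H[OF that] image_support[OF that]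
    by (auto simp: bij_betw_def inj_on_def)
  have "group_hom G (BijGroup ?E) act"
    unfolding group_hom_def group_hom_axioms_def
  proof (intro conjI group_G group_BijGroup homI)
    fix g assume "g \<in> carrier G"
    then show "act g \<in> carrier (BijGroup ?E)" using act_Bij by (simp add: BijGroup_def)
  next
    fix g h assume "g \<in> carrier G" "h \<in> carrier G"
    then have gh: "g \<in> H" "h \<in> H" by auto
    then have "g \<in> Bij UNIV" "h \<in> Bij UNIV"
      using subgroup.subset[OF subgroup_H] by (auto simp: BijGroup_def)
    then have "g \<otimes>\<^bsub>G\<^esub> h = g \<circ> h" by (simp add: G_def BijGroup_def compose_def comp_def restrict_UNIV)
    moreover have "act (g \<circ> h) = compose ?E (act g) (act h)"
    proof
      fix x
      have "h x \<in> ?E" if "x \<in> ?E" using that image_support[OF gh(2)] by blast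
      then show "act (g \<circ> h) x = compose ?E (act g) (act h) x"
        by (auto simp: act_def compose_def)
    qed
    ultimately show "act (g \<otimes>\<^bsub>G\<^esub> h) = act g \<otimes>\<^bsub>BijGroup ?E\<^esub> act h"
      using act_Bij gh by (simp add: BijGroup_def)
  qed
  then show ?thesis unfolding topspace_X polys_X by (rule group_action.intro)
qed

lemma gpc_automorphism_act:
  assumes g: "g \<in> H" shows "gpc_automorphism X (act g)"
  unfolding gpc_automorphism_def
proof (intro conjI ballI)
  obtain h where h: "h \<in> H" "\<And>x. h (g x) = x" "\<And>x. g (h x) = x" using inverse_H[OF g] by blast
  let ?S = "\<Union>(K ` \<Delta>)"
  have "homeomorphic_map (subtopology lin_topology ?S)
      (subtopology lin_topology ((\<lambda>x. g x + 0) ` ?S)) (\<lambda>x. g x + 0)"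
    by (rule homeomorphic_map_lin_affine[OF linear_H[OF g] linear_H[OF h(1)] h(2,3)])
  then have "homeomorphic_map (gtop X) (gtop X) g"
    using image_support[OF g] by (simp add: gtop_X)
  then show "homeomorphic_map (gtop X) (gtop X) (act g)"
    by (rule homeomorphic_map_eq) (simp add: gtop_X act_def)
  show "(\<lambda>\<sigma>. act g ` \<sigma>) ` polys X = polys X"
  proof (intro equalityI subsetI)
    fix \<sigma> assume "\<sigma> \<in> (\<lambda>\<sigma>. act g ` \<sigma>) ` polys X"
    then obtain B where B: "B \<in> \<Delta>" "\<sigma> = act g ` K B" unfolding polys_X by blast
    then show "\<sigma> \<in> polys X" using act_K[OF g B(1)] simplex_H[OF g B(1)] unfolding polys_X by blast
  next
    fix \<sigma> assume "\<sigma> \<in> polys X"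
    then obtain B where B: "B \<in> \<Delta>" "\<sigma> = K B" unfolding polys_X by blast
    have "g ` (h ` B) = B" using h(3) by (simp add: image_image)
    then have "\<sigma> = act g ` K (h ` B)" using act_K[OF g simplex_H[OF h(1) B(1)]] B(2) by simp
    then show "\<sigma> \<in> (\<lambda>\<sigma>. act g ` \<sigma>) ` polys X"
      using simplex_H[OF h(1) B(1)] unfolding polys_X by blast
  qed
next
  fix \<sigma> assume "\<sigma> \<in> polys X"
  then obtain B where B: "B \<in> \<Delta>" "\<sigma> = K B" unfolding polys_X by blast
  have gB: "g ` B \<in> \<Delta>" "act g ` \<sigma> = K (g ` B)" using simplex_H[OF g B(1)] act_K[OF g B(1)] B(2) by auto
  have inj: "inj g" using inj_H[OF g] .
  have lat_eq: "g ` int_span B = int_span (g ` B)"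
    using int_span_image[OF linear_H[OF g]] inj inj_on_subset by blast
  have "int_span (g ` B) = int_span (g ` B) \<inter> g ` span (int_span B)"
    using lat_eq span_superset[of "int_span B"] by blast
  then have "g ` int_span B = int_span (g ` B) \<inter> g ` span (int_span B)" using lat_eq by simp
  then show "int_affine_embedding (lat X \<sigma>) (lat X (act g ` \<sigma>)) \<sigma> (chart X \<sigma>) (chart X (act g ` \<sigma>) \<circ> act g)"
    unfolding gB(2) lat_X[OF gB(1)] unfolding B(2) lat_X[OF B(1)] chart_X
    by (rule int_affine_embedding_linear[OF linear_H[OF g] inj, of _ _ _ _ _ 0])
      (use B(1) in \<open>auto simp: act_def\<close>)
  obtain b where b: "star_chart X \<sigma> = (\<lambda>x. x - b)" using star_chart_at[OF B(1)] B(2) by blast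
  obtain b' where b': "star_chart X (act g ` \<sigma>) = (\<lambda>x. x - b')"
    using star_chart_at[OF gB(1)] gB(2) by metis
  have "g ` \<Lambda> = \<Lambda> \<inter> g ` span \<Lambda>" using image_lattice[OF g] span_superset[of \<Lambda>] by blast
  moreover have "x - (0::'a) - b' = x - b'" for x by simp
  ultimately show "int_affine_embedding (star_lat X \<sigma>) (star_lat X (act g ` \<sigma>)) (star X \<sigma>)
      (star_chart X \<sigma>) (star_chart X (act g ` \<sigma>) \<circ> act g)"
    unfolding b b' star_lat_X
  proof (intro int_affine_embedding_linear[OF linear_H[OF g] inj, of _ _ _ _ _ "g b - b'"])
    fix x assume "x \<in> star X \<sigma>"
    then have "x \<in> \<Union>(K ` \<Delta>)" using star_subset[OF B(1)] B(2) by blast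
    then show "((\<lambda>x. x - b') \<circ> act g) x = g (x - b) + (g b - b')"
      by (simp add: act_def linear_diff[OF linear_H[OF g]])
  qed
qed

lemma fixer_K:
  assumes B: "B \<in> \<Delta>" shows "fixer G act (K B) = {g \<in> H. \<forall>b\<in>B. g b = b}"
proof (intro equalityI subsetI)
  fix g assume "g \<in> fixer G act (K B)"
  then have g: "g \<in> H" "\<forall>x\<in>K B. act g x = x" by (auto simp: fixer_def)
  have fix_K: "g x = id x" if x: "x \<in> K B" for x
  proof -
    have "act g x = g x" using x B unfolding act_def by auto
    then show ?thesis using g(2) x by simp
  qed
  have "g b = b" if "b \<in> B" for b
  proof -
    have "b \<in> span (K B)" using span_K[OF B] span_base[OF that] by simp
    then show ?thesis using linear_eq_on_span[OF linear_H[OF g(1)] linear_id fix_K] by simp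
  qed
  then show "g \<in> {g \<in> H. \<forall>b\<in>B. g b = b}" using g by simp
next
  fix g assume g: "g \<in> {g \<in> H. \<forall>b\<in>B. g b = b}"
  have "g x = x" if "x \<in> K B" for x
    using linear_eq_on_span[OF linear_H linear_id, of g B x] g that K_subset_span[OF B] by auto
  then show "g \<in> fixer G act (K B)" using g B by (auto simp: fixer_def act_def)
qed

text \<open>An element that fixes the cone fixes the sum of its rays, a point with \<open>ell > 0\<close>.\<close>

lemma finite_fixer:
  assumes B: "B \<in> \<Delta>" shows "finite (fixer G act (K B))"
proof -
  have "\<Sum>B \<in> K B" using sum_in_K[OF B] .
  then have "0 < ell (\<Sum>B)" by (auto simp: half_open_cone_def)
  moreover have "fixer G act (K B) \<subseteq> {g \<in> H. g (\<Sum>B) = \<Sum>B}"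
    unfolding fixer_K[OF B] by (auto simp: linear_sum[OF linear_H])
  ultimately show ?thesis using finite_stabilizer finite_subset by blast
qed

lemma card_fixer_pos:
  assumes B: "B \<in> \<Delta>" shows "card (fixer G act (K B)) > 0"
proof -
  have "id \<in> fixer G act (K B)" unfolding fixer_K[OF B] using id_H by simp
  then show ?thesis using finite_fixer[OF B] card_gt_0_iff by blast
qed

definition link :: "'a set \<Rightarrow> 'a set" where
  "link T = {u. u \<notin> T \<and> insert u T \<in> \<Delta>}"

lemma inj_on_link: "inj_on (\<lambda>u. K (insert u T)) (link T)"
proof (rule inj_onI)
  fix u w assume "u \<in> link T" "w \<in> link T" "K (insert u T) = K (insert w T)"
  then have "insert u T = insert w T" "u \<notin> T" "w \<notin> T" using K_eq_iff unfolding link_def by auto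
  then show "u = w" by blast
qed

lemma finite_link: assumes T: "T \<in> \<Delta>" shows "finite (link T)"
proof -
  have "inj_on (\<lambda>u. insert u T) (link T)" by (auto simp: inj_on_def link_def)
  moreover have "(\<lambda>u. insert u T) ` link T \<subseteq> {C \<in> \<Delta>. T \<subseteq> C}" by (auto simp: link_def)
  ultimately show ?thesis using locally_finite[OF T] finite_subset finite_imageD by blast
qed

lemma above_codim_one:
  assumes T: "T \<in> \<Delta>" "card T + 1 = m"
  shows "above X (K T) = (\<lambda>u. K (insert u T)) ` link T"
proof -
  have "{B \<in> \<Delta>. T \<subset> B} = (\<lambda>u. insert u T) ` link T"
  proof (intro equalityI subsetI)
    fix B assume B: "B \<in> {B \<in> \<Delta>. T \<subset> B}"
    then obtain u where u: "u \<in> B" "u \<notin> T" by blast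
    have fin: "finite B" "finite T" using B T finite_simplex by auto
    have "card B \<le> card (insert u T)" using card_le[of B] B T(2) u fin by simp
    then have "insert u T = B" using B u fin by (intro card_seteq) auto
    then show "B \<in> (\<lambda>u. insert u T) ` link T" using B u unfolding link_def by blast
  qed (auto simp: link_def)
  then show ?thesis unfolding above_K[OF T(1)] by (simp add: image_image)
qed

text \<open>
  Orbit counting for the group \<open>F\<close> fixing \<open>T\<close>: the elements of \<open>F\<close> that map \<open>u\<close> to \<open>w\<close> form a
  coset of the stabilizer of \<open>w\<close>.
\<close>

lemma sum_stabilizers:
  assumes T: "T \<in> \<Delta>"
  defines "F \<equiv> {g \<in> H. \<forall>b\<in>T. g b = b}"
  shows "(\<Sum>w\<in>(\<lambda>g. g u) ` F. card {h \<in> F. h w = w}) = card F"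
proof -
  have fin: "finite F" using finite_fixer[OF T] unfolding fixer_K[OF T] F_def .
  have "card {h \<in> F. h w = w} = card {g \<in> F. g u = w}" if w: "w \<in> (\<lambda>g. g u) ` F" for w
  proof -
    obtain g0 where g0: "g0 \<in> F" "w = g0 u" using w by blast
    then have "g0 \<in> H" unfolding F_def by blast
    obtain k where k: "k \<in> H" "\<And>x. k (g0 x) = x" "\<And>x. g0 (k x) = x" using inverse_H[OF \<open>g0 \<in> H\<close>] by blast
    have kT: "k b = b" if "b \<in> T" for b using k(2)[of b] g0(1) that unfolding F_def by auto
    have "bij_betw (\<lambda>h. h \<circ> g0) {h \<in> F. h w = w} {g \<in> F. g u = w}"
    proof (rule bij_betw_byWitness[where f' = "\<lambda>g. g \<circ> k"])
      show "(\<lambda>h. h \<circ> g0) ` {h \<in> F. h w = w} \<subseteq> {g \<in> F. g u = w}"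
        using g0 comp_H unfolding F_def by auto
      show "(\<lambda>g. g \<circ> k) ` {g \<in> F. g u = w} \<subseteq> {h \<in> F. h w = w}"
        using g0(2) k comp_H kT unfolding F_def by auto
    qed (auto simp: k fun_eq_iff)
    then show ?thesis by (rule bij_betw_same_card)
  qed
  then have "(\<Sum>w\<in>(\<lambda>g. g u) ` F. card {h \<in> F. h w = w}) = (\<Sum>w\<in>(\<lambda>g. g u) ` F. card {g \<in> F. g u = w})"
    by simp
  also have "\<dots> = (\<Sum>w\<in>(\<lambda>g. g u) ` F. (\<Sum>g\<in>{g \<in> F. g u = w}. 1))" by simp
  also have "\<dots> = (\<Sum>g\<in>F. 1)" by (rule sum.image_gen[OF fin, symmetric])
  finally show ?thesis by simp
qed

text \<open>
  With \<open>\<lambda>\<^bsub>\<sigma>/\<tau>\<^esub> = |G\<^sub>\<sigma>| / |G\<^sub>\<tau>|\<close> the coefficient of each normal vector is the constant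
  \<open>1 / |G\<^sub>\<tau>|\<close>, so the weighted balancing condition is the unweighted one.
\<close>

lemma balanced_at_K:
  assumes T: "T \<in> \<Delta>" "card T + 1 = m" shows "balanced_at X G act (\<lambda>_. 1) (K T)"
proof -
  define F where "F = {g \<in> H. \<forall>b\<in>T. g b = b}"
  define \<phi> where "\<phi> = (\<lambda>u. K (insert u T))"
  \<comment> \<open>\<open>\<phi>\<close> indexes the facets above \<open>T\<close> by their new rays, which are also the normal vectors \<open>u\<close>\<close>
  define u where "u = the_inv_into (link T) \<phi>"
  define lam where "lam = (\<lambda>\<sigma>. real (card {h \<in> F. h (u \<sigma>) = u \<sigma>}) / real (card F))"
  have u: "u (\<phi> w) = w" if "w \<in> link T" for w
    unfolding u_def \<phi>_def using that by (intro the_inv_into_f_f inj_on_link)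
  have F: "fixer G act (K T) = F" unfolding fixer_K[OF T(1)] F_def ..
  have cardF: "card F > 0" using card_fixer_pos[OF T(1)] F by simp
  have fixer_link: "fixer G act (\<phi> w) = {h \<in> F. h w = w}" if "w \<in> link T" for w
    using that fixer_K[of "insert w T"] unfolding link_def \<phi>_def F_def by auto
  have F_link: "act g ` \<phi> w = \<phi> (g w)" "g w \<in> link T" if w: "g \<in> F" "w \<in> link T" for g w
  proof -
    have g: "g \<in> H" "g ` T = T" using w(1) unfolding F_def by auto
    have B: "insert w T \<in> \<Delta>" using w(2) unfolding link_def by blast
    have "g ` insert w T = insert (g w) T" using g(2) by simp
    moreover have "g w \<notin> T"
    proof
      assume "g w \<in> T"
      then have "g (g w) = g w" using w(1) unfolding F_def by blast
      then have "g w = w" using inj_H[OF g(1)] by (simp add: inj_eq)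
      then show False using \<open>g w \<in> T\<close> w(2) unfolding link_def by simp
    qed
    ultimately show "act g ` \<phi> w = \<phi> (g w)" "g w \<in> link T"
      using act_K[OF g(1) B] simplex_H[OF g(1) B] unfolding \<phi>_def link_def by auto
  qed
  have above: "above X (K T) = \<phi> ` link T" unfolding above_codim_one[OF T] \<phi>_def ..
  have inj: "inj_on \<phi> (link T)" unfolding \<phi>_def by (rule inj_on_link)
  have "(\<Sum>\<sigma>'\<in>fixer_orbit G act \<sigma> (K T). lam \<sigma>') = 1" if \<sigma>: "\<sigma> \<in> above X (K T)" for \<sigma>
  proof -
    obtain w where w: "w \<in> link T" "\<sigma> = \<phi> w" using \<sigma> above by blast
    have sub: "(\<lambda>g. g w) ` F \<subseteq> link T" using F_link(2) w(1) by blast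
    have "fixer_orbit G act \<sigma> (K T) = \<phi> ` (\<lambda>g. g w) ` F"
      unfolding fixer_orbit_def F w(2) using F_link(1)[OF _ w(1)] by (auto simp: image_iff)
    then have "(\<Sum>\<sigma>'\<in>fixer_orbit G act \<sigma> (K T). lam \<sigma>') = (\<Sum>v\<in>(\<lambda>g. g w) ` F. lam (\<phi> v))"
      using sum.reindex[OF inj_on_subset[OF inj sub]] by simp
    also have "\<dots> = (\<Sum>v\<in>(\<lambda>g. g w) ` F. real (card {h \<in> F. h v = v}) / real (card F))"
      using sub u by (intro sum.cong) (auto simp: lam_def)
    also have "\<dots> = real (\<Sum>v\<in>(\<lambda>g. g w) ` F. card {h \<in> F. h v = v}) / real (card F)"
      by (simp add: sum_divide_distrib)
    also have "\<dots> = 1" using sum_stabilizers[OF T(1), of w] cardF by (simp add: F_def)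
    finally show ?thesis .
  qed
  moreover have "primitive_normal X (K T) \<sigma> (u \<sigma>)" if \<sigma>: "\<sigma> \<in> above X (K T)" for \<sigma>
  proof -
    obtain w where w: "w \<in> link T" "\<sigma> = \<phi> w" using \<sigma> above by blast
    then show ?thesis
      using primitive_normal_K[OF T(1), of w] u[OF w(1)] unfolding link_def \<phi>_def by simp
  qed
  moreover have "(\<Sum>\<sigma>\<in>above X (K T). (lam \<sigma> * of_rat (orbit_weight G act (\<lambda>_. 1) \<sigma>)) *\<^sub>R u \<sigma>)
      \<in> loc_span X (K T) (K T)"
  proof -
    have "(\<Sum>\<sigma>\<in>above X (K T). (lam \<sigma> * of_rat (orbit_weight G act (\<lambda>_. 1) \<sigma>)) *\<^sub>R u \<sigma>)
        = (\<Sum>w\<in>link T. (lam (\<phi> w) * of_rat (orbit_weight G act (\<lambda>_. 1) (\<phi> w))) *\<^sub>R u (\<phi> w))"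
      unfolding above using sum.reindex[OF inj] by simp
    also have "\<dots> = (\<Sum>w\<in>link T. (1 / real (card F)) *\<^sub>R w)"
    proof (intro sum.cong refl)
      fix w assume w: "w \<in> link T"
      have "card (fixer G act (\<phi> w)) > 0"
        using card_fixer_pos[of "insert w T"] w unfolding \<phi>_def link_def by blast
      then have "lam (\<phi> w) * of_rat (orbit_weight G act (\<lambda>_. 1) (\<phi> w)) = 1 / real (card F)"
        unfolding lam_def orbit_weight_def u[OF w] fixer_link[OF w] by (simp add: of_rat_divide)
      then show "(lam (\<phi> w) * of_rat (orbit_weight G act (\<lambda>_. 1) (\<phi> w))) *\<^sub>R u (\<phi> w) = (1 / real (card F)) *\<^sub>R w"
        using u[OF w] by simp
    qed
    also have "\<dots> = (1 / real (card F)) *\<^sub>R \<Sum>(link T)" by (simp add: scaleR_sum_right)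
    also have "\<dots> \<in> span T" using balance[OF T] unfolding link_def by (rule span_scale)
    finally show ?thesis using loc_span_K[OF T(1) T(1)] by simp
  qed
  moreover have "lam \<sigma> \<ge> 0" for \<sigma> by (simp add: lam_def)
  ultimately show ?thesis unfolding balanced_at_def by blast
qed

lemma finite_orbit_classes: "finite (orbit_classes X G act)"
proof -
  obtain \<Delta>0 where \<Delta>0: "finite \<Delta>0" "\<forall>B\<in>\<Delta>. \<exists>g\<in>H. \<exists>C\<in>\<Delta>0. C \<in> \<Delta> \<and> B = g ` C"
    using finite_representatives by (elim exE conjE)
  have "orbit_classes X G act \<subseteq> (\<lambda>C. {K (g ` C) | g. g \<in> H}) ` \<Delta>0"
  proof
    fix c assume "c \<in> orbit_classes X G act"
    then obtain B where B: "B \<in> \<Delta>" "c = {act g ` K B | g. g \<in> H}"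
      unfolding orbit_classes_def orbits_def orbit_def polys_X by auto
    obtain g C where g: "g \<in> H" "C \<in> \<Delta>0" "C \<in> \<Delta>" "B = g ` C" using bspec[OF \<Delta>0(2) B(1)] by blast
    obtain k where k: "k \<in> H" "\<And>x. k (g x) = x" "\<And>x. g (k x) = x" using inverse_H[OF g(1)] by blast
    have "c = {K (f ` B) | f. f \<in> H}" unfolding B(2)
      by (rule Collect_cong, rule ex_cong1) (metis act_K[OF _ B(1)])
    also have "\<dots> = {K (f ` C) | f. f \<in> H}"
    proof (intro equalityI subsetI)
      fix \<sigma> assume "\<sigma> \<in> {K (f ` B) | f. f \<in> H}"
      then obtain f where f: "f \<in> H" "\<sigma> = K (f ` B)" by blast
      then have "\<sigma> = K ((f \<circ> g) ` C)" using g(4) by (simp add: image_comp)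
      then show "\<sigma> \<in> {K (f ` C) | f. f \<in> H}" using comp_H[OF f(1) g(1)] by blast
    next
      fix \<sigma> assume "\<sigma> \<in> {K (f ` C) | f. f \<in> H}"
      then obtain f where f: "f \<in> H" "\<sigma> = K (f ` C)" by blast
      have "(f \<circ> k) ` B = f ` C" using g(4) k(2) by (simp add: image_image)
      then have "\<sigma> = K ((f \<circ> k) ` B)" using f(2) by simp
      then show "\<sigma> \<in> {K (f ` B) | f. f \<in> H}" using comp_H[OF f(1) k(1)] by blast
    qed
    finally show "c \<in> (\<lambda>C. {K (g ` C) | g. g \<in> H}) ` \<Delta>0" using g(2) by blast
  qed
  then show ?thesis using \<Delta>0(1) finite_subset by blast
qed

theorem tropical_orbit_space_X: "tropical_orbit_space X G act (\<lambda>_. 1)"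
  unfolding tropical_orbit_space_def
proof (intro exI[of _ m] conjI ballI impI)
  have "pure_dim X m" unfolding pure_dim_def
  proof (intro ballI conjI)
    fix \<sigma> assume "\<sigma> \<in> polys X"
    then obtain B where B: "B \<in> \<Delta>" "\<sigma> = K B" unfolding polys_X by blast
    show "poly_dim X \<sigma> \<le> m" using B poly_dim_K card_le by simp
    obtain C where C: "C \<in> \<Delta>" "B \<subseteq> C" "card C = m" using pure[OF B(1)] by blast
    then show "\<exists>\<rho>\<in>polys X. \<sigma> \<subseteq> \<rho> \<and> poly_dim X \<rho> = m"
      using B poly_dim_K[OF C(1)] K_subset_iff[OF B(1) C(1)] unfolding polys_X by blast
  qed
  then show "weighted_orbit_space X G act m (\<lambda>_. 1)"
    unfolding weighted_orbit_space_def orbit_space_def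
    using general_polyhedral_complex_X group_action_G gpc_automorphism_act by simp
  show "finite (orbit_classes X G act)" by (rule finite_orbit_classes)
next
  fix \<sigma> assume "\<sigma> \<in> polys X"
  then show "finite (fixer G act \<sigma>)" using finite_fixer unfolding polys_X by blast
next
  fix \<tau> assume "\<tau> \<in> polys X" "poly_dim X \<tau> + 1 = m"
  then obtain T where T: "T \<in> \<Delta>" "\<tau> = K T" "card T + 1 = m" unfolding polys_X using poly_dim_K by auto
  show "finite (above X \<tau>)" unfolding T(2) above_codim_one[OF T(1,3)] using finite_link[OF T(1)] by simp
  show "balanced_at X G act (\<lambda>_. 1) \<tau>" using balanced_at_K T by simp
qed

end

section \<open>Coordinates on \<open>V\<^sub>n\<close>\<close>

lemma vn_relE:
  assumes "vn_rel x y"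
  obtains b c where "\<And>S. x $ S = y $ S + Phi b $ S + c * s_vec $ S"
proof -
  obtain b c where "x - y = Phi b + c *\<^sub>R s_vec" using assms unfolding vn_rel_def by blast
  then have "x = y + Phi b + c *\<^sub>R s_vec" by (metis add.assoc add.commute diff_add_cancel)
  then show thesis using that[of b c] by simp
qed

text \<open>
  For a cut curve, \<open>circ\<close> is the length of the path from \<open>A\<close> to \<open>B\<close>, that is, of the cycle, and
  \<open>height\<close> the distance of a leaf from this path; heights are arbitrary in the quotient by the
  image of \<open>Phi\<close>. The signed distance between the feet of two leaves on the path is \<open>offset\<close>. What
  remains of the distance of two leaves after subtracting their heights is \<open>rdist\<close>: the distance
  of their feet or, if these agree, minus twice the length of the common part of their ways to the
  path.
\<close>

definition height :: "real ^ 'n::finite pairs \<Rightarrow> 'n \<Rightarrow> real" where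
  "height x m = (x $ pr (Leg m) LA + x $ pr (Leg m) LB - x $ pr LA LB) / 2"

lift_definition circ :: "'n::finite vn \<Rightarrow> real" is "\<lambda>x. x $ pr LA LB"
  by (erule vn_relE) (simp add: Phi_nth s_vec_nth)

lift_definition offset :: "'n::finite \<Rightarrow> 'n \<Rightarrow> 'n vn \<Rightarrow> real" is
  "\<lambda>k l x. ((x $ pr (Leg k) LA - x $ pr (Leg k) LB) - (x $ pr (Leg l) LA - x $ pr (Leg l) LB)) / 2"
  by (erule vn_relE) (simp add: Phi_nth s_vec_nth)

lift_definition rdist :: "'n::finite \<Rightarrow> 'n \<Rightarrow> 'n vn \<Rightarrow> real" is
  "\<lambda>k l x. if k = l then 0 else x $ pr (Leg k) (Leg l) - height x k - height x l"
  by (erule vn_relE) (simp add: Phi_nth s_vec_nth height_def field_simps)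

lemma linear_circ: "linear circ"
  by (rule linearI) (transfer; simp)+

lemma linear_offset: "linear (offset k l)"
  by (rule linearI) (transfer; simp add: field_simps)+

lemma linear_rdist: "linear (rdist k l)"
  by (rule linearI) (transfer; simp add: field_simps height_def)+

lemmas circ_simps = linear_0[OF linear_circ] linear_add[OF linear_circ] linear_scale[OF linear_circ]
  linear_sum[OF linear_circ]
lemmas offset_simps = linear_0[OF linear_offset] linear_add[OF linear_offset]
  linear_scale[OF linear_offset] linear_sum[OF linear_offset]
lemmas rdist_simps = linear_0[OF linear_rdist] linear_add[OF linear_rdist]
  linear_scale[OF linear_rdist] linear_sum[OF linear_rdist]

lemma offset_self [simp]: "offset k k x = 0"
  by transfer simp

lemma rdist_self [simp]: "rdist k k x = 0"
  by transfer simp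

lemma offset_diff: "offset k l x = offset k m x - offset l m x"
  by transfer (simp add: field_simps)

lemma rdist_commute: "rdist k l x = rdist l k x"
  by transfer (simp add: pr_commute)

text \<open>
  Two vectors with the same coordinates differ by \<open>Phi b + c s\<close>, where \<open>b\<close> is the difference of
  the heights and \<open>c\<close> the difference of the positions on the path from \<open>A\<close> to \<open>B\<close>, which is the
  same for all leaves.
\<close>

lemma vn_eqI:
  assumes "circ x = circ y" "\<And>k l. offset k l x = offset k l y" "\<And>k l. rdist k l x = rdist k l y"
  shows "x = y"
proof -
  have "circ x = circ y \<and> (\<forall>k l. offset k l x = offset k l y) \<and> (\<forall>k l. rdist k l x = rdist k l y) \<longrightarrow> x = y"
  proof (transfer, intro impI, elim conjE)
    fix x y :: "real ^ 'a pairs"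
    let ?off = "\<lambda>k l x :: real ^ 'a pairs.
      ((x $ pr (Leg k) LA - x $ pr (Leg k) LB) - (x $ pr (Leg l) LA - x $ pr (Leg l) LB)) / 2"
    let ?rd = "\<lambda>k l x. if k = l then 0 else x $ pr (Leg k) (Leg l) - height x k - height x l"
    assume 1: "x $ pr LA LB = y $ pr LA LB"
      and 2: "\<forall>k l. ?off k l x = ?off k l y" and 3: "\<forall>k l. ?rd k l x = ?rd k l y"
    define b where "b = (\<chi> m. height x m - height y m)"
    define m0 where "m0 = (undefined :: 'a)"
    define c where "c = ((x $ pr (Leg m0) LA - x $ pr (Leg m0) LB) - (y $ pr (Leg m0) LA - y $ pr (Leg m0) LB)) / 2"
    have c: "(x $ pr (Leg m) LA - x $ pr (Leg m) LB) - (y $ pr (Leg m) LA - y $ pr (Leg m) LB) = 2 * c" for m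
      using 2[rule_format, of m m0] by (simp add: c_def field_simps)
    have "x = y + (Phi b + c *\<^sub>R s_vec)"
    proof (rule pairs_vec_eqI)
      fix m
      show "x $ pr (Leg m) LA = (y + (Phi b + c *\<^sub>R s_vec)) $ pr (Leg m) LA"
        "x $ pr (Leg m) LB = (y + (Phi b + c *\<^sub>R s_vec)) $ pr (Leg m) LB"
        using c[of m] 1 by (simp_all add: Phi_nth s_vec_nth b_def height_def field_simps)
    next
      show "x $ pr LA LB = (y + (Phi b + c *\<^sub>R s_vec)) $ pr LA LB"
        using 1 by (simp add: Phi_nth s_vec_nth)
    next
      fix k l :: 'a assume kl: "k \<noteq> l"
      have "x $ pr (Leg k) (Leg l) - height x k - height x l = y $ pr (Leg k) (Leg l) - height y k - height y l"
        using 3[rule_format, of k l] kl by simp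
      then show "x $ pr (Leg k) (Leg l) = (y + (Phi b + c *\<^sub>R s_vec)) $ pr (Leg k) (Leg l)"
        using kl by (simp add: Phi_nth s_vec_nth b_def)
    qed
    then have "x - y = Phi b + c *\<^sub>R s_vec" by simp
    then show "vn_rel x y" unfolding vn_rel_def by blast
  qed
  then show ?thesis using assms by blast
qed

section \<open>Split vectors\<close>

definition split_vec :: "'n leaf set \<Rightarrow> real ^ 'n::finite pairs" where
  "split_vec F = (\<chi> S. if card (Rep_pairs S \<inter> F) = 1 then 1 else 0)"

lemma Rep_pairs_pr: "i \<noteq> j \<Longrightarrow> Rep_pairs (pr i j) = {i, j}"
  by (simp add: pr_def Abs_pairs_inverse)

lemma split_vec_nth: "i \<noteq> j \<Longrightarrow> split_vec F $ pr i j = of_bool ((i \<in> F) \<noteq> (j \<in> F))"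
  by (cases "i \<in> F"; cases "j \<in> F") (auto simp: split_vec_def Rep_pairs_pr Int_insert_left)

text \<open>
  The distances in a tree with a single bounded edge of length one, beyond which lie the leaves in
  \<open>F\<close>.
\<close>

definition ray :: "'n leaf set \<Rightarrow> 'n::finite vn" where
  "ray F = cls (split_vec F)"

lemma circ_ray: "circ (ray F) = of_bool ((LA \<in> F) \<noteq> (LB \<in> F))"
  by (simp add: ray_def circ.abs_eq split_vec_nth)

lemma offset_ray:
  "LA \<notin> F \<Longrightarrow> offset k l (ray F) =
     (if LB \<in> F then of_bool (Leg k \<in> F) - of_bool (Leg l \<in> F) else 0)"
  by (auto simp: ray_def offset.abs_eq split_vec_nth)

lemma rdist_ray:
  "LA \<notin> F \<Longrightarrow> rdist k l (ray F) = (if k = l then 0 else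
     if LB \<in> F then of_bool ((Leg k \<in> F) \<noteq> (Leg l \<in> F)) else - 2 * of_bool (Leg k \<in> F \<and> Leg l \<in> F))"
  by (auto simp: ray_def rdist.abs_eq split_vec_nth height_def)

lemma ray_empty: "ray {} = 0"
  by (rule vn_eqI) (simp_all add: circ_ray offset_ray rdist_ray circ_simps offset_simps rdist_simps)

lemma ray_leg: "ray {Leg k} = 0"
  by (rule vn_eqI) (auto simp: circ_ray offset_ray rdist_ray circ_simps offset_simps rdist_simps)

lemma ray_full: "ray (UNIV - {LA}) = ray {LB}"
  by (rule vn_eqI) (auto simp: circ_ray offset_ray rdist_ray)

text \<open>
  The three ways of resolving a vertex at which the subtrees with leaf sets \<open>T1\<close>, \<open>T2\<close>, \<open>T3\<close> meet
  the rest of the tree.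
\<close>

lemma ray_resolutions:
  fixes T1 T2 T3 :: "'n::finite leaf set"
  assumes "T1 \<inter> T2 = {}" "T1 \<inter> T3 = {}" "T2 \<inter> T3 = {}"
  shows "ray (T1 \<union> T2) + ray (T1 \<union> T3) + ray (T2 \<union> T3) = ray T1 + ray T2 + ray T3 + ray (T1 \<union> T2 \<union> T3)"
proof -
  have "split_vec (T1 \<union> T2) + split_vec (T1 \<union> T3) + split_vec (T2 \<union> T3) =
      split_vec T1 + split_vec T2 + split_vec T3 + split_vec (T1 \<union> T2 \<union> T3)"
  proof (subst vec_eq_iff, intro allI)
    fix S :: "'n pairs"
    obtain i j :: "'n leaf" where S: "i \<noteq> j" "S = pr i j"
      by (cases S rule: pairs_cases) (use leaf.distinct in blast)+
    have "\<not> (i \<in> T1 \<and> i \<in> T2)" "\<not> (i \<in> T1 \<and> i \<in> T3)" "\<not> (i \<in> T2 \<and> i \<in> T3)"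
      "\<not> (j \<in> T1 \<and> j \<in> T2)" "\<not> (j \<in> T1 \<and> j \<in> T3)" "\<not> (j \<in> T2 \<and> j \<in> T3)" using assms by auto
    then show "(split_vec (T1 \<union> T2) + split_vec (T1 \<union> T3) + split_vec (T2 \<union> T3)) $ S =
        (split_vec T1 + split_vec T2 + split_vec T3 + split_vec (T1 \<union> T2 \<union> T3)) $ S"
      unfolding S(2) using S(1)
      by (cases "i \<in> T1"; cases "i \<in> T2"; cases "i \<in> T3"; cases "j \<in> T1"; cases "j \<in> T2"; cases "j \<in> T3")
        (simp_all add: split_vec_nth)
  qed
  then show ?thesis by (simp add: ray_def plus_vn.abs_eq)
qed

section \<open>The group \<open>G\<^sub>n\<close>\<close>

text \<open>
  The integer \<open>a k\<close> says how often the leaf \<open>k\<close> is moved around the cycle; adding a constant to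
  \<open>a\<close> changes nothing. The change of \<open>rdist\<close> is quadratic in \<open>a\<close> because on cycle edges \<open>rdist\<close> is
  the square of \<open>offset\<close>.
\<close>

definition acts_as :: "('n::finite vn \<Rightarrow> 'n vn) \<Rightarrow> real \<Rightarrow> ('n \<Rightarrow> int) \<Rightarrow> bool" where
  "acts_as g \<epsilon> a \<longleftrightarrow> (\<epsilon> = 1 \<or> \<epsilon> = - 1) \<and> (\<forall>x. circ (g x) = circ x) \<and>
     (\<forall>x k l. offset k l (g x) = \<epsilon> * offset k l x - of_int (a k - a l) * circ x) \<and>
     (\<forall>x k l. rdist k l (g x) = rdist k l x - 2 * \<epsilon> * of_int (a k - a l) * offset k l x
        + (of_int (a k - a l))\<^sup>2 * circ x)"

lemma acts_asD:
  assumes "acts_as g \<epsilon> a"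
  shows "\<epsilon> = 1 \<or> \<epsilon> = - 1" "circ (g x) = circ x"
    "offset k l (g x) = \<epsilon> * offset k l x - of_int (a k - a l) * circ x"
    "rdist k l (g x) = rdist k l x - 2 * \<epsilon> * of_int (a k - a l) * offset k l x
        + (of_int (a k - a l))\<^sup>2 * circ x"
  using assms unfolding acts_as_def by blast+

lemma acts_as_unique:
  assumes "acts_as g \<epsilon> a" "acts_as h \<epsilon> b" "\<And>k l. a k - a l = b k - b l"
  shows "g = h"
proof
  fix x show "g x = h x"
    by (rule vn_eqI) (simp_all only: acts_asD(2-4)[OF assms(1)] acts_asD(2-4)[OF assms(2)] assms(3))
qed

lemma acts_as_id: "acts_as id 1 (\<lambda>_. 0)"
  by (simp add: acts_as_def)

lemma acts_as_I: "acts_as I_map (- 1) (\<lambda>_. 0)"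
proof -
  have "circ (I_map x) = circ x" for x :: "'a vn" by transfer (simp add: I_coord_nth)
  moreover have "offset k l (I_map x) = - offset k l x" for k l and x :: "'a vn"
    by transfer (simp add: I_coord_nth field_simps)
  moreover have "rdist k l (I_map x) = rdist k l x" for k l and x :: "'a vn"
    by transfer (simp add: I_coord_nth height_def algebra_simps)
  ultimately show ?thesis by (simp add: acts_as_def)
qed

lemma acts_as_M: "acts_as (M_map p) 1 (\<lambda>k. if k = p then 1 else 0)"
proof -
  have "circ (M_map p x) = circ x" for x by transfer (simp add: M_coord_nth)
  moreover have "offset k l (M_map p x) =
      offset k l x - of_int ((if k = p then 1 else 0) - (if l = p then 1 else 0)) * circ x" for k l x
    by transfer (auto simp: M_coord_nth field_simps)
  moreover have r: "rdist p l (M_map p x) = rdist p l x - 2 * offset p l x + circ x" if "l \<noteq> p" for l x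
    using that by transfer (simp add: M_coord_nth height_def field_simps)
  moreover have "rdist k l (M_map p x) = rdist k l x" if "k \<noteq> p" "l \<noteq> p" for k l x
    using that by transfer (simp add: M_coord_nth height_def)
  moreover have "rdist k p (M_map p x) = rdist k p x + 2 * offset k p x + circ x" if "k \<noteq> p" for k x
    using r[OF that, of x] rdist_commute[of k p] offset_diff[of p k x k] offset_diff[of k p x k] by simp
  ultimately show ?thesis by (auto simp: acts_as_def)
qed

lemma acts_as_comp:
  assumes g: "acts_as g \<epsilon> a" and h: "acts_as h \<delta> b"
  shows "acts_as (g \<circ> h) (\<epsilon> * \<delta>) (\<lambda>k. a k + (if \<epsilon> = 1 then b k else - b k))"
proof -
  have \<epsilon>: "\<epsilon> = 1 \<or> \<epsilon> = - 1" and \<delta>: "\<delta> = 1 \<or> \<delta> = - 1" using acts_asD(1)[OF g] acts_asD(1)[OF h] .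
  show ?thesis unfolding acts_as_def comp_apply acts_asD(2-4)[OF g] acts_asD(2-4)[OF h]
    using \<epsilon> \<delta> by (elim disjE) (simp_all add: algebra_simps power2_eq_square)
qed

lemma acts_as_inverse:
  assumes g: "acts_as g \<epsilon> a" and inv: "\<And>x. g (h x) = x"
  shows "acts_as h \<epsilon> (\<lambda>k. if \<epsilon> = 1 then - a k else a k)"
proof -
  have \<epsilon>: "\<epsilon> = 1 \<or> \<epsilon> = - 1" using acts_asD(1)[OF g] .
  have c: "circ (h x) = circ x" for x using acts_asD(2)[OF g, of "h x"] inv by simp
  have o: "offset k l (h x) = \<epsilon> * offset k l x + \<epsilon> * of_int (a k - a l) * circ x" for k l x
  proof -
    have "offset k l x = \<epsilon> * offset k l (h x) - of_int (a k - a l) * circ x"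
      using acts_asD(3)[OF g, of k l "h x"] inv c by simp
    then show ?thesis using \<epsilon> by (auto simp: algebra_simps)
  qed
  have r: "rdist k l (h x) = rdist k l x + 2 * \<epsilon> * of_int (a k - a l) * offset k l (h x)
        - (of_int (a k - a l))\<^sup>2 * circ x" for k l x
    using acts_asD(4)[OF g, of k l "h x"] inv c by simp
  show ?thesis unfolding acts_as_def c r o
    using \<epsilon> by (elim disjE) (simp_all add: algebra_simps power2_eq_square)
qed

lemma I_involution: "I_map \<circ> I_map = id"
  by (rule acts_as_unique[OF acts_as_comp[OF acts_as_I acts_as_I, simplified] acts_as_id]) simp

lemma acts_as_IMI: "acts_as (I_map \<circ> (M_map p \<circ> I_map)) 1 (\<lambda>k. - (if k = p then 1 else 0))"
  using acts_as_comp[OF acts_as_I acts_as_comp[OF acts_as_M[of p] acts_as_I]] by simp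

text \<open>Reflecting, winding the leaf \<open>p\<close> around the cycle and reflecting back unwinds it.\<close>

lemma M_inverse: "M_map p \<circ> (I_map \<circ> (M_map p \<circ> I_map)) = id" "(I_map \<circ> (M_map p \<circ> I_map)) \<circ> M_map p = id"
  by (rule acts_as_unique[OF acts_as_comp[OF acts_as_M acts_as_IMI, simplified] acts_as_id];
      simp add: if_distrib)
    (rule acts_as_unique[OF acts_as_comp[OF acts_as_IMI acts_as_M, simplified] acts_as_id];
      simp add: if_distrib)

lemma generators_Bij: "insert I_map (range M_map) \<subseteq> carrier (BijGroup (UNIV :: 'n::finite vn set))"
proof -
  have "bij (I_map :: 'n vn \<Rightarrow> 'n vn)" using I_involution by (rule o_bij) (rule I_involution)
  moreover have "bij (M_map p :: 'n vn \<Rightarrow> 'n vn)" for p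
    using M_inverse(2) M_inverse(1) by (rule o_bij)
  ultimately show ?thesis by (auto simp: BijGroup_def Bij_def)
qed

lemma subgroup_Gn: "subgroup (carrier (Gn :: ('n::finite vn \<Rightarrow> 'n vn) monoid)) (BijGroup UNIV)"
  unfolding Gn_def using group.generate_is_subgroup[OF group_BijGroup generators_Bij] by simp

lemma generators_Gn: "I_map \<in> carrier Gn" "M_map p \<in> carrier Gn"
  unfolding Gn_def by (auto intro: generate.incl)

lemmas comp_Gn = subgroup_BijGroup_comp[OF subgroup_Gn]

lemmas id_Gn = subgroup_BijGroup_id[OF subgroup_Gn]

lemma BijGroup_inv_apply:
  assumes "g \<in> carrier (BijGroup UNIV)" shows "g ((inv\<^bsub>BijGroup UNIV\<^esub> g) x) = x"
proof -
  interpret B: group "BijGroup (UNIV :: 'a set)" by (rule group_BijGroup)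
  have "g \<otimes>\<^bsub>BijGroup UNIV\<^esub> inv\<^bsub>BijGroup UNIV\<^esub> g = \<one>\<^bsub>BijGroup UNIV\<^esub>" using B.r_inv[OF assms] .
  then have "compose UNIV g (inv\<^bsub>BijGroup UNIV\<^esub> g) = id"
    using assms B.inv_closed[OF assms] by (simp add: BijGroup_def id_def restrict_UNIV)
  then show ?thesis by (metis compose_eq UNIV_I id_apply)
qed

lemma acts_as_Gn:
  assumes "g \<in> carrier (Gn :: ('n::finite vn \<Rightarrow> 'n vn) monoid)" shows "\<exists>\<epsilon> a. acts_as g \<epsilon> a"
proof -
  have "g \<in> generate (BijGroup UNIV) (insert I_map (range M_map))" using assms by (simp add: Gn_def)
  then show ?thesis
  proof (induction rule: generate.induct)
    case one
    then show ?case using acts_as_id by (auto simp: BijGroup_def id_def restrict_UNIV)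
  next
    case (incl h)
    then show ?case using acts_as_I acts_as_M by blast
  next
    case (inv h)
    then have "h \<in> carrier (BijGroup UNIV)" using generators_Bij by blast
    note right_inverse = BijGroup_inv_apply[OF this]
    obtain \<epsilon> a where "acts_as h \<epsilon> a" using inv acts_as_I acts_as_M by blast
    from acts_as_inverse[OF this right_inverse] show ?case by blast
  next
    case (eng h1 h2)
    have "h1 \<in> carrier (BijGroup UNIV)" "h2 \<in> carrier (BijGroup UNIV)"
      using eng(1,2) group.generate_in_carrier[OF group_BijGroup generators_Bij] by auto
    then have "h1 \<otimes>\<^bsub>BijGroup UNIV\<^esub> h2 = h1 \<circ> h2"
      by (simp add: BijGroup_def compose_def comp_def restrict_UNIV)
    then show ?case using eng(3,4) acts_as_comp by metis
  qed
qed

text \<open>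
  The \<open>M_map p\<close> and their inverses wind a single leaf around the cycle once in either direction.
\<close>

lemma translation_in_Gn: "\<exists>g\<in>carrier Gn. acts_as g 1 (a :: 'n::finite \<Rightarrow> int)"
proof -
  define T where "T a \<longleftrightarrow> (\<exists>g\<in>carrier Gn. acts_as g 1 a)" for a :: "'n \<Rightarrow> int"
  have 0: "T (\<lambda>_. 0)" unfolding T_def using id_Gn acts_as_id by blast
  have up: "T (\<lambda>k. a k + (if k = p then 1 else 0))" if Ta: "T a" for a p
  proof -
    obtain g where g: "g \<in> carrier Gn" "acts_as g 1 a" using Ta T_def by blast
    have "acts_as (g \<circ> M_map p) 1 (\<lambda>k. a k + (if k = p then 1 else 0))"
      using acts_as_comp[OF g(2) acts_as_M[of p]] by simp
    then show ?thesis unfolding T_def using comp_Gn[OF g(1) generators_Gn(2)] by blast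
  qed
  have down: "T (\<lambda>k. a k - (if k = p then 1 else 0))" if Ta: "T a" for a p
  proof -
    obtain g where g: "g \<in> carrier Gn" "acts_as g 1 a" using Ta T_def by blast
    have "acts_as (g \<circ> (I_map \<circ> (M_map p \<circ> I_map))) 1 (\<lambda>k. a k - (if k = p then 1 else 0))"
      using acts_as_comp[OF g(2) acts_as_IMI[of p]] by simp
    moreover have "I_map \<circ> (M_map p \<circ> I_map) \<in> carrier Gn"
      using comp_Gn generators_Gn by blast
    ultimately show ?thesis unfolding T_def using comp_Gn[OF g(1)] by blast
  qed
  have "\<forall>a. (\<forall>k. k \<notin> S \<longrightarrow> a k = 0) \<longrightarrow> T a" if "finite S" for S
    using that
  proof (induction S)
    case empty
    show ?case
    proof (intro allI impI)
      fix a :: "'n \<Rightarrow> int" assume "\<forall>k. k \<notin> {} \<longrightarrow> a k = 0"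
      then have "a = (\<lambda>_. 0)" by auto
      then show "T a" using 0 by simp
    qed
  next
    case (insert p S)
    show ?case
    proof (intro allI impI)
      fix a :: "'n \<Rightarrow> int" assume a: "\<forall>k. k \<notin> insert p S \<longrightarrow> a k = 0"
      have "T (a(p := i))" for i
      proof (induction i rule: int_induct[where k = 0])
        case base
        have "\<forall>k. k \<notin> S \<longrightarrow> (a(p := 0)) k = 0" using a by auto
        then show ?case using insert.IH by blast
      next
        case (step1 i)
        have "a(p := i + 1) = (\<lambda>k. (a(p := i)) k + (if k = p then 1 else 0))" by auto
        then show ?case using up[OF step1(2), of p] by simp
      next
        case (step2 i)
        have "a(p := i - 1) = (\<lambda>k. (a(p := i)) k - (if k = p then 1 else 0))" by auto
        then show ?case using down[OF step2(2), of p] by simp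
      qed
      from this[of "a p"] show "T a" by simp
    qed
  qed
  from this[of UNIV] show ?thesis unfolding T_def by simp
qed

lemma acts_as_linear:
  assumes g: "acts_as g \<epsilon> a" shows "linear g"
proof (rule linearI)
  show "g (x + y) = g x + g y" for x y
    by (rule vn_eqI)
      (simp_all add: acts_asD(2-4)[OF g] circ_simps offset_simps rdist_simps algebra_simps)
  show "g (r *\<^sub>R x) = r *\<^sub>R g x" for r x
    by (rule vn_eqI)
      (simp_all add: acts_asD(2-4)[OF g] circ_simps offset_simps rdist_simps algebra_simps)
qed

text \<open>
  If the cycle has positive length, the offsets of a fixed point and the sign determine the
  winding numbers up to a constant, so at most two elements fix the point.
\<close>

lemma finite_stabilizer_Gn:
  assumes "0 < circ x" shows "finite {g \<in> carrier Gn. g x = x}"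
proof -
  define sign where "sign g = (SOME \<epsilon>. \<exists>a. acts_as g \<epsilon> a)" for g :: "'a vn \<Rightarrow> 'a vn"
  have sign: "\<exists>a. acts_as g (sign g) a" if "g \<in> carrier Gn" for g
    unfolding sign_def using acts_as_Gn[OF that] by (rule someI_ex)
  have "inj_on sign {g \<in> carrier Gn. g x = x}"
  proof (rule inj_onI)
    fix g h assume g: "g \<in> {g \<in> carrier Gn. g x = x}" and h: "h \<in> {g \<in> carrier Gn. g x = x}"
      and eq: "sign g = sign h"
    obtain a where a: "acts_as g (sign g) a" using sign g by blast
    obtain b where b: "acts_as h (sign g) b" using sign h eq by auto
    have "a k - a l = b k - b l" for k l
    proof -
      have "of_int (a k - a l) * circ x = of_int (b k - b l) * circ x"
      proof -
        have x: "g x = x" "h x = x" using g h by auto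
        have "offset k l x = sign g * offset k l x - of_int (a k - a l) * circ x"
          "offset k l x = sign g * offset k l x - of_int (b k - b l) * circ x"
          using acts_asD(3)[OF a, of k l x] acts_asD(3)[OF b, of k l x] unfolding x .
        then show ?thesis by linarith
      qed
      then show ?thesis using assms by simp
    qed
    then show "g = h" using acts_as_unique[OF a b] by blast
  qed
  moreover have "sign ` {g \<in> carrier Gn. g x = x} \<subseteq> {1, - 1}"
    using sign acts_asD(1) by blast
  ultimately show ?thesis by (meson finite.emptyI finite.insertI finite_subset finite_imageD)
qed

section \<open>The lattice of \<open>V\<^sub>n\<close>\<close>

text \<open>
  On the rays of cycle edges \<open>rdist\<close> is the square of \<open>offset\<close>, and on those of tree edges both
  are even; hence the division by two.
\<close>

definition half_gap :: "'n::finite \<Rightarrow> 'n \<Rightarrow> 'n vn \<Rightarrow> real" where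
  "half_gap k l x = (offset k l x - rdist k l x) / 2"

lemma linear_half_gap: "linear (half_gap k l)"
  by (rule linearI) (simp_all add: half_gap_def offset_simps rdist_simps field_simps)

lemmas half_gap_simps = linear_0[OF linear_half_gap] linear_add[OF linear_half_gap]
  linear_scale[OF linear_half_gap] linear_sum[OF linear_half_gap]

text \<open>In the end this is the lattice \<open>Vn_lat\<close> generated by all cones.\<close>

definition Vlat :: "'n::finite vn set" where
  "Vlat = {x. circ x \<in> \<int> \<and> (\<forall>k l. offset k l x \<in> \<int> \<and> half_gap k l x \<in> \<int>)}"

lemma VlatD:
  assumes "x \<in> Vlat" shows "circ x \<in> \<int>" "offset k l x \<in> \<int>" "half_gap k l x \<in> \<int>"
  using assms by (auto simp: Vlat_def)

lemma Vlat_add: "x \<in> Vlat \<Longrightarrow> y \<in> Vlat \<Longrightarrow> x + y \<in> Vlat"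
  by (simp add: Vlat_def circ_simps offset_simps half_gap_simps)

lemma Vlat_scale: "x \<in> Vlat \<Longrightarrow> of_int k *\<^sub>R x \<in> Vlat"
  by (simp add: Vlat_def circ_simps offset_simps half_gap_simps)

lemma Vlat_zero: "0 \<in> Vlat"
  by (simp add: Vlat_def circ_simps offset_simps half_gap_simps)

lemma Vlat_sum: "(\<And>b. b \<in> B \<Longrightarrow> b \<in> Vlat) \<Longrightarrow> (\<Sum>b\<in>B. of_int (k b) *\<^sub>R b) \<in> Vlat"
  by (induction B rule: infinite_finite_induct) (auto simp: Vlat_zero Vlat_add Vlat_scale)

lemma ray_in_Vlat: "LA \<notin> F \<Longrightarrow> ray F \<in> Vlat"
  by (auto simp: Vlat_def half_gap_def circ_ray offset_ray rdist_ray)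

text \<open>
  An element changes \<open>offset - rdist\<close> by \<open>2 z - (d + d\<^sup>2) circ\<close> for integers \<open>z\<close> and \<open>d\<close>, and
  \<open>d + d\<^sup>2\<close> is even.
\<close>

lemma acts_as_Vlat:
  assumes g: "acts_as g \<epsilon> a" and x: "x \<in> Vlat" shows "g x \<in> Vlat"
proof -
  have \<epsilon>: "\<epsilon> = 1 \<or> \<epsilon> = - 1" using acts_asD(1)[OF g] .
  have "half_gap k l (g x) \<in> \<int> \<and> offset k l (g x) \<in> \<int>" for k l
  proof
    obtain c where c: "circ x = of_int c" using VlatD(1)[OF x] Ints_cases by blast
    obtain d where d: "offset k l x = of_int d" using VlatD(2)[OF x] Ints_cases by blast
    obtain e where e: "half_gap k l x = of_int e" using VlatD(3)[OF x] Ints_cases by blast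
    obtain s :: int where s: "\<epsilon> = of_int s" "s = 1 \<or> s = - 1" using \<epsilon> by (metis of_int_1 of_int_minus)
    define z where "z = a k - a l"
    have "even ((s - 1) * d - z * (z + 1) * c)" using s(2) by auto
    then obtain w where w: "(s - 1) * d - z * (z + 1) * c = 2 * w" by (elim evenE)
    have r: "rdist k l x = of_int d - 2 * of_int e" using e d by (simp add: half_gap_def field_simps)
    have o: "offset k l (g x) = of_int (s * d - z * c)"
      unfolding acts_asD(3)[OF g] c d s(1) z_def by simp
    have rg: "rdist k l (g x) = of_int (d - 2 * e - 2 * s * z * d + z\<^sup>2 * c)"
      unfolding acts_asD(4)[OF g] c d s(1) r z_def by simp
    have "(s * d - z * c) - (d - 2 * e - 2 * s * z * d + z\<^sup>2 * c) = 2 * (e + s * z * d + w)"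
      using w by (simp add: algebra_simps power2_eq_square)
    then have "offset k l (g x) - rdist k l (g x) = of_int (2 * (e + s * z * d + w))"
      unfolding o rg by (metis of_int_diff)
    then have "half_gap k l (g x) = of_int (e + s * z * d + w)" by (simp add: half_gap_def)
    then show "half_gap k l (g x) \<in> \<int>" by (metis Ints_of_int)
    show "offset k l (g x) \<in> \<int>" unfolding o by (rule Ints_of_int)
  qed
  then show ?thesis using x by (simp add: Vlat_def acts_asD(2)[OF g])
qed

lemma dual_basis_lattice:
  fixes v :: "'j \<Rightarrow> 'v::real_vector" and f :: "'j \<Rightarrow> 'v \<Rightarrow> real"
  assumes J: "finite J" and f: "\<And>i. i \<in> J \<Longrightarrow> linear (f i)"
    "\<And>i j. i \<in> J \<Longrightarrow> j \<in> J \<Longrightarrow> f i (v j) = of_bool (i = j)"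
    and expand: "\<And>x. x \<in> L \<Longrightarrow> x = (\<Sum>j\<in>J. f j x *\<^sub>R v j)"
    and int: "\<And>j x. j \<in> J \<Longrightarrow> x \<in> L \<Longrightarrow> f j x \<in> \<int>"
    and closed: "\<And>k. (\<Sum>b\<in>v ` J. of_int (k b) *\<^sub>R b) \<in> L"
  shows "L = int_span (v ` J)" "is_lattice L"
proof -
  have inj: "inj_on v J"
  proof (rule inj_onI)
    fix i j assume "i \<in> J" "j \<in> J" "v i = v j"
    then show "i = j" using f(2)[of i i] f(2)[of i j] by (simp split: if_splits)
  qed
  show L: "L = int_span (v ` J)"
  proof (intro equalityI subsetI)
    fix x assume x: "x \<in> L"
    define k where "k = (\<lambda>b. \<lfloor>f (inv_into J v b) x\<rfloor>)"
    have "x = (\<Sum>j\<in>J. of_int (k (v j)) *\<^sub>R v j)"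
    proof (subst expand[OF x], intro sum.cong refl)
      fix j assume j: "j \<in> J"
      show "f j x *\<^sub>R v j = of_int (k (v j)) *\<^sub>R v j"
        using int[OF j x] j inj by (auto simp: k_def elim!: Ints_cases)
    qed
    then have "x = (\<Sum>b\<in>v ` J. of_int (k b) *\<^sub>R b)" using inj by (simp add: sum.reindex)
    then show "x \<in> int_span (v ` J)" unfolding int_span_def by blast
  qed (use closed in \<open>auto simp: int_span_def\<close>)
  have "independent (v ` J)"
  proof (subst dependent_finite)
    show "finite (v ` J)" using J by simp
    have "u (v i) = 0" if u: "(\<Sum>b\<in>v ` J. u b *\<^sub>R b) = 0" and i: "i \<in> J" for u i
    proof -
      have "0 = f i (\<Sum>j\<in>J. u (v j) *\<^sub>R v j)"
        using u inj linear_0[OF f(1)[OF i]] by (simp add: sum.reindex)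
      also have "\<dots> = (\<Sum>j\<in>J. u (v j) * of_bool (i = j))"
        using f i by (simp add: linear_sum[OF f(1)[OF i]] linear_scale[OF f(1)[OF i]])
      also have "\<dots> = (\<Sum>j\<in>J. if j = i then u (v i) else 0)" by (intro sum.cong) auto
      finally show ?thesis using J i by simp
    qed
    then show "\<not> (\<exists>u. (\<exists>b\<in>v ` J. u b \<noteq> 0) \<and> (\<Sum>b\<in>v ` J. u b *\<^sub>R b) = 0)" by blast
  qed
  then show "is_lattice L" unfolding L using J by (intro is_lattice_int_span) auto
qed

text \<open>
  A basis of the lattice: the ray of the loop with all leaves at one vertex, the rays that move one
  leaf \<open>m\<close> across the cut, except for the leaf \<open>undefined\<close>, which serves as base point, and the rays
  of trees with two leaves.
\<close>

definition basis_index :: "('n::finite option + 'n set) set" where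
  "basis_index = insert (Inl None) ((\<lambda>m. Inl (Some m)) ` (UNIV - {undefined}) \<union> Inr ` {S. card S = 2})"

definition basis_ray :: "('n::finite option + 'n set) \<Rightarrow> 'n vn" where
  "basis_ray j = (case j of Inl None \<Rightarrow> ray {LB} | Inl (Some m) \<Rightarrow> ray {LB, Leg m} | Inr S \<Rightarrow> ray (Leg ` S))"

definition basis_dual :: "('n::finite option + 'n set) \<Rightarrow> 'n vn \<Rightarrow> real" where
  "basis_dual j x = (case j of
     Inl None \<Rightarrow> circ x - (\<Sum>m\<in>UNIV - {undefined}. offset m undefined x)
   | Inl (Some m) \<Rightarrow> offset m undefined x
   | Inr S \<Rightarrow> (\<Sum>k\<in>S. \<Sum>l\<in>S - {k}. (offset k undefined x + offset l undefined x - rdist k l x) / 4))"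

lemma sum_basis_index:
  "(\<Sum>j\<in>basis_index. h j) = h (Inl None) + (\<Sum>m\<in>UNIV - {undefined}. h (Inl (Some m)))
     + (\<Sum>S\<in>{S. card S = 2}. h (Inr S))"
proof -
  have "(\<Sum>j\<in>basis_index. h j) = h (Inl None) +
      (\<Sum>j\<in>(\<lambda>m. Inl (Some m)) ` (UNIV - {undefined}) \<union> Inr ` {S. card S = 2}. h j)"
    unfolding basis_index_def by (intro sum.insert) auto
  also have "(\<Sum>j\<in>(\<lambda>m. Inl (Some m)) ` (UNIV - {undefined}) \<union> Inr ` {S. card S = 2}. h j) =
      (\<Sum>j\<in>(\<lambda>m. Inl (Some m)) ` (UNIV - {undefined}). h j) + (\<Sum>j\<in>Inr ` {S. card S = 2}. h j)"
    by (intro sum.union_disjoint) auto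
  also have "(\<Sum>j\<in>(\<lambda>m. Inl (Some m)) ` (UNIV - {undefined}). h j) = (\<Sum>m\<in>UNIV - {undefined}. h (Inl (Some m)))"
    by (subst sum.reindex) (auto simp: inj_on_def)
  also have "(\<Sum>j\<in>Inr ` {S. card S = 2}. h j) = (\<Sum>S\<in>{S. card S = 2}. h (Inr S))"
    by (subst sum.reindex) (auto simp: inj_on_def)
  finally show ?thesis by (simp add: add.assoc)
qed

lemma basis_dual_pair:
  assumes "k \<noteq> l"
  shows "basis_dual (Inr {k, l}) x = (offset k undefined x + offset l undefined x - rdist k l x) / 2"
proof -
  have "{k, l} - {k} = {l}" "{k, l} - {l} = {k}" using assms by auto
  then show ?thesis using assms rdist_commute[of k l x] by (simp add: basis_dual_def field_simps)
qed

lemma linear_basis_dual: "linear (basis_dual j)"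
proof (rule linearI)
  show "basis_dual j (x + y) = basis_dual j x + basis_dual j y" for x y
    by (simp add: basis_dual_def circ_simps offset_simps rdist_simps sum.distrib[symmetric]
        add_divide_distrib[symmetric] algebra_simps split: sum.split option.split)
  show "basis_dual j (r *\<^sub>R x) = r *\<^sub>R basis_dual j x" for r x
    by (simp add: basis_dual_def circ_simps offset_simps rdist_simps sum_distrib_left
        algebra_simps split: sum.split option.split)
qed

lemma basis_dual_ray:
  assumes "i \<in> basis_index" "j \<in> basis_index" shows "basis_dual i (basis_ray j) = of_bool (i = j)"
proof -
  let ?o = "undefined :: 'a"
  have j: "j = Inl None \<or> (\<exists>m. m \<noteq> ?o \<and> j = Inl (Some m)) \<or> (\<exists>k l. k \<noteq> l \<and> j = Inr {k, l})"
    using assms(2) by (auto simp: basis_index_def card_2_iff)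
  have off: "offset m ?o (basis_ray j) = of_bool (j = Inl (Some m))" if "m \<noteq> ?o" for m
    using j that by (auto simp: basis_ray_def offset_ray)
  consider "i = Inl None" | m where "i = Inl (Some m)" "m \<noteq> ?o" | k l where "i = Inr {k, l}" "k \<noteq> l"
    using assms(1) by (auto simp: basis_index_def card_2_iff)
  then show ?thesis
  proof cases
    case 1
    have "(\<Sum>m\<in>UNIV - {?o}. offset m ?o (basis_ray j)) = (\<Sum>m\<in>UNIV - {?o}. of_bool (j = Inl (Some m)))"
      using off by (intro sum.cong) auto
    also have "\<dots> = of_bool (\<exists>m. j = Inl (Some m))"
    proof (cases "\<exists>m. j = Inl (Some m)")
      case True
      then obtain m where m: "j = Inl (Some m)" "m \<noteq> ?o" using j by auto
      have "(\<Sum>m'\<in>UNIV - {?o}. of_bool (j = Inl (Some m'))) = (\<Sum>m'\<in>UNIV - {?o}. if m' = m then 1 else (0::real))"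
        using m by (intro sum.cong) auto
      then show ?thesis using m by simp
    qed simp
    finally have "(\<Sum>m\<in>UNIV - {?o}. offset m ?o (basis_ray j)) = of_bool (\<exists>m. j = Inl (Some m))" .
    moreover have "circ (basis_ray j) = of_bool (j = Inl None \<or> (\<exists>m. j = Inl (Some m)))"
      using j by (auto simp: basis_ray_def circ_ray)
    ultimately show ?thesis using 1 j by (auto simp: basis_dual_def)
  next
    case 2
    then show ?thesis using off[of m] by (auto simp: basis_dual_def)
  next
    case (3 k l)
    have "offset k ?o (basis_ray j) + offset l ?o (basis_ray j) - rdist k l (basis_ray j) = 2 * of_bool (i = j)"
      using j 3 by (elim disjE exE conjE) (auto simp: basis_ray_def offset_ray rdist_ray doubleton_eq_iff)
    then show ?thesis unfolding 3(1) basis_dual_pair[OF 3(2)] by simp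
  qed
qed

lemma basis_expansion: "x = (\<Sum>j\<in>basis_index. basis_dual j x *\<^sub>R basis_ray j)"
proof -
  let ?o = "undefined :: 'a"
  have off: "offset k ?o (\<Sum>j\<in>basis_index. basis_dual j x *\<^sub>R basis_ray j) = offset k ?o x" for k
  proof (cases "k = ?o")
    case False
    have "offset k ?o (\<Sum>j\<in>basis_index. basis_dual j x *\<^sub>R basis_ray j) =
        (\<Sum>j\<in>basis_index. basis_dual j x * basis_dual (Inl (Some k)) (basis_ray j))"
      by (simp add: offset_simps basis_dual_def)
    also have "\<dots> = (\<Sum>j\<in>basis_index. if j = Inl (Some k) then basis_dual (Inl (Some k)) x else 0)"
      using False by (intro sum.cong refl) (subst basis_dual_ray, auto simp: basis_index_def)
    also have "\<dots> = offset k ?o x" using False by (simp add: basis_dual_def) (simp add: basis_index_def)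
    finally show ?thesis .
  qed simp
  show ?thesis
  proof (rule vn_eqI)
    have "circ (\<Sum>j\<in>basis_index. basis_dual j x *\<^sub>R basis_ray j) =
        (\<Sum>j\<in>basis_index. basis_dual j x * circ (basis_ray j))" by (simp add: circ_simps)
    also have "\<dots> = circ x"
      unfolding sum_basis_index by (simp add: basis_ray_def circ_ray basis_dual_def image_iff)
    finally show "circ x = circ (\<Sum>j\<in>basis_index. basis_dual j x *\<^sub>R basis_ray j)" by simp
    show "offset k l x = offset k l (\<Sum>j\<in>basis_index. basis_dual j x *\<^sub>R basis_ray j)" for k l
      using off[of k] off[of l] offset_diff[of k l _ ?o] by simp
    show "rdist k l x = rdist k l (\<Sum>j\<in>basis_index. basis_dual j x *\<^sub>R basis_ray j)" for k l
    proof (cases "k = l")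
      case False
      let ?y = "\<Sum>j\<in>basis_index. basis_dual j x *\<^sub>R basis_ray j"
      have mem: "Inr {k, l} \<in> basis_index" using False by (auto simp: basis_index_def)
      have "basis_dual (Inr {k, l}) ?y = (\<Sum>j\<in>basis_index. basis_dual j x * basis_dual (Inr {k, l}) (basis_ray j))"
        by (simp add: linear_sum[OF linear_basis_dual] linear_scale[OF linear_basis_dual])
      also have "\<dots> = (\<Sum>j\<in>basis_index. if j = Inr {k, l} then basis_dual (Inr {k, l}) x else 0)"
        using mem by (intro sum.cong refl) (subst basis_dual_ray, auto)
      also have "\<dots> = basis_dual (Inr {k, l}) x" using mem by simp
      finally show ?thesis
        unfolding basis_dual_pair[OF False] using off[of k] off[of l] by simp
    qed simp
  qed
qed

lemma basis_dual_Vlat: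
  assumes j: "j \<in> basis_index" and x: "x \<in> Vlat" shows "basis_dual j x \<in> \<int>"
proof -
  note * = VlatD[OF x]
  have half: "(offset k undefined x + offset l undefined x - rdist k l x) / 2 \<in> \<int>" for k l
  proof -
    have eq: "(offset k undefined x + offset l undefined x - rdist k l x) / 2 = half_gap k l x + offset l undefined x"
      unfolding half_gap_def offset_diff[of k l x undefined] by (simp add: field_simps)
    show ?thesis unfolding eq using * by simp
  qed
  have "basis_dual (Inr {k, l}) x \<in> \<int>" if "k \<noteq> l" for k l
    unfolding basis_dual_pair[OF that] by (rule half)
  moreover have "basis_dual (Inl None) x \<in> \<int>" using * by (auto simp: basis_dual_def intro: Ints_sum Ints_diff)
  moreover have "basis_dual (Inl (Some m)) x \<in> \<int>" for m using * by (simp add: basis_dual_def)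
  ultimately show ?thesis using j by (auto simp: basis_index_def card_2_iff)
qed

lemma Vlat_basis: "Vlat = int_span (basis_ray ` basis_index)" "is_lattice Vlat"
proof -
  have fin: "finite basis_index" by simp
  have "basis_ray j \<in> Vlat" if "j \<in> basis_index" for j
    using that by (auto simp: basis_index_def basis_ray_def intro!: ray_in_Vlat)
  then have closed: "(\<Sum>b\<in>basis_ray ` basis_index. of_int (k b) *\<^sub>R b) \<in> Vlat" for k
    by (intro Vlat_sum) auto
  show "Vlat = int_span (basis_ray ` basis_index)" "is_lattice Vlat"
    using dual_basis_lattice[OF fin linear_basis_dual basis_dual_ray basis_expansion basis_dual_Vlat closed]
    by blast+
qed

section \<open>Laminar families\<close>

definition laminar :: "'x set set \<Rightarrow> bool" where
  "laminar \<F> \<longleftrightarrow> (\<forall>E\<in>\<F>. \<forall>F\<in>\<F>. E \<inter> F = {} \<or> E \<subseteq> F \<or> F \<subseteq> E)"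

lemma laminarD: "laminar \<F> \<Longrightarrow> E \<in> \<F> \<Longrightarrow> F \<in> \<F> \<Longrightarrow> x \<in> E \<Longrightarrow> x \<in> F \<Longrightarrow> E \<subseteq> F \<or> F \<subseteq> E"
  unfolding laminar_def by blast

lemma laminar_cases: "laminar \<F> \<Longrightarrow> E \<in> \<F> \<Longrightarrow> F \<in> \<F> \<Longrightarrow> E \<inter> F = {} \<or> E \<subseteq> F \<or> F \<subseteq> E"
  unfolding laminar_def by blast

lemma laminar_subset: "laminar \<F> \<Longrightarrow> \<G> \<subseteq> \<F> \<Longrightarrow> laminar \<G>"
  unfolding laminar_def by blast

text \<open>
  Two leaves whose last common ancestor is the vertex with leaf set \<open>F\<close>: one inside a maximal smaller
  cluster and one outside of it.
\<close>

lemma last_common_ancestor_pair: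
  fixes \<F> :: "'x::finite set set"
  assumes lam: "laminar \<F>" and F: "F \<in> \<F>" "2 \<le> card F"
  obtains i j where "i \<in> F" "j \<in> F" "i \<noteq> j" "\<And>F'. F' \<in> \<F> \<Longrightarrow> i \<in> F' \<Longrightarrow> j \<in> F' \<Longrightarrow> F \<subseteq> F'"
proof (cases "\<exists>M\<in>\<F>. M \<subset> F \<and> M \<noteq> {}")
  case True
  define \<M> where "\<M> = {M \<in> \<F>. M \<subset> F \<and> M \<noteq> {}}"
  have "finite \<M>" "\<M> \<noteq> {}" using True by (auto simp: \<M>_def)
  then obtain M where M: "M \<in> \<M>" "\<And>M'. M' \<in> \<M> \<Longrightarrow> M \<subseteq> M' \<Longrightarrow> M = M'"
    using finite_has_maximal[of \<M>] by blast
  then obtain i j where ij: "i \<in> M" "j \<in> F" "j \<notin> M" "M \<in> \<F>" "M \<subset> F" unfolding \<M>_def by blast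
  have "F \<subseteq> F'" if F': "F' \<in> \<F>" "i \<in> F'" "j \<in> F'" for F'
  proof (rule ccontr)
    assume not: "\<not> F \<subseteq> F'"
    have "i \<in> F" using ij by blast
    then have "F' \<subseteq> F" using laminarD[OF lam F'(1) F(1) F'(2)] not by blast
    then have "F' \<in> \<M>" using not F'(1,2) by (auto simp: \<M>_def)
    moreover have "M \<subseteq> F'" using laminarD[OF lam F'(1) ij(4) F'(2) ij(1)] F'(3) ij(3) by blast
    ultimately show False using M(2)[of F'] F'(3) ij(3) by blast
  qed
  then show thesis using that[of i j] ij by blast
next
  case False
  obtain i j where ij: "i \<in> F" "j \<in> F" "i \<noteq> j"
    using F(2) by (metis card_2_iff' ex_card subset_iff)
  have "F \<subseteq> F'" if F': "F' \<in> \<F>" "i \<in> F'" for F'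
    using laminarD[OF lam F'(1) F(1) F'(2) ij(1)] False F' by blast
  then show thesis using that[of i j] ij by blast
qed

text \<open>
  The weights of a tree are determined by the lengths of the common parts of paths to the root,
  over any additive subgroup of the reals. This is used for \<open>{0}\<close>, where it gives linear
  independence, and for the integers, where it says that the lattice of a cone is saturated.
\<close>

lemma laminar_coefficients:
  fixes \<F> :: "'x::finite set set" and a :: "'x set \<Rightarrow> real"
  assumes lam: "laminar \<F>"
    and H: "0 \<in> H" "\<And>x y. x \<in> H \<Longrightarrow> y \<in> H \<Longrightarrow> x - y \<in> H"
    and sums: "\<And>i j. i \<noteq> j \<Longrightarrow> (\<Sum>F\<in>{F \<in> \<F>. i \<in> F \<and> j \<in> F}. a F) \<in> H"
  shows "F \<in> \<F> \<Longrightarrow> 2 \<le> card F \<Longrightarrow> a F \<in> H"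
proof (rule ccontr)
  assume F: "F \<in> \<F>" "2 \<le> card F" "a F \<notin> H"
  have Hsum: "(\<Sum>F\<in>S. a F) \<in> H" if "\<And>F. F \<in> S \<Longrightarrow> a F \<in> H" for S
  proof -
    have add: "x + y \<in> H" if "x \<in> H" "y \<in> H" for x y
      using H(2)[OF that(1) H(2)[OF H(1) that(2)]] by simp
    have "finite S" by simp
    then show ?thesis using that by (induction S) (auto simp: H(1) add)
  qed
  define \<B> where "\<B> = {F \<in> \<F>. 2 \<le> card F \<and> a F \<notin> H}"
  have "finite \<B>" "\<B> \<noteq> {}" using F by (auto simp: \<B>_def)
  then obtain M where M: "M \<in> \<B>" "\<And>M'. M' \<in> \<B> \<Longrightarrow> M \<subseteq> M' \<Longrightarrow> M = M'"
    using finite_has_maximal[of \<B>] by blast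
  then have M': "M \<in> \<F>" "2 \<le> card M" "a M \<notin> H" by (auto simp: \<B>_def)
  obtain i j where ij: "i \<in> M" "j \<in> M" "i \<noteq> j" "\<And>F'. F' \<in> \<F> \<Longrightarrow> i \<in> F' \<Longrightarrow> j \<in> F' \<Longrightarrow> M \<subseteq> F'"
    using last_common_ancestor_pair[OF lam M'(1,2)] by blast
  have "{F \<in> \<F>. i \<in> F \<and> j \<in> F} = insert M {F \<in> \<F>. M \<subset> F}" using ij M'(1) by blast
  then have "(\<Sum>F\<in>{F \<in> \<F>. i \<in> F \<and> j \<in> F}. a F) = a M + (\<Sum>F\<in>{F \<in> \<F>. M \<subset> F}. a F)" by simp
  moreover have "(\<Sum>F\<in>{F \<in> \<F>. M \<subset> F}. a F) \<in> H"
  proof (rule Hsum)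
    fix F assume FF: "F \<in> {F \<in> \<F>. M \<subset> F}"
    have "card M < card F" using FF by (intro psubset_card_mono) auto
    then show "a F \<in> H" using M(2)[of F] FF M'(2) unfolding \<B>_def by auto
  qed
  ultimately show False using H(2)[OF sums[OF ij(3)]] M'(3) by fastforce
qed

section \<open>Cluster families\<close>

text \<open>
  The trees obtained by cutting a curve at a vertex and splitting off nothing but the end \<open>B\<close>,
  rooted at the leaf \<open>A\<close>: each edge is given by the set of the leaves beyond it.
\<close>

definition cluster_family :: "'n::finite leaf set set \<Rightarrow> bool" where
  "cluster_family \<F> \<longleftrightarrow> laminar \<F> \<and> {LB} \<in> \<F> \<and>
     (\<forall>F\<in>\<F>. LA \<notin> F \<and> F \<noteq> UNIV - {LA} \<and> (F = {LB} \<or> 2 \<le> card F))"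

text \<open>
  The length of the common part of the paths from the root to \<open>i\<close> and to \<open>j\<close>, if \<open>F\<close> has length
  \<open>a F\<close>.
\<close>

definition common_weight :: "('n::finite leaf set \<Rightarrow> real) \<Rightarrow> 'n leaf set set \<Rightarrow> 'n leaf \<Rightarrow> 'n leaf \<Rightarrow> real" where
  "common_weight a \<F> i j = (\<Sum>F\<in>{F \<in> \<F>. i \<in> F \<and> j \<in> F}. a F)"

lemma common_weight_of_bool:
  "common_weight a \<F> i j = (\<Sum>F\<in>\<F>. a F * of_bool (i \<in> F \<and> j \<in> F))"
  unfolding common_weight_def by (intro sum.mono_neutral_cong_left) auto

lemma coordinates_of_combination:
  fixes a :: "'n::finite leaf set \<Rightarrow> real"
  assumes "\<And>F. F \<in> \<F> \<Longrightarrow> LA \<notin> F"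
  defines "x \<equiv> \<Sum>F\<in>\<F>. a F *\<^sub>R ray F" and "c \<equiv> common_weight a \<F>"
  shows "circ x = c LB LB" "offset k l x = c LB (Leg k) - c LB (Leg l)"
    "k \<noteq> l \<Longrightarrow> rdist k l x = c LB (Leg k) + c LB (Leg l) - 2 * c (Leg k) (Leg l)"
proof -
  show "circ x = c LB LB"
    unfolding x_def c_def common_weight_of_bool circ_simps
    by (intro sum.cong) (auto simp: circ_ray assms(1))
  show "offset k l x = c LB (Leg k) - c LB (Leg l)"
    unfolding x_def c_def common_weight_of_bool offset_simps sum_subtractf[symmetric]
    by (intro sum.cong) (auto simp: offset_ray assms(1))
  show "rdist k l x = c LB (Leg k) + c LB (Leg l) - 2 * c (Leg k) (Leg l)" if "k \<noteq> l"
    unfolding x_def c_def common_weight_of_bool rdist_simps sum_distrib_left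
      sum.distrib[symmetric] sum_subtractf[symmetric]
    using that by (intro sum.cong) (auto simp: rdist_ray assms(1))
qed

text \<open>The clusters containing \<open>B\<close> form a chain, and the largest of them is not the whole tree.\<close>

lemma leaf_next_to_root:
  assumes "cluster_family \<F>" obtains l where "\<And>F. F \<in> \<F> \<Longrightarrow> LB \<in> F \<Longrightarrow> Leg l \<notin> F"
proof -
  have lam: "laminar \<F>" using assms by (simp add: cluster_family_def)
  define \<C> where "\<C> = {F \<in> \<F>. LB \<in> F}"
  have "finite \<C>" "\<C> \<noteq> {}" using assms unfolding \<C>_def cluster_family_def by auto
  then obtain M where M: "M \<in> \<C>" "\<And>F. F \<in> \<C> \<Longrightarrow> M \<subseteq> F \<Longrightarrow> M = F"
    using finite_has_maximal[of \<C>] by blast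
  have M': "M \<in> \<F>" "LB \<in> M" using M(1) by (auto simp: \<C>_def)
  have top: "F \<subseteq> M" if "F \<in> \<F>" "LB \<in> F" for F
  proof -
    have "F \<in> \<C>" using that by (simp add: \<C>_def)
    moreover have "F \<subseteq> M \<or> M \<subseteq> F" using laminarD[OF lam that(1) M'(1) that(2) M'(2)] .
    ultimately show ?thesis using M(2) by blast
  qed
  have "LA \<notin> M" "M \<noteq> UNIV - {LA}" using assms M' unfolding cluster_family_def by auto
  then obtain i where i: "i \<notin> M" "i \<noteq> LA" by blast
  then obtain l where "i = Leg l" using M'(2) by (cases i) auto
  then show thesis using that[of l] i top by blast
qed

text \<open>
  Coordinates are differences of common weights; the leaf next to the root, where common weights
  with \<open>B\<close> vanish, allows to recover the common weights themselves.
\<close>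

lemma cluster_coefficients:
  fixes a :: "'n::finite leaf set \<Rightarrow> real"
  assumes \<F>: "cluster_family \<F>"
    and H: "0 \<in> H" "\<And>x y. x \<in> H \<Longrightarrow> y \<in> H \<Longrightarrow> x - y \<in> H"
  defines "x \<equiv> \<Sum>F\<in>\<F>. a F *\<^sub>R ray F"
  assumes x: "circ x \<in> H" "\<And>k l. offset k l x \<in> H" "\<And>k l. half_gap k l x \<in> H"
  shows "F \<in> \<F> \<Longrightarrow> a F \<in> H"
proof -
  have LA: "LA \<notin> F" if "F \<in> \<F>" for F using \<F> that unfolding cluster_family_def by blast
  have lam: "laminar \<F>" using \<F> unfolding cluster_family_def by blast
  define c where "c = common_weight a \<F>"
  have coords: "circ x = c LB LB" "\<And>k l. offset k l x = c LB (Leg k) - c LB (Leg l)"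
    "\<And>k l. k \<noteq> l \<Longrightarrow> rdist k l x = c LB (Leg k) + c LB (Leg l) - 2 * c (Leg k) (Leg l)"
    unfolding x_def c_def using coordinates_of_combination[where \<F> = \<F> and a = a] LA by blast+
  have add: "x + y \<in> H" if "x \<in> H" "y \<in> H" for x y
    using H(2)[OF that(1) H(2)[OF H(1) that(2)]] by simp
  obtain l0 where l0: "\<And>F. F \<in> \<F> \<Longrightarrow> LB \<in> F \<Longrightarrow> Leg l0 \<notin> F" using leaf_next_to_root[OF \<F>] by blast
  have "c LB (Leg l0) = 0" unfolding c_def common_weight_def
    using l0 by (intro sum.neutral) blast
  then have LB: "c LB (Leg k) \<in> H" for k using coords(2)[of k l0] x(2)[of k l0] by simp
  have comm: "c i j = c j i" for i j unfolding c_def common_weight_def by (simp add: conj_commute)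
  have legs: "c (Leg k) (Leg l) \<in> H" if "k \<noteq> l" for k l
  proof -
    have "c (Leg k) (Leg l) = half_gap k l x + c LB (Leg l)"
      unfolding half_gap_def coords(2) coords(3)[OF that] by (simp add: field_simps)
    then show ?thesis using add[OF x(3) LB] by simp
  qed
  have A: "c LA j = 0" for j unfolding c_def common_weight_def using LA by (intro sum.neutral) blast
  have pairs: "c i j \<in> H" if "i \<noteq> j" for i j
    using that LB legs A H(1) comm by (cases i; cases j) (simp_all, (metis comm)+)
  have big: "a F \<in> H" if "F \<in> \<F>" "2 \<le> card F" for F
    by (rule laminar_coefficients[OF lam H _ that])
      (use pairs in \<open>auto simp: c_def common_weight_def\<close>)
  show "a F \<in> H" if F: "F \<in> \<F>"
  proof (cases "2 \<le> card F")
    case False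
    then have "F = {LB}" using \<F> F unfolding cluster_family_def by blast
    have "c LB LB = a {LB} + (\<Sum>F\<in>{F \<in> \<F>. LB \<in> F} - {{LB}}. a F)"
      using F \<open>F = {LB}\<close> unfolding c_def common_weight_def by (simp add: sum.remove)
    moreover have "(\<Sum>F\<in>{F \<in> \<F>. LB \<in> F} - {{LB}}. a F) \<in> H"
    proof -
      have *: "a F \<in> H" if "F \<in> {F \<in> \<F>. LB \<in> F} - {{LB}}" for F
        using big[of F] \<F> that unfolding cluster_family_def by blast
      have "(\<Sum>F\<in>S. a F) \<in> H" if "\<And>F. F \<in> S \<Longrightarrow> a F \<in> H" for S :: "'n leaf set set"
      proof -
        have "finite S" by simp
        then show ?thesis using that by (induction S) (auto simp: H(1) add)
      qed
      then show ?thesis using * by blast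
    qed
    moreover have "c LB LB \<in> H" using x(1) coords(1) by simp
    ultimately show ?thesis using H(2) \<open>F = {LB}\<close> by (metis add_diff_cancel_right')
  qed (use big F in blast)
qed

lemma cluster_rays_independent:
  assumes \<F>: "cluster_family \<F>"
  shows "inj_on ray \<F>" "independent (ray ` \<F>)"
proof -
  have zero: "a F = 0" if "(\<Sum>F\<in>\<F>. a F *\<^sub>R ray F) = 0" "F \<in> \<F>" for a F
  proof -
    have "a F \<in> {0}"
      by (rule cluster_coefficients[OF \<F>, of "{0}" a])
        (use that in \<open>auto simp: circ_simps offset_simps half_gap_simps\<close>)
    then show ?thesis by simp
  qed
  show inj: "inj_on ray \<F>"
  proof (rule inj_onI)
    fix E F assume EF: "E \<in> \<F>" "F \<in> \<F>" "ray E = ray F"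
    show "E = F"
    proof (rule ccontr)
      assume ne: "E \<noteq> F"
      have "(\<Sum>D\<in>\<F>. (of_bool (D = E) - of_bool (D = F)) *\<^sub>R ray D) =
          (\<Sum>D\<in>\<F>. if D = E then ray E else 0) - (\<Sum>D\<in>\<F>. if D = F then ray F else 0)"
        unfolding sum_subtractf[symmetric] by (intro sum.cong) auto
      then have "(\<Sum>D\<in>\<F>. (of_bool (D = E) - of_bool (D = F)) *\<^sub>R ray D) = 0"
        using EF by simp
      from zero[OF this EF(1)] show False using ne by simp
    qed
  qed
  show "independent (ray ` \<F>)"
  proof (subst dependent_finite)
    have "u (ray F) = 0" if "(\<Sum>b\<in>ray ` \<F>. u b *\<^sub>R b) = 0" "F \<in> \<F>" for u F
      using zero[of "\<lambda>F. u (ray F)"] that inj by (simp add: sum.reindex)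
    then show "\<not> (\<exists>u. (\<exists>b\<in>ray ` \<F>. u b \<noteq> 0) \<and> (\<Sum>b\<in>ray ` \<F>. u b *\<^sub>R b) = 0)" by blast
  qed simp
qed

lemma cluster_rays_saturated:
  assumes \<F>: "cluster_family \<F>" shows "Vlat \<inter> span (ray ` \<F>) = int_span (ray ` \<F>)"
proof (intro equalityI subsetI)
  have inj: "inj_on ray \<F>" using cluster_rays_independent(1)[OF \<F>] .
  fix x assume x: "x \<in> Vlat \<inter> span (ray ` \<F>)"
  then obtain u where "x = (\<Sum>b\<in>ray ` \<F>. u b *\<^sub>R b)" using span_finite[of "ray ` \<F>"] by auto
  then have u: "x = (\<Sum>F\<in>\<F>. u (ray F) *\<^sub>R ray F)" using inj by (simp add: sum.reindex)
  have "u (ray F) \<in> \<int>" if "F \<in> \<F>" for F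
    by (rule cluster_coefficients[OF \<F>, of \<int> "\<lambda>F. u (ray F)"])
      (use x that in \<open>auto simp: u[symmetric] VlatD\<close>)
  then have "x = (\<Sum>F\<in>\<F>. of_int \<lfloor>u (ray F)\<rfloor> *\<^sub>R ray F)"
    unfolding u by (intro sum.cong) (auto elim!: Ints_cases)
  then have "x = (\<Sum>b\<in>ray ` \<F>. of_int \<lfloor>u b\<rfloor> *\<^sub>R b)" using inj by (simp add: sum.reindex)
  then show "x \<in> int_span (ray ` \<F>)"
    unfolding int_span_def by (intro CollectI exI[of _ "\<lambda>b. \<lfloor>u b\<rfloor>"]) simp
next
  fix x assume x: "x \<in> int_span (ray ` \<F>)"
  then obtain k :: "_ \<Rightarrow> int" where k: "x = (\<Sum>b\<in>ray ` \<F>. of_int (k b) *\<^sub>R b)"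
    unfolding int_span_def by auto
  have "b \<in> Vlat" if "b \<in> ray ` \<F>" for b
    using that \<F> ray_in_Vlat unfolding cluster_family_def by auto
  then have "x \<in> Vlat" unfolding k by (rule Vlat_sum)
  then show "x \<in> Vlat \<inter> span (ray ` \<F>)" using int_span_subset_span x by blast
qed

section \<open>The simplices of \<open>X\<^sub>n\<close>\<close>

text \<open>
  The translates of the rays of cycle edges under \<open>G\<^sub>n\<close>. Between the leaves \<open>l\<close> and \<open>k\<close> such an edge is
  crossed \<open>offset k l\<close> times, counted with sign.
\<close>

definition cycle_rays :: "'n::finite vn set" where
  "cycle_rays = {v. circ v = 1 \<and> (\<forall>k l. offset k l v \<in> \<int> \<and> rdist k l v = (offset k l v)\<^sup>2)}"

definition tree_ray :: "'n set \<Rightarrow> 'n::finite vn" where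
  "tree_ray S = ray (Leg ` S)"

text \<open>
  The conditions on pairs of rays say for the clusters of a tree: any two clusters containing \<open>B\<close>
  are nested; a cluster without \<open>B\<close> lies on one side of each cluster with \<open>B\<close>; and any two
  clusters without \<open>B\<close> are nested or disjoint. In the first two only differences of offsets
  between cycle rays of the same simplex occur, since the offsets themselves depend on the
  translate.
\<close>

definition simplices :: "'n::finite vn set set" where
  "simplices = {B. finite B \<and> B \<inter> cycle_rays \<noteq> {} \<and>
     (\<forall>v\<in>B. v \<in> cycle_rays \<or> (\<exists>S. 2 \<le> card S \<and> v = tree_ray S)) \<and>
     (\<forall>v\<in>B \<inter> cycle_rays. \<forall>w\<in>B \<inter> cycle_rays. \<forall>k l. \<bar>offset k l v - offset k l w\<bar> \<le> 1) \<and>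
     (\<forall>S. 2 \<le> card S \<longrightarrow> tree_ray S \<in> B \<longrightarrow>
        (\<forall>k\<in>S. \<forall>l\<in>S. \<forall>v\<in>B \<inter> cycle_rays. \<forall>w\<in>B \<inter> cycle_rays. offset k l v = offset k l w)) \<and>
     laminar {S. 2 \<le> card S \<and> tree_ray S \<in> B}}"

lemma simplicesD:
  assumes "B \<in> simplices"
  shows "finite B" "B \<inter> cycle_rays \<noteq> {}" "\<And>v. v \<in> B \<Longrightarrow> v \<in> cycle_rays \<or> (\<exists>S. 2 \<le> card S \<and> v = tree_ray S)"
    "\<And>v w k l. v \<in> B \<Longrightarrow> v \<in> cycle_rays \<Longrightarrow> w \<in> B \<Longrightarrow> w \<in> cycle_rays \<Longrightarrow> \<bar>offset k l v - offset k l w\<bar> \<le> 1"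
    "\<And>S k l v w. 2 \<le> card S \<Longrightarrow> tree_ray S \<in> B \<Longrightarrow> k \<in> S \<Longrightarrow> l \<in> S \<Longrightarrow> v \<in> B \<Longrightarrow> v \<in> cycle_rays \<Longrightarrow>
       w \<in> B \<Longrightarrow> w \<in> cycle_rays \<Longrightarrow> offset k l v = offset k l w"
    "laminar {S. 2 \<le> card S \<and> tree_ray S \<in> B}"
proof -
  note conj = assms[unfolded simplices_def mem_Collect_eq]
  note * = conj[THEN conjunct1]
    conj[THEN conjunct2, THEN conjunct1]
    conj[THEN conjunct2, THEN conjunct2, THEN conjunct1]
    conj[THEN conjunct2, THEN conjunct2, THEN conjunct2, THEN conjunct1]
    conj[THEN conjunct2, THEN conjunct2, THEN conjunct2, THEN conjunct2, THEN conjunct1]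
    conj[THEN conjunct2, THEN conjunct2, THEN conjunct2, THEN conjunct2, THEN conjunct2]
  show "finite B" "B \<inter> cycle_rays \<noteq> {}" "laminar {S. 2 \<le> card S \<and> tree_ray S \<in> B}" by (rule *)+
  show "v \<in> cycle_rays \<or> (\<exists>S. 2 \<le> card S \<and> v = tree_ray S)" if "v \<in> B" for v
    using bspec[OF *(3) that] .
  show "\<bar>offset k l v - offset k l w\<bar> \<le> 1"
    if "v \<in> B" "v \<in> cycle_rays" "w \<in> B" "w \<in> cycle_rays" for v w k l
    using *(4)[rule_format, OF IntI[OF that(1,2)] IntI[OF that(3,4)]] .
  show "offset k l v = offset k l w"
    if "2 \<le> card S" "tree_ray S \<in> B" "k \<in> S" "l \<in> S" "v \<in> B" "v \<in> cycle_rays" "w \<in> B" "w \<in> cycle_rays"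
    for S k l v w
    using *(5)[rule_format, OF that(1-4) IntI[OF that(5,6)] IntI[OF that(7,8)]] .
qed

lemma simplicesI:
  assumes "finite B" "B \<inter> cycle_rays \<noteq> {}" "\<And>v. v \<in> B \<Longrightarrow> v \<in> cycle_rays \<or> (\<exists>S. 2 \<le> card S \<and> v = tree_ray S)"
    "\<And>v w k l. v \<in> B \<Longrightarrow> v \<in> cycle_rays \<Longrightarrow> w \<in> B \<Longrightarrow> w \<in> cycle_rays \<Longrightarrow> \<bar>offset k l v - offset k l w\<bar> \<le> 1"
    "\<And>S k l v w. 2 \<le> card S \<Longrightarrow> tree_ray S \<in> B \<Longrightarrow> k \<in> S \<Longrightarrow> l \<in> S \<Longrightarrow> v \<in> B \<Longrightarrow> v \<in> cycle_rays \<Longrightarrow>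
       w \<in> B \<Longrightarrow> w \<in> cycle_rays \<Longrightarrow> offset k l v = offset k l w"
    "laminar {S. 2 \<le> card S \<and> tree_ray S \<in> B}"
  shows "B \<in> simplices"
  unfolding simplices_def mem_Collect_eq
proof (intro conjI ballI allI impI)
  show "\<bar>offset k l v - offset k l w\<bar> \<le> 1" if "v \<in> B \<inter> cycle_rays" "w \<in> B \<inter> cycle_rays" for v w k l
    using that by (intro assms(4)) auto
  show "offset k l v = offset k l w"
    if "2 \<le> card S" "tree_ray S \<in> B" "k \<in> S" "l \<in> S" "v \<in> B \<inter> cycle_rays" "w \<in> B \<inter> cycle_rays" for S k l v w
    using that(5,6) by (intro assms(5)[OF that(1-4)]) auto
qed (rule assms, assumption?)+

lemma tree_ray_coords:
  "circ (tree_ray S) = 0" "offset k l (tree_ray S) = 0"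
  "rdist k l (tree_ray S) = (if k = l then 0 else - 2 * of_bool (k \<in> S \<and> l \<in> S))"
proof -
  have "LA \<notin> Leg ` S" "LB \<notin> Leg ` S" by auto
  then show "circ (tree_ray S) = 0" "offset k l (tree_ray S) = 0"
    "rdist k l (tree_ray S) = (if k = l then 0 else - 2 * of_bool (k \<in> S \<and> l \<in> S))"
    unfolding tree_ray_def by (auto simp: circ_ray offset_ray rdist_ray image_iff)
qed

lemma tree_ray_not_cycle: "tree_ray S \<notin> cycle_rays"
  by (simp add: cycle_rays_def tree_ray_coords)

lemma tree_ray_inject:
  assumes "2 \<le> card S" "2 \<le> card S'" "tree_ray S = tree_ray S'" shows "S = S'"
proof -
  have "S \<subseteq> S'" if "2 \<le> card S" "tree_ray S = tree_ray S'" for S S' :: "'a set"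
  proof
    fix k assume k: "k \<in> S"
    have "\<not> S \<subseteq> {k}" using that(1) card_mono[of "{k}" S] by auto
    then obtain l where l: "l \<in> S" "l \<noteq> k" by blast
    have "rdist k l (tree_ray S) = rdist k l (tree_ray S')" using that(2) by simp
    then show "k \<in> S'" using k l by (simp add: tree_ray_coords split: if_splits)
  qed
  then show ?thesis using assms by (metis subset_antisym)
qed

lemma ray_cycle:
  assumes "LA \<notin> F" "LB \<in> F" shows "ray F \<in> cycle_rays"
  using assms by (auto simp: cycle_rays_def circ_ray offset_ray rdist_ray)

lemma ray_tree:
  assumes "LA \<notin> F" "LB \<notin> F"
  shows "ray F = tree_ray {k. Leg k \<in> F}" "Leg ` {k. Leg k \<in> F} = F" "card {k. Leg k \<in> F} = card F"
proof -
  show F: "Leg ` {k. Leg k \<in> F} = F"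
  proof (intro equalityI subsetI)
    fix i assume "i \<in> F"
    then show "i \<in> Leg ` {k. Leg k \<in> F}" using assms by (cases i) auto
  qed auto
  then show "ray F = tree_ray {k. Leg k \<in> F}" by (simp add: tree_ray_def)
  have "inj_on Leg {k. Leg k \<in> F}" by (simp add: inj_on_def)
  then show "card {k. Leg k \<in> F} = card F" using card_image F by metis
qed

lemma ray_small_tree:
  assumes "LA \<notin> F" "LB \<notin> F" "\<not> 2 \<le> card F" shows "ray F = 0"
proof (cases "F = {}")
  case False
  then have "card F = 1" using assms(3) by (metis One_nat_def Suc_leI card_gt_0_iff finite le_antisym not_less_eq_eq numeral_2_eq_2)
  then obtain i where "F = {i}" by (metis card_1_singletonE)
  then show ?thesis using assms ray_leg by (cases i) auto
qed (simp add: ray_empty)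

text \<open>
  Clusters with at most one leaf have the ray \<open>0\<close> unless they contain \<open>B\<close>; they are removed.
\<close>

lemma laminar_leaf_sets_simplex:
  fixes \<F> :: "'n::finite leaf set set"
  assumes lam: "laminar \<F>" and LA: "\<And>F. F \<in> \<F> \<Longrightarrow> LA \<notin> F" and LB: "\<exists>F\<in>\<F>. LB \<in> F"
  shows "ray ` \<F> - {0} \<in> simplices"
proof (rule simplicesI)
  have cyc: "\<exists>F\<in>\<F>. LB \<in> F \<and> v = ray F" if v: "v \<in> ray ` \<F> - {0}" "v \<in> cycle_rays" for v
  proof -
    obtain F where F: "F \<in> \<F>" "v = ray F" using v(1) by blast
    have "LB \<in> F"
    proof (rule ccontr)
      assume "LB \<notin> F"
      then show False using ray_tree(1)[of F] LA[OF F(1)] tree_ray_not_cycle v(2) F(2) by metis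
    qed
    then show ?thesis using F by blast
  qed
  have tree: "Leg ` S \<in> \<F>" if S: "2 \<le> card S" "tree_ray S \<in> ray ` \<F> - {0}" for S
  proof -
    obtain F where F: "F \<in> \<F>" "tree_ray S = ray F" "ray F \<noteq> 0" using S(2) by auto
    have "LB \<notin> F" using F(2) ray_cycle[OF LA[OF F(1)]] tree_ray_not_cycle by metis
    note F' = ray_tree[OF LA[OF F(1)] this]
    have "2 \<le> card F" using ray_small_tree[OF LA[OF F(1)] \<open>LB \<notin> F\<close>] F(3) by blast
    then have "S = {k. Leg k \<in> F}" using tree_ray_inject[OF S(1)] F' F(2) by simp
    then show ?thesis using F'(2) F(1) by simp
  qed
  show "finite (ray ` \<F> - {0})" by simp
  show "(ray ` \<F> - {0}) \<inter> cycle_rays \<noteq> {}"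
  proof -
    obtain F where "F \<in> \<F>" "LB \<in> F" using LB by blast
    then have F: "ray F \<in> ray ` \<F>" "ray F \<in> cycle_rays" using ray_cycle LA by auto
    then have "ray F \<noteq> 0" by (auto simp: cycle_rays_def circ_simps)
    then show ?thesis using F by blast
  qed
  show "v \<in> cycle_rays \<or> (\<exists>S. 2 \<le> card S \<and> v = tree_ray S)" if v: "v \<in> ray ` \<F> - {0}" for v
  proof -
    obtain F where F: "F \<in> \<F>" "v = ray F" "ray F \<noteq> 0" using v by auto
    show ?thesis
    proof (cases "LB \<in> F")
      case True
      then show ?thesis using ray_cycle[OF LA[OF F(1)]] F(2) by simp
    next
      case False
      have "2 \<le> card F" using ray_small_tree[OF LA[OF F(1)] False] F(3) by blast
      then show ?thesis using ray_tree(1,3)[OF LA[OF F(1)] False] F(2) by metis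
    qed
  qed
  show "\<bar>offset k l v - offset k l w\<bar> \<le> 1"
    if vw: "v \<in> ray ` \<F> - {0}" "v \<in> cycle_rays" "w \<in> ray ` \<F> - {0}" "w \<in> cycle_rays" for v w k l
  proof -
    obtain E where E: "E \<in> \<F>" "LB \<in> E" "v = ray E" using cyc[OF vw(1,2)] by blast
    obtain F where F: "F \<in> \<F>" "LB \<in> F" "w = ray F" using cyc[OF vw(3,4)] by blast
    have "E \<subseteq> F \<or> F \<subseteq> E" using laminarD[OF lam E(1) F(1) E(2) F(2)] .
    then show ?thesis using E F LA[OF E(1)] LA[OF F(1)] by (auto simp: offset_ray)
  qed
  show "offset k l v = offset k l w"
    if "2 \<le> card S" "tree_ray S \<in> ray ` \<F> - {0}" and kl: "k \<in> S" "l \<in> S"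
      and "v \<in> ray ` \<F> - {0}" "v \<in> cycle_rays" "w \<in> ray ` \<F> - {0}" "w \<in> cycle_rays" for S k l v w
  proof -
    have S: "Leg ` S \<in> \<F>" using tree that(1,2) by blast
    have "offset k l u = 0" if u: "u \<in> ray ` \<F> - {0}" "u \<in> cycle_rays" for u
    proof -
      obtain E where E: "E \<in> \<F>" "LB \<in> E" "u = ray E" using cyc[OF u] by blast
      have "LB \<notin> Leg ` S" by auto
      moreover have "Leg ` S \<inter> E = {} \<or> Leg ` S \<subseteq> E \<or> E \<subseteq> Leg ` S"
        using laminar_cases[OF lam S E(1)] .
      ultimately have "Leg ` S \<inter> E = {} \<or> Leg ` S \<subseteq> E" using E(2) by blast
      then have "Leg k \<in> E \<longleftrightarrow> Leg l \<in> E" using kl by blast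
      then show ?thesis using E LA[OF E(1)] by (simp add: offset_ray)
    qed
    then show ?thesis using that by simp
  qed
  show "laminar {S. 2 \<le> card S \<and> tree_ray S \<in> ray ` \<F> - {0}}"
    unfolding laminar_def
  proof (intro ballI)
    fix S S' assume "S \<in> {S. 2 \<le> card S \<and> tree_ray S \<in> ray ` \<F> - {0}}"
      "S' \<in> {S. 2 \<le> card S \<and> tree_ray S \<in> ray ` \<F> - {0}}"
    then have "Leg ` S \<in> \<F>" "Leg ` S' \<in> \<F>" using tree by blast+
    then have "Leg ` S \<inter> Leg ` S' = {} \<or> Leg ` S \<subseteq> Leg ` S' \<or> Leg ` S' \<subseteq> Leg ` S"
      by (rule laminar_cases[OF lam])
    then show "S \<inter> S' = {} \<or> S \<subseteq> S' \<or> S' \<subseteq> S" by (auto simp: inj_image_subset_iff inj_def)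
  qed
qed

lemma cluster_family_simplex:
  assumes \<F>: "cluster_family \<F>" shows "ray ` \<F> \<in> simplices"
proof -
  have "0 \<notin> ray ` \<F>" using cluster_rays_independent(2)[OF \<F>] dependent_zero by blast
  then have "ray ` \<F> - {0} = ray ` \<F>" by blast
  moreover have "ray ` \<F> - {0} \<in> simplices"
    using \<F> unfolding cluster_family_def by (intro laminar_leaf_sets_simplex) auto
  ultimately show ?thesis by simp
qed

lemma cycle_raysD:
  assumes "v \<in> cycle_rays"
  shows "circ v = 1" "offset k l v \<in> \<int>" "rdist k l v = (offset k l v)\<^sup>2"
  using assms by (auto simp: cycle_rays_def)

lemma LB_not_full: "{LB} \<noteq> UNIV - {LA :: 'n leaf}"
proof -
  have "Leg undefined \<in> UNIV - {LA :: 'n leaf}" "Leg undefined \<notin> {LB :: 'n leaf}" by auto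
  then show ?thesis by blast
qed

text \<open>
  The set \<open>F\<close> consists of \<open>B\<close> and of the leaves on the same side of the edge as \<open>B\<close>: these have
  offset \<open>1\<close> relative to a leaf \<open>l0\<close> on the other side. If all offsets vanish, then \<open>F = {B}\<close>.
\<close>

lemma cycle_ray_offset_01:
  assumes v: "v \<in> cycle_rays" and small: "\<And>k l. \<bar>offset k l v\<bar> \<le> 1"
  obtains F where "LA \<notin> F" "LB \<in> F" "F = {LB} \<or> 2 \<le> card F" "F \<noteq> UNIV - {LA}" "v = ray F"
proof (cases "\<exists>k l. offset k l v > 0")
  case False
  have "offset k l v = 0" for k l
  proof -
    have "offset k l v \<le> 0" "offset l k v \<le> 0" using False by (auto simp: not_less)
    then show ?thesis using offset_diff[of k l v k] by simp
  qed
  then have "v = ray {LB}" using v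
    by (intro vn_eqI) (simp_all add: cycle_rays_def circ_ray offset_ray rdist_ray)
  then show thesis using that[of "{LB}"] LB_not_full by simp
next
  case True
  have int: "offset k l v = -1 \<or> offset k l v = 0 \<or> offset k l v = 1" for k l
  proof -
    obtain z where z: "offset k l v = of_int z" using cycle_raysD(2)[OF v] Ints_cases by blast
    have "\<bar>z\<bar> \<le> 1" using small[of k l] z by linarith
    then show ?thesis using z by auto
  qed
  obtain k0 l0 where "offset k0 l0 v > 0" using True by blast
  then have k0: "offset k0 l0 v = 1" using int[of k0 l0] by auto
  define F where "F = insert LB {Leg k | k. offset k l0 v = 1}"
  have nonneg: "offset k l0 v = 0 \<or> offset k l0 v = 1" for k
    using int[of k l0] int[of k0 k] k0 offset_diff[of k0 k v l0] by auto
  have mem: "Leg k \<in> F \<longleftrightarrow> offset k l0 v = 1" "LB \<in> F" "LA \<notin> F" for k by (auto simp: F_def)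
  have "v = ray F"
  proof (rule vn_eqI)
    show "circ v = circ (ray F)" using v mem by (simp add: cycle_rays_def circ_ray)
    have off: "offset k l v = offset k l (ray F)" for k l
    proof -
      have "offset k l (ray F) = of_bool (Leg k \<in> F) - of_bool (Leg l \<in> F)"
        unfolding offset_ray[OF mem(3)] using mem(2) by simp
      also have "\<dots> = offset k l0 v - offset l l0 v"
        unfolding mem(1) using nonneg[of k] nonneg[of l] by auto
      also have "\<dots> = offset k l v" by (rule offset_diff[symmetric])
      finally show ?thesis ..
    qed
    then show "offset k l v = offset k l (ray F)" for k l .
    show "rdist k l v = rdist k l (ray F)" for k l
      using cycle_raysD(3)[OF v] cycle_raysD(3)[OF ray_cycle[OF mem(3,2)]] off[of k l] by simp
  qed
  moreover have "Leg l0 \<notin> F" by (simp add: mem)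
  then have "F \<noteq> UNIV - {LA}" by auto
  moreover have "2 \<le> card F"
  proof -
    have "{LB, Leg k0} \<subseteq> F" using mem k0 by auto
    then have "card {LB, Leg k0} \<le> card F" by (intro card_mono) auto
    then show ?thesis by simp
  qed
  ultimately show thesis using that[of F] mem by blast
qed

text \<open>
  All offsets of \<open>ray {B}\<close> vanish, so the other cycle rays of the simplex have offsets of
  absolute value at most one and are therefore rays of clusters.
\<close>

lemma simplex_cluster_family:
  assumes B: "B \<in> simplices" and o: "ray {LB} \<in> B"
  shows "\<exists>\<F>. cluster_family \<F> \<and> B = ray ` \<F>"
proof -
  define \<F> where "\<F> = {F. LA \<notin> F \<and> F \<noteq> UNIV - {LA} \<and> (F = {LB} \<or> 2 \<le> card F) \<and> ray F \<in> B}"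
  have o': "ray {LB} \<in> cycle_rays" by (rule ray_cycle) auto
  note LBne = LB_not_full
  have "laminar \<F>" unfolding laminar_def
  proof (intro ballI)
    fix E F assume E: "E \<in> \<F>" and F: "F \<in> \<F>"
    have cc: "E \<inter> F = {} \<or> E \<subseteq> F \<or> F \<subseteq> E" if EF: "E \<in> \<F>" "F \<in> \<F>" "LB \<in> E" "LB \<in> F" for E F
    proof (rule ccontr)
      assume "\<not> ?thesis"
      then obtain i j where ij: "i \<in> E" "i \<notin> F" "j \<in> F" "j \<notin> E" by blast
      have LA: "LA \<notin> E" "LA \<notin> F" using EF by (auto simp: \<F>_def)
      obtain k l where kl: "i = Leg k" "j = Leg l"
        using ij EF(3,4) LA by (cases i; cases j) auto
      have "offset k l (ray E) = 1" "offset k l (ray F) = - 1"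
        using ij kl LA EF(3,4) by (auto simp: offset_ray)
      moreover have "\<bar>offset k l (ray E) - offset k l (ray F)\<bar> \<le> 1"
      proof -
        have "ray E \<in> B" "ray F \<in> B" using EF by (auto simp: \<F>_def)
        then show ?thesis
          using simplicesD(4)[OF B _ ray_cycle[OF LA(1) EF(3)] _ ray_cycle[OF LA(2) EF(4)]] by blast
      qed
      ultimately show False by simp
    qed
    have ct: "E \<inter> F = {} \<or> E \<subseteq> F \<or> F \<subseteq> E" if EF: "E \<in> \<F>" "F \<in> \<F>" "LB \<in> E" "LB \<notin> F" for E F
    proof -
      have LA: "LA \<notin> E" "LA \<notin> F" using EF by (auto simp: \<F>_def)
      define S where "S = {k. Leg k \<in> F}"
      have S: "ray F = tree_ray S" "Leg ` S = F" "card S = card F"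
        using ray_tree[OF LA(2) EF(4)] by (auto simp: S_def)
      have S2: "2 \<le> card S" "tree_ray S \<in> B" using EF S unfolding \<F>_def by auto
      have EB: "ray E \<in> B" using EF(1) by (simp add: \<F>_def)
      have "offset k l (ray E) = offset k l (ray {LB})" if "k \<in> S" "l \<in> S" for k l
        using simplicesD(5)[OF B S2 that EB ray_cycle[OF LA(1) EF(3)] o o'] .
      then have "Leg k \<in> E \<longleftrightarrow> Leg l \<in> E" if "k \<in> S" "l \<in> S" for k l
        using that LA(1) EF(3) by (fastforce simp: offset_ray split: if_splits)
      then have "F \<subseteq> E \<or> E \<inter> F = {}" unfolding S(2)[symmetric] by blast
      then show ?thesis by blast
    qed
    show "E \<inter> F = {} \<or> E \<subseteq> F \<or> F \<subseteq> E"
    proof -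
      consider "LB \<in> E" "LB \<in> F" | "LB \<in> E" "LB \<notin> F" | "LB \<notin> E" "LB \<in> F" | "LB \<notin> E" "LB \<notin> F"
        by blast
      then show ?thesis
      proof cases
        case 1 then show ?thesis by (rule cc[OF E F])
      next
        case 2 then show ?thesis by (rule ct[OF E F])
      next
        case 3
        have "F \<inter> E = {} \<or> F \<subseteq> E \<or> E \<subseteq> F" by (rule ct[OF F E 3(2,1)])
        then show ?thesis by blast
      next
        case LB: 4
        have LA: "LA \<notin> E" "LA \<notin> F" using E F by (auto simp: \<F>_def)
        define S S' where "S = {k. Leg k \<in> E}" and "S' = {k. Leg k \<in> F}"
        note SE = ray_tree[OF LA(1) LB(1), folded S_def] and SF = ray_tree[OF LA(2) LB(2), folded S'_def]
        have "E \<noteq> {LB}" "F \<noteq> {LB}" using LB by auto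
        then have "S \<in> {S. 2 \<le> card S \<and> tree_ray S \<in> B}" "S' \<in> {S. 2 \<le> card S \<and> tree_ray S \<in> B}"
          using SE(1,3) SF(1,3) E F by (simp_all add: \<F>_def)
        then have "S \<inter> S' = {} \<or> S \<subseteq> S' \<or> S' \<subseteq> S"
          by (rule laminar_cases[OF simplicesD(6)[OF B]])
        then have "Leg ` S \<inter> Leg ` S' = {} \<or> Leg ` S \<subseteq> Leg ` S' \<or> Leg ` S' \<subseteq> Leg ` S" by auto
        then show ?thesis unfolding SE(2) SF(2) .
      qed
    qed
  qed
  moreover have "{LB} \<in> \<F>" using o LBne by (simp add: \<F>_def)
  ultimately have fam: "cluster_family \<F>" unfolding cluster_family_def by (auto simp: \<F>_def)
  have "B \<subseteq> ray ` \<F>"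
  proof
    fix v assume v: "v \<in> B"
    show "v \<in> ray ` \<F>"
    proof (cases "v \<in> cycle_rays")
      case True
      have "\<bar>offset k l v\<bar> \<le> 1" for k l
        using simplicesD(4)[OF B v True o o', of k l] by (simp add: offset_ray)
      then obtain F where "LA \<notin> F" "F = {LB} \<or> 2 \<le> card F" "F \<noteq> UNIV - {LA}" "v = ray F"
        using cycle_ray_offset_01[OF True] by metis
      then show ?thesis using v by (intro image_eqI[of _ _ F]) (auto simp: \<F>_def)
    next
      case False
      then obtain S where S: "2 \<le> card S" "v = tree_ray S" using simplicesD(3)[OF B v] by blast
      have "card (Leg ` S) = card S" by (intro card_image) (simp add: inj_on_def)
      moreover have "Leg ` S \<noteq> UNIV - {LA}" by auto
      ultimately have "Leg ` S \<in> \<F>" using S v by (auto simp: \<F>_def tree_ray_def)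
      then show ?thesis using S(2) by (simp add: tree_ray_def)
    qed
  qed
  moreover have "ray ` \<F> \<subseteq> B" by (auto simp: \<F>_def)
  ultimately show ?thesis using fam by blast
qed

section \<open>Translating simplices\<close>

lemma acts_as_tree_ray: "acts_as g \<epsilon> a \<Longrightarrow> g (tree_ray S) = tree_ray S"
  by (rule vn_eqI) (simp_all add: acts_asD(2-4) tree_ray_coords)

lemma acts_as_cycle_rays:
  assumes g: "acts_as g \<epsilon> a" and v: "v \<in> cycle_rays" shows "g v \<in> cycle_rays"
proof -
  have \<epsilon>: "\<epsilon> = 1 \<or> \<epsilon> = - 1" using acts_asD(1)[OF g] .
  have "offset k l (g v) \<in> \<int>" for k l
    unfolding acts_asD(3)[OF g] cycle_raysD(1)[OF v] using \<epsilon> cycle_raysD(2)[OF v, of k l] by auto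
  moreover have "rdist k l (g v) = (offset k l (g v))\<^sup>2" for k l
    unfolding acts_asD(3,4)[OF g] cycle_raysD(1,3)[OF v] using \<epsilon>
    by (auto simp: power2_eq_square algebra_simps)
  ultimately show ?thesis using acts_asD(2)[OF g] cycle_raysD(1)[OF v] by (simp add: cycle_rays_def)
qed

text \<open>
  The group fixes the rays of trees, and it changes the offsets of all cycle rays of a simplex by
  the same sign and the same integers.
\<close>

lemma simplex_image:
  assumes g: "g \<in> carrier Gn" and B: "B \<in> simplices" shows "g ` B \<in> simplices"
proof -
  obtain h where h: "h \<in> carrier Gn" "\<And>x. h (g x) = x" "\<And>x. g (h x) = x"
    using subgroup_BijGroup_inverse[OF subgroup_Gn g] by blast
  obtain \<epsilon> a where ga: "acts_as g \<epsilon> a" using acts_as_Gn[OF g] by blast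
  obtain \<delta> b where hb: "acts_as h \<delta> b" using acts_as_Gn[OF h(1)] by blast
  have cyc: "\<exists>u\<in>B. u \<in> cycle_rays \<and> v = g u" if v: "v \<in> g ` B" "v \<in> cycle_rays" for v
  proof -
    obtain u where u: "u \<in> B" "v = g u" using v(1) by blast
    have "h v \<in> cycle_rays" using acts_as_cycle_rays[OF hb v(2)] .
    then show ?thesis using u h(2) by auto
  qed
  have tree: "tree_ray S \<in> g ` B \<longleftrightarrow> tree_ray S \<in> B" for S
  proof
    assume "tree_ray S \<in> g ` B"
    then obtain u where u: "u \<in> B" "tree_ray S = g u" by blast
    then have "u = h (tree_ray S)" using h(2) by simp
    then show "tree_ray S \<in> B" using u(1) acts_as_tree_ray[OF hb] by simp
  next
    assume "tree_ray S \<in> B"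
    then show "tree_ray S \<in> g ` B" using acts_as_tree_ray[OF ga] by (metis image_eqI)
  qed
  have off: "\<bar>offset k l (g u) - offset k l (g w)\<bar> = \<bar>offset k l u - offset k l w\<bar>"
    if "u \<in> cycle_rays" "w \<in> cycle_rays" for u w k l
    unfolding acts_asD(3)[OF ga] cycle_raysD(1)[OF that(1)] cycle_raysD(1)[OF that(2)]
    using acts_asD(1)[OF ga] by auto
  show ?thesis
  proof (rule simplicesI)
    show "finite (g ` B)" using simplicesD(1)[OF B] by simp
    show "(g ` B) \<inter> cycle_rays \<noteq> {}" using simplicesD(2)[OF B] acts_as_cycle_rays[OF ga] by blast
    show "v \<in> cycle_rays \<or> (\<exists>S. 2 \<le> card S \<and> v = tree_ray S)" if v: "v \<in> g ` B" for v
    proof -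
      obtain u where u: "u \<in> B" "v = g u" using v by blast
      then show ?thesis
        using simplicesD(3)[OF B u(1)] acts_as_cycle_rays[OF ga] acts_as_tree_ray[OF ga] by metis
    qed
    show "\<bar>offset k l v - offset k l w\<bar> \<le> 1"
      if vw: "v \<in> g ` B" "v \<in> cycle_rays" "w \<in> g ` B" "w \<in> cycle_rays" for v w k l
    proof -
      obtain u where u: "u \<in> B" "u \<in> cycle_rays" "v = g u" using cyc[OF vw(1,2)] by blast
      obtain u' where u': "u' \<in> B" "u' \<in> cycle_rays" "w = g u'" using cyc[OF vw(3,4)] by blast
      show ?thesis unfolding u(3) u'(3) off[OF u(2) u'(2)] by (rule simplicesD(4)[OF B u(1,2) u'(1,2)])
    qed
    show "offset k l v = offset k l w"
      if S: "2 \<le> card S" "tree_ray S \<in> g ` B" "k \<in> S" "l \<in> S"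
        and vw: "v \<in> g ` B" "v \<in> cycle_rays" "w \<in> g ` B" "w \<in> cycle_rays" for S k l v w
    proof -
      obtain u where u: "u \<in> B" "u \<in> cycle_rays" "v = g u" using cyc[OF vw(1,2)] by blast
      obtain u' where u': "u' \<in> B" "u' \<in> cycle_rays" "w = g u'" using cyc[OF vw(3,4)] by blast
      have SB: "tree_ray S \<in> B" using S(2) tree by blast
      have "offset k l u = offset k l u'" by (rule simplicesD(5)[OF B S(1) SB S(3,4) u(1,2) u'(1,2)])
      then show ?thesis using off[OF u(2) u'(2), of k l] u(3) u'(3) by simp
    qed
    show "laminar {S. 2 \<le> card S \<and> tree_ray S \<in> g ` B}" unfolding tree by (rule simplicesD(6)[OF B])
  qed
qed

text \<open>The offsets of the ray relative to a base leaf are the winding numbers to be undone.\<close>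

lemma translate_cycle_ray:
  assumes v: "v \<in> cycle_rays" shows "\<exists>g\<in>carrier Gn. g v = ray {LB}"
proof -
  define m0 :: 'a where "m0 = undefined"
  define a where "a k = \<lfloor>offset k m0 v\<rfloor>" for k
  have a: "of_int (a k) = offset k m0 v" for k
    using cycle_raysD(2)[OF v, of k m0] by (auto simp: a_def elim!: Ints_cases)
  have diff: "of_int (a k - a l) = offset k l v" for k l
    using a[of k] a[of l] offset_diff[of k l v m0] by simp
  obtain g where g: "g \<in> carrier Gn" "acts_as g 1 a" using translation_in_Gn by blast
  have "g v = ray {LB}"
    by (rule vn_eqI)
      (simp_all only: acts_asD(2-4)[OF g(2)] diff cycle_raysD(1,3)[OF v],
        simp_all add: circ_ray offset_ray rdist_ray power2_eq_square)
  then show ?thesis using g(1) by blast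
qed

text \<open>Up to the group, every simplex comes from a tree, in which a chosen cycle edge is next to \<open>B\<close>.\<close>

lemma simplex_normal_form:
  assumes B: "B \<in> simplices" and v: "v \<in> B" "v \<in> cycle_rays"
  obtains g h \<F> where "g \<in> carrier Gn" "g v = ray {LB}" "h \<in> carrier Gn" "\<And>x. h (g x) = x" "\<And>x. g (h x) = x"
    "cluster_family \<F>" "g ` B = ray ` \<F>" "B = h ` ray ` \<F>"
proof -
  obtain g where g: "g \<in> carrier Gn" "g v = ray {LB}" using translate_cycle_ray[OF v(2)] by blast
  obtain h where h: "h \<in> carrier Gn" "\<And>x. h (g x) = x" "\<And>x. g (h x) = x"
    using subgroup_BijGroup_inverse[OF subgroup_Gn g(1)] by blast
  have "ray {LB} \<in> g ` B" using g(2) v(1) by (metis image_eqI)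
  then obtain \<F> where \<F>: "cluster_family \<F>" "g ` B = ray ` \<F>"
    using simplex_cluster_family[OF simplex_image[OF g(1) B]] by blast
  have "h ` g ` B = B" using h(2) by (simp add: image_image)
  then show thesis using that[OF g h \<F>] \<F>(2) by simp
qed

lemma linear_Gn: "g \<in> carrier Gn \<Longrightarrow> linear g"
  using acts_as_Gn acts_as_linear by blast

lemma inj_Gn: assumes "g \<in> carrier Gn" shows "inj g"
proof -
  obtain h where "h \<in> carrier Gn" "\<And>x. h (g x) = x" "\<And>x. g (h x) = x"
    using subgroup_BijGroup_inverse[OF subgroup_Gn assms] by blast
  then show ?thesis by (metis injI)
qed

lemma simplex_independent:
  assumes B: "B \<in> simplices" shows "independent B"
proof -
  obtain v where v: "v \<in> B" "v \<in> cycle_rays" using simplicesD(2)[OF B] by blast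
  obtain h :: "'a vn \<Rightarrow> 'a vn" and \<F> where h: "h \<in> carrier Gn" "cluster_family \<F>" "B = h ` ray ` \<F>"
    using simplex_normal_form[OF B v] by metis
  show ?thesis unfolding h(3)
    using linear_independent_injective_image[OF linear_Gn[OF h(1)] cluster_rays_independent(2)[OF h(2)]]
      inj_on_subset[OF inj_Gn[OF h(1)] subset_UNIV] by blast
qed

lemma image_Vlat:
  assumes g: "g \<in> carrier Gn" shows "g ` Vlat = Vlat"
proof -
  obtain h where h: "h \<in> carrier Gn" "\<And>x. h (g x) = x" "\<And>x. g (h x) = x"
    using subgroup_BijGroup_inverse[OF subgroup_Gn g] by blast
  have "f ` Vlat \<subseteq> Vlat" if "f \<in> carrier Gn" for f :: "'a vn \<Rightarrow> 'a vn"
    using acts_as_Gn[OF that] acts_as_Vlat by blast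
  from this[OF g] this[OF h(1)] show ?thesis using h(3) by (metis image_eqI image_subset_iff subsetI subset_antisym)
qed

lemma simplex_saturated:
  assumes B: "B \<in> simplices" shows "Vlat \<inter> span B = int_span B"
proof -
  obtain v where v: "v \<in> B" "v \<in> cycle_rays" using simplicesD(2)[OF B] by blast
  obtain h :: "'a vn \<Rightarrow> 'a vn" and \<F> where h: "h \<in> carrier Gn" "cluster_family \<F>" "B = h ` ray ` \<F>"
    using simplex_normal_form[OF B v] by metis
  have lin: "linear h" "inj h" using linear_Gn[OF h(1)] inj_Gn[OF h(1)] by auto
  have "Vlat \<inter> span B = h ` Vlat \<inter> h ` span (ray ` \<F>)"
    unfolding h(3) image_Vlat[OF h(1)] linear_span_image[OF lin(1)] ..
  also have "\<dots> = h ` (Vlat \<inter> span (ray ` \<F>))" using image_Int[OF lin(2)] by simp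
  also have "\<dots> = int_span B"
    unfolding cluster_rays_saturated[OF h(2)] h(3)
    using int_span_image[OF lin(1)] lin(2) inj_on_subset by blast
  finally show ?thesis .
qed

section \<open>Cones with a common interior point\<close>

lemma coordinates_of_simplex_combination:
  fixes c :: "'n::finite vn \<Rightarrow> real"
  assumes B: "B \<in> simplices"
  defines "x \<equiv> \<Sum>b\<in>B. c b *\<^sub>R b" and "R \<equiv> B \<inter> cycle_rays"
  shows "circ x = (\<Sum>b\<in>R. c b)" "offset k l x = (\<Sum>b\<in>R. c b * offset k l b)"
    "k \<noteq> l \<Longrightarrow> rdist k l x = (\<Sum>b\<in>R. c b * (offset k l b)\<^sup>2)
       - 2 * (\<Sum>S\<in>{S. 2 \<le> card S \<and> tree_ray S \<in> B \<and> k \<in> S \<and> l \<in> S}. c (tree_ray S))"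
proof -
  define T where "T = {S. 2 \<le> card S \<and> tree_ray S \<in> B}"
  have R: "finite R" "\<And>b. b \<in> R \<Longrightarrow> b \<in> cycle_rays" using simplicesD(1)[OF B] by (auto simp: R_def)
  have split: "B = R \<union> tree_ray ` T" "R \<inter> tree_ray ` T = {}" "inj_on tree_ray T"
  proof -
    show "B = R \<union> tree_ray ` T"
    proof (intro equalityI subsetI)
      fix b assume b: "b \<in> B"
      then consider "b \<in> cycle_rays" | S where "2 \<le> card S" "b = tree_ray S"
        using simplicesD(3)[OF B b] by blast
      then show "b \<in> R \<union> tree_ray ` T" by cases (use b in \<open>auto simp: R_def T_def\<close>)
    qed (auto simp: R_def T_def)
    show "R \<inter> tree_ray ` T = {}" using R(2) tree_ray_not_cycle by blast
    show "inj_on tree_ray T" by (rule inj_onI) (auto simp: T_def dest: tree_ray_inject)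
  qed
  have sum: "(\<Sum>b\<in>B. f b) = (\<Sum>b\<in>R. f b) + (\<Sum>S\<in>T. f (tree_ray S))" for f :: "'n vn \<Rightarrow> real"
  proof -
    have "(\<Sum>b\<in>B. f b) = (\<Sum>b\<in>R. f b) + (\<Sum>b\<in>tree_ray ` T. f b)"
      using split(1,2) R(1) by (simp add: sum.union_disjoint)
    then show ?thesis using split(3) by (simp add: sum.reindex)
  qed
  show "circ x = (\<Sum>b\<in>R. c b)"
    unfolding x_def circ_simps sum using R(2) by (simp add: tree_ray_coords cycle_raysD(1))
  show "offset k l x = (\<Sum>b\<in>R. c b * offset k l b)"
    unfolding x_def offset_simps sum by (simp add: tree_ray_coords)
  assume kl: "k \<noteq> l"
  have "(\<Sum>S\<in>T. c (tree_ray S) * rdist k l (tree_ray S)) =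
      (\<Sum>S\<in>{S. 2 \<le> card S \<and> tree_ray S \<in> B \<and> k \<in> S \<and> l \<in> S}. c (tree_ray S) * (- 2))"
    using kl by (intro sum.mono_neutral_cong_right) (auto simp: T_def tree_ray_coords)
  also have "\<dots> = - 2 * (\<Sum>S\<in>{S. 2 \<le> card S \<and> tree_ray S \<in> B \<and> k \<in> S \<and> l \<in> S}. c (tree_ray S))"
    by (simp add: sum_distrib_left mult.commute)
  finally show "rdist k l x = (\<Sum>b\<in>R. c b * (offset k l b)\<^sup>2)
       - 2 * (\<Sum>S\<in>{S. 2 \<le> card S \<and> tree_ray S \<in> B \<and> k \<in> S \<and> l \<in> S}. c (tree_ray S))"
    unfolding x_def rdist_simps sum using R(2) by (simp add: cycle_raysD(3))
qed

text \<open>The common part of the ways of \<open>k\<close> and \<open>l\<close> to the cycle.\<close>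

definition shared :: "'n::finite vn set \<Rightarrow> ('n vn \<Rightarrow> real) \<Rightarrow> 'n \<Rightarrow> 'n \<Rightarrow> real" where
  "shared D a k l = (\<Sum>S\<in>{S. 2 \<le> card S \<and> tree_ray S \<in> D \<and> k \<in> S \<and> l \<in> S}. a (tree_ray S))"

text \<open>
  The positive coefficients make \<open>offset k l x / circ x\<close> a proper average of the offsets of the
  cycle rays of \<open>B\<close>, and likewise of \<open>B'\<close>. All comparisons between the two simplices rest on this.
\<close>

locale common_point =
  fixes B B' :: "'n::finite vn set" and c c' :: "'n vn \<Rightarrow> real" and x :: "'n vn"
  assumes B: "B \<in> simplices" "\<And>b. b \<in> B \<Longrightarrow> 0 < c b" "x = (\<Sum>b\<in>B. c b *\<^sub>R b)"
    and B': "B' \<in> simplices" "\<And>b. b \<in> B' \<Longrightarrow> 0 < c' b" "x = (\<Sum>b\<in>B'. c' b *\<^sub>R b)"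
begin

lemma swap: "common_point B' B c' c x"
  using B B' by unfold_locales

lemma offset_sum: "offset k l x - q * circ x = (\<Sum>b\<in>B \<inter> cycle_rays. c b * (offset k l b - q))"
  unfolding B(3) coordinates_of_simplex_combination(1,2)[OF B(1)]
  by (simp add: sum_subtractf sum_distrib_left algebra_simps)

lemma offset_average_less:
  assumes "\<And>b. b \<in> B \<Longrightarrow> b \<in> cycle_rays \<Longrightarrow> q \<le> offset k l b" "v \<in> B" "v \<in> cycle_rays" "q < offset k l v"
  shows "q * circ x < offset k l x"
proof -
  have "0 < (\<Sum>b\<in>B \<inter> cycle_rays. c b * (offset k l b - q))"
  proof (rule sum_pos2[of _ v])
    show "0 < c v * (offset k l v - q)" using assms(2,4) B(2) by simp
    show "0 \<le> c b * (offset k l b - q)" if "b \<in> B \<inter> cycle_rays" for b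
      using assms(1)[of b] B(2)[of b] that by (simp add: mult_nonneg_nonneg less_imp_le)
  qed (use assms simplicesD(1)[OF B(1)] in auto)
  then show ?thesis using offset_sum[of k l q] by simp
qed

lemma offset_swap: "offset k l y = - offset l k y"
  using offset_diff[of k l y k] by simp

lemma circ_pos: "0 < circ x"
proof -
  obtain v where "v \<in> B \<inter> cycle_rays" using simplicesD(2)[OF B(1)] by blast
  then show ?thesis unfolding B(3) coordinates_of_simplex_combination(1)[OF B(1)]
    using B(2) simplicesD(1)[OF B(1)] by (intro sum_pos2[of _ v]) (auto intro: less_imp_le)
qed

text \<open>
  The offset of \<open>v\<close> exceeds the average by less than one, since the offsets in \<open>B\<close> differ by at
  most one; similarly for \<open>w\<close> in \<open>B'\<close>. So the difference is an integer less than two.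
\<close>

lemma offset_close_le:
  assumes v: "v \<in> B" "v \<in> cycle_rays" and w: "w \<in> B'" "w \<in> cycle_rays"
  shows "offset k l v - offset k l w \<le> 1"
proof -
  interpret s: common_point B' B c' c x by (rule swap)
  have "(offset k l v - 1) * circ x < offset k l x"
    using simplicesD(4)[OF B(1) v, of _ k l] v by (intro offset_average_less[of _ k l v]) force+
  moreover have "(offset l k w - 1) * circ x < offset l k x"
    using simplicesD(4)[OF B'(1) w, of _ l k] w by (intro s.offset_average_less[of _ l k w]) force+
  ultimately have "(offset k l v - 1) * circ x + (- offset k l w - 1) * circ x < 0"
    using offset_swap[of l k w] offset_swap[of l k x] by simp
  then have "(offset k l v - offset k l w - 2) * circ x < 0" by (simp add: algebra_simps)
  then have "offset k l v - offset k l w < 2" using circ_pos by (simp add: mult_less_0_iff)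
  moreover obtain i j :: int where ij: "offset k l v = of_int i" "offset k l w = of_int j"
    using cycle_raysD(2)[OF v(2)] cycle_raysD(2)[OF w(2)] Ints_cases by metis
  ultimately have "real_of_int (i - j) < real_of_int 2" by simp
  then have "i - j \<le> 1" unfolding of_int_less_iff by linarith
  then have "real_of_int (i - j) \<le> real_of_int 1" by (simp only: of_int_le_iff)
  then show ?thesis using ij by simp
qed

lemma offset_close:
  assumes "v \<in> B \<union> B'" "v \<in> cycle_rays" "w \<in> B \<union> B'" "w \<in> cycle_rays"
  shows "\<bar>offset k l v - offset k l w\<bar> \<le> 1"
proof -
  have *: "\<bar>offset k l v - offset k l w\<bar> \<le> 1"
    if vw: "v \<in> B" "v \<in> cycle_rays" "w \<in> B'" "w \<in> cycle_rays" for v w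
    using offset_close_le[OF vw, of k l] offset_close_le[OF vw, of l k] offset_swap[of l k v] offset_swap[of l k w]
    by simp
  show ?thesis
    using * simplicesD(4)[OF B(1)] simplicesD(4)[OF B'(1)] assms abs_minus_commute
    by (metis Un_iff)
qed

text \<open>
  For leaves on the same tree all offsets in \<open>B\<close> agree, so the average is attained by \<open>v\<close>. The
  offsets in \<open>B'\<close> differ by at most one, so a larger one among them would give a larger average.
\<close>

lemma offset_tree_le:
  assumes S: "2 \<le> card S" "tree_ray S \<in> B" "k \<in> S" "l \<in> S"
    and v: "v \<in> B" "v \<in> cycle_rays" and w: "w \<in> B'" "w \<in> cycle_rays"
  shows "offset k l w \<le> offset k l v"
proof (rule ccontr)
  interpret s: common_point B' B c' c x by (rule swap)
  assume "\<not> ?thesis"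
  moreover obtain i j :: int where ij: "offset k l v = of_int i" "offset k l w = of_int j"
    using cycle_raysD(2)[OF v(2)] cycle_raysD(2)[OF w(2)] Ints_cases by metis
  ultimately have "offset k l v + 1 \<le> offset k l w" by simp
  then have "offset k l v * circ x < offset k l x"
    using simplicesD(4)[OF B'(1) w, of _ k l] w by (intro s.offset_average_less[of _ k l w]) force+
  moreover have "offset k l x - offset k l v * circ x = 0"
    unfolding offset_sum using simplicesD(5)[OF B(1) S _ _ v] by (intro sum.neutral) auto
  ultimately show False by simp
qed

lemma offset_tree:
  assumes S: "2 \<le> card S" "tree_ray S \<in> B" "k \<in> S" "l \<in> S"
    and v: "v \<in> B \<union> B'" "v \<in> cycle_rays" and w: "w \<in> B \<union> B'" "w \<in> cycle_rays"
  shows "offset k l v = offset k l w"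
proof -
  obtain u where u: "u \<in> B" "u \<in> cycle_rays" using simplicesD(2)[OF B(1)] by blast
  have "offset k l z = offset k l u" if z: "z \<in> B \<union> B'" "z \<in> cycle_rays" for z
  proof (cases "z \<in> B")
    case True
    then show ?thesis using simplicesD(5)[OF B(1) S _ z(2) u] by blast
  next
    case False
    then have zB: "z \<in> B'" using z(1) by blast
    then show ?thesis
      using offset_tree_le[OF S u zB z(2)] offset_tree_le[OF S(1,2,4,3) u zB z(2)]
        offset_swap[of l k z] offset_swap[of l k u] by simp
  qed
  then show ?thesis using v w by metis
qed

text \<open>
  All offsets lie in \<open>{q, q + 1}\<close> for some integer \<open>q\<close>; there the square agrees with an affine
  function, so the contribution of the cycle to \<open>rdist k l x\<close> depends on \<open>x\<close> only.
\<close>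

lemma shared_eq: assumes kl: "k \<noteq> l" shows "shared B c k l = shared B' c' k l"
proof -
  define R where "R = (B \<union> B') \<inter> cycle_rays"
  define q where "q = Min (offset k l ` R)"
  have fin: "finite R" "R \<noteq> {}"
    using simplicesD(1)[OF B(1)] simplicesD(1)[OF B'(1)] simplicesD(2)[OF B(1)] by (auto simp: R_def)
  have "q \<in> offset k l ` R" unfolding q_def using fin by (intro Min_in) auto
  then obtain v where v: "v \<in> R" "offset k l v = q" by auto
  have sq: "(offset k l b)\<^sup>2 = (2 * q + 1) * offset k l b - q * (q + 1)" if b: "b \<in> R" for b
  proof -
    have "q \<le> offset k l b" unfolding q_def using fin b by (intro Min_le) auto
    moreover have "\<bar>offset k l b - q\<bar> \<le> 1" using offset_close[of b v k l] b v by (auto simp: R_def)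
    moreover obtain i j :: int where "offset k l b = of_int i" "q = of_int j"
      using cycle_raysD(2) b v Ints_cases unfolding R_def by (metis IntD2)
    ultimately have "offset k l b = q \<or> offset k l b = q + 1" by auto
    then show ?thesis by (auto simp: power2_eq_square algebra_simps)
  qed
  have "(\<Sum>b\<in>B \<inter> cycle_rays. c b * (offset k l b)\<^sup>2) = (2 * q + 1) * offset k l x - q * (q + 1) * circ x"
    unfolding B(3) coordinates_of_simplex_combination(1,2)[OF B(1)] sum_distrib_left sum_subtractf[symmetric]
    by (intro sum.cong) (auto simp: sq R_def algebra_simps)
  moreover have "(\<Sum>b\<in>B' \<inter> cycle_rays. c' b * (offset k l b)\<^sup>2) = (2 * q + 1) * offset k l x - q * (q + 1) * circ x"
    unfolding B'(3) coordinates_of_simplex_combination(1,2)[OF B'(1)] sum_distrib_left sum_subtractf[symmetric]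
    by (intro sum.cong) (auto simp: sq R_def algebra_simps)
  moreover have "rdist k l x = (\<Sum>b\<in>B \<inter> cycle_rays. c b * (offset k l b)\<^sup>2) - 2 * shared B c k l"
    unfolding shared_def B(3) by (rule coordinates_of_simplex_combination(3)[OF B(1) kl])
  moreover have "rdist k l x = (\<Sum>b\<in>B' \<inter> cycle_rays. c' b * (offset k l b)\<^sup>2) - 2 * shared B' c' k l"
    unfolding shared_def B'(3) by (rule coordinates_of_simplex_combination(3)[OF B'(1) kl])
  ultimately show ?thesis by linarith
qed

text \<open>The trees containing \<open>k\<close> form a chain, so those containing \<open>m\<close> also contain \<open>S\<close>.\<close>

lemma shared_less:
  assumes S: "2 \<le> card S" "tree_ray S \<in> B" "k \<in> S" "l \<in> S" "m \<notin> S"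
  shows "shared B c k m < shared B c k l"
  unfolding shared_def
proof (rule sum_strict_mono2)
  show "{S. 2 \<le> card S \<and> tree_ray S \<in> B \<and> k \<in> S \<and> m \<in> S} \<subseteq> {S. 2 \<le> card S \<and> tree_ray S \<in> B \<and> k \<in> S \<and> l \<in> S}"
  proof
    fix S' assume S': "S' \<in> {S. 2 \<le> card S \<and> tree_ray S \<in> B \<and> k \<in> S \<and> m \<in> S}"
    then have "S \<subseteq> S' \<or> S' \<subseteq> S"
      using laminarD[OF simplicesD(6)[OF B(1)], of S S' k] S by blast
    then show "S' \<in> {S. 2 \<le> card S \<and> tree_ray S \<in> B \<and> k \<in> S \<and> l \<in> S}" using S S' by blast
  qed
  show "S \<in> {S. 2 \<le> card S \<and> tree_ray S \<in> B \<and> k \<in> S \<and> l \<in> S} - {S. 2 \<le> card S \<and> tree_ray S \<in> B \<and> k \<in> S \<and> m \<in> S}"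
    using S by blast
qed (use S B(2) in \<open>auto intro: less_imp_le\<close>)

text \<open>
  Crossing trees \<open>S\<close> of \<open>B\<close> and \<open>S'\<close> of \<open>B'\<close> would compare the common parts for two pairs of
  leaves in opposite ways, although these are determined by \<open>x\<close>.
\<close>

lemma union_simplex: "B \<union> B' \<in> simplices"
proof (rule simplicesI)
  interpret s: common_point B' B c' c x by (rule swap)
  show "finite (B \<union> B')" using simplicesD(1)[OF B(1)] simplicesD(1)[OF B'(1)] by simp
  show "(B \<union> B') \<inter> cycle_rays \<noteq> {}" using simplicesD(2)[OF B(1)] by blast
  show "v \<in> cycle_rays \<or> (\<exists>S. 2 \<le> card S \<and> v = tree_ray S)" if "v \<in> B \<union> B'" for v
    using that simplicesD(3)[OF B(1), of v] simplicesD(3)[OF B'(1), of v] by blast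
  show "\<bar>offset k l v - offset k l w\<bar> \<le> 1"
    if "v \<in> B \<union> B'" "v \<in> cycle_rays" "w \<in> B \<union> B'" "w \<in> cycle_rays" for v w k l
    using offset_close[OF that] .
  show "offset k l v = offset k l w"
    if S: "2 \<le> card S" "tree_ray S \<in> B \<union> B'" "k \<in> S" "l \<in> S"
      and vw: "v \<in> B \<union> B'" "v \<in> cycle_rays" "w \<in> B \<union> B'" "w \<in> cycle_rays" for S k l v w
  proof (cases "tree_ray S \<in> B")
    case True
    then show ?thesis using offset_tree[OF S(1) _ S(3,4) vw] by blast
  next
    case False
    then have "tree_ray S \<in> B'" using S(2) by blast
    then show ?thesis using s.offset_tree[OF S(1) _ S(3,4)] vw by (metis Un_commute)
  qed
  have cross: "S \<inter> S' = {} \<or> S \<subseteq> S' \<or> S' \<subseteq> S"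
    if S: "2 \<le> card S" "tree_ray S \<in> B" and S': "2 \<le> card S'" "tree_ray S' \<in> B'" for S S'
  proof (rule ccontr)
    assume "\<not> ?thesis"
    then obtain k l m where klm: "k \<in> S" "k \<in> S'" "l \<in> S" "l \<notin> S'" "m \<in> S'" "m \<notin> S" by blast
    have "shared B c k m < shared B c k l" using shared_less[OF S] klm by blast
    moreover have "shared B' c' k l < shared B' c' k m" using s.shared_less[OF S'] klm by blast
    moreover have "shared B c k m = shared B' c' k m" "shared B c k l = shared B' c' k l"
      using shared_eq klm by metis+
    ultimately show False by simp
  qed
  show "laminar {S. 2 \<le> card S \<and> tree_ray S \<in> B \<union> B'}"
    unfolding laminar_def
  proof (intro ballI)
    fix S S' assume "S \<in> {S. 2 \<le> card S \<and> tree_ray S \<in> B \<union> B'}" "S' \<in> {S. 2 \<le> card S \<and> tree_ray S \<in> B \<union> B'}"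
    then have S: "2 \<le> card S" "tree_ray S \<in> B \<union> B'" "2 \<le> card S'" "tree_ray S' \<in> B \<union> B'" by auto
    consider "tree_ray S \<in> B" "tree_ray S' \<in> B" | "tree_ray S \<in> B'" "tree_ray S' \<in> B'"
      | "tree_ray S \<in> B" "tree_ray S' \<in> B'" | "tree_ray S \<in> B'" "tree_ray S' \<in> B" using S by blast
    then show "S \<inter> S' = {} \<or> S \<subseteq> S' \<or> S' \<subseteq> S"
    proof cases
      case 1 then show ?thesis using laminar_cases[OF simplicesD(6)[OF B(1)], of S S'] S by simp
    next
      case 2 then show ?thesis using laminar_cases[OF simplicesD(6)[OF B'(1)], of S S'] S by simp
    next
      case 3 then show ?thesis using cross[OF S(1) _ S(3)] by blast
    next
      case 4 then show ?thesis using cross[OF S(3) _ S(1)] by blast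
    qed
  qed
qed

text \<open>
  Both coefficient vectors represent \<open>x\<close> over the independent set \<open>B \<union> B'\<close>, and a simplex is the
  support of its coefficients.
\<close>

lemma same_simplex: "B = B'"
proof -
  have ind: "independent (B \<union> B')" using simplex_independent[OF union_simplex] .
  have fin: "finite (B \<union> B')" using simplicesD(1)[OF union_simplex] .
  define d where "d b = (if b \<in> B then c b else 0) - (if b \<in> B' then c' b else 0)" for b
  have "x = (\<Sum>b\<in>B \<union> B'. (if b \<in> B then c b else 0) *\<^sub>R b)"
    unfolding B(3) using fin by (intro sum.mono_neutral_cong_left) auto
  moreover have "x = (\<Sum>b\<in>B \<union> B'. (if b \<in> B' then c' b else 0) *\<^sub>R b)"
    unfolding B'(3) using fin by (intro sum.mono_neutral_cong_left) auto
  ultimately have "(\<Sum>b\<in>B \<union> B'. d b *\<^sub>R b) = 0"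
    unfolding d_def scaleR_left_diff_distrib sum_subtractf by simp
  then have "d b = 0" if "b \<in> B \<union> B'" for b
    using ind that unfolding dependent_finite[OF fin] by blast
  then have "b \<in> B \<longleftrightarrow> b \<in> B'" for b
    using B(2)[of b] B'(2)[of b] by (cases "b \<in> B"; cases "b \<in> B'") (force simp: d_def)+
  then show ?thesis by blast
qed

end

lemma circ_ray_cases:
  assumes "B \<in> simplices" "b \<in> B"
  shows "circ b = (if b \<in> cycle_rays then 1 else 0)"
  using simplicesD(3)[OF assms] tree_ray_coords(1) cycle_raysD(1) tree_ray_not_cycle by metis

lemma subset_simplex:
  assumes B: "B \<in> simplices" and C: "C \<subseteq> B" "C \<inter> cycle_rays \<noteq> {}"
  shows "C \<in> simplices"
proof (rule simplicesI)
  show "finite C" using simplicesD(1)[OF B] C(1) finite_subset by blast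
  show "laminar {S. 2 \<le> card S \<and> tree_ray S \<in> C}"
    by (rule laminar_subset[OF simplicesD(6)[OF B]]) (use C(1) in blast)
  show "v \<in> cycle_rays \<or> (\<exists>S. 2 \<le> card S \<and> v = tree_ray S)" if "v \<in> C" for v
    using simplicesD(3)[OF B, of v] that C(1) by blast
  show "\<bar>offset k l v - offset k l w\<bar> \<le> 1"
    if "v \<in> C" "v \<in> cycle_rays" "w \<in> C" "w \<in> cycle_rays" for v w k l
    using simplicesD(4)[OF B _ that(2) _ that(4)] that(1,3) C(1) by blast
  show "offset k l v = offset k l w"
    if "2 \<le> card S" "tree_ray S \<in> C" "k \<in> S" "l \<in> S"
      "v \<in> C" "v \<in> cycle_rays" "w \<in> C" "w \<in> cycle_rays" for S k l v w
    using simplicesD(5)[OF B that(1) _ that(3,4) _ that(6) _ that(8)] that(2,5,7) C(1) by blast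
qed (rule C(2))

lemma locally_finite_simplices:
  assumes B: "B \<in> simplices" shows "finite {C \<in> simplices. B \<subseteq> C}"
proof -
  obtain v where v: "v \<in> B" "v \<in> cycle_rays" using simplicesD(2)[OF B] by blast
  obtain g where g: "g \<in> carrier Gn" "g v = ray {LB}" using translate_cycle_ray[OF v(2)] by blast
  obtain h where h: "h \<in> carrier Gn" "\<And>x. h (g x) = x" "\<And>x. g (h x) = x"
    using subgroup_BijGroup_inverse[OF subgroup_Gn g(1)] by blast
  have "{C \<in> simplices. B \<subseteq> C} \<subseteq> range (\<lambda>\<F>. h ` ray ` \<F>)"
  proof
    fix C assume C: "C \<in> {C \<in> simplices. B \<subseteq> C}"
    then have CS: "C \<in> simplices" "v \<in> C" using v(1) by auto
    have "ray {LB} \<in> g ` C" using g(2) CS(2) by (metis image_eqI)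
    then obtain \<F> where "g ` C = ray ` \<F>"
      using simplex_cluster_family[OF simplex_image[OF g(1) CS(1)]] by blast
    then have "h ` ray ` \<F> = h ` g ` C" by simp
    also have "\<dots> = C" using h(2) by (simp add: image_image)
    finally show "C \<in> range (\<lambda>\<F>. h ` ray ` \<F>)" by blast
  qed
  then show ?thesis by (rule finite_subset) simp
qed

lemma cone_complex_simplices: "cone_complex circ Vlat simplices"
proof (rule cone_complex.intro)
  fix B B' C :: "'a vn set" and b x :: "'a vn"
  show "linear (circ :: 'a vn \<Rightarrow> real)" by (rule linear_circ)
  show "circ ` Vlat \<subseteq> \<int>" using VlatD(1) by blast
  show "is_lattice (Vlat :: 'a vn set)" by (rule Vlat_basis(2))
  show "finite B" if "B \<in> simplices" using simplicesD(1)[OF that] .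
  show "independent B" if "B \<in> simplices" using simplex_independent[OF that] .
  show "Vlat \<inter> span B = int_span B" if "B \<in> simplices" using simplex_saturated[OF that] .
  show "0 \<le> circ b" if "B \<in> simplices" "b \<in> B" using circ_ray_cases[OF that] by simp
  show "\<exists>b\<in>B. 0 < circ b" if "B \<in> simplices"
    using simplicesD(2)[OF that] cycle_raysD(1) by (metis IntE ex_in_conv zero_less_one)
  show "C \<in> simplices" if "B \<in> simplices" "C \<subseteq> B" "b \<in> C" "0 < circ b"
  proof -
    have "b \<in> cycle_rays" using circ_ray_cases[OF that(1), of b] that(2-4) by (auto split: if_splits)
    then show ?thesis using subset_simplex[OF that(1,2)] that(3) by blast
  qed
  show "B = B'" if S: "B \<in> simplices" "B' \<in> simplices" "positive_on B x" "positive_on B' x"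
  proof -
    obtain c c' where "\<forall>b\<in>B. 0 < c b" "x = (\<Sum>b\<in>B. c b *\<^sub>R b)" "\<forall>b\<in>B'. 0 < c' b" "x = (\<Sum>b\<in>B'. c' b *\<^sub>R b)"
      using S(3,4) unfolding positive_on_def by blast
    then have "common_point B B' c c' x" using S by unfold_locales auto
    then show ?thesis by (rule common_point.same_simplex)
  qed
  show "finite {C \<in> simplices. B \<subseteq> C}" if "B \<in> simplices" using locally_finite_simplices[OF that] .
qed

section \<open>Trees as laminar families\<close>

text \<open>A rooted tree, each of whose nodes is given by the set of the leaves below it.\<close>

locale laminar_tree =
  fixes \<L> :: "'x::finite set set" and X :: "'x set"
  assumes lam: "laminar \<L>" and root: "X \<in> \<L>" and leaves: "\<And>x. x \<in> X \<Longrightarrow> {x} \<in> \<L>"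
    and nodes: "\<And>F. F \<in> \<L> \<Longrightarrow> F \<subseteq> X \<and> F \<noteq> {}"
begin

definition children :: "'x set \<Rightarrow> 'x set set" where
  "children P = {C \<in> \<L>. C \<subset> P \<and> (\<forall>D\<in>\<L>. D \<subset> P \<longrightarrow> C \<subseteq> D \<longrightarrow> C = D)}"

lemma childD:
  assumes "C \<in> children P"
  shows "C \<in> \<L>" "C \<subset> P" "C \<noteq> {}" "C \<subseteq> X" "\<And>D. D \<in> \<L> \<Longrightarrow> D \<subset> P \<Longrightarrow> C \<subseteq> D \<Longrightarrow> C = D"
  using assms nodes[of C] unfolding children_def by blast+

lemma below_child:
  assumes "F \<in> \<L>" "F \<subset> P" obtains C where "C \<in> children P" "F \<subseteq> C"
proof -
  define \<D> where "\<D> = {D \<in> \<L>. D \<subset> P \<and> F \<subseteq> D}"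
  have "finite \<D>" "\<D> \<noteq> {}" using assms by (auto simp: \<D>_def)
  then obtain C where C: "C \<in> \<D>" "\<And>D. D \<in> \<D> \<Longrightarrow> C \<subseteq> D \<Longrightarrow> C = D"
    using finite_has_maximal[of \<D>] by blast
  have C': "C \<in> \<L>" "C \<subset> P" "F \<subseteq> C" using C(1) by (auto simp: \<D>_def)
  have "C = D" if "D \<in> \<L>" "D \<subset> P" "C \<subseteq> D" for D
    using C(2)[of D] that C'(3) by (auto simp: \<D>_def)
  then have "C \<in> children P" using C' unfolding children_def by blast
  then show thesis using that C'(3) by blast
qed

lemma children_disjoint:
  assumes "C \<in> children P" "D \<in> children P" "C \<noteq> D" shows "C \<inter> D = {}"
proof -
  have "C \<inter> D = {} \<or> C \<subseteq> D \<or> D \<subseteq> C"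
    using assms(1,2) by (intro laminar_cases[OF lam]) (auto simp: children_def)
  then show ?thesis using assms unfolding children_def by blast
qed

lemma children_cover:
  assumes "P \<in> \<L>" "2 \<le> card P" shows "\<Union>(children P) = P"
proof (intro equalityI subsetI)
  fix x assume x: "x \<in> P"
  have "{x} \<noteq> P" using assms(2) by auto
  moreover have "{x} \<in> \<L>" using leaves nodes[OF assms(1)] x by blast
  ultimately obtain C where "C \<in> children P" "{x} \<subseteq> C" using below_child[of "{x}" P] x by blast
  then show "x \<in> \<Union>(children P)" by blast
qed (auto simp: children_def)

lemma card_children: assumes "P \<in> \<L>" "2 \<le> card P" shows "2 \<le> card (children P)"
proof (rule ccontr)
  assume "\<not> ?thesis"
  then have "card (children P) = 0 \<or> card (children P) = 1" by linarith
  then have "children P = {} \<or> (\<exists>C. children P = {C})" by (auto simp: card_1_singleton_iff)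
  then have "P = {} \<or> (\<exists>C. children P = {C} \<and> P = C)" using children_cover[OF assms] by auto
  then show False using nodes[OF assms(1)] unfolding children_def by blast
qed

lemma children_singleton: "card P < 2 \<Longrightarrow> children P = {}"
proof (rule ccontr)
  assume "card P < 2" "children P \<noteq> {}"
  then obtain C where C: "C \<in> \<L>" "C \<subset> P" unfolding children_def by blast
  have "card C < card P" using C(2) by (intro psubset_card_mono) auto
  then have "card C = 0" using \<open>card P < 2\<close> by linarith
  then have "C = {}" by simp
  then show False using nodes[OF C(1)] by blast
qed

lemma minimal_above:
  assumes "F \<subseteq> X" "F \<noteq> X \<or> \<not> strict"
  obtains P where "P \<in> \<L>" "F \<subseteq> P" "strict \<Longrightarrow> F \<noteq> P"
    "\<And>D. D \<in> \<L> \<Longrightarrow> F \<subseteq> D \<Longrightarrow> (strict \<Longrightarrow> F \<noteq> D) \<Longrightarrow> D \<subseteq> P \<Longrightarrow> D = P"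
proof -
  define \<D> where "\<D> = {D \<in> \<L>. F \<subseteq> D \<and> (strict \<longrightarrow> F \<noteq> D)}"
  have "finite \<D>" "\<D> \<noteq> {}" using assms root by (auto simp: \<D>_def)
  then obtain P where P: "P \<in> \<D>" "\<And>D. D \<in> \<D> \<Longrightarrow> D \<subseteq> P \<Longrightarrow> P = D"
    using finite_has_minimal[of \<D>] by blast
  show thesis
  proof (rule that[of P])
    show "D = P" if "D \<in> \<L>" "F \<subseteq> D" "strict \<Longrightarrow> F \<noteq> D" "D \<subseteq> P" for D
      using P(2)[of D] that by (auto simp: \<D>_def)
  qed (use P(1) in \<open>auto simp: \<D>_def\<close>)
qed

lemma parent_exists:
  assumes F: "F \<in> \<L>" "F \<noteq> X" obtains P where "P \<in> \<L>" "F \<in> children P"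
proof -
  have "F \<subseteq> X" using nodes[OF F(1)] by blast
  with F(2) obtain P where P: "P \<in> \<L>" "F \<subseteq> P" "F \<noteq> P" "\<And>D. D \<in> \<L> \<Longrightarrow> F \<subseteq> D \<Longrightarrow> F \<noteq> D \<Longrightarrow> D \<subseteq> P \<Longrightarrow> D = P"
    using minimal_above[of F True] by metis
  have "F = D" if "D \<in> \<L>" "D \<subset> P" "F \<subseteq> D" for D using P(4)[of D] that by blast
  then have "F \<in> children P" using P(2,3) F(1) unfolding children_def by blast
  then show thesis using that P(1) by blast
qed

lemma parent_unique:
  assumes "P \<in> \<L>" "Q \<in> \<L>" "F \<in> children P" "F \<in> children Q" shows "P = Q"
proof -
  note F = childD(1,2)[OF assms(3)] childD(2)[OF assms(4)]
  obtain x where "x \<in> F" using nodes[OF F(1)] by blast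
  then have "P \<subseteq> Q \<or> Q \<subseteq> P" using laminarD[OF lam assms(1,2), of x] F by blast
  then show ?thesis using childD(5)[OF assms(3) assms(2)] childD(5)[OF assms(4) assms(1)] F by blast
qed

lemma sum_children: "(\<Sum>P\<in>\<L>. card (children P)) + 1 = card \<L>"
proof -
  have "(\<Sum>P\<in>\<L>. card (children P)) = card (\<Union>P\<in>\<L>. children P)"
    using parent_unique by (intro card_UN_disjoint[symmetric]) auto
  also have "(\<Union>P\<in>\<L>. children P) = \<L> - {X}"
  proof (intro equalityI subsetI)
    fix F assume "F \<in> (\<Union>P\<in>\<L>. children P)"
    then obtain P where "P \<in> \<L>" "F \<in> \<L>" "F \<subset> P" unfolding children_def by blast
    then show "F \<in> \<L> - {X}" using nodes[of P] by blast
  next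
    fix F assume "F \<in> \<L> - {X}"
    then show "F \<in> (\<Union>P\<in>\<L>. children P)" using parent_exists[of F] by blast
  qed
  finally have "(\<Sum>P\<in>\<L>. card (children P)) = card (\<L> - {X})" .
  moreover have "card (\<L> - {X}) + 1 = card \<L>" using card_Suc_Diff1[OF finite root] by simp
  ultimately show ?thesis by simp
qed

definition inner_nodes :: "'x set set" where "inner_nodes = {P \<in> \<L>. 2 \<le> card P}"

lemma card_nodes: "card \<L> = card inner_nodes + card X"
proof -
  have "\<L> = inner_nodes \<union> (\<lambda>x. {x}) ` X"
  proof (intro equalityI subsetI)
    fix F assume F: "F \<in> \<L>"
    show "F \<in> inner_nodes \<union> (\<lambda>x. {x}) ` X"
    proof (cases "2 \<le> card F")
      case False
      then have "card F = 0 \<or> card F = 1" by linarith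
      then have "card F = 1" using nodes[OF F] by auto
      then obtain x where "F = {x}" by (metis card_1_singletonE)
      then show ?thesis using nodes[OF F] by blast
    qed (use F in \<open>simp add: inner_nodes_def\<close>)
  qed (use leaves in \<open>auto simp: inner_nodes_def\<close>)
  moreover have "inner_nodes \<inter> (\<lambda>x. {x}) ` X = {}" by (auto simp: inner_nodes_def)
  moreover have "card ((\<lambda>x. {x}) ` X) = card X" by (rule card_image) simp
  ultimately show ?thesis by (metis card_Un_disjoint finite)
qed

text \<open>
  Every inner node of a binary tree has two children, and the tree has \<open>2 |X| - 1\<close> nodes. The two
  deviations from this agree.
\<close>

lemma excess: "(\<Sum>P\<in>inner_nodes. card (children P) - 2) + card \<L> + 1 = 2 * card X"
proof -
  have "(\<Sum>P\<in>\<L>. card (children P)) = (\<Sum>P\<in>inner_nodes. card (children P))"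
    using children_singleton by (intro sum.mono_neutral_right) (auto simp: inner_nodes_def not_le)
  also have "\<dots> = (\<Sum>P\<in>inner_nodes. (card (children P) - 2) + 2)"
  proof (intro sum.cong refl)
    fix P assume "P \<in> inner_nodes"
    then have "2 \<le> card (children P)" using card_children[of P] by (simp add: inner_nodes_def)
    then show "card (children P) = (card (children P) - 2) + 2" by simp
  qed
  also have "\<dots> = (\<Sum>P\<in>inner_nodes. card (children P) - 2) + 2 * card inner_nodes"
    by (simp only: sum.distrib sum_constant) simp
  finally show ?thesis using sum_children card_nodes by simp
qed

text \<open>The new node is inserted between \<open>P\<close> and its children \<open>T1\<close> and \<open>T2\<close>.\<close>

lemma resolve_laminar:
  assumes P: "P \<in> \<L>" and T: "T1 \<in> children P" "T2 \<in> children P"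
  shows "laminar (insert (T1 \<union> T2) \<L>)"
proof -
  have TP: "T1 \<union> T2 \<subseteq> P" using childD(2)[OF T(1)] childD(2)[OF T(2)] by blast
  have *: "M \<inter> (T1 \<union> T2) = {} \<or> M \<subseteq> T1 \<union> T2 \<or> T1 \<union> T2 \<subseteq> M" if M: "M \<in> \<L>" for M
  proof -
    consider "M \<inter> P = {}" | "P \<subseteq> M" | "M \<subset> P" using laminar_cases[OF lam M P] by blast
    then show ?thesis
    proof cases
      case 3
      obtain C where C: "C \<in> children P" "M \<subseteq> C" using below_child[OF M 3] by blast
      show ?thesis
        using children_disjoint[OF C(1) T(1)] children_disjoint[OF C(1) T(2)] C(2) by blast
    qed (use TP in blast)+
  qed
  show ?thesis unfolding laminar_def
  proof (intro ballI)
    fix E F assume "E \<in> insert (T1 \<union> T2) \<L>" "F \<in> insert (T1 \<union> T2) \<L>"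
    then consider "E \<in> \<L>" "F \<in> \<L>" | "E = T1 \<union> T2" "F \<in> \<L>" | "E \<in> \<L>" "F = T1 \<union> T2" | "E = F" by blast
    then show "E \<inter> F = {} \<or> E \<subseteq> F \<or> F \<subseteq> E"
    proof cases
      case 1 then show ?thesis by (rule laminar_cases[OF lam])
    next
      case 2 then show ?thesis using *[of F] by blast
    next
      case 3 then show ?thesis using *[of E] by blast
    qed blast
  qed
qed

lemma resolve_new:
  assumes T: "T1 \<in> children P" "T2 \<in> children P" "T3 \<in> children P" "T1 \<noteq> T2" "T1 \<noteq> T3" "T2 \<noteq> T3"
  shows "T1 \<union> T2 \<notin> \<L>"
proof
  assume new: "T1 \<union> T2 \<in> \<L>"
  note ne = childD(3)[OF T(1)] childD(3)[OF T(2)] childD(3)[OF T(3)]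
  note dis = children_disjoint[OF T(1,2,4)] children_disjoint[OF T(1,3,5)] children_disjoint[OF T(2,3,6)]
  have "T1 \<subseteq> P" "T2 \<subseteq> P" "T3 \<subseteq> P" using childD(2) T(1-3) by blast+
  then have "T1 \<union> T2 \<subset> P" using ne dis by blast
  then have "T1 = T1 \<union> T2" using childD(5)[OF T(1) new] by blast
  then show False using ne dis by blast
qed

text \<open>A new cluster is a union of at least two, but not all, children of some vertex.\<close>

lemma new_cluster:
  assumes F: "F \<notin> \<L>" "F \<subseteq> X" "F \<noteq> {}" and lamF: "laminar (insert F \<L>)"
  obtains P \<C> where "P \<in> inner_nodes" "\<C> \<subset> children P" "2 \<le> card \<C>" "F = \<Union>\<C>"
proof -
  obtain P where P: "P \<in> \<L>" "F \<subseteq> P" "\<And>D. D \<in> \<L> \<Longrightarrow> F \<subseteq> D \<Longrightarrow> D \<subseteq> P \<Longrightarrow> D = P"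
    using minimal_above[of F False] F(2) by metis
  have FP: "F \<subset> P" using P(1,2) F(1) by blast
  have "2 \<le> card P"
  proof -
    have "card F < card P" using FP by (intro psubset_card_mono) auto
    moreover have "0 < card F" using F(3) by (simp add: card_gt_0_iff)
    ultimately show ?thesis by simp
  qed
  then have inner: "P \<in> inner_nodes" using P(1) by (simp add: inner_nodes_def)
  define \<C> where "\<C> = {C \<in> children P. C \<subseteq> F}"
  have "F = \<Union>\<C>"
  proof (intro equalityI subsetI)
    fix x assume x: "x \<in> F"
    then obtain C where C: "C \<in> children P" "x \<in> C"
      using children_cover[OF P(1) \<open>2 \<le> card P\<close>] FP by blast
    note C' = childD(1,2)[OF C(1)]
    have "C \<subseteq> F \<or> F \<subseteq> C" using laminarD[OF lamF, of C F x] C'(1) x C(2) by blast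
    moreover have "\<not> F \<subseteq> C" using P(3)[OF C'(1)] C'(2) by blast
    ultimately show "x \<in> \<Union>\<C>" using C by (auto simp: \<C>_def)
  qed (auto simp: \<C>_def)
  moreover have "\<C> \<noteq> children P"
    using children_cover[OF P(1) \<open>2 \<le> card P\<close>] FP \<open>F = \<Union>\<C>\<close> by blast
  then have "\<C> \<subset> children P" by (auto simp: \<C>_def)
  moreover have "2 \<le> card \<C>"
  proof (rule ccontr)
    assume "\<not> ?thesis"
    then have "card \<C> = 0 \<or> card \<C> = 1" by linarith
    then have "\<C> = {} \<or> (\<exists>C. \<C> = {C})" by (auto simp: card_1_singleton_iff)
    then show False
    proof
      assume "\<exists>C. \<C> = {C}"
      then obtain C where "\<C> = {C}" by blast
      then have "F = C" "C \<in> \<C>" using \<open>F = \<Union>\<C>\<close> by simp_all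
      moreover from this(2) have "C \<in> \<L>" using childD(1)[of C P] by (simp add: \<C>_def)
      ultimately show False using F(1) by blast
    qed (use \<open>F = \<Union>\<C>\<close> F(3) in simp)
  qed
  ultimately show thesis using that inner by blast
qed

text \<open>
  With fewer nodes than a binary tree, some node has three children, two of which can be joined.
\<close>

lemma extension_exists:
  assumes "card \<L> + 1 < 2 * card X"
  obtains F where "F \<notin> \<L>" "F \<subseteq> X" "F \<noteq> {}" "laminar (insert F \<L>)"
proof -
  have "(\<Sum>P\<in>inner_nodes. card (children P) - 2) \<noteq> 0" using excess assms by linarith
  then obtain P where P: "P \<in> inner_nodes" "card (children P) - 2 \<noteq> 0" by (meson sum.neutral)
  then have "3 \<le> card (children P)" by simp
  then obtain \<T> where "\<T> \<subseteq> children P" "card \<T> = 3" by (metis obtain_subset_with_card_n)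
  then obtain T1 T2 T3 where T: "T1 \<in> children P" "T2 \<in> children P" "T3 \<in> children P"
    "T1 \<noteq> T2" "T1 \<noteq> T3" "T2 \<noteq> T3" by (auto simp: card_3_iff)
  have PL: "P \<in> \<L>" using P(1) by (simp add: inner_nodes_def)
  have "T1 \<union> T2 \<subseteq> X" "T1 \<union> T2 \<noteq> {}" using childD(3,4)[OF T(1)] childD(4)[OF T(2)] by blast+
  then show thesis using that[of "T1 \<union> T2"] resolve_new[OF T] resolve_laminar[OF PL T(1,2)] by blast
qed

text \<open>
  By the count of \<open>excess\<close> all inner nodes have two children, except for one with three.
\<close>

lemma codimension_one_extensions:
  assumes "card \<L> + 2 = 2 * card X"
  obtains T1 T2 T3 where "T1 \<in> \<L>" "T2 \<in> \<L>" "T3 \<in> \<L>" "T1 \<union> T2 \<union> T3 \<in> \<L>"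
    "T1 \<inter> T2 = {}" "T1 \<inter> T3 = {}" "T2 \<inter> T3 = {}" "T1 \<noteq> {}" "T2 \<noteq> {}" "T3 \<noteq> {}"
    "{F. F \<notin> \<L> \<and> F \<subseteq> X \<and> F \<noteq> {} \<and> laminar (insert F \<L>)} = {T1 \<union> T2, T1 \<union> T3, T2 \<union> T3}"
proof -
  have fin: "finite inner_nodes" by simp
  have "(\<Sum>P\<in>inner_nodes. card (children P) - 2) = 1" using excess assms by simp
  from iffD1[OF sum_eq_1_iff[OF fin] this] obtain P where P: "P \<in> inner_nodes" "card (children P) - 2 = 1"
    "\<And>Q. Q \<in> inner_nodes \<Longrightarrow> Q \<noteq> P \<Longrightarrow> card (children Q) - 2 = 0"
    by metis
  have PL: "P \<in> \<L>" "2 \<le> card P" using P(1) by (auto simp: inner_nodes_def)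
  have "card (children P) = 3" using P(2) by simp
  then obtain T1 T2 T3 where T: "children P = {T1, T2, T3}" "T1 \<noteq> T2" "T1 \<noteq> T3" "T2 \<noteq> T3"
    by (auto simp: card_3_iff)
  have TP: "T1 \<in> children P" "T2 \<in> children P" "T3 \<in> children P" using T(1) by auto
  have union: "T1 \<union> T2 \<union> T3 = P" using children_cover[OF PL] T(1) by auto
  have sub: "T \<in> \<L>" "T \<subseteq> X" "T \<noteq> {}" if "T \<in> children P" for T
    using childD(1,4,3)[OF that] .
  have "{F. F \<notin> \<L> \<and> F \<subseteq> X \<and> F \<noteq> {} \<and> laminar (insert F \<L>)} = {T1 \<union> T2, T1 \<union> T3, T2 \<union> T3}"
  proof (intro equalityI subsetI)
    fix F assume "F \<in> {F. F \<notin> \<L> \<and> F \<subseteq> X \<and> F \<noteq> {} \<and> laminar (insert F \<L>)}"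
    then obtain Q \<C> where Q: "Q \<in> inner_nodes" "\<C> \<subset> children Q" "2 \<le> card \<C>" "F = \<Union>\<C>"
      using new_cluster[of F] by blast
    have "card \<C> < card (children Q)" using Q(2) by (intro psubset_card_mono) auto
    then have "Q = P" using P(3)[OF Q(1)] Q(3) by fastforce
    then have "\<C> \<subset> {T1, T2, T3}" using Q(2) T(1) by simp
    then have sub\<C>: "\<C> \<subseteq> {T1, T2, T3}" and "T1 \<notin> \<C> \<or> T2 \<notin> \<C> \<or> T3 \<notin> \<C>" by blast+
    then consider "\<C> \<subseteq> {T1, T2}" | "\<C> \<subseteq> {T1, T3}" | "\<C> \<subseteq> {T2, T3}" by blast
    then have "\<C> = {T1, T2} \<or> \<C> = {T1, T3} \<or> \<C> = {T2, T3}"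
    proof cases
      case 1 then show ?thesis using card_seteq[of "{T1, T2}" \<C>] Q(3) T(2) by simp
    next
      case 2 then show ?thesis using card_seteq[of "{T1, T3}" \<C>] Q(3) T(3) by simp
    next
      case 3 then show ?thesis using card_seteq[of "{T2, T3}" \<C>] Q(3) T(4) by simp
    qed
    then show "F \<in> {T1 \<union> T2, T1 \<union> T3, T2 \<union> T3}" using Q(4) by auto
  next
    fix F assume "F \<in> {T1 \<union> T2, T1 \<union> T3, T2 \<union> T3}"
    moreover have "T1 \<union> T2 \<notin> \<L>" "T1 \<union> T3 \<notin> \<L>" "T2 \<union> T3 \<notin> \<L>"
      using resolve_new[of T1 P T2 T3] resolve_new[of T1 P T3 T2] resolve_new[of T2 P T3 T1] TP T(2-4) by auto
    moreover have "laminar (insert (T1 \<union> T2) \<L>)" "laminar (insert (T1 \<union> T3) \<L>)" "laminar (insert (T2 \<union> T3) \<L>)"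
      using resolve_laminar[OF PL(1)] TP by blast+
    ultimately show "F \<in> {F. F \<notin> \<L> \<and> F \<subseteq> X \<and> F \<noteq> {} \<and> laminar (insert F \<L>)}"
      using sub(2)[OF TP(1)] sub(2)[OF TP(2)] sub(2)[OF TP(3)] sub(3)[OF TP(1)] sub(3)[OF TP(2)] by auto
  qed
  then show thesis
    using that[of T1 T2 T3] sub[OF TP(1)] sub[OF TP(2)] sub[OF TP(3)] union PL(1)
      children_disjoint[OF TP(1,2) T(2)] children_disjoint[OF TP(1,3) T(3)] children_disjoint[OF TP(2,3) T(4)]
    by blast
qed

end

section \<open>Facets and codimension one\<close>

text \<open>
  The family lacks the root, which is not an edge, and the leaves, which are unbounded edges.
\<close>

definition completion :: "'n::finite leaf set set \<Rightarrow> 'n leaf set set" where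
  "completion \<F> = \<F> \<union> {UNIV - {LA}} \<union> (\<lambda>x. {x}) ` (UNIV - {LA})"

lemma cluster_familyD:
  assumes "cluster_family \<F>"
  shows "laminar \<F>" "{LB} \<in> \<F>" "\<And>F. F \<in> \<F> \<Longrightarrow> LA \<notin> F" "\<And>F. F \<in> \<F> \<Longrightarrow> F \<noteq> UNIV - {LA}"
    "\<And>F. F \<in> \<F> \<Longrightarrow> F = {LB} \<or> 2 \<le> card F"
  using assms unfolding cluster_family_def by blast+

lemma laminar_completion:
  assumes "laminar \<F>" "\<And>F. F \<in> \<F> \<Longrightarrow> LA \<notin> F" shows "laminar (completion \<F>)"
  unfolding laminar_def
proof (intro ballI)
  fix E F assume EF: "E \<in> completion \<F>" "F \<in> completion \<F>"
  have sub: "D \<subseteq> UNIV - {LA}" if "D \<in> completion \<F>" for D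
    using that assms(2) unfolding completion_def by auto
  consider "E \<in> \<F>" "F \<in> \<F>" | "E = UNIV - {LA}" | "F = UNIV - {LA}" | x where "E = {x}" | x where "F = {x}"
    using EF unfolding completion_def by blast
  then show "E \<inter> F = {} \<or> E \<subseteq> F \<or> F \<subseteq> E"
  proof cases
    case 1 then show ?thesis by (rule laminar_cases[OF assms(1)])
  next
    case 2 then show ?thesis using sub[OF EF(2)] by simp
  next
    case 3 then show ?thesis using sub[OF EF(1)] by simp
  qed simp_all
qed

lemma card_leaves: "card (UNIV - {LA :: 'n::finite leaf}) = CARD('n) + 1"
proof -
  have "UNIV - {LA :: 'n leaf} = insert LB (range Leg)" by (auto intro: leaf.exhaust)
  moreover have "card (range (Leg :: 'n \<Rightarrow> 'n leaf)) = CARD('n)" by (rule card_image) (simp add: inj_on_def)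
  moreover have "LB \<notin> range (Leg :: 'n \<Rightarrow> 'n leaf)" by auto
  ultimately show ?thesis by simp
qed

lemma laminar_tree_completion:
  assumes "cluster_family \<F>" shows "laminar_tree (completion \<F>) (UNIV - {LA})"
proof
  note F = cluster_familyD[OF assms]
  show "laminar (completion \<F>)" using laminar_completion[OF F(1,3)] by blast
  show "UNIV - {LA} \<in> completion \<F>" by (simp add: completion_def)
  show "{x} \<in> completion \<F>" if "x \<in> UNIV - {LA}" for x using that by (simp add: completion_def)
  show "E \<subseteq> UNIV - {LA} \<and> E \<noteq> {}" if E: "E \<in> completion \<F>" for E
  proof -
    have "E \<noteq> {} \<and> LA \<notin> E" if "E \<in> \<F>" using F(3,5)[OF that] by auto
    moreover have "UNIV - {LA} \<noteq> ({} :: 'a leaf set)" by auto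
    ultimately show ?thesis using E unfolding completion_def by auto
  qed
qed

lemma card_completion:
  fixes \<F> :: "'n::finite leaf set set"
  assumes "cluster_family \<F>" shows "card (completion \<F>) = card \<F> + CARD('n) + 1"
proof -
  let ?X = "UNIV - {LA :: 'n leaf}"
  note F = cluster_familyD[OF assms]
  have "0 < CARD('n)" by simp
  then have "2 \<le> card ?X" using card_leaves[where 'n = 'n] by linarith
  have "?X \<notin> (\<lambda>x. {x}) ` ?X"
  proof
    assume "?X \<in> (\<lambda>x. {x}) ` ?X"
    then obtain x where "?X = {x}" by blast
    then have "card ?X = 1" by simp
    then show False using \<open>2 \<le> card ?X\<close> by linarith
  qed
  moreover have "?X \<notin> \<F>" using F(4) by blast
  ultimately have "card (completion \<F>) = Suc (card (\<F> \<union> (\<lambda>x. {x}) ` ?X))"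
    unfolding completion_def by (simp add: Un_assoc Un_insert_left)
  also have "\<F> \<union> (\<lambda>x. {x}) ` ?X = (\<F> - {{LB}}) \<union> (\<lambda>x. {x}) ` ?X" by auto
  also have "card \<dots> = card (\<F> - {{LB}}) + card ((\<lambda>x. {x}) ` ?X)"
  proof (rule card_Un_disjoint)
    have "{x} \<notin> \<F> - {{LB}}" for x using F(5)[of "{x}"] by auto
    then show "(\<F> - {{LB}}) \<inter> (\<lambda>x. {x}) ` ?X = {}" by blast
  qed simp_all
  also have "card ((\<lambda>x. {x}) ` ?X) = CARD('n) + 1"
    using card_leaves[where 'n = 'n] by (subst card_image) auto
  also have "card (\<F> - {{LB}}) = card \<F> - 1" using F(2) by simp
  also have "Suc (card \<F> - 1 + (CARD('n) + 1)) = card \<F> + CARD('n) + 1"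
    using F(2) by (simp add: card_gt_0_iff) (metis One_nat_def Suc_pred card_gt_0_iff empty_iff finite add_Suc)
  finally show ?thesis .
qed

lemma cluster_family_insert:
  assumes \<F>: "cluster_family \<F>"
  shows "F \<notin> \<F> \<and> cluster_family (insert F \<F>) \<longleftrightarrow>
     F \<notin> completion \<F> \<and> F \<subseteq> UNIV - {LA} \<and> F \<noteq> {} \<and> laminar (insert F (completion \<F>))"
proof
  assume F: "F \<notin> \<F> \<and> cluster_family (insert F \<F>)"
  note D = cluster_familyD[OF conjunct2[OF F]]
  have ne: "F \<noteq> {LB}" using F cluster_familyD(2)[OF \<F>] by blast
  then have card: "2 \<le> card F" using D(5)[of F] by blast
  then have "F \<notin> completion \<F>" using F D(4)[of F] by (auto simp: completion_def)
  moreover have "completion (insert F \<F>) = insert F (completion \<F>)" by (auto simp: completion_def)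
  then have "laminar (insert F (completion \<F>))" using laminar_completion[OF D(1,3)] by simp
  ultimately show "F \<notin> completion \<F> \<and> F \<subseteq> UNIV - {LA} \<and> F \<noteq> {} \<and> laminar (insert F (completion \<F>))"
    using D(3)[of F] card by auto
next
  assume F: "F \<notin> completion \<F> \<and> F \<subseteq> UNIV - {LA} \<and> F \<noteq> {} \<and> laminar (insert F (completion \<F>))"
  have "F \<noteq> {x}" for x using F by (auto simp: completion_def)
  then have "card F \<noteq> 1" by (auto simp: card_1_singleton_iff)
  moreover have "card F \<noteq> 0" using F by simp
  ultimately have "2 \<le> card F" by linarith
  moreover have "laminar (insert F \<F>)"
    by (rule laminar_subset[OF conjunct2[OF conjunct2[OF conjunct2[OF F]]]]) (auto simp: completion_def)
  ultimately show "F \<notin> \<F> \<and> cluster_family (insert F \<F>)"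
    using F cluster_familyD[OF \<F>] unfolding cluster_family_def by (auto simp: completion_def)
qed

lemma card_simplex:
  assumes "cluster_family \<F>" "h \<in> carrier Gn" shows "card (h ` ray ` \<F>) = card \<F>"
  using cluster_rays_independent(1)[OF assms(1)] inj_Gn[OF assms(2)]
  by (metis card_image inj_on_subset subset_UNIV)

lemma simplex_some_normal_form:
  assumes B: "B \<in> simplices"
  obtains h \<F> where "h \<in> carrier Gn" "cluster_family \<F>" "B = h ` ray ` \<F>"
proof -
  obtain v where "v \<in> B" "v \<in> cycle_rays" using simplicesD(2)[OF B] by blast
  then show thesis using simplex_normal_form[OF B] that by metis
qed

lemma card_simplex_le:
  fixes B :: "'n::finite vn set"
  assumes B: "B \<in> simplices" shows "card B \<le> CARD('n)"
proof -
  obtain h :: "'n vn \<Rightarrow> 'n vn" and \<F> where h: "h \<in> carrier Gn" "cluster_family \<F>" "B = h ` ray ` \<F>"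
    using simplex_some_normal_form[OF B] by blast
  have "card (completion \<F>) + 1 \<le> 2 * card (UNIV - {LA :: 'n leaf})"
    using laminar_tree.excess[OF laminar_tree_completion[OF h(2)]] by linarith
  then show ?thesis
    using card_completion[OF h(2)] card_leaves[where 'n = 'n] card_simplex[OF h(2,1)] h(3) by simp
qed

text \<open>A maximal simplex comes from a binary tree, because any other tree has an extension.\<close>

lemma simplex_in_facet:
  fixes B :: "'n::finite vn set"
  assumes B: "B \<in> simplices" shows "\<exists>C\<in>simplices. B \<subseteq> C \<and> card C = CARD('n)"
proof -
  obtain C where C: "C \<in> simplices" "B \<subseteq> C" "\<And>D. D \<in> simplices \<Longrightarrow> C \<subseteq> D \<Longrightarrow> C = D"
    using finite_has_maximal2[OF locally_finite_simplices[OF B], of B] B by auto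
  obtain h :: "'n vn \<Rightarrow> 'n vn" and \<F> where h: "h \<in> carrier Gn" "cluster_family \<F>" "C = h ` ray ` \<F>"
    using simplex_some_normal_form[OF C(1)] by blast
  have "card C = CARD('n)"
  proof (rule ccontr)
    assume "card C \<noteq> CARD('n)"
    then have "card C < CARD('n)" using card_simplex_le[OF C(1)] by simp
    then have "card (completion \<F>) + 1 < 2 * card (UNIV - {LA :: 'n leaf})"
      using card_completion[OF h(2)] card_leaves[where 'n = 'n] card_simplex[OF h(2,1)] h(3) by simp
    then obtain F where "F \<notin> completion \<F>" "F \<subseteq> UNIV - {LA}" "F \<noteq> {}" "laminar (insert F (completion \<F>))"
      using laminar_tree.extension_exists[OF laminar_tree_completion[OF h(2)]] by blast
    then have F: "F \<notin> \<F>" "cluster_family (insert F \<F>)" using cluster_family_insert[OF h(2)] by blast+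
    have "h ` ray ` insert F \<F> \<in> simplices"
      using simplex_image[OF h(1) cluster_family_simplex[OF F(2)]] .
    moreover have "C \<subseteq> h ` ray ` insert F \<F>" unfolding h(3) by blast
    ultimately have "C = h ` ray ` insert F \<F>" using C(3) by blast
    then have "card \<F> = card (insert F \<F>)"
      using card_simplex[OF h(2,1)] card_simplex[OF F(2) h(1)] h(3) by simp
    then show False using F(1) by simp
  qed
  then show ?thesis using C by blast
qed

text \<open>
  For clusters of one family this is part of independence; here the two clusters are unrelated,
  and the coordinates of the rays have to be compared.
\<close>

lemma inj_on_ray_clusters:
  "inj_on ray {F :: 'n::finite leaf set. LA \<notin> F \<and> F \<noteq> UNIV - {LA} \<and> (F = {LB} \<or> 2 \<le> card F)}"
proof (rule inj_onI)
  have sub: "E \<subseteq> F" if E: "LA \<notin> E" "E \<noteq> UNIV - {LA}" "LB \<in> E" "LA \<notin> F" "LB \<in> F" "ray E = ray F"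
    for E F :: "'n leaf set"
  proof
    fix i assume i: "i \<in> E"
    obtain j where j: "j \<notin> E" "j \<noteq> LA" using E(1,2) by blast
    then obtain l where l: "j = Leg l" using E(3) by (cases j) auto
    show "i \<in> F"
    proof (cases i)
      case (Leg k)
      have "offset k l (ray E) = 1" using i j l Leg E(1,3) by (simp add: offset_ray)
      moreover have "offset k l (ray F) = of_bool (Leg k \<in> F) - of_bool (Leg l \<in> F)"
        using E(4,5) by (simp add: offset_ray)
      ultimately have "Leg k \<in> F" unfolding E(6) by (cases "Leg k \<in> F"; cases "Leg l \<in> F") auto
      then show ?thesis using Leg by simp
    qed (use i E in auto)
  qed
  fix E F :: "'n leaf set" assume E: "E \<in> {F. LA \<notin> F \<and> F \<noteq> UNIV - {LA} \<and> (F = {LB} \<or> 2 \<le> card F)}"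
    and F: "F \<in> {F. LA \<notin> F \<and> F \<noteq> UNIV - {LA} \<and> (F = {LB} \<or> 2 \<le> card F)}" and eq: "ray E = ray F"
  have "circ (ray E) = circ (ray F)" using eq by simp
  moreover have "circ (ray E) = of_bool (LB \<in> E)" "circ (ray F) = of_bool (LB \<in> F)"
    using E F by (simp_all add: circ_ray)
  ultimately have "LB \<in> E \<longleftrightarrow> LB \<in> F" by (cases "LB \<in> E"; cases "LB \<in> F") simp_all
  then consider "LB \<in> E" "LB \<in> F" | "LB \<notin> E" "LB \<notin> F" by blast
  then show "E = F"
  proof cases
    case 1
    have "E \<subseteq> F" by (rule sub) (use 1 E F eq in simp_all)
    moreover have "F \<subseteq> E" by (rule sub) (use 1 E F eq in simp_all)
    ultimately show ?thesis by blast
  next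
    case 2
    have LA: "LA \<notin> E" "LA \<notin> F" using E F by auto
    note rE = ray_tree[OF LA(1) 2(1)] and rF = ray_tree[OF LA(2) 2(2)]
    have "2 \<le> card E" "2 \<le> card F" using E F 2 by auto
    then have c: "2 \<le> card {k. Leg k \<in> E}" "2 \<le> card {k. Leg k \<in> F}" unfolding rE(3) rF(3) by auto
    have "tree_ray {k. Leg k \<in> E} = tree_ray {k. Leg k \<in> F}" unfolding rE(1)[symmetric] rF(1)[symmetric] by (rule eq)
    then have "{k. Leg k \<in> E} = {k. Leg k \<in> F}" by (rule tree_ray_inject[OF c])
    then have "Leg ` {k. Leg k \<in> E} = Leg ` {k. Leg k \<in> F}" by (rule arg_cong)
    then show ?thesis unfolding rE(2) rF(2) .
  qed
qed

text \<open>
  The nodes \<open>T1\<close>, \<open>T2\<close>, \<open>T3\<close> and their union belong to the tree, so that by \<open>ray_resolutions\<close> the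
  sum of the new rays is a combination of the old ones; the rays of single leaves other than \<open>B\<close>
  vanish, and the root has the ray of \<open>{B}\<close>.
\<close>

lemma balance_codimension_one:
  fixes B :: "'n::finite vn set"
  assumes B: "B \<in> simplices" and card: "card B + 1 = CARD('n)"
  shows "\<Sum>{u. u \<notin> B \<and> insert u B \<in> simplices} \<in> span B"
proof -
  let ?cl = "{F :: 'n leaf set. LA \<notin> F \<and> F \<noteq> UNIV - {LA} \<and> (F = {LB} \<or> 2 \<le> card F)}"
  obtain v where v: "v \<in> B" "v \<in> cycle_rays" using simplicesD(2)[OF B] by blast
  obtain g h :: "'n vn \<Rightarrow> 'n vn" and \<F> where gh: "g \<in> carrier Gn" "h \<in> carrier Gn"
    "\<And>x. h (g x) = x" "\<And>x. g (h x) = x" "cluster_family \<F>" "g ` B = ray ` \<F>" "B = h ` ray ` \<F>"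
    using simplex_normal_form[OF B v] by metis
  have \<F>cl: "\<G> \<subseteq> ?cl" if "cluster_family \<G>" for \<G> using cluster_familyD[OF that] by blast
  have "card (completion \<F>) + 2 = 2 * card (UNIV - {LA :: 'n leaf})"
    using card_completion[OF gh(5)] card_leaves[where 'n = 'n] card_simplex[OF gh(5,2)] gh(7) card by simp
  then obtain T1 T2 T3 where T: "T1 \<in> completion \<F>" "T2 \<in> completion \<F>" "T3 \<in> completion \<F>"
    "T1 \<union> T2 \<union> T3 \<in> completion \<F>"
    "T1 \<inter> T2 = {}" "T1 \<inter> T3 = {}" "T2 \<inter> T3 = {}" "T1 \<noteq> {}" "T2 \<noteq> {}" "T3 \<noteq> {}"
    and ext: "{F. F \<notin> completion \<F> \<and> F \<subseteq> UNIV - {LA} \<and> F \<noteq> {} \<and> laminar (insert F (completion \<F>))}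
      = {T1 \<union> T2, T1 \<union> T3, T2 \<union> T3}"
    by (rule laminar_tree.codimension_one_extensions[OF laminar_tree_completion[OF gh(5)]])
  define E where "E = {T1 \<union> T2, T1 \<union> T3, T2 \<union> T3}"
  have E: "F \<in> E \<longleftrightarrow> F \<notin> \<F> \<and> cluster_family (insert F \<F>)" for F
    unfolding E_def ext[symmetric] mem_Collect_eq cluster_family_insert[OF gh(5)] by blast
  have link: "{u. u \<notin> B \<and> insert u B \<in> simplices} = h ` ray ` E"
  proof (intro equalityI subsetI)
    fix u assume u: "u \<in> {u. u \<notin> B \<and> insert u B \<in> simplices}"
    have img: "g ` insert u B = insert (g u) (ray ` \<F>)" using gh(6) by simp
    have "ray {LB} \<in> g ` insert u B" unfolding img using cluster_familyD(2)[OF gh(5)] by blast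
    then obtain \<G> where \<G>: "cluster_family \<G>" "insert (g u) (ray ` \<F>) = ray ` \<G>"
      using simplex_cluster_family[OF simplex_image[OF gh(1)], of "insert u B"] u img by auto
    have "g u \<in> ray ` \<G>" using \<G>(2) by blast
    then obtain F where F: "F \<in> \<G>" "ray F = g u" by auto
    have mem: "D \<in> \<G> \<longleftrightarrow> D = F \<or> D \<in> \<F>" if "D \<in> ?cl" for D
    proof -
      have "D \<in> \<G> \<longleftrightarrow> ray D \<in> ray ` \<G>"
        using inj_on_image_mem_iff[OF inj_on_ray_clusters that \<F>cl[OF \<G>(1)]] by simp
      also have "\<dots> \<longleftrightarrow> ray D = ray F \<or> ray D \<in> ray ` \<F>" unfolding \<G>(2)[symmetric] F(2) by blast
      also have "ray D = ray F \<longleftrightarrow> D = F"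
        using inj_on_eq_iff[OF inj_on_ray_clusters that] F(1) \<F>cl[OF \<G>(1)] by blast
      also have "ray D \<in> ray ` \<F> \<longleftrightarrow> D \<in> \<F>"
        using inj_on_image_mem_iff[OF inj_on_ray_clusters that \<F>cl[OF gh(5)]] by simp
      finally show ?thesis .
    qed
    have "\<G> = insert F \<F>"
    proof (intro equalityI subsetI)
      fix D assume "D \<in> \<G>"
      then show "D \<in> insert F \<F>" using mem[OF subsetD[OF \<F>cl[OF \<G>(1)]]] by simp
    next
      fix D assume D: "D \<in> insert F \<F>"
      then have "D \<in> ?cl" using subsetD[OF \<F>cl[OF \<G>(1)] F(1)] subsetD[OF \<F>cl[OF gh(5)], of D] by blast
      then show "D \<in> \<G>" using mem D by blast
    qed
    moreover have "F \<notin> \<F>"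
    proof
      assume "F \<in> \<F>"
      then have "h (ray F) \<in> B" using gh(7) by blast
      then show False using F(2) gh(3) u by simp
    qed
    ultimately have "F \<in> E" using E \<G>(1) by simp
    moreover have "u = h (ray F)" using F(2) gh(3) by simp
    ultimately show "u \<in> h ` ray ` E" by blast
  next
    fix u assume "u \<in> h ` ray ` E"
    then obtain F where F: "F \<in> E" "u = h (ray F)" by blast
    have F': "F \<notin> \<F>" "cluster_family (insert F \<F>)" using F(1) E by blast+
    have "insert u B = h ` ray ` insert F \<F>" using F(2) gh(7) by simp
    then have ins: "insert u B \<in> simplices" using simplex_image[OF gh(2) cluster_family_simplex[OF F'(2)]] by simp
    have "card (insert u B) = card (insert F \<F>)"
      using \<open>insert u B = h ` ray ` insert F \<F>\<close> card_simplex[OF F'(2) gh(2)] by simp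
    also have "\<dots> = Suc (card B)" using F'(1) card_simplex[OF gh(5,2)] gh(7) by simp
    finally have "u \<notin> B" by (metis insert_absorb n_not_Suc_n)
    then show "u \<in> {u. u \<notin> B \<and> insert u B \<in> simplices}" using ins by simp
  qed
  have "E \<subseteq> ?cl"
  proof
    fix F assume "F \<in> E"
    then have "cluster_family (insert F \<F>)" using E by blast
    from subsetD[OF \<F>cl[OF this] insertI1] show "F \<in> ?cl" .
  qed
  then have inj: "inj_on ray E" using inj_on_ray_clusters inj_on_subset by blast
  have "\<Sum>(h ` ray ` E) = (\<Sum>F\<in>E. h (ray F))"
    using inj inj_Gn[OF gh(2)] by (simp add: sum.reindex inj_on_subset[OF inj_Gn[OF gh(2)]])
  also have "\<dots> = h (\<Sum>F\<in>E. ray F)" by (simp add: linear_sum[OF linear_Gn[OF gh(2)]])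
  also have "(\<Sum>F\<in>E. ray F) = ray (T1 \<union> T2) + ray (T1 \<union> T3) + ray (T2 \<union> T3)"
  proof -
    have "T1 \<union> T2 \<noteq> T1 \<union> T3" "T1 \<union> T2 \<noteq> T2 \<union> T3" "T1 \<union> T3 \<noteq> T2 \<union> T3" using T(5-10) by blast+
    then show ?thesis unfolding E_def by (simp add: add.assoc)
  qed
  also have "\<dots> = ray T1 + ray T2 + ray T3 + ray (T1 \<union> T2 \<union> T3)" by (rule ray_resolutions[OF T(5-7)])
  finally have sum: "\<Sum>(h ` ray ` E) = h (ray T1 + ray T2 + ray T3 + ray (T1 \<union> T2 \<union> T3))" .
  have in_span: "ray F \<in> span (ray ` \<F>)" if F: "F \<in> completion \<F>" for F
  proof -
    have LB: "ray {LB} \<in> span (ray ` \<F>)" using cluster_familyD(2)[OF gh(5)] by (intro span_base) blast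
    consider "F \<in> \<F>" | "F = UNIV - {LA}" | x where "x \<noteq> LA" "F = {x}"
      using F unfolding completion_def by auto
    then show ?thesis
    proof cases
      case 1 then show ?thesis by (simp add: span_base)
    next
      case 2 then show ?thesis using LB by (simp add: ray_full)
    next
      case (3 x) then show ?thesis using LB by (cases x) (auto simp: ray_leg span_zero)
    qed
  qed
  have "ray T1 + ray T2 + ray T3 + ray (T1 \<union> T2 \<union> T3) \<in> span (ray ` \<F>)"
    using in_span T(1-4) by (intro span_add)
  then have "h (ray T1 + ray T2 + ray T3 + ray (T1 \<union> T2 \<union> T3)) \<in> span (h ` ray ` \<F>)"
    unfolding linear_span_image[OF linear_Gn[OF gh(2)]] by blast
  then show ?thesis unfolding link sum gh(7)[symmetric] .
qed

section \<open>Cuts in graphs\<close>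

definition crosses :: "'l graph \<Rightarrow> nat set \<Rightarrow> nat \<Rightarrow> bool" where
  "crosses G P e \<longleftrightarrow> (tail G e \<in> P) \<noteq> (head G e \<in> P)"

text \<open>The bridge separates \<open>P\<close> from its complement; either side may play the part of \<open>P\<close>.\<close>

definition bridge :: "'l graph \<Rightarrow> nat \<Rightarrow> nat set \<Rightarrow> bool" where
  "bridge G e P \<longleftrightarrow> e \<in> edges G \<and> (\<forall>f\<in>edges G. crosses G P f \<longleftrightarrow> f = e)"

definition reach :: "'l graph \<Rightarrow> nat set \<Rightarrow> (nat \<times> nat) set" where
  "reach G Q = {(a, b). \<exists>e\<in>Q. joins G e a b}\<^sup>*"

lemma joins_crosses: "joins G e a b \<Longrightarrow> crosses G P e \<longleftrightarrow> (a \<in> P) \<noteq> (b \<in> P)"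
  by (auto simp: joins_def crosses_def)

lemma even_changes: "even (card {i. i < n \<and> f i \<noteq> f (Suc i)}) \<longleftrightarrow> (f 0 = (f n :: bool))"
proof (induction n)
  case (Suc n)
  have "{i. i < Suc n \<and> f i \<noteq> f (Suc i)} =
      (if f n \<noteq> f (Suc n) then insert n {i. i < n \<and> f i \<noteq> f (Suc i)} else {i. i < n \<and> f i \<noteq> f (Suc i)})"
    by (auto simp: less_Suc_eq)
  then show ?case using Suc by auto
qed simp

lemma distinct_count:
  assumes "distinct es"
  shows "card {e \<in> set es. Q e} = card {i. i < length es \<and> Q (es ! i)}"
proof -
  have "{e \<in> set es. Q e} = (!) es ` {i. i < length es \<and> Q (es ! i)}"
    by (auto simp: in_set_conv_nth)
  moreover have "inj_on ((!) es) {i. i < length es \<and> Q (es ! i)}"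
    using assms by (auto simp: inj_on_def nth_eq_iff_index_eq)
  ultimately show ?thesis by (simp add: card_image)
qed

text \<open>On the way around a cycle, \<open>P\<close> is entered as often as it is left.\<close>

lemma cycle_crosses_evenly:
  assumes "simple_cycle G vs es" shows "even (card {e \<in> set es. crosses G P e})"
proof -
  define n where "n = length es"
  have c: "distinct es" "n > 0" "\<And>i. i < n \<Longrightarrow> joins G (es ! i) (vs ! i) (vs ! (Suc i mod n))"
    using assms by (auto simp: simple_cycle_def n_def)
  define f where "f i \<longleftrightarrow> vs ! (i mod n) \<in> P" for i
  have "crosses G P (es ! i) \<longleftrightarrow> f i \<noteq> f (Suc i)" if "i < n" for i
    using joins_crosses[OF c(3)[OF that], of P] that by (simp add: f_def)
  then have "{i. i < n \<and> crosses G P (es ! i)} = {i. i < n \<and> f i \<noteq> f (Suc i)}" by auto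
  moreover have "f 0 = f n" by (simp add: f_def)
  ultimately show ?thesis unfolding distinct_count[OF c(1)] n_def[symmetric] using even_changes[of n f] by simp
qed

lemma simple_path_edge_once:
  assumes p: "simple_path G vs es" and ij: "i < length es" "j < length es" "es ! i = es ! j"
  shows "i = j"
proof -
  have p': "distinct vs" "length vs = Suc (length es)"
    "\<And>i. i < length es \<Longrightarrow> joins G (es ! i) (vs ! i) (vs ! Suc i)"
    using p by (auto simp: simple_path_def)
  have "{vs ! i, vs ! Suc i} = {vs ! j, vs ! Suc j}"
    using p'(3)[OF ij(1)] p'(3)[OF ij(2)] ij(3) by (auto simp: joins_def)
  then have "(vs ! i = vs ! j \<or> vs ! i = vs ! Suc j) \<and> (vs ! Suc i = vs ! j \<or> vs ! Suc i = vs ! Suc j)"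
    by blast
  then show ?thesis using p'(1,2) ij(1,2) by (auto simp: nth_eq_iff_index_eq)
qed

text \<open>A path uses an edge at most once, and it changes sides exactly at the bridge.\<close>

lemma path_crosses_bridge:
  assumes p: "simple_path G vs es" and b: "bridge G e P"
  shows "e \<in> set es \<longleftrightarrow> (hd vs \<in> P) \<noteq> (last vs \<in> P)"
proof -
  define n where "n = length es"
  have p': "length vs = Suc n" "\<And>i. i < n \<Longrightarrow> joins G (es ! i) (vs ! i) (vs ! Suc i)"
    using p by (auto simp: simple_path_def n_def)
  then have "vs \<noteq> []" by auto
  then have ends: "hd vs = vs ! 0" "last vs = vs ! n" using p'(1) by (auto simp: hd_conv_nth last_conv_nth)
  have "(vs ! i \<in> P) \<noteq> (vs ! Suc i \<in> P) \<longleftrightarrow> es ! i = e" if "i < n" for i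
  proof -
    have "es ! i \<in> edges G" using p'(2)[OF that] by (simp add: joins_def)
    then show ?thesis using b joins_crosses[OF p'(2)[OF that], of P] unfolding bridge_def by blast
  qed
  then have eq: "{i. i < n \<and> (vs ! i \<in> P) \<noteq> (vs ! Suc i \<in> P)} = {i. i < n \<and> es ! i = e}" by auto
  show ?thesis
  proof (cases "e \<in> set es")
    case True
    then obtain i where i: "i < n" "es ! i = e" by (auto simp: in_set_conv_nth n_def)
    have "{i. i < n \<and> es ! i = e} = {i}"
      using i simple_path_edge_once[OF p] unfolding n_def by auto
    then have "odd (card {i. i < n \<and> (vs ! i \<in> P) \<noteq> (vs ! Suc i \<in> P)})" unfolding eq by simp
    then show ?thesis using even_changes[of n "\<lambda>i. vs ! i \<in> P"] True ends by simp
  next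
    case False
    then have none: "{i. i < n \<and> es ! i = e} = {}" by (auto simp: n_def)
    have "even (card {i. i < n \<and> (vs ! i \<in> P) \<noteq> (vs ! Suc i \<in> P)})" unfolding eq none by simp
    then show ?thesis using even_changes[of n "\<lambda>i. vs ! i \<in> P"] False ends by simp
  qed
qed

text \<open>A walk that returns to one of its vertices is cut back to the first visit.\<close>

lemma reach_simple_path:
  assumes wf: "wf_graph G" and u: "u \<in> verts G" and r: "(u, v) \<in> reach G Q"
  shows "\<exists>vs es. simple_path G vs es \<and> hd vs = u \<and> last vs = v \<and> set es \<subseteq> Q"
  using r unfolding reach_def
proof (induction rule: rtrancl_induct)
  case base
  have "simple_path G [u] []" using u by (simp add: simple_path_def)
  then show ?case by (intro exI[of _ "[u]"] exI[of _ "[]"]) simp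
next
  case (step y z)
  then obtain vs es where p: "simple_path G vs es" "hd vs = u" "last vs = y" "set es \<subseteq> Q" by blast
  obtain e where e: "e \<in> Q" "joins G e y z" using step(2) by blast
  have p': "set vs \<subseteq> verts G" "distinct vs" "length vs = Suc (length es)"
    "\<And>i. i < length es \<Longrightarrow> joins G (es ! i) (vs ! i) (vs ! Suc i)"
    using p(1) by (auto simp: simple_path_def)
  have ne: "vs \<noteq> []" using p'(3) by auto
  show ?case
  proof (cases "z \<in> set vs")
    case False
    have z: "z \<in> verts G" using e(2) wf by (auto simp: joins_def wf_graph_def)
    have "vs ! length es = y" using p(3) p'(3) ne by (simp add: last_conv_nth)
    then have "simple_path G (vs @ [z]) (es @ [e])"
      using p' False z e(2) by (auto simp: simple_path_def nth_append less_Suc_eq)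
    then show ?thesis using p e(1) ne by (intro exI[of _ "vs @ [z]"] exI[of _ "es @ [e]"]) simp
  next
    case True
    then obtain k where k: "k < length vs" "vs ! k = z" by (auto simp: in_set_conv_nth)
    have "simple_path G (take (Suc k) vs) (take k es)"
      using p' k(1) by (auto simp: simple_path_def dest!: in_set_takeD)
    moreover have "last (take (Suc k) vs) = z" using k by (simp add: take_Suc_conv_app_nth)
    moreover have "hd (take (Suc k) vs) = u" using p(2) ne by (simp add: hd_take)
    moreover have "set (take k es) \<subseteq> Q" using p(4) set_take_subset by fastforce
    ultimately show ?thesis by blast
  qed
qed

text \<open>The set \<open>P\<close> consists of what can be reached from \<open>u\<close> along \<open>Q\<close>.\<close>

lemma component_cut:
  assumes "(u, v) \<notin> reach G Q"
  shows "\<exists>P. u \<in> P \<and> v \<notin> P \<and> (\<forall>e\<in>Q. e \<in> edges G \<longrightarrow> \<not> crosses G P e)"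
proof (intro exI[of _ "{w. (u, w) \<in> reach G Q}"] conjI ballI impI)
  let ?P = "{w. (u, w) \<in> reach G Q}"
  show "u \<in> ?P" by (simp add: reach_def)
  show "v \<notin> ?P" using assms by simp
  have step: "(u, b) \<in> reach G Q" if "(u, a) \<in> reach G Q" "e \<in> Q" "joins G e a b" for a b e
  proof -
    have "(a, b) \<in> {(a, b). \<exists>e\<in>Q. joins G e a b}" using that(2,3) by blast
    then show ?thesis using that(1) unfolding reach_def by (rule rtrancl_into_rtrancl[rotated])
  qed
  show "\<not> crosses G ?P e" if "e \<in> Q" "e \<in> edges G" for e
  proof -
    have "joins G e (tail G e) (head G e)" "joins G e (head G e) (tail G e)"
      using that(2) by (auto simp: joins_def)
    then show ?thesis using step that(1) unfolding crosses_def by blast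
  qed
qed

lemma connected_cut:
  assumes c: "connected_graph G" and uv: "u \<in> verts G" "v \<in> verts G" "u \<in> P" "v \<notin> P"
  obtains e where "e \<in> edges G" "crosses G P e"
proof -
  have "(u, v) \<in> {(a, b). \<exists>e. joins G e a b}\<^sup>*" using c uv unfolding connected_graph_def by blast
  then have "v \<in> P \<or> (\<exists>e\<in>edges G. crosses G P e)"
  proof (induction rule: rtrancl_induct)
    case (step y z)
    then obtain e where "joins G e y z" by blast
    then have "crosses G P e \<longleftrightarrow> (y \<in> P) \<noteq> (z \<in> P)" "e \<in> edges G"
      by (rule joins_crosses) (use \<open>joins G e y z\<close> in \<open>simp add: joins_def\<close>)
    then show ?case using step(3) by blast
  qed (use uv in simp)
  then show thesis using uv(4) that by blast
qed

lemma connectedI: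
  assumes "verts G \<noteq> {}"
    and cut: "\<And>P u v. u \<in> verts G \<Longrightarrow> v \<in> verts G \<Longrightarrow> u \<in> P \<Longrightarrow> v \<notin> P \<Longrightarrow> \<exists>e\<in>edges G. crosses G P e"
  shows "connected_graph G"
  unfolding connected_graph_def
proof (intro conjI ballI)
  fix u v assume uv: "u \<in> verts G" "v \<in> verts G"
  have "(u, v) \<in> reach G UNIV"
  proof (rule ccontr)
    assume "(u, v) \<notin> reach G UNIV"
    from component_cut[OF this] obtain P where P: "u \<in> P" "v \<notin> P" "\<And>e. e \<in> UNIV \<Longrightarrow> e \<in> edges G \<Longrightarrow> \<not> crosses G P e" by blast
    then show False using cut[OF uv P(1,2)] by blast
  qed
  then show "(u, v) \<in> {(a, b). \<exists>e. joins G e a b}\<^sup>*" by (simp add: reach_def)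
qed (rule assms(1))

lemma cycle_through_edge:
  assumes wf: "wf_graph G" and e: "e \<in> edges G" "e \<notin> Q" and r: "(head G e, tail G e) \<in> reach G Q"
  shows "\<exists>vs es. simple_cycle G vs es \<and> e \<in> set es \<and> set es \<subseteq> insert e Q"
proof -
  have "head G e \<in> verts G" using wf e(1) by (simp add: wf_graph_def)
  then obtain vs es where p: "simple_path G vs es" "hd vs = head G e" "last vs = tail G e" "set es \<subseteq> Q"
    using reach_simple_path[OF wf _ r] by blast
  have p': "distinct vs" "length vs = Suc (length es)"
    "\<And>i. i < length es \<Longrightarrow> joins G (es ! i) (vs ! i) (vs ! Suc i)"
    using p(1) by (auto simp: simple_path_def)
  have ne: "vs \<noteq> []" using p'(2) by auto
  have ends: "vs ! 0 = head G e" "vs ! length es = tail G e"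
    using p(2,3) p'(2) ne by (auto simp: hd_conv_nth last_conv_nth)
  have "distinct es" using simple_path_edge_once[OF p(1)] by (auto simp: distinct_conv_nth)
  then have "distinct (es @ [e])" using p(4) e(2) by auto
  moreover have "joins G ((es @ [e]) ! i) (vs ! i) (vs ! (Suc i mod length (es @ [e])))"
    if "i < length (es @ [e])" for i
  proof (cases "i = length es")
    case True
    then show ?thesis using ends e(1) by (simp add: joins_def)
  next
    case False
    then show ?thesis using that p'(3)[of i] by (simp add: nth_append)
  qed
  ultimately have "simple_cycle G vs (es @ [e])"
    using p'(1,2) by (simp add: simple_cycle_def)
  then show ?thesis using p(4) by (intro exI[of _ vs] exI[of _ "es @ [e]"]) auto
qed

section \<open>Graphs with one cycle\<close>

locale unicyclic_graph =
  fixes G :: "'l graph"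
  assumes wf: "wf_graph G" and connected: "connected_graph G"
    and one_cycle: "\<exists>!C. \<exists>vs es. simple_cycle G vs es \<and> C = set es"
begin

lemma set_cycle: "simple_cycle G vs es \<Longrightarrow> set es = cycle_edges G"
proof -
  assume c: "simple_cycle G vs es"
  have "set es' = set es" if "simple_cycle G vs' es'" for vs' es' using one_cycle c that by blast
  then have "{set es | vs es. simple_cycle G vs es} = {set es}" using c by blast
  then show ?thesis unfolding cycle_edges_def by simp
qed

lemma a_cycle: obtains vs es where "simple_cycle G vs es" "set es = cycle_edges G"
proof -
  obtain vs es where "simple_cycle G vs es" using one_cycle by blast
  then show thesis using that set_cycle by metis
qed

lemma cycle_edges_subset: "cycle_edges G \<subseteq> edges G"
proof -
  obtain vs es where c: "simple_cycle G vs es" "set es = cycle_edges G" by (rule a_cycle)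
  have "es ! i \<in> edges G" if "i < length es" for i
    using c(1) that by (auto simp: simple_cycle_def joins_def)
  then show ?thesis unfolding c(2)[symmetric] by (auto simp: in_set_conv_nth)
qed

lemma even_crossings: "even (card {e \<in> cycle_edges G. crosses G P e})"
  using a_cycle cycle_crosses_evenly by metis

lemma finite_cycle: "finite (cycle_edges G)"
  using cycle_edges_subset wf finite_subset unfolding wf_graph_def by blast

lemma cycle_edge_not_bridge:
  assumes "e \<in> cycle_edges G" "crosses G P e"
  obtains f where "f \<in> cycle_edges G" "f \<noteq> e" "crosses G P f"
proof -
  have "{f \<in> cycle_edges G. crosses G P f} \<noteq> {e}" using even_crossings[of P] by auto
  then show thesis using that assms by blast
qed

text \<open>Removing a cycle edge leaves a tree: every other edge becomes a bridge.\<close>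

lemma bridge_up_to_cycle_edge:
  assumes e: "e \<in> cycle_edges G" and f: "f \<in> edges G" "f \<noteq> e"
  shows "\<exists>P. crosses G P f \<and> (\<forall>h\<in>edges G. h \<noteq> e \<longrightarrow> h \<noteq> f \<longrightarrow> \<not> crosses G P h)"
proof -
  let ?Q = "edges G - {e, f}"
  have "(head G f, tail G f) \<notin> reach G ?Q"
  proof
    assume r: "(head G f, tail G f) \<in> reach G ?Q"
    have "f \<notin> ?Q" by blast
    from cycle_through_edge[OF wf f(1) this r] obtain vs es
      where c: "simple_cycle G vs es" "set es \<subseteq> insert f ?Q" by blast
    then show False using set_cycle[OF c(1)] e f(2) by blast
  qed
  from component_cut[OF this] obtain P where P: "head G f \<in> P" "tail G f \<notin> P" "\<And>h. h \<in> ?Q \<Longrightarrow> h \<in> edges G \<Longrightarrow> \<not> crosses G P h" by blast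
  have "crosses G P f" using P(1,2) by (simp add: crosses_def)
  moreover have "\<forall>h\<in>edges G. h \<noteq> e \<longrightarrow> h \<noteq> f \<longrightarrow> \<not> crosses G P h" using P(3) by simp
  ultimately show ?thesis by blast
qed

lemma non_cycle_bridge:
  assumes f: "f \<in> edges G" "f \<notin> cycle_edges G" obtains P where "bridge G f P"
proof -
  let ?Q = "edges G - {f}"
  have "(head G f, tail G f) \<notin> reach G ?Q"
  proof
    assume r: "(head G f, tail G f) \<in> reach G ?Q"
    have "f \<notin> ?Q" by blast
    from cycle_through_edge[OF wf f(1) this r] obtain vs es
      where c: "simple_cycle G vs es" "f \<in> set es" by blast
    then show False using set_cycle[OF c(1)] f(2) by blast
  qed
  from component_cut[OF this] obtain P where P: "head G f \<in> P" "tail G f \<notin> P" "\<And>h. h \<in> ?Q \<Longrightarrow> h \<in> edges G \<Longrightarrow> \<not> crosses G P h" by blast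
  have "crosses G P f" using P(1,2) by (simp add: crosses_def)
  then have "bridge G f P" unfolding bridge_def using P(3) f(1) by blast
  then show thesis by (rule that)
qed

end

section \<open>Metric trees\<close>

definition tree_graph :: "'l graph \<Rightarrow> bool" where
  "tree_graph T \<longleftrightarrow> wf_graph T \<and> connected_graph T \<and> (\<forall>e\<in>edges T. \<exists>P. bridge T e P)"

lemma cls_sum: "cls (\<Sum>e\<in>E. c e *\<^sub>R x e) = (\<Sum>e\<in>E. c e *\<^sub>R cls (x e))"
  by (induction E rule: infinite_finite_induct)
    (simp_all add: zero_vn.abs_eq plus_vn.abs_eq[symmetric] scaleR_vn.abs_eq[symmetric])

lemma leaf_path:
  assumes "wf_graph T" "connected_graph T"
  obtains vs es where "simple_path T vs es" "hd vs = leaf T i" "last vs = leaf T j"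
proof -
  have v: "leaf T i \<in> verts T" "leaf T j \<in> verts T" using assms(1) by (auto simp: wf_graph_def)
  then have "(leaf T i, leaf T j) \<in> reach T UNIV"
    using assms(2) by (simp add: connected_graph_def reach_def)
  then show thesis using reach_simple_path[OF assms(1) v(1)] that by blast
qed

lemma path_edges_separate:
  assumes T: "wf_graph T" "connected_graph T" and P: "\<And>e. e \<in> edges T \<Longrightarrow> bridge T e (P e)"
  shows "path_edges T {i, j} = {e \<in> edges T. (leaf T i \<in> P e) \<noteq> (leaf T j \<in> P e)}"
proof (intro equalityI subsetI)
  fix e assume "e \<in> path_edges T {i, j}"
  then obtain i' j' vs es where e: "{i, j} = {i', j'}" "simple_path T vs es"
    "hd vs = leaf T i'" "last vs = leaf T j'" "e \<in> set es" unfolding path_edges_def by blast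
  obtain n where "n < length es" "es ! n = e" using e(5) by (auto simp: in_set_conv_nth)
  then have E: "e \<in> edges T" using e(2) by (auto simp: simple_path_def joins_def)
  have "(leaf T i' \<in> P e) \<noteq> (leaf T j' \<in> P e)"
    using path_crosses_bridge[OF e(2) P[OF E]] e(3-5) by simp
  moreover have "i = i' \<and> j = j' \<or> i = j' \<and> j = i'" using e(1) by (auto simp: doubleton_eq_iff)
  ultimately show "e \<in> {e \<in> edges T. (leaf T i \<in> P e) \<noteq> (leaf T j \<in> P e)}" using E by auto
next
  fix e assume e: "e \<in> {e \<in> edges T. (leaf T i \<in> P e) \<noteq> (leaf T j \<in> P e)}"
  obtain vs es where p: "simple_path T vs es" "hd vs = leaf T i" "last vs = leaf T j"
    using leaf_path[OF T] by blast
  have "e \<in> set es" using path_crosses_bridge[OF p(1) P] e p(2,3) by simp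
  then show "e \<in> path_edges T {i, j}" unfolding path_edges_def using p by blast
qed

text \<open>In a tree, the path between two leaves consists of the edges that separate them.\<close>

lemma dist_vec_splits:
  fixes T :: "'n::finite leaf graph"
  assumes T: "wf_graph T" "connected_graph T" and P: "\<And>e. e \<in> edges T \<Longrightarrow> bridge T e (P e)"
  shows "cls (dist_vec T len) = (\<Sum>e\<in>edges T. len e *\<^sub>R ray {l. leaf T l \<in> P e})"
proof -
  have fin: "finite (edges T)" using T(1) by (simp add: wf_graph_def)
  have "dist_vec T len = (\<Sum>e\<in>edges T. len e *\<^sub>R split_vec {l. leaf T l \<in> P e})"
  proof (subst vec_eq_iff, intro allI)
    fix S :: "'n pairs"
    obtain i j :: "'n leaf" where S: "i \<noteq> j" "S = pr i j"
      by (cases S rule: pairs_cases) (use leaf.distinct in blast)+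
    have "dist_vec T len $ S = (\<Sum>e\<in>{e \<in> edges T. (leaf T i \<in> P e) \<noteq> (leaf T j \<in> P e)}. len e)"
      using path_edges_separate[OF T P, of i j] S by (simp add: dist_vec_def Rep_pairs_pr)
    also have "\<dots> = (\<Sum>e\<in>edges T. len e * of_bool ((leaf T i \<in> P e) \<noteq> (leaf T j \<in> P e)))"
      using fin by (intro sum.mono_neutral_cong_left) auto
    finally show "dist_vec T len $ S = (\<Sum>e\<in>edges T. len e *\<^sub>R split_vec {l. leaf T l \<in> P e}) $ S"
      using S by (simp add: split_vec_nth)
  qed
  then show ?thesis by (simp add: cls_sum ray_def)
qed

text \<open>
  Two bridges split the vertices into at most three classes: an edge joins the two classes on one
  side of the other bridge, so that a fourth class would not be connected to the rest.
\<close>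

lemma bridges_laminar:
  assumes c: "connected_graph T" and e: "bridge T e P" and f: "bridge T f Q"
    and v: "v1 \<in> verts T" "v1 \<in> P" "v1 \<in> Q" "v2 \<in> verts T" "v2 \<in> P" "v2 \<notin> Q"
      "v3 \<in> verts T" "v3 \<notin> P" "v3 \<in> Q" "v4 \<in> verts T" "v4 \<notin> P" "v4 \<notin> Q"
  shows "e = f"
proof (rule ccontr)
  assume ne: "e \<noteq> f"
  have E: "e \<in> edges T" "f \<in> edges T" "\<And>h. h \<in> edges T \<Longrightarrow> crosses T P h \<longleftrightarrow> h = e"
    "\<And>h. h \<in> edges T \<Longrightarrow> crosses T Q h \<longleftrightarrow> h = f" using e f by (auto simp: bridge_def)
  define Z where "Z = {w. (w \<in> Q \<longleftrightarrow> tail T e \<notin> Q) \<and> (w \<in> P \<longleftrightarrow> tail T f \<notin> P)}"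
  have eQ: "head T e \<in> Q \<longleftrightarrow> tail T e \<in> Q" using E(4)[OF E(1)] ne by (auto simp: crosses_def)
  have fP: "head T f \<in> P \<longleftrightarrow> tail T f \<in> P" using E(3)[OF E(2)] ne by (auto simp: crosses_def)
  have "\<not> crosses T Z h" if h: "h \<in> edges T" for h
  proof -
    consider "h = e" | "h = f" | "h \<noteq> e" "h \<noteq> f" by blast
    then show ?thesis
    proof cases
      case 1 then show ?thesis using eQ by (auto simp: crosses_def Z_def)
    next
      case 2 then show ?thesis using fP by (auto simp: crosses_def Z_def)
    next
      case 3
      then have "\<not> crosses T P h" "\<not> crosses T Q h" using E(3,4)[OF h] by auto
      then show ?thesis by (auto simp: crosses_def Z_def)
    qed
  qed
  moreover obtain z where "z \<in> verts T" "z \<in> Z"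
    using v by (cases "tail T e \<in> Q"; cases "tail T f \<in> P") (auto simp: Z_def)
  moreover obtain z' where "z' \<in> verts T" "z' \<notin> Z"
    using v by (cases "tail T e \<in> Q"; cases "tail T f \<in> P") (auto simp: Z_def)
  ultimately show False using connected_cut[OF c] by blast
qed

text \<open>The side of a bridge that does not contain \<open>A\<close> is the one beyond the edge.\<close>

lemma tree_clusters:
  fixes T :: "'n::finite leaf graph"
  assumes T: "tree_graph T"
  shows "\<exists>L. (\<forall>e\<in>edges T. LA \<notin> L e) \<and> laminar (L ` edges T) \<and>
    (\<forall>len. cls (dist_vec T len) = (\<Sum>e\<in>edges T. len e *\<^sub>R ray (L e))) \<and>
    (\<forall>e P. bridge T e P \<longrightarrow> (LB \<in> L e \<longleftrightarrow> (leaf T LA \<in> P) \<noteq> (leaf T LB \<in> P)))"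
proof -
  have wf: "wf_graph T" and c: "connected_graph T" using T by (auto simp: tree_graph_def)
  have "\<forall>e\<in>edges T. \<exists>P. bridge T e P \<and> leaf T LA \<notin> P"
  proof
    fix e assume "e \<in> edges T"
    then obtain P where P: "bridge T e P" using T by (auto simp: tree_graph_def)
    have "bridge T e (- P)" using P by (auto simp: bridge_def crosses_def)
    then show "\<exists>P. bridge T e P \<and> leaf T LA \<notin> P" using P by blast
  qed
  from bchoice[OF this] obtain P where P: "\<And>e. e \<in> edges T \<Longrightarrow> bridge T e (P e)"
    "\<And>e. e \<in> edges T \<Longrightarrow> leaf T LA \<notin> P e" by blast
  define L where "L e = {l. leaf T l \<in> P e}" for e
  have lv: "leaf T l \<in> verts T" for l using wf by (simp add: wf_graph_def)
  have lam: "laminar (L ` edges T)" unfolding laminar_def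
  proof (intro ballI, rule ccontr)
    fix E F assume "E \<in> L ` edges T" "F \<in> L ` edges T" and not: "\<not> (E \<inter> F = {} \<or> E \<subseteq> F \<or> F \<subseteq> E)"
    then obtain e f where ef: "e \<in> edges T" "E = L e" "f \<in> edges T" "F = L f" by blast
    obtain l1 l2 l3 where "l1 \<in> E" "l1 \<in> F" "l2 \<in> E" "l2 \<notin> F" "l3 \<notin> E" "l3 \<in> F" using not by blast
    then have "leaf T l1 \<in> P e" "leaf T l1 \<in> P f" "leaf T l2 \<in> P e" "leaf T l2 \<notin> P f"
      "leaf T l3 \<notin> P e" "leaf T l3 \<in> P f" unfolding ef L_def by auto
    then have "e = f"
      using bridges_laminar[OF c P(1)[OF ef(1)] P(1)[OF ef(3)], of "leaf T l1" "leaf T l2" "leaf T l3" "leaf T LA"]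
        lv P(2)[OF ef(1)] P(2)[OF ef(3)] by blast
    then show False using not ef by blast
  qed
  have LB: "LB \<in> L e \<longleftrightarrow> (leaf T LA \<in> Q) \<noteq> (leaf T LB \<in> Q)" if Q: "bridge T e Q" for e Q
  proof -
    have e: "e \<in> edges T" using Q by (simp add: bridge_def)
    obtain vs es where p: "simple_path T vs es" "hd vs = leaf T LA" "last vs = leaf T LB"
      using leaf_path[OF wf c] by blast
    show ?thesis
      using path_crosses_bridge[OF p(1) Q] path_crosses_bridge[OF p(1) P(1)[OF e]] p(2,3) P(2)[OF e]
      by (simp add: L_def)
  qed
  have "\<forall>e\<in>edges T. LA \<notin> L e" using P(2) by (simp add: L_def)
  moreover have "\<forall>len. cls (dist_vec T len) = (\<Sum>e\<in>edges T. len e *\<^sub>R ray (L e))"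
    unfolding L_def using dist_vec_splits[OF wf c P(1)] by blast
  moreover have "\<forall>e P. bridge T e P \<longrightarrow> (LB \<in> L e \<longleftrightarrow> (leaf T LA \<in> P) \<noteq> (leaf T LB \<in> P))"
    using LB by (intro allI impI)
  ultimately show ?thesis using lam by (intro exI[of _ L] conjI)
qed

section \<open>Cutting the cycle at a vertex\<close>

text \<open>
  Contracting \<open>v'\<close> to \<open>v\<close> recovers \<open>G\<close> from the cut graph; this is the map \<open>glue\<close> below.
\<close>

locale vertex_cut_graph = unicyclic_graph G for G :: "'n::finite graph" +
  fixes v v' :: nat and St Sh :: "nat set" and Sl :: "'n set"
  assumes v: "v \<in> verts G" "v' \<notin> verts G" and St: "St \<subseteq> {e \<in> edges G. tail G e = v}"
    and Sh: "Sh \<subseteq> {e \<in> edges G. head G e = v}" and Sl: "Sl \<subseteq> {l. leaf G l = v}"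
    and one_end: "card (cycle_edges G \<inter> St) + card (cycle_edges G \<inter> Sh) = 1"
begin

abbreviation "T \<equiv> split_vertex G v v' St Sh Sl"

lemma edges_T: "edges T = edges G" and verts_T: "verts T = insert v' (verts G)"
  and leaf_T: "leaf T LA = v" "leaf T LB = v'"
  by (simp_all add: split_vertex_def)

lemma tail_T: "tail T e = (if e \<in> St then v' else tail G e)"
  and head_T: "head T e = (if e \<in> Sh then v' else head G e)"
  by (simp_all add: split_vertex_def)

lemma wf_T: "wf_graph T"
  using wf v unfolding wf_graph_def by (auto simp: split_vertex_def split: leaf.split)

definition glue :: "nat \<Rightarrow> nat" where "glue w = (if w = v' then v else w)"

lemma glue_T: "e \<in> edges G \<Longrightarrow> glue (tail T e) = tail G e" "e \<in> edges G \<Longrightarrow> glue (head T e) = head G e"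
  using St Sh wf v unfolding glue_def tail_T head_T wf_graph_def by auto

lemma crosses_glue: "e \<in> edges G \<Longrightarrow> crosses T (glue -` P) e \<longleftrightarrow> crosses G P e"
  by (simp add: crosses_def glue_T)

lemma joins_glue: "joins T e a b \<Longrightarrow> joins G e (glue a) (glue b)"
  using glue_T by (auto simp: joins_def edges_T)

lemma one_moved: "card {e \<in> cycle_edges G. (e \<in> St) \<noteq> (e \<in> Sh)} = 1"
proof -
  have fin: "finite (cycle_edges G \<inter> St)" "finite (cycle_edges G \<inter> Sh)" using finite_cycle by auto
  consider "card (cycle_edges G \<inter> St) = 1" "card (cycle_edges G \<inter> Sh) = 0"
    | "card (cycle_edges G \<inter> St) = 0" "card (cycle_edges G \<inter> Sh) = 1" using one_end by linarith
  then show ?thesis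
  proof cases
    case 1
    then have "{e \<in> cycle_edges G. (e \<in> St) \<noteq> (e \<in> Sh)} = cycle_edges G \<inter> St" using fin by auto
    then show ?thesis using 1 by simp
  next
    case 2
    then have "{e \<in> cycle_edges G. (e \<in> St) \<noteq> (e \<in> Sh)} = cycle_edges G \<inter> Sh" using fin by auto
    then show ?thesis using 2 by simp
  qed
qed

text \<open>
  Suppose that no edge of the cut graph crosses \<open>Z\<close>. If \<open>Z\<close> does not separate \<open>v\<close> from \<open>v'\<close>, it
  comes from \<open>G\<close>. Otherwise the edges of \<open>G\<close> that cross \<open>Z\<close> are those that have been moved at one
  end, and just one of them lies on the cycle, whereas a cycle crosses every set evenly.
\<close>

lemma connected_T: "connected_graph T"
proof (rule connectedI)
  show "verts T \<noteq> {}" by (simp add: verts_T)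
  fix Z u w assume uw: "u \<in> verts T" "w \<in> verts T" "u \<in> Z" "w \<notin> Z"
  show "\<exists>e\<in>edges T. crosses T Z e"
  proof (rule ccontr)
    assume none: "\<not> (\<exists>e\<in>edges T. crosses T Z e)"
    have ends: "tail G e \<in> verts G" "head G e \<in> verts G" if "e \<in> edges G" for e
      using wf that by (auto simp: wf_graph_def)
    show False
    proof (cases "v \<in> Z \<longleftrightarrow> v' \<in> Z")
      case True
      have "x \<in> Z \<longleftrightarrow> glue x \<in> Z" for x using True by (simp add: glue_def)
      then have "Z = glue -` Z" by auto
      then have "crosses T Z e \<longleftrightarrow> crosses G Z e" if "e \<in> edges G" for e
        using crosses_glue[OF that, of Z] by simp
      moreover have "glue u \<in> verts G" "glue w \<in> verts G" using uw v by (auto simp: glue_def verts_T)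
      moreover have "glue u \<in> Z" "glue w \<notin> Z" using uw \<open>\<And>x. x \<in> Z \<longleftrightarrow> glue x \<in> Z\<close> by auto
      ultimately show False using connected_cut[OF connected] none edges_T by metis
    next
      case False
      have "crosses G Z e \<longleftrightarrow> (e \<in> St) \<noteq> (e \<in> Sh)" if e: "e \<in> edges G" for e
      proof -
        have t: "tail T e \<in> Z \<longleftrightarrow> (tail G e \<in> Z) \<noteq> (e \<in> St)"
          using St False by (auto simp: tail_T)
        have h: "head T e \<in> Z \<longleftrightarrow> (head G e \<in> Z) \<noteq> (e \<in> Sh)"
          using Sh False by (auto simp: head_T)
        have "(tail T e \<in> Z) = (head T e \<in> Z)" using none e edges_T by (auto simp: crosses_def)
        then show ?thesis unfolding t h crosses_def by blast
      qed
      then have "{e \<in> cycle_edges G. crosses G Z e} = {e \<in> cycle_edges G. (e \<in> St) \<noteq> (e \<in> Sh)}"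
        using cycle_edges_subset by blast
      then show False using even_crossings[of Z] one_moved by simp
    qed
  qed
qed

text \<open>
  A path from \<open>v\<close> to \<open>v'\<close> in the cut graph is a simple cycle of \<open>G\<close>, hence uses all cycle edges.
\<close>

lemma cycle_edge_bridge:
  assumes e: "e \<in> cycle_edges G" obtains P where "bridge T e P" "v \<in> P" "v' \<notin> P"
proof -
  have vv: "v \<noteq> v'" using v by blast
  have "(v, v') \<notin> reach T (edges T - {e})"
  proof
    assume "(v, v') \<in> reach T (edges T - {e})"
    then obtain vs es where p: "simple_path T vs es" "hd vs = v" "last vs = v'" "set es \<subseteq> edges T - {e}"
      using reach_simple_path[OF wf_T, of v v'] v(1) verts_T by blast
    have p': "set vs \<subseteq> verts T" "distinct vs" "length vs = Suc (length es)"
      "\<And>i. i < length es \<Longrightarrow> joins T (es ! i) (vs ! i) (vs ! Suc i)"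
      using p(1) by (auto simp: simple_path_def)
    have ne: "vs \<noteq> []" using p'(3) by auto
    have ends: "vs ! 0 = v" "vs ! length es = v'"
      using p(2,3) p'(3) ne by (auto simp: hd_conv_nth last_conv_nth)
    then have "es \<noteq> []" using vv by auto
    have inner: "vs ! i \<noteq> v'" if "i < length es" for i
      using nth_eq_iff_index_eq[OF p'(2), of i "length es"] that p'(3) ends(2) by auto
    have "simple_cycle G (butlast vs) es"
      unfolding simple_cycle_def
    proof (intro conjI allI impI)
      show "distinct (butlast vs)" using p'(2) by (rule distinct_butlast)
      show "distinct es" using simple_path_edge_once[OF p(1)] by (auto simp: distinct_conv_nth)
      show "length (butlast vs) = length es" using p'(3) by simp
      fix i assume i: "i < length es"
      have "joins G (es ! i) (glue (vs ! i)) (glue (vs ! Suc i))" using joins_glue[OF p'(4)[OF i]] .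
      moreover have "glue (vs ! i) = butlast vs ! i"
        using inner[OF i] i p'(3) by (simp add: glue_def nth_butlast)
      moreover have "glue (vs ! Suc i) = butlast vs ! (Suc i mod length es)"
      proof (cases "Suc i = length es")
        case True
        then show ?thesis using ends p'(3) \<open>es \<noteq> []\<close> by (simp add: glue_def nth_butlast)
      next
        case False
        then have "Suc i < length es" using i by simp
        then show ?thesis using inner[of "Suc i"] p'(3) by (simp add: glue_def nth_butlast)
      qed
      ultimately show "joins G (es ! i) (butlast vs ! i) (butlast vs ! (Suc i mod length es))" by simp
    qed (rule \<open>es \<noteq> []\<close>)
    then have "set es = cycle_edges G" by (rule set_cycle)
    then show False using e p(4) by blast
  qed
  from component_cut[OF this] obtain P where P: "v \<in> P" "v' \<notin> P" "\<And>h. h \<in> edges T - {e} \<Longrightarrow> h \<in> edges T \<Longrightarrow> \<not> crosses T P h" by blast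
  obtain h where h: "h \<in> edges T" "crosses T P h"
    using connected_cut[OF connected_T _ _ P(1,2)] v(1) verts_T by blast
  then have "h = e" using P(3) by blast
  then have "bridge T e P" unfolding bridge_def using h P(3) by blast
  then show thesis using that P(1,2) by blast
qed

lemma tree_edge_bridge:
  assumes "e \<in> edges G" "e \<notin> cycle_edges G" obtains P where "bridge T e P" "v \<in> P \<longleftrightarrow> v' \<in> P"
proof -
  obtain P where P: "bridge G e P" using non_cycle_bridge[OF assms] .
  have "bridge T e (glue -` P)"
    using P crosses_glue edges_T by (auto simp: bridge_def)
  moreover have "v \<in> glue -` P \<longleftrightarrow> v' \<in> glue -` P" using v by (auto simp: glue_def)
  ultimately show thesis by (rule that)
qed

lemma tree_T: "tree_graph T"
  unfolding tree_graph_def edges_T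
  using wf_T connected_T cycle_edge_bridge tree_edge_bridge by metis

lemma cut_clusters:
  "\<exists>L. (\<forall>e\<in>edges G. LA \<notin> L e) \<and> laminar (L ` edges G) \<and>
    (\<forall>len. cls (dist_vec T len) = (\<Sum>e\<in>edges G. len e *\<^sub>R ray (L e))) \<and>
    (\<forall>e\<in>edges G. LB \<in> L e \<longleftrightarrow> e \<in> cycle_edges G)"
proof -
  from tree_clusters[OF tree_T] obtain L where L: "\<forall>e\<in>edges T. LA \<notin> L e" "laminar (L ` edges T)"
    "\<forall>len. cls (dist_vec T len) = (\<Sum>e\<in>edges T. len e *\<^sub>R ray (L e))"
    "\<And>e P. bridge T e P \<Longrightarrow> LB \<in> L e \<longleftrightarrow> (leaf T LA \<in> P) \<noteq> (leaf T LB \<in> P)" by blast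
  have "LB \<in> L e \<longleftrightarrow> e \<in> cycle_edges G" if e: "e \<in> edges G" for e
  proof (cases "e \<in> cycle_edges G")
    case True
    then obtain P where "bridge T e P" "v \<in> P" "v' \<notin> P" by (rule cycle_edge_bridge)
    then show ?thesis using L(4)[of e P] True leaf_T by simp
  next
    case False
    obtain P where "bridge T e P" "v \<in> P \<longleftrightarrow> v' \<in> P" using tree_edge_bridge[OF e False] .
    then show ?thesis using L(4)[of e P] False leaf_T by simp
  qed
  then show ?thesis using L(1-3) unfolding edges_T by blast
qed

end

section \<open>The cone of a cut curve\<close>

text \<open>
  Different edges of a cut curve may have the same ray: after a cut inside an edge, both of its
  halves have the ray of \<open>{B}\<close>. Their coefficients are then added.
\<close>

lemma combinations_image:
  fixes \<phi> :: "'e \<Rightarrow> 'v::real_vector"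
  assumes fin: "finite E" and A: "0 \<in> A" "\<And>x y. x \<in> A \<Longrightarrow> y \<in> A \<Longrightarrow> x + y \<in> A"
  shows "{\<Sum>e\<in>E. a e *\<^sub>R \<phi> e | a. \<forall>e\<in>E. a e \<in> A} =
    {\<Sum>b\<in>\<phi> ` E - {0}. c b *\<^sub>R b | c. \<forall>b\<in>\<phi> ` E - {0}. c b \<in> A}"
proof (intro equalityI subsetI)
  fix x assume "x \<in> {\<Sum>e\<in>E. a e *\<^sub>R \<phi> e | a. \<forall>e\<in>E. a e \<in> A}"
  then obtain a where a: "\<forall>e\<in>E. a e \<in> A" "x = (\<Sum>e\<in>E. a e *\<^sub>R \<phi> e)" by blast
  define c where "c b = (\<Sum>e\<in>{e \<in> E. \<phi> e = b}. a e)" for b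
  have closed: "(\<Sum>e\<in>F. a e) \<in> A" if "finite F" "F \<subseteq> E" for F
    using that by (induction F) (auto simp: A a(1))
  have "x = (\<Sum>b\<in>\<phi> ` E. \<Sum>e\<in>{e \<in> E. \<phi> e = b}. a e *\<^sub>R \<phi> e)"
    unfolding a(2) by (rule sum.image_gen[OF fin])
  also have "\<dots> = (\<Sum>b\<in>\<phi> ` E. c b *\<^sub>R b)"
    unfolding c_def scaleR_sum_left by (intro sum.cong) auto
  also have "\<dots> = (\<Sum>b\<in>\<phi> ` E - {0}. c b *\<^sub>R b)"
    using fin by (intro sum.mono_neutral_right) auto
  finally have x: "x = (\<Sum>b\<in>\<phi> ` E - {0}. c b *\<^sub>R b)" .
  have "c b \<in> A" for b unfolding c_def using fin by (intro closed) auto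
  then show "x \<in> {\<Sum>b\<in>\<phi> ` E - {0}. c b *\<^sub>R b | c. \<forall>b\<in>\<phi> ` E - {0}. c b \<in> A}" using x by blast
next
  fix x assume "x \<in> {\<Sum>b\<in>\<phi> ` E - {0}. c b *\<^sub>R b | c. \<forall>b\<in>\<phi> ` E - {0}. c b \<in> A}"
  then obtain c where c: "\<forall>b\<in>\<phi> ` E - {0}. c b \<in> A" "x = (\<Sum>b\<in>\<phi> ` E - {0}. c b *\<^sub>R b)" by blast
  define r where "r = inv_into E \<phi>"
  define a where "a e = (if \<phi> e \<noteq> 0 \<and> e = r (\<phi> e) then c (\<phi> e) else 0)" for e
  have r: "r b \<in> E" "\<phi> (r b) = b" if "b \<in> \<phi> ` E" for b
    using that by (auto simp: r_def inv_into_into f_inv_into_f)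
  have "(\<Sum>e\<in>E. a e *\<^sub>R \<phi> e) = (\<Sum>e\<in>r ` (\<phi> ` E - {0}). a e *\<^sub>R \<phi> e)"
  proof (rule sum.mono_neutral_right[OF fin])
    show "r ` (\<phi> ` E - {0}) \<subseteq> E" using r(1) by blast
    show "\<forall>e\<in>E - r ` (\<phi> ` E - {0}). a e *\<^sub>R \<phi> e = 0"
    proof
      fix e assume e: "e \<in> E - r ` (\<phi> ` E - {0})"
      then have "\<not> (\<phi> e \<noteq> 0 \<and> e = r (\<phi> e))" by auto
      then show "a e *\<^sub>R \<phi> e = 0" by (auto simp: a_def)
    qed
  qed
  also have "\<dots> = (\<Sum>b\<in>\<phi> ` E - {0}. a (r b) *\<^sub>R \<phi> (r b))"
  proof (rule sum.reindex_cong[of r])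
    show "inj_on r (\<phi> ` E - {0})" by (rule inj_on_inverseI[of _ \<phi>]) (use r(2) in blast)
  qed simp_all
  also have "\<dots> = x" unfolding c(2)
  proof (rule sum.cong[OF refl])
    fix b assume b: "b \<in> \<phi> ` E - {0}"
    then have "\<phi> (r b) = b" using r(2) by blast
    then show "a (r b) *\<^sub>R \<phi> (r b) = c b *\<^sub>R b" using b by (simp add: a_def)
  qed
  finally have "x = (\<Sum>e\<in>E. a e *\<^sub>R \<phi> e)" by simp
  moreover have "a e \<in> A" if "e \<in> E" for e using c(1) A(1) that by (auto simp: a_def)
  ultimately show "x \<in> {\<Sum>e\<in>E. a e *\<^sub>R \<phi> e | a. \<forall>e\<in>E. a e \<in> A}" by blast
qed

lemma integral_combinations:
  fixes \<psi> :: "'i \<Rightarrow> 'v::real_vector"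
  shows "{\<Sum>e\<in>F. of_int (k e) *\<^sub>R \<psi> e | k :: 'i \<Rightarrow> int. True} =
    {\<Sum>e\<in>F. a e *\<^sub>R \<psi> e | a. \<forall>e\<in>F. a e \<in> \<int>}"
proof (intro equalityI subsetI)
  fix x assume "x \<in> {\<Sum>e\<in>F. a e *\<^sub>R \<psi> e | a. \<forall>e\<in>F. a e \<in> \<int>}"
  then obtain a where a: "\<forall>e\<in>F. a e \<in> \<int>" "x = (\<Sum>e\<in>F. a e *\<^sub>R \<psi> e)" by blast
  have "x = (\<Sum>e\<in>F. of_int \<lfloor>a e\<rfloor> *\<^sub>R \<psi> e)" unfolding a(2)
    using a(1) by (intro sum.cong) (auto elim!: Ints_cases)
  then show "x \<in> {\<Sum>e\<in>F. of_int (k e) *\<^sub>R \<psi> e | k :: 'i \<Rightarrow> int. True}"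
    by (intro CollectI exI[of _ "\<lambda>e. \<lfloor>a e\<rfloor>"]) simp
next
  fix x assume "x \<in> {\<Sum>e\<in>F. of_int (k e) *\<^sub>R \<psi> e | k :: 'i \<Rightarrow> int. True}"
  then obtain k :: "'i \<Rightarrow> int" where "x = (\<Sum>e\<in>F. of_int (k e) *\<^sub>R \<psi> e)" by blast
  then show "x \<in> {\<Sum>e\<in>F. a e *\<^sub>R \<psi> e | a. \<forall>e\<in>F. a e \<in> \<int>}"
    by (intro CollectI exI[of _ "\<lambda>e. real_of_int (k e)"]) simp
qed

lemma int_span_image_combinations:
  fixes \<phi> :: "'e \<Rightarrow> 'v::real_vector"
  assumes "finite E"
  shows "{\<Sum>e\<in>E. of_int (k e) *\<^sub>R \<phi> e | k :: 'e \<Rightarrow> int. True} = int_span (\<phi> ` E - {0})"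
  unfolding int_span_def integral_combinations by (rule combinations_image[OF assms]) auto

lemma half_open_cone_image_combinations:
  assumes "finite E"
  shows "{x. \<exists>a. (\<forall>e\<in>E. 0 \<le> a e) \<and> x = (\<Sum>e\<in>E. a e *\<^sub>R \<phi> e) \<and> 0 < ell x} =
    half_open_cone ell (\<phi> ` E - {0})"
proof -
  have eq: "{\<Sum>e\<in>E. a e *\<^sub>R \<phi> e | a. \<forall>e\<in>E. a e \<in> {0..}} =
      {\<Sum>b\<in>\<phi> ` E - {0}. c b *\<^sub>R b | c. \<forall>b\<in>\<phi> ` E - {0}. c b \<in> {0..}}"
    by (rule combinations_image[OF assms]) auto
  have "{x. \<exists>a. (\<forall>e\<in>E. 0 \<le> a e) \<and> x = (\<Sum>e\<in>E. a e *\<^sub>R \<phi> e) \<and> 0 < ell x} =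
      {\<Sum>e\<in>E. a e *\<^sub>R \<phi> e | a. \<forall>e\<in>E. a e \<in> {0..}} \<inter> {x. 0 < ell x}" by auto
  also have "\<dots> = half_open_cone ell (\<phi> ` E - {0})"
    unfolding eq half_open_cone_def by auto
  finally show ?thesis .
qed

lemma curve_cone_clusters:
  fixes T :: "'n::finite leaf graph"
  assumes fin: "finite (edges G)" and sub: "cycle_edges G \<subseteq> edges G"
    and LA: "\<forall>e\<in>edges G. LA \<notin> L e" and LB: "\<forall>e\<in>edges G. LB \<in> L e \<longleftrightarrow> e \<in> cycle_edges G"
    and dist: "\<forall>len. cls (dist_vec T len) = (\<Sum>e\<in>edges G. len e *\<^sub>R ray (L e))"
  shows "curve_cone G T = half_open_cone circ ((\<lambda>e. ray (L e)) ` edges G - {0})"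
    "{cls (dist_vec T (\<lambda>e. of_int (k e))) | k. True} = int_span ((\<lambda>e. ray (L e)) ` edges G - {0})"
proof -
  have circ: "circ (\<Sum>e\<in>edges G. len e *\<^sub>R ray (L e)) = (\<Sum>e\<in>cycle_edges G. len e)" for len
  proof -
    have "circ (\<Sum>e\<in>edges G. len e *\<^sub>R ray (L e)) = (\<Sum>e\<in>edges G. len e * of_bool (e \<in> cycle_edges G))"
      unfolding circ_simps by (intro sum.cong) (use LA LB in \<open>auto simp: circ_ray\<close>)
    also have "\<dots> = (\<Sum>e\<in>cycle_edges G. len e)"
      using fin sub by (intro sum.mono_neutral_cong_right) auto
    finally show ?thesis .
  qed
  have "curve_cone G T =
      {x. \<exists>len. (\<forall>e\<in>edges G. 0 \<le> len e) \<and> x = (\<Sum>e\<in>edges G. len e *\<^sub>R ray (L e)) \<and> 0 < circ x}"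
    unfolding curve_cone_def dist[rule_format] by (auto simp: circ)
  then show "curve_cone G T = half_open_cone circ ((\<lambda>e. ray (L e)) ` edges G - {0})"
    unfolding half_open_cone_image_combinations[OF fin] .
  show "{cls (dist_vec T (\<lambda>e. of_int (k e))) | k. True} = int_span ((\<lambda>e. ray (L e)) ` edges G - {0})"
    unfolding dist[rule_format] by (rule int_span_image_combinations[OF fin])
qed

lemma tree_point_in_simplex:
  fixes T :: "'n::finite leaf graph"
  assumes T: "tree_graph T" and len: "\<forall>e\<in>edges T. 0 \<le> len e"
    and e: "bridge T e P" "(leaf T LA \<in> P) \<noteq> (leaf T LB \<in> P)" "0 < len e"
  shows "\<exists>B\<in>simplices. cls (dist_vec T len) \<in> half_open_cone circ B"
proof -
  from tree_clusters[OF T] obtain L where L: "\<forall>e\<in>edges T. LA \<notin> L e" "laminar (L ` edges T)"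
    "\<forall>len. cls (dist_vec T len) = (\<Sum>e\<in>edges T. len e *\<^sub>R ray (L e))"
    "\<And>e P. bridge T e P \<Longrightarrow> LB \<in> L e \<longleftrightarrow> (leaf T LA \<in> P) \<noteq> (leaf T LB \<in> P)" by blast
  have fin: "finite (edges T)" using T by (simp add: tree_graph_def wf_graph_def)
  have eT: "e \<in> edges T" using e(1) by (simp add: bridge_def)
  have LBe: "LB \<in> L e" using L(4)[OF e(1)] e(2) by blast
  let ?x = "\<Sum>e\<in>edges T. len e *\<^sub>R ray (L e)"
  have "circ ?x = (\<Sum>f\<in>edges T. len f * of_bool (LB \<in> L f))"
    unfolding circ_simps by (intro sum.cong) (use L(1) in \<open>auto simp: circ_ray\<close>)
  moreover have "0 < (\<Sum>f\<in>edges T. len f * of_bool (LB \<in> L f))"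
    by (rule sum_pos2[OF fin eT]) (use LBe e(3) len in auto)
  ultimately have "0 < circ ?x" by simp
  then have "?x \<in> {x. \<exists>a. (\<forall>e\<in>edges T. 0 \<le> a e) \<and> x = (\<Sum>e\<in>edges T. a e *\<^sub>R ray (L e)) \<and> 0 < circ x}"
    using len by (intro CollectI exI[of _ len]) simp
  then have "cls (dist_vec T len) \<in> half_open_cone circ ((\<lambda>e. ray (L e)) ` edges T - {0})"
    unfolding half_open_cone_image_combinations[OF fin] L(3)[rule_format] .
  moreover have "ray ` L ` edges T - {0} \<in> simplices"
    by (rule laminar_leaf_sets_simplex[OF L(2)]) (use L(1) LBe eT in auto)
  ultimately show ?thesis unfolding image_image by blast
qed

section \<open>Elliptic graphs cut at a vertex\<close>

lemma unicyclic_elliptic: "elliptic_graph G \<Longrightarrow> unicyclic_graph G"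
  unfolding elliptic_graph_def unicyclic_graph_def by (elim conjE, intro conjI)

lemma vertex_cutE:
  assumes G: "unicyclic_graph G" and cut: "vertex_cut G v T"
  obtains v' St Sh Sl where "vertex_cut_graph G v v' St Sh Sl" "T = split_vertex G v v' St Sh Sl"
proof -
  obtain v' St Sh Sl where *: "v \<in> verts G" "v' \<notin> verts G"
    "St \<subseteq> {e \<in> edges G. tail G e = v}" "Sh \<subseteq> {e \<in> edges G. head G e = v}"
    "Sl \<subseteq> {l. leaf G l = v}" "card (cycle_edges G \<inter> St) + card (cycle_edges G \<inter> Sh) = 1"
    "T = split_vertex G v v' St Sh Sl"
    using cut unfolding vertex_cut_def by blast
  have "vertex_cut_graph G v v' St Sh Sl"
    by (rule vertex_cut_graph.intro[OF G vertex_cut_graph_axioms.intro]) (fact *)+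
  then show thesis using that *(7) by blast
qed

lemma vertex_cut_simplex:
  fixes G :: "'n::finite graph"
  assumes G: "elliptic_graph G" and cut: "vertex_cut G v T"
  shows "\<exists>B\<in>simplices. curve_cone G T = half_open_cone circ B \<and>
    {cls (dist_vec T (\<lambda>e. of_int (k e))) | k. True} = int_span B"
proof -
  obtain v' St Sh Sl where c: "vertex_cut_graph G v v' St Sh Sl" "T = split_vertex G v v' St Sh Sl"
    by (rule vertex_cutE[OF unicyclic_elliptic[OF G] cut])
  interpret vertex_cut_graph G v v' St Sh Sl by (rule c(1))
  from cut_clusters obtain L where L: "\<forall>e\<in>edges G. LA \<notin> L e" "laminar (L ` edges G)"
    "\<forall>len. cls (dist_vec T len) = (\<Sum>e\<in>edges G. len e *\<^sub>R ray (L e))"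
    "\<forall>e\<in>edges G. LB \<in> L e \<longleftrightarrow> e \<in> cycle_edges G" unfolding c(2) by blast
  have fin: "finite (edges G)" using wf by (simp add: wf_graph_def)
  obtain vs es where cyc: "simple_cycle G vs es" "set es = cycle_edges G" by (rule a_cycle)
  have "set es \<noteq> {}" using cyc(1) by (simp add: simple_cycle_def)
  then obtain e where e: "e \<in> cycle_edges G" unfolding cyc(2) by blast
  then have eG: "e \<in> edges G" using cycle_edges_subset by blast
  have "ray ` L ` edges G - {0} \<in> simplices"
    by (rule laminar_leaf_sets_simplex[OF L(2)]) (use L(1,4) e eG in auto)
  then have "(\<lambda>e. ray (L e)) ` edges G - {0} \<in> simplices" unfolding image_image .
  then show ?thesis using curve_cone_clusters[OF fin cycle_edges_subset L(1,4,3)] by blast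
qed

section \<open>Cutting inside an edge\<close>

text \<open>
  The two halves \<open>e\<close> and \<open>e'\<close> of the cut edge end at the new vertices \<open>a\<close> and \<open>b\<close>. Which of these
  carries the leaf \<open>A\<close> depends on the half that has been moved.
\<close>

locale edge_cut_graph = unicyclic_graph G for G :: "'n::finite graph" +
  fixes e e' a b :: nat and T :: "'n leaf graph"
  assumes e: "e \<in> cycle_edges G" and e': "e' \<notin> edges G" and ab: "a \<notin> verts G" "b \<notin> verts G" "a \<noteq> b"
    and verts_T: "verts T = insert a (insert b (verts G))" and edges_T: "edges T = insert e' (edges G)"
    and e_T: "tail T e = tail G e" "head T e = a" and e'_T: "tail T e' = b" "head T e' = head G e"
    and f_T: "\<And>f. f \<in> edges G \<Longrightarrow> f \<noteq> e \<Longrightarrow> tail T f = tail G f \<and> head T f = head G f"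
    and leaf_T: "leaf T (Leg p) = leaf G p" "{leaf T LA, leaf T LB} = {a, b}"
begin

lemma ends: "f \<in> edges G \<Longrightarrow> tail G f \<in> verts G \<and> head G f \<in> verts G"
  using wf by (simp add: wf_graph_def)

lemma e_edge: "e \<in> edges G"
  using e cycle_edges_subset by blast

lemma ee': "e \<noteq> e'"
  using e_edge e' by blast

lemma edge_cases: "f \<in> edges T \<Longrightarrow> f = e \<or> f = e' \<or> f \<in> edges G \<and> f \<noteq> e \<and> f \<noteq> e'"
  unfolding edges_T using e' by blast

lemma wf_T: "wf_graph T"
  unfolding wf_graph_def
proof (intro conjI ballI allI)
  show "finite (verts T)" "finite (edges T)" using wf by (auto simp: verts_T edges_T wf_graph_def)
  fix f assume "f \<in> edges T"
  from edge_cases[OF this] show "tail T f \<in> verts T" "head T f \<in> verts T"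
    using ends[of f] ends[OF e_edge] f_T[of f] e_T e'_T by (auto simp: verts_T)
next
  fix l
  have "leaf T LA \<in> {a, b}" "leaf T LB \<in> {a, b}" unfolding leaf_T(2)[symmetric] by auto
  moreover have "leaf G p \<in> verts G" for p using wf by (simp add: wf_graph_def)
  ultimately show "leaf T l \<in> verts T" by (cases l) (auto simp: verts_T leaf_T(1))
qed

lemma connected_T: "connected_graph T"
proof (rule connectedI)
  show "verts T \<noteq> {}" by (simp add: verts_T)
  fix Z u w assume uw: "u \<in> verts T" "w \<in> verts T" "u \<in> Z" "w \<notin> Z"
  show "\<exists>f\<in>edges T. crosses T Z f"
  proof (rule ccontr)
    assume none: "\<not> (\<exists>f\<in>edges T. crosses T Z f)"
    have "\<not> crosses T Z e" "\<not> crosses T Z e'" using none e_edge edges_T by auto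
    then have a: "a \<in> Z \<longleftrightarrow> tail G e \<in> Z" and b: "b \<in> Z \<longleftrightarrow> head G e \<in> Z"
      by (auto simp: crosses_def e_T e'_T)
    have other: "\<not> crosses G Z f" if "f \<in> edges G" "f \<noteq> e" for f
      using none f_T[OF that] that edges_T by (auto simp: crosses_def)
    have "\<not> crosses G Z e"
    proof
      assume "crosses G Z e"
      then obtain f where "f \<in> cycle_edges G" "f \<noteq> e" "crosses G Z f" by (rule cycle_edge_not_bridge[OF e])
      then show False using other[of f] cycle_edges_subset by blast
    qed
    then have all: "\<not> crosses G Z f" if "f \<in> edges G" for f using other that by blast
    have same: "x \<in> Z \<longleftrightarrow> y \<in> Z" if "x \<in> verts G" "y \<in> verts G" for x y
      using connected_cut[OF connected that] connected_cut[OF connected that(2,1)] all by metis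
    have "x \<in> Z \<longleftrightarrow> tail G e \<in> Z" if "x \<in> verts T" for x
      using that a b same[of x "tail G e"] same[of "head G e" "tail G e"] ends[OF e_edge]
      unfolding verts_T by auto
    then show False using uw by blast
  qed
qed

lemma bridge_e: "bridge T e {a}"
  unfolding bridge_def
proof (intro conjI ballI)
  show "e \<in> edges T" using e_edge edges_T by simp
  fix f assume "f \<in> edges T"
  from edge_cases[OF this] show "crosses T {a} f \<longleftrightarrow> f = e"
    using ends[of f] ends[OF e_edge] f_T[of f] e_T e'_T ab ee' by (auto simp: crosses_def)
qed

lemma bridge_e': "bridge T e' {b}"
  unfolding bridge_def
proof (intro conjI ballI)
  show "e' \<in> edges T" using edges_T by simp
  fix f assume "f \<in> edges T"
  from edge_cases[OF this] show "crosses T {b} f \<longleftrightarrow> f = e'"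
    using ends[of f] ends[OF e_edge] f_T[of f] e_T e'_T ab ee' by (auto simp: crosses_def)
qed

text \<open>
  In \<open>G\<close> without \<open>e\<close> the edge \<open>f\<close> is a bridge; the new vertices are added to the sides on which
  their neighbours lie.
\<close>

lemma bridge_other:
  assumes f: "f \<in> edges G" "f \<noteq> e" shows "\<exists>P. bridge T f P"
proof -
  from bridge_up_to_cycle_edge[OF e f] obtain P where P: "crosses G P f"
    "\<forall>h\<in>edges G. h \<noteq> e \<longrightarrow> h \<noteq> f \<longrightarrow> \<not> crosses G P h" by blast
  define Q where "Q = {x. x \<in> verts G \<and> x \<in> P \<or> x = a \<and> tail G e \<in> P \<or> x = b \<and> head G e \<in> P}"
  have Q: "x \<in> Q \<longleftrightarrow> x \<in> P" if "x \<in> verts G" for x using that ab by (auto simp: Q_def)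
  have Qa: "a \<in> Q \<longleftrightarrow> tail G e \<in> P" and Qb: "b \<in> Q \<longleftrightarrow> head G e \<in> P" using ab by (auto simp: Q_def)
  have "crosses T Q h \<longleftrightarrow> h = f" if "h \<in> edges T" for h
    using edge_cases[OF that]
  proof (elim disjE conjE)
    assume h: "h \<in> edges G" "h \<noteq> e"
    then have "crosses T Q h \<longleftrightarrow> crosses G P h"
      using f_T[OF h] Q ends[OF h(1)] by (simp add: crosses_def)
    then show ?thesis using P h by blast
  next
    assume "h = e"
    then show ?thesis using f(2) Q[of "tail G e"] Qa ends[OF e_edge] by (simp add: crosses_def e_T)
  next
    assume "h = e'"
    then show ?thesis using f(1) e' Q[of "head G e"] Qb ends[OF e_edge] by (auto simp: crosses_def e'_T)
  qed
  then have "bridge T f Q" unfolding bridge_def using f(1) edges_T by simp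
  then show ?thesis by blast
qed

lemma tree_T: "tree_graph T"
  unfolding tree_graph_def using wf_T connected_T bridge_e bridge_e' bridge_other edge_cases by metis

end

text \<open>A cycle crosses the set consisting of the new vertex evenly.\<close>

lemma subdivided_cycle:
  assumes wf: "wf_graph G" and w: "w \<notin> verts G" and e: "e \<in> edges G" "e' \<notin> edges G"
  shows "e \<in> cycle_edges (subdivide G e w e') \<longleftrightarrow> e' \<in> cycle_edges (subdivide G e w e')"
proof -
  let ?G = "subdivide G e w e'"
  have "crosses ?G {w} f \<longleftrightarrow> f = e \<or> f = e'" if "f \<in> edges ?G" for f
    using that wf w e by (auto simp: subdivide_def crosses_def wf_graph_def)
  moreover have "set es \<subseteq> edges ?G" if "simple_cycle ?G vs es" for vs es
    using that by (auto simp: simple_cycle_def joins_def in_set_conv_nth)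
  ultimately have crossed: "{f \<in> set es. crosses ?G {w} f} = set es \<inter> {e, e'}" if "simple_cycle ?G vs es" for vs es
    using that by blast
  have ne: "e \<noteq> e'" using e by blast
  have "e \<in> set es \<longleftrightarrow> e' \<in> set es" if c: "simple_cycle ?G vs es" for vs es
    using cycle_crosses_evenly[OF c, of "{w}"] ne unfolding crossed[OF c]
    by (cases "e \<in> set es"; cases "e' \<in> set es") auto
  then show ?thesis unfolding cycle_edges_def by blast
qed

lemma edge_cutE:
  fixes G :: "'n::finite graph"
  assumes G: "unicyclic_graph G" and e: "e \<in> cycle_edges G" and w: "w \<notin> verts G" and e': "e' \<notin> edges G"
    and cut: "vertex_cut (subdivide G e w e') w T"
  obtains a b where "edge_cut_graph G e e' a b T"
proof -
  interpret unicyclic_graph G by (rule G)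
  let ?G = "subdivide G e w e'"
  obtain v' St Sh Sl where c: "v' \<notin> verts ?G" "St \<subseteq> {f \<in> edges ?G. tail ?G f = w}"
    "Sh \<subseteq> {f \<in> edges ?G. head ?G f = w}" "Sl \<subseteq> {l. leaf ?G l = w}"
    "card (cycle_edges ?G \<inter> St) + card (cycle_edges ?G \<inter> Sh) = 1" "T = split_vertex ?G w v' St Sh Sl"
    using cut unfolding vertex_cut_def by blast
  have eG: "e \<in> edges G" using e cycle_edges_subset by blast
  have ends: "tail G f \<in> verts G" "head G f \<in> verts G" if "f \<in> edges G" for f
    using wf that by (auto simp: wf_graph_def)
  have ne: "e \<noteq> e'" using eG e' by blast
  have leaves: "leaf G l \<in> verts G" for l using wf by (simp add: wf_graph_def)
  have "f = e'" if "f \<in> edges ?G" "tail ?G f = w" for f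
    using that w ends(1)[of f] e' by (auto simp: subdivide_def split: if_splits)
  then have St: "St \<subseteq> {e'}" using c(2) by blast
  have "f = e" if "f \<in> edges ?G" "head ?G f = w" for f
    using that w ends(2)[of f] ends(2)[OF eG] by (auto simp: subdivide_def split: if_splits)
  then have Sh: "Sh \<subseteq> {e}" using c(3) by blast
  have Sl: "Sl = {}" using c(4) w leaves by (auto simp: subdivide_def)
  have v': "v' \<noteq> w" "v' \<notin> verts G" using c(1) by (auto simp: subdivide_def)
  have "St \<noteq> {} \<longleftrightarrow> Sh = {}"
  proof -
    consider "St = {}" "Sh = {}" | "St = {e'}" "Sh = {}" | "St = {}" "Sh = {e}" | "St = {e'}" "Sh = {e}"
      using St Sh by blast
    then show ?thesis
    proof cases
      case 1 then show ?thesis using c(5) by simp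
    next
      case 4
      then show ?thesis using c(5) subdivided_cycle[OF wf w eG e']
        by (cases "e \<in> cycle_edges ?G") auto
    qed simp_all
  qed
  then consider "St = {e'}" "Sh = {}" | "St = {}" "Sh = {e}" using St Sh by blast
  then show thesis
  proof cases
    case 1
    have "edge_cut_graph G e e' w v' T"
      by (rule edge_cut_graph.intro[OF G edge_cut_graph_axioms.intro])
        (use 1 e e' w v' ne Sl in \<open>auto simp: c(6) split_vertex_def subdivide_def\<close>)
    then show ?thesis by (rule that)
  next
    case 2
    have "edge_cut_graph G e e' v' w T"
      by (rule edge_cut_graph.intro[OF G edge_cut_graph_axioms.intro])
        (use 2 e e' w v' ne Sl in \<open>auto simp: c(6) split_vertex_def subdivide_def\<close>)
    then show ?thesis by (rule that)
  qed
qed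

lemma curve_cut_in_simplex:
  fixes G :: "'n::finite graph"
  assumes C: "elliptic_curve (G, len)" and cut: "curve_cut (G, len) (T, len')"
  shows "\<exists>B\<in>simplices. cls (dist_vec T len') \<in> half_open_cone circ B"
proof -
  have G: "elliptic_graph G" and pos: "\<And>e. e \<in> edges G \<Longrightarrow> 0 < len e" using C by (auto simp: elliptic_curve_def)
  interpret unicyclic_graph G by (rule unicyclic_elliptic[OF G])
  consider v where "vertex_cut G v T" "len' = len"
    | e t w e' where "e \<in> cycle_edges G" "0 < t" "t < len e" "w \<notin> verts G" "e' \<notin> edges G"
      "vertex_cut (subdivide G e w e') w T" "len' = len(e := t, e' := len e - t)"
    using cut unfolding curve_cut_def by auto
  then show ?thesis
  proof cases
    case (1 v)
    obtain B where B: "B \<in> simplices" "curve_cone G T = half_open_cone circ B"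
      using vertex_cut_simplex[OF G 1(1)] by blast
    obtain vs es where cyc: "simple_cycle G vs es" "set es = cycle_edges G" by (rule a_cycle)
    have "cycle_edges G \<noteq> {}" using cyc unfolding cyc(2)[symmetric] by (simp add: simple_cycle_def)
    then have "0 < (\<Sum>e\<in>cycle_edges G. len e)"
      using finite_cycle pos cycle_edges_subset by (intro sum_pos) auto
    then have "cls (dist_vec T len') \<in> curve_cone G T"
      unfolding curve_cone_def 1(2) using pos less_imp_le by blast
    then show ?thesis using B by blast
  next
    case (2 e t w e')
    obtain a b where ab: "edge_cut_graph G e e' a b T"
      by (rule edge_cutE[OF unicyclic_graph_axioms 2(1,4,5,6)])
    interpret cut: edge_cut_graph G e e' a b T by (rule ab)
    have "(leaf T LA \<in> {a}) \<noteq> (leaf T LB \<in> {a})"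
      using cut.leaf_T(2) cut.ab(3) by (auto simp: doubleton_eq_iff)
    moreover have "\<forall>f\<in>edges T. 0 \<le> len' f"
      using pos 2(2,3) unfolding cut.edges_T 2(7) by (auto simp: less_imp_le)
    moreover have "0 < len' e" using 2(2) cut.ee' by (simp add: 2(7))
    ultimately show ?thesis using tree_point_in_simplex[OF cut.tree_T _ cut.bridge_e] by blast
  qed
qed

section \<open>The curve of a cluster family\<close>

lemma chain_Inter_mem:
  assumes "finite C" "C \<noteq> {}" "\<And>A B. A \<in> C \<Longrightarrow> B \<in> C \<Longrightarrow> A \<subseteq> B \<or> B \<subseteq> A"
  shows "\<Inter>C \<in> C"
proof -
  obtain M where M: "M \<in> C" "\<And>A. A \<in> C \<Longrightarrow> A \<subseteq> M \<Longrightarrow> M = A"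
    using finite_has_minimal[OF assms(1,2)] by blast
  have "M \<subseteq> A" if "A \<in> C" for A using assms(3)[OF M(1) that] M(2)[OF that] by blast
  then have "\<Inter>C = M" using M(1) by blast
  then show ?thesis using M(1) by simp
qed

text \<open>
  The curve has a vertex for each cluster except \<open>{B}\<close>, and one for the root \<open>X = UNIV - {A}\<close>; every
  cluster is an edge from its vertex to that of the next larger cluster, where the edge \<open>{B}\<close> starts
  at the root and so closes the cycle.
\<close>

locale cluster_curve =
  fixes \<F> :: "'n::finite leaf set set" and \<nu> :: "'n leaf set \<Rightarrow> nat"
  assumes family: "cluster_family \<F>" and inj: "inj \<nu>"
begin

abbreviation label :: "nat \<Rightarrow> 'n leaf set" where "label \<equiv> inv_into UNIV \<nu>"

abbreviation root :: "'n leaf set" where "root \<equiv> UNIV - {LA}"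

abbreviation nodes :: "'n leaf set set" where "nodes \<equiv> insert root \<F>"

definition parent :: "'n leaf set \<Rightarrow> 'n leaf set" where
  "parent F = \<Inter>{H \<in> nodes. F \<subset> H}"

definition base :: "'n \<Rightarrow> 'n leaf set" where
  "base k = \<Inter>{H \<in> nodes. Leg k \<in> H}"

text \<open>
  The lower end of an edge is its own vertex, but that of the edge \<open>{B}\<close> is glued to the root.
\<close>

definition start :: "'n leaf set \<Rightarrow> 'n leaf set" where
  "start F = (if F = {LB} then root else F)"

definition G :: "'n graph" where
  "G = \<lparr> verts = \<nu> ` (nodes - {{LB}}), edges = \<nu> ` \<F>,
     tail = (\<lambda>e. \<nu> (start (label e))), head = (\<lambda>e. \<nu> (parent (label e))),
     leaf = (\<lambda>k. \<nu> (base k)) \<rparr>"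

lemmas cluster = cluster_familyD[OF family]

lemma label_\<nu> [simp]: "label (\<nu> F) = F"
  using inj by simp

lemma \<nu>_eq [simp]: "\<nu> E = \<nu> F \<longleftrightarrow> E = F"
  using inj by (simp add: inj_eq)

lemma \<nu>_mem [simp]: "\<nu> F \<in> \<nu> ` \<S> \<longleftrightarrow> F \<in> \<S>"
  using inj by (simp add: inj_image_mem_iff)

lemma G_simps [simp]: "verts G = \<nu> ` (nodes - {{LB}})" "edges G = \<nu> ` \<F>"
  "tail G (\<nu> F) = \<nu> (start F)" "head G (\<nu> F) = \<nu> (parent F)" "leaf G k = \<nu> (base k)"
  by (simp_all add: G_def)

lemma nonempty: "F \<in> nodes \<Longrightarrow> F \<noteq> {}"
  using cluster(5)[of F] by auto

lemma node_subset_root: "F \<in> nodes \<Longrightarrow> F \<subseteq> root"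
  using cluster(3)[of F] by blast

lemma nodes_chain:
  assumes "E \<in> nodes" "F \<in> nodes" "x \<in> E" "x \<in> F" shows "E \<subseteq> F \<or> F \<subseteq> E"
proof -
  consider "E = root" | "F = root" | "E \<in> \<F>" "F \<in> \<F>" using assms(1,2) by blast
  then show ?thesis
  proof cases
    case 1 then show ?thesis using node_subset_root[OF assms(2)] by simp
  next
    case 2 then show ?thesis using node_subset_root[OF assms(1)] by simp
  next
    case 3 then show ?thesis using laminarD[OF cluster(1) 3 assms(3,4)] by simp
  qed
qed

lemma parent:
  assumes F: "F \<in> \<F>"
  shows "parent F \<in> nodes" "F \<subset> parent F" "\<And>H. H \<in> nodes \<Longrightarrow> F \<subset> H \<Longrightarrow> parent F \<subseteq> H"
proof -
  obtain x where x: "x \<in> F" using nonempty[of F] F by blast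
  have "\<Inter>{H \<in> nodes. F \<subset> H} \<in> {H \<in> nodes. F \<subset> H}"
  proof (rule chain_Inter_mem)
    have "F \<subset> root" using node_subset_root[of F] cluster(4)[OF F] F by blast
    then show "{H \<in> nodes. F \<subset> H} \<noteq> {}" by blast
    show "A \<subseteq> B \<or> B \<subseteq> A" if "A \<in> {H \<in> nodes. F \<subset> H}" "B \<in> {H \<in> nodes. F \<subset> H}" for A B
      by (rule nodes_chain[of A B x]) (use that x in auto)
  qed simp
  then show "parent F \<in> nodes" "F \<subset> parent F" unfolding parent_def by auto
  show "parent F \<subseteq> H" if "H \<in> nodes" "F \<subset> H" for H unfolding parent_def using that by blast
qed

lemma base: "base k \<in> nodes" "Leg k \<in> base k" "\<And>H. H \<in> nodes \<Longrightarrow> Leg k \<in> H \<Longrightarrow> base k \<subseteq> H"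
proof -
  have "\<Inter>{H \<in> nodes. Leg k \<in> H} \<in> {H \<in> nodes. Leg k \<in> H}"
  proof (rule chain_Inter_mem)
    show "{H \<in> nodes. Leg k \<in> H} \<noteq> {}" by blast
    show "A \<subseteq> B \<or> B \<subseteq> A" if "A \<in> {H \<in> nodes. Leg k \<in> H}" "B \<in> {H \<in> nodes. Leg k \<in> H}" for A B
      by (rule nodes_chain[of A B "Leg k"]) (use that in auto)
  qed simp
  then show "base k \<in> nodes" "Leg k \<in> base k" unfolding base_def by auto
  show "base k \<subseteq> H" if "H \<in> nodes" "Leg k \<in> H" for H unfolding base_def using that by blast
qed

lemma parent_not_LB: assumes "F \<in> \<F>" shows "parent F \<noteq> {LB}"
proof
  assume "parent F = {LB}"
  then have "F \<subset> {LB}" using parent(2)[OF assms] by simp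
  then have "F = {}" by auto
  then show False using nonempty[of F] assms by simp
qed

lemma base_not_LB: "base k \<noteq> {LB}"
  using base(2)[of k] by auto

lemma root_not_LB: "root \<noteq> {LB}"
proof
  assume "root = {LB}"
  moreover have "Leg undefined \<in> root" by simp
  ultimately show False by auto
qed

lemma start: "F \<in> \<F> \<Longrightarrow> start F \<in> nodes - {{LB}}"
  using root_not_LB by (simp add: start_def)

lemma wf_G: "wf_graph G"
  unfolding wf_graph_def
proof (intro conjI ballI allI)
  show "finite (verts G)" "finite (edges G)" by simp_all
  fix e assume "e \<in> edges G"
  then obtain F where F: "F \<in> \<F>" "e = \<nu> F" by auto
  show "tail G e \<in> verts G" unfolding F(2) G_simps \<nu>_mem by (rule start[OF F(1)])
  show "head G e \<in> verts G" unfolding F(2) G_simps \<nu>_mem using parent(1)[OF F(1)] parent_not_LB[OF F(1)] by blast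
next
  fix k show "leaf G k \<in> verts G" unfolding G_simps \<nu>_mem using base(1) base_not_LB by blast
qed

text \<open>Follow the parents up to the root.\<close>

lemma uncrossed_root:
  assumes "\<And>F. F \<in> \<F> \<Longrightarrow> F \<noteq> {LB} \<Longrightarrow> \<not> crosses G P (\<nu> F)"
  shows "H \<in> nodes - {{LB}} \<Longrightarrow> \<nu> H \<in> P \<longleftrightarrow> \<nu> root \<in> P"
proof (induction "card (- H)" arbitrary: H rule: less_induct)
  case less
  show ?case
  proof (cases "H = root")
    case False
    then have H: "H \<in> \<F>" "H \<noteq> {LB}" using less.prems by auto
    have "- parent H \<subset> - H" using parent(2)[OF H(1)] by blast
    then have "card (- parent H) < card (- H)" by (intro psubset_card_mono) simp_all
    then have "\<nu> (parent H) \<in> P \<longleftrightarrow> \<nu> root \<in> P"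
      using less.hyps parent(1)[OF H(1)] parent_not_LB[OF H(1)] by blast
    moreover have "\<nu> H \<in> P \<longleftrightarrow> \<nu> (parent H) \<in> P"
      using assms[OF H] H(2) by (simp add: crosses_def start_def)
    ultimately show ?thesis by blast
  qed simp
qed

lemma connected_G: "connected_graph G"
proof (rule connectedI)
  show "verts G \<noteq> {}" using root_not_LB by auto
  fix P u v assume uv: "u \<in> verts G" "v \<in> verts G" "u \<in> P" "v \<notin> P"
  show "\<exists>e\<in>edges G. crosses G P e"
  proof (rule ccontr)
    assume "\<not> ?thesis"
    then have "\<not> crosses G P (\<nu> F)" if "F \<in> \<F>" for F using that by simp
    note un = uncrossed_root[OF this]
    obtain E F where EF: "E \<in> nodes - {{LB}}" "F \<in> nodes - {{LB}}" "u = \<nu> E" "v = \<nu> F" using uv by auto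
    show False using un[OF _ EF(1)] un[OF _ EF(2)] uv(3,4) unfolding EF(3,4) by blast
  qed
qed

abbreviation below :: "'n leaf set \<Rightarrow> nat set" where
  "below F \<equiv> \<nu> ` {E \<in> nodes - {{LB}}. E \<subseteq> F}"

lemma parent_below:
  assumes "E \<in> \<F>" "F \<in> \<F>" shows "parent E \<subseteq> F \<longleftrightarrow> E \<subset> F"
proof
  show "E \<subset> F" if "parent E \<subseteq> F" using parent(2)[OF assms(1)] that by (rule psubset_subset_trans)
  show "parent E \<subseteq> F" if "E \<subset> F" by (rule parent(3)[OF assms(1) _ that]) (use assms(2) in simp)
qed

lemma head_below:
  assumes "E \<in> \<F>" "F \<in> \<F>" shows "head G (\<nu> E) \<in> below F \<longleftrightarrow> E \<subset> F"
proof -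
  have "head G (\<nu> E) \<in> below F \<longleftrightarrow> parent E \<in> {E \<in> nodes - {{LB}}. E \<subseteq> F}" unfolding G_simps \<nu>_mem ..
  also have "\<dots> \<longleftrightarrow> parent E \<subseteq> F" using parent(1)[OF assms(1)] parent_not_LB[OF assms(1)] by simp
  finally show ?thesis unfolding parent_below[OF assms] .
qed

lemma crosses_below:
  assumes E: "E \<in> \<F>" "E \<noteq> {LB}" and F: "F \<in> \<F>"
  shows "crosses G (below F) (\<nu> E) \<longleftrightarrow> E = F"
proof -
  have "tail G (\<nu> E) \<in> below F \<longleftrightarrow> E \<subseteq> F" using E by (simp add: start_def)
  then show ?thesis unfolding crosses_def head_below[OF E(1) F] by blast
qed

lemma LB_crosses_below:
  assumes F: "F \<in> \<F>" shows "crosses G (below F) (\<nu> {LB}) \<longleftrightarrow> {LB} \<subset> F"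
proof -
  have "\<not> root \<subseteq> F" using node_subset_root[of F] cluster(4)[OF F] F by blast
  then have "tail G (\<nu> {LB}) \<notin> below F" by (auto simp: start_def)
  then show ?thesis unfolding crosses_def head_below[OF cluster(2) F] by blast
qed

text \<open>
  The set \<open>below F\<close> is crossed only by the edge of \<open>F\<close> if \<open>B\<close> is not in \<open>F\<close>, so that this edge is
  on no cycle; otherwise it is crossed by the edges of \<open>F\<close> and \<open>{B}\<close>, so that a cycle contains
  both or none.
\<close>

lemma cycle_of_G:
  assumes c: "simple_cycle G vs es" shows "set es = \<nu> ` {F \<in> \<F>. LB \<in> F}"
proof -
  have sub: "set es \<subseteq> \<nu> ` \<F>"
    using c by (auto simp: simple_cycle_def joins_def in_set_conv_nth)
  have tree: "\<nu> F \<notin> set es" if F: "F \<in> \<F>" "LB \<notin> F" for F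
  proof
    assume "\<nu> F \<in> set es"
    have "crosses G (below F) (\<nu> E) \<longleftrightarrow> E = F" if "E \<in> \<F>" for E
      using crosses_below[OF that _ F(1)] LB_crosses_below[OF F(1)] F(2) by (cases "E = {LB}") auto
    then have "{e \<in> set es. crosses G (below F) e} = {\<nu> F}" using sub F(1) \<open>\<nu> F \<in> set es\<close> by auto
    then show False using cycle_crosses_evenly[OF c, of "below F"] by simp
  qed
  have cyc: "\<nu> F \<in> set es \<longleftrightarrow> \<nu> {LB} \<in> set es" if F: "F \<in> \<F>" "LB \<in> F" "F \<noteq> {LB}" for F
  proof -
    have "crosses G (below F) (\<nu> E) \<longleftrightarrow> E = F \<or> E = {LB}" if "E \<in> \<F>" for E
      using crosses_below[OF that _ F(1)] LB_crosses_below[OF F(1)] F(2,3) by (cases "E = {LB}") auto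
    then have "{e \<in> set es. crosses G (below F) e} = set es \<inter> {\<nu> F, \<nu> {LB}}" using sub F(1) cluster(2) by auto
    then show ?thesis using cycle_crosses_evenly[OF c, of "below F"] F(3)
      by (cases "\<nu> F \<in> set es"; cases "\<nu> {LB} \<in> set es") auto
  qed
  have LB: "\<nu> {LB} \<in> set es"
  proof -
    have hd: "hd es \<in> set es" using c by (simp add: simple_cycle_def)
    then have "hd es \<in> \<nu> ` \<F>" by (rule subsetD[OF sub])
    then obtain F where F: "F \<in> \<F>" "hd es = \<nu> F" by (rule imageE)
    have F: "F \<in> \<F>" "\<nu> F \<in> set es" using F hd by simp_all
    have "LB \<in> F" using tree[OF F(1)] F(2) by blast
    then show ?thesis using cyc[OF F(1)] F(2) by (cases "F = {LB}") simp_all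
  qed
  show ?thesis
  proof (intro equalityI subsetI)
    fix e assume e: "e \<in> set es"
    then have "e \<in> \<nu> ` \<F>" by (rule subsetD[OF sub])
    then obtain F where F: "F \<in> \<F>" "e = \<nu> F" by (rule imageE)
    then show "e \<in> \<nu> ` {F \<in> \<F>. LB \<in> F}" using tree[OF F(1)] e by auto
  next
    fix e assume "e \<in> \<nu> ` {F \<in> \<F>. LB \<in> F}"
    then obtain F where F: "F \<in> \<F>" "LB \<in> F" "e = \<nu> F" by blast
    show "e \<in> set es"
    proof (cases "F = {LB}")
      case False then show ?thesis using cyc[OF F(1,2)] LB F(3) by simp
    qed (use LB F in simp)
  qed
qed

lemma G_has_cycle: "\<exists>vs es. simple_cycle G vs es"
proof -
  let ?e = "\<nu> {LB}" and ?Q = "\<nu> ` (\<F> - {{LB}})"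
  have e: "?e \<in> edges G" "?e \<notin> ?Q" using cluster(2) by auto
  have "(head G ?e, tail G ?e) \<in> reach G ?Q"
  proof (rule ccontr)
    assume "(head G ?e, tail G ?e) \<notin> reach G ?Q"
    from component_cut[OF this] obtain P where P: "head G ?e \<in> P" "tail G ?e \<notin> P"
      "\<forall>e\<in>?Q. e \<in> edges G \<longrightarrow> \<not> crosses G P e" by blast
    have un: "\<not> crosses G P (\<nu> F)" if "F \<in> \<F>" "F \<noteq> {LB}" for F using P(3) that by simp
    have "parent {LB} \<in> nodes - {{LB}}" using parent(1)[OF cluster(2)] parent_not_LB[OF cluster(2)] by blast
    from uncrossed_root[OF un this] show False using P(1,2) by (simp add: start_def)
  qed
  from cycle_through_edge[OF wf_G e this] show ?thesis by blast
qed

lemma unicyclic_G: "unicyclic_graph G"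
proof (rule unicyclic_graph.intro[OF wf_G connected_G])
  obtain vs es where "simple_cycle G vs es" using G_has_cycle by blast
  then show "\<exists>!C. \<exists>vs es. simple_cycle G vs es \<and> C = set es" using cycle_of_G by metis
qed

lemma cycle_edges_G: "cycle_edges G = \<nu> ` {F \<in> \<F>. LB \<in> F}"
  using unicyclic_graph.a_cycle[OF unicyclic_G] cycle_of_G by metis

lemma card_node:
  assumes "H \<in> nodes" "H \<noteq> {LB}" shows "2 \<le> card H"
proof (cases "H = root")
  case True
  have "2 = card {LB, Leg undefined :: 'n leaf}" by simp
  also have "\<dots> \<le> card root" by (intro card_mono) auto
  finally show ?thesis using True by simp
qed (use cluster(5)[of H] assms in auto)

lemma children_cover:
  assumes H: "H \<in> nodes" "H \<noteq> {LB}"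
  shows "H \<subseteq> \<Union>{F \<in> \<F>. parent F = H} \<union> Leg ` {k. base k = H}"
proof
  have child: "x \<in> \<Union>{F \<in> \<F>. parent F = H}" if F: "F \<in> \<F>" "x \<in> F" "F \<subset> H" for x F
  proof -
    have "{E \<in> \<F>. F \<subseteq> E \<and> E \<subset> H} \<noteq> {}" using F by blast
    then obtain E where E: "E \<in> {E \<in> \<F>. F \<subseteq> E \<and> E \<subset> H}"
      "\<And>D. D \<in> {E \<in> \<F>. F \<subseteq> E \<and> E \<subset> H} \<Longrightarrow> E \<subseteq> D \<Longrightarrow> E = D"
      using finite_has_maximal[of "{E \<in> \<F>. F \<subseteq> E \<and> E \<subset> H}"] by auto
    have E': "E \<in> \<F>" "F \<subseteq> E" "E \<subset> H" using E(1) by auto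
    note p = parent[OF E'(1)]
    have "parent E \<subseteq> H" using p(3)[OF H(1) E'(3)] .
    moreover have "\<not> parent E \<subset> H"
    proof
      assume less: "parent E \<subset> H"
      then have "parent E \<noteq> root" using node_subset_root[OF H(1)] by blast
      then have "parent E \<in> \<F>" using p(1) by blast
      then have "E = parent E" using E(2)[of "parent E"] E'(2) p(2) less by blast
      then show False using p(2) by blast
    qed
    ultimately have "parent E = H" by blast
    then show ?thesis using E' F(2) by blast
  qed
  fix x assume x: "x \<in> H"
  show "x \<in> \<Union>{F \<in> \<F>. parent F = H} \<union> Leg ` {k. base k = H}"
  proof (cases x)
    case (Leg k)
    note b = base[where k = k]
    have sub: "base k \<subseteq> H" using b(3)[OF H(1)] x Leg by blast
    show ?thesis
    proof (cases "base k = H")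
      case False
      then have "base k \<noteq> root" using sub node_subset_root[OF H(1)] by blast
      then have "base k \<in> \<F>" using b(1) by blast
      then show ?thesis using child[of "base k" x] b(2) sub False Leg by blast
    qed (use Leg in blast)
  next
    case LA then show ?thesis using x node_subset_root[OF H(1)] by blast
  next
    case LB
    then have "{LB} \<subset> H" using x H(2) by blast
    then show ?thesis using child[OF cluster(2), of x] LB by blast
  qed
qed

text \<open>
  At every vertex one edge starts, and at least two edges or leaves end there, since a single one
  would have to cover the whole cluster.
\<close>

lemma valence_G:
  assumes H: "H \<in> nodes" "H \<noteq> {LB}" shows "3 \<le> valence G (\<nu> H)"
proof -
  let ?D = "{F \<in> \<F>. parent F = H}" and ?K = "{k. base k = H}"
  define F0 where "F0 = (if H = root then {LB} else H)"
  have "start F = H \<longleftrightarrow> F = F0" if "F \<in> \<F>" for F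
    using that H(2) cluster(4)[OF that] by (auto simp: start_def F0_def)
  moreover have "F0 \<in> \<F>" using H cluster(2) by (auto simp: F0_def)
  ultimately have "{e \<in> edges G. tail G e = \<nu> H} = {\<nu> F0}" by auto
  then have t: "card {e \<in> edges G. tail G e = \<nu> H} = 1" by simp
  have "{e \<in> edges G. head G e = \<nu> H} = \<nu> ` ?D" by auto
  then have h: "card {e \<in> edges G. head G e = \<nu> H} = card ?D"
    using card_image[OF inj_on_subset[OF inj subset_UNIV]] by simp
  have "2 \<le> card ?D + card ?K"
  proof (rule ccontr)
    assume "\<not> 2 \<le> card ?D + card ?K"
    then consider "card ?D = 0" "card ?K \<le> 1" | "card ?D = 1" "card ?K = 0" by linarith
    then show False
    proof cases
      case 1
      then have "?D = {}" by simp
      then have "H \<subseteq> Leg ` ?K" using children_cover[OF H] by (metis Union_empty sup_bot_left)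
      then have "card H \<le> card (Leg ` ?K)" by (intro card_mono) simp_all
      also have "\<dots> \<le> card ?K" by (rule card_image_le) simp
      finally show False using card_node[OF H] 1(2) by linarith
    next
      case 2
      obtain F where F: "?D = {F}" using 2(1) by (auto simp: card_1_singleton_iff)
      have "?K = {}" using 2(2) by simp
      then have "H \<subseteq> F" using children_cover[OF H] unfolding F by simp
      moreover have "F \<in> \<F>" "parent F = H" using F by auto
      ultimately show False using parent(2)[of F] by blast
    qed
  qed
  then show ?thesis unfolding valence_def t h by simp
qed

lemma elliptic_G: "elliptic_graph G"
  unfolding elliptic_graph_def
proof (intro conjI ballI)
  show "\<exists>!C. \<exists>vs es. simple_cycle G vs es \<and> C = set es" using unicyclic_graph.one_cycle[OF unicyclic_G] .
  fix v assume "v \<in> verts G"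
  then obtain H where "H \<in> nodes" "H \<noteq> {LB}" "v = \<nu> H" by auto
  then show "3 \<le> valence G v" using valence_G by simp
qed (rule wf_G connected_G)+

lemma cut_graph: "vertex_cut_graph G (\<nu> root) (\<nu> {LB}) {\<nu> {LB}} {} {}"
proof (rule vertex_cut_graph.intro[OF unicyclic_G vertex_cut_graph_axioms.intro])
  show "\<nu> root \<in> verts G" "\<nu> {LB} \<notin> verts G" using root_not_LB by simp_all
  show "{\<nu> {LB}} \<subseteq> {e \<in> edges G. tail G e = \<nu> root}" using cluster(2) by (simp add: start_def)
  have "cycle_edges G \<inter> {\<nu> {LB}} = {\<nu> {LB}}" using cluster(2) unfolding cycle_edges_G by auto
  then show "card (cycle_edges G \<inter> {\<nu> {LB}}) + card (cycle_edges G \<inter> {}) = 1" by simp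
qed simp_all

sublocale cut: vertex_cut_graph G "\<nu> root" "\<nu> {LB}" "{\<nu> {LB}}" "{}" "{}"
  by (rule cut_graph)

lemma tail_T: "F \<in> \<F> \<Longrightarrow> tail cut.T (\<nu> F) = \<nu> F"
  by (simp add: cut.tail_T start_def)

lemma bridge_T:
  assumes F: "F \<in> \<F>" shows "bridge cut.T (\<nu> F) (\<nu> ` {E \<in> nodes. E \<subseteq> F})"
  unfolding bridge_def
proof (intro conjI ballI)
  show "\<nu> F \<in> edges cut.T" using F by (simp add: cut.edges_T)
  fix e assume "e \<in> edges cut.T"
  then obtain E where E: "E \<in> \<F>" "e = \<nu> E" by (auto simp: cut.edges_T)
  have "tail cut.T e \<in> \<nu> ` {E \<in> nodes. E \<subseteq> F} \<longleftrightarrow> E \<subseteq> F" using E by (simp add: tail_T)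
  moreover have "head cut.T e \<in> \<nu> ` {E \<in> nodes. E \<subseteq> F} \<longleftrightarrow> E \<subset> F"
    using parent(1)[OF E(1)] parent_below[OF E(1) F] by (simp add: cut.head_T E(2))
  ultimately show "crosses cut.T (\<nu> ` {E \<in> nodes. E \<subseteq> F}) e \<longleftrightarrow> e = \<nu> F" unfolding crosses_def E(2) by auto
qed

lemma leaves_beyond:
  assumes F: "F \<in> \<F>" shows "{l. leaf cut.T l \<in> \<nu> ` {E \<in> nodes. E \<subseteq> F}} = F"
proof -
  have "leaf cut.T l \<in> \<nu> ` {E \<in> nodes. E \<subseteq> F} \<longleftrightarrow> l \<in> F" for l
  proof (cases l)
    case (Leg k)
    have "leaf cut.T l = \<nu> (base k)" unfolding Leg by (simp add: split_vertex_def)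
    moreover have "base k \<subseteq> F \<longleftrightarrow> Leg k \<in> F" using base(2)[of k] base(3)[of F k] F by blast
    ultimately show ?thesis using base(1) Leg by simp
  next
    case LA
    have "\<not> root \<subseteq> F" using node_subset_root[of F] cluster(4)[OF F] F by blast
    then show ?thesis using cluster(3)[OF F] LA by (simp add: cut.leaf_T)
  next
    case LB
    then show ?thesis using cluster(2) by (simp add: cut.leaf_T)
  qed
  then show ?thesis by blast
qed

lemma dist_T: "cls (dist_vec cut.T len) = (\<Sum>e\<in>edges G. len e *\<^sub>R ray (label e))"
proof -
  have "cls (dist_vec cut.T len) =
      (\<Sum>e\<in>edges cut.T. len e *\<^sub>R ray {l. leaf cut.T l \<in> \<nu> ` {E \<in> nodes. E \<subseteq> label e}})"
    by (rule dist_vec_splits[OF cut.wf_T cut.connected_T]) (use bridge_T in \<open>auto simp: cut.edges_T\<close>)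
  also have "\<dots> = (\<Sum>e\<in>edges G. len e *\<^sub>R ray (label e))"
    unfolding cut.edges_T
  proof (rule sum.cong[OF refl])
    fix e assume "e \<in> edges G"
    then obtain F where F: "F \<in> \<F>" "e = \<nu> F" by auto
    have "{l. leaf cut.T l \<in> \<nu> ` {E \<in> nodes. E \<subseteq> label e}} = label e"
      unfolding F(2) label_\<nu> by (rule leaves_beyond[OF F(1)])
    then show "len e *\<^sub>R ray {l. leaf cut.T l \<in> \<nu> ` {E \<in> nodes. E \<subseteq> label e}} = len e *\<^sub>R ray (label e)"
      by (rule arg_cong)
  qed
  finally show ?thesis .
qed

lemma curve_cone_T: "curve_cone G cut.T = half_open_cone circ (ray ` \<F>)"
proof -
  have "curve_cone G cut.T = half_open_cone circ ((\<lambda>e. ray (label e)) ` edges G - {0})"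
    by (rule curve_cone_clusters(1)) (use cut.cycle_edges_subset cluster(3) dist_T in \<open>auto simp: cycle_edges_G\<close>)
  moreover have "(\<lambda>e. ray (label e)) ` edges G = ray ` \<F>" by (simp add: image_image)
  moreover have "0 \<notin> ray ` \<F>" using cluster_rays_independent(2)[OF family] dependent_zero by blast
  ultimately show ?thesis by simp
qed

lemma cut_T: "vertex_cut G (\<nu> root) cut.T"
  unfolding vertex_cut_def using cut.v cut.St cut.Sh cut.Sl cut.one_end by blast

lemma dist_T_weights: "cls (dist_vec cut.T (\<lambda>e. c (label e))) = (\<Sum>F\<in>\<F>. c F *\<^sub>R ray F)"
proof -
  have "inj_on \<nu> \<F>" using inj inj_on_subset by blast
  then show ?thesis unfolding dist_T by (simp add: sum.reindex)
qed

end

lemma cluster_family_curve: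
  fixes \<F> :: "'n::finite leaf set set"
  assumes \<F>: "cluster_family \<F>"
  shows "\<exists>G v (T :: 'n leaf graph). elliptic_graph G \<and> vertex_cut G v T \<and>
    curve_cone G T = half_open_cone circ (ray ` \<F>) \<and>
    (\<forall>c. (\<forall>F\<in>\<F>. 0 < c F) \<longrightarrow>
      (\<exists>len. (\<forall>e\<in>edges G. 0 < len e) \<and> cls (dist_vec T len) = (\<Sum>F\<in>\<F>. c F *\<^sub>R ray F)))"
proof -
  obtain \<nu> :: "'n leaf set \<Rightarrow> nat" where \<nu>: "inj \<nu>"
    using finite_imp_inj_to_nat_seg[of "UNIV :: 'n leaf set set"] by auto
  interpret cluster_curve \<F> \<nu> by (rule cluster_curve.intro[OF \<F> \<nu>])
  have "\<exists>len. (\<forall>e\<in>edges G. 0 < len e) \<and> cls (dist_vec cut.T len) = (\<Sum>F\<in>\<F>. c F *\<^sub>R ray F)"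
    if c: "\<forall>F\<in>\<F>. 0 < c F" for c :: "'n leaf set \<Rightarrow> real"
  proof -
    have "\<forall>e\<in>edges G. 0 < c (label e)" using c by auto
    then show ?thesis using dist_T_weights[of c] by (intro exI[of _ "\<lambda>e. c (label e)"]) blast
  qed
  then show ?thesis using elliptic_G cut_T curve_cone_T by blast
qed

section \<open>The polyhedra of \<open>X\<^sub>n\<close>\<close>

interpretation simplices: cone_complex circ "Vlat :: 'n::finite vn set" simplices
  by (rule cone_complex_simplices)

lemma circ_Gn: "g \<in> carrier Gn \<Longrightarrow> circ (g x) = circ x"
  using acts_as_Gn acts_asD(2) by blast

lemma image_cone:
  assumes "g \<in> carrier Gn" shows "g ` half_open_cone circ B = half_open_cone circ (g ` B)"
  by (intro half_open_cone_image linear_Gn[OF assms] inj_on_subset[OF inj_Gn[OF assms]] subset_UNIV circ_Gn[OF assms])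

lemma Xn_polys_simplices: "Xn_polys = half_open_cone circ ` (simplices :: 'n::finite vn set set)"
proof (intro equalityI subsetI)
  fix \<sigma> :: "'n vn set" assume "\<sigma> \<in> Xn_polys"
  then obtain g G v T where *: "\<sigma> = g ` curve_cone G T" "g \<in> carrier Gn" "elliptic_graph G" "vertex_cut G v T"
    unfolding Xn_polys_def by blast
  obtain B where B: "B \<in> simplices" "curve_cone G T = half_open_cone circ B"
    using vertex_cut_simplex[OF *(3,4)] by blast
  show "\<sigma> \<in> half_open_cone circ ` simplices"
    unfolding *(1) B(2) image_cone[OF *(2)] using simplex_image[OF *(2) B(1)] by blast
next
  fix \<sigma> :: "'n vn set" assume "\<sigma> \<in> half_open_cone circ ` simplices"
  then obtain B where B: "B \<in> simplices" "\<sigma> = half_open_cone circ B" by blast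
  obtain h \<F> where h: "h \<in> carrier Gn" "cluster_family \<F>" "B = h ` ray ` \<F>"
    by (rule simplex_some_normal_form[OF B(1)])
  obtain G v T where G: "elliptic_graph G" "vertex_cut G v T" "curve_cone G T = half_open_cone circ (ray ` \<F>)"
    using cluster_family_curve[OF h(2)] by blast
  have "\<sigma> = h ` curve_cone G T" unfolding B(2) h(3) G(3) image_cone[OF h(1)] ..
  then show "\<sigma> \<in> Xn_polys" unfolding Xn_polys_def using h(1) G(1,2) by blast
qed

text \<open>
  A cone determines its simplex, so all cuts with the same cone induce the same lattice.
\<close>

lemma Xn_lat_simplex:
  fixes B :: "'n::finite vn set"
  assumes B: "B \<in> simplices" shows "Xn_lat (half_open_cone circ B) = int_span B"
proof (intro equalityI subsetI)
  fix x assume "x \<in> Xn_lat (half_open_cone circ B)"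
  then obtain g G T v k where *: "x = g (cls (dist_vec T (\<lambda>e. of_int (k e))))" "g \<in> carrier Gn"
    "elliptic_graph G" "vertex_cut G v T" "half_open_cone circ B = g ` curve_cone G T"
    unfolding Xn_lat_def by blast
  obtain C where C: "C \<in> simplices" "curve_cone G T = half_open_cone circ C"
    "{cls (dist_vec T (\<lambda>e. of_int (k e))) | k. True} = int_span C"
    using vertex_cut_simplex[OF *(3,4)] by blast
  have "half_open_cone circ B = half_open_cone circ (g ` C)" unfolding *(5) C(2) image_cone[OF *(2)] ..
  then have "B = g ` C" using simplices.K_eq_iff[OF B simplex_image[OF *(2) C(1)]] by blast
  moreover have "cls (dist_vec T (\<lambda>e. of_int (k e))) \<in> int_span C" unfolding C(3)[symmetric] by blast
  then have "x \<in> g ` int_span C" unfolding *(1) by (rule imageI)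
  ultimately show "x \<in> int_span B"
    using int_span_image[OF linear_Gn[OF *(2)] inj_on_subset[OF inj_Gn[OF *(2)] subset_UNIV]] by simp
next
  fix x assume x: "x \<in> int_span B"
  obtain h \<F> where h: "h \<in> carrier Gn" "cluster_family \<F>" "B = h ` ray ` \<F>"
    by (rule simplex_some_normal_form[OF B])
  obtain G v T where G: "elliptic_graph G" "vertex_cut G v T" "curve_cone G T = half_open_cone circ (ray ` \<F>)"
    using cluster_family_curve[OF h(2)] by blast
  obtain C where C: "C \<in> simplices" "curve_cone G T = half_open_cone circ C"
    "{cls (dist_vec T (\<lambda>e. of_int (k e))) | k. True} = int_span C"
    using vertex_cut_simplex[OF G(1,2)] by blast
  have "C = ray ` \<F>" using simplices.K_eq_iff[OF C(1) cluster_family_simplex[OF h(2)]] C(2) G(3) by simp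
  then have "x \<in> h ` int_span C"
    using x int_span_image[OF linear_Gn[OF h(1)] inj_on_subset[OF inj_Gn[OF h(1)] subset_UNIV]] h(3) by simp
  then obtain k where "x = h (cls (dist_vec T (\<lambda>e. of_int (k e))))" unfolding C(3)[symmetric] by blast
  moreover have "half_open_cone circ B = h ` curve_cone G T" unfolding h(3) G(3) image_cone[OF h(1)] ..
  ultimately show "x \<in> Xn_lat (half_open_cone circ B)" unfolding Xn_lat_def using h(1) G(1,2) by blast
qed

lemma basis_ray_in_simplex:
  assumes "j \<in> basis_index" shows "\<exists>B\<in>simplices. basis_ray j \<in> B"
proof -
  have simplex: "ray ` {{LB}, F} - {0} \<in> simplices" if "LA \<notin> F" for F :: "'a leaf set"
  proof (rule laminar_leaf_sets_simplex)
    show "laminar {{LB}, F}" unfolding laminar_def by auto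
  qed (use that in auto)
  have ne: "basis_ray j \<noteq> 0"
    using basis_dual_ray[OF assms assms] linear_0[OF linear_basis_dual, of j] by auto
  have "\<exists>F. basis_ray j = ray F \<and> LA \<notin> F"
  proof -
    consider "j = Inl None" | m where "j = Inl (Some m)" | S where "j = Inr S"
      by (cases j) (metis option.exhaust, metis)
    then show ?thesis
    proof cases
      case 1 then show ?thesis by (intro exI[of _ "{LB}"]) (simp add: basis_ray_def)
    next
      case (2 m) then show ?thesis by (intro exI[of _ "{LB, Leg m}"]) (simp add: basis_ray_def)
    next
      case (3 S) then show ?thesis by (intro exI[of _ "Leg ` S"]) (auto simp: basis_ray_def)
    qed
  qed
  then obtain F where F: "basis_ray j = ray F" "LA \<notin> F" by blast
  have "basis_ray j \<in> ray ` {{LB}, F} - {0}" using F(1) ne by simp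
  then show ?thesis by (rule bexI[OF _ simplex[OF F(2)]])
qed

lemma Vn_lat_Vlat: "Vn_lat = (Vlat :: 'n::finite vn set)"
proof (intro equalityI subsetI)
  have sub: "(\<Union>\<sigma>\<in>Xn_polys. Xn_lat \<sigma>) \<subseteq> (Vlat :: 'n vn set)"
    using Xn_lat_simplex simplex_saturated unfolding Xn_polys_simplices by auto
  fix x :: "'n vn" assume "x \<in> Vn_lat"
  then obtain B k where x: "x = (\<Sum>b\<in>B. of_int (k b) *\<^sub>R b)" "B \<subseteq> (\<Union>\<sigma>\<in>Xn_polys. Xn_lat \<sigma>)"
    unfolding Vn_lat_def by blast
  show "x \<in> Vlat" unfolding x(1) by (rule Vlat_sum) (rule subsetD[OF subset_trans[OF x(2) sub]])
next
  fix x :: "'n vn" assume "x \<in> Vlat"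
  then obtain k :: "'n vn \<Rightarrow> int" where k: "x = (\<Sum>b\<in>basis_ray ` basis_index. of_int (k b) *\<^sub>R b)"
    unfolding Vlat_basis(1) int_span_def by blast
  have "basis_ray ` basis_index \<subseteq> (\<Union>\<sigma>\<in>Xn_polys. Xn_lat \<sigma> :: 'n vn set)"
  proof
    fix b :: "'n vn" assume "b \<in> basis_ray ` basis_index"
    then obtain j where "j \<in> basis_index" "b = basis_ray j" by blast
    then obtain B where B: "B \<in> simplices" "b \<in> B" using basis_ray_in_simplex[of j] by blast
    then have "b \<in> Xn_lat (half_open_cone circ B)"
      using Xn_lat_simplex[OF B(1)] int_span_superset[OF simplices.finite_simplex[OF B(1)]] by blast
    then show "b \<in> (\<Union>\<sigma>\<in>Xn_polys. Xn_lat \<sigma>)" using B(1) unfolding Xn_polys_simplices by blast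
  qed
  moreover have "finite (basis_ray ` basis_index :: 'n vn set)" by simp
  ultimately show "x \<in> Vn_lat" unfolding Vn_lat_def k by blast
qed

lemma Psi_eq: "Psi x = {g x | g. g \<in> carrier Gn}"
  by (simp add: Psi_def orbit_def)

lemma Psi_image:
  assumes g: "g \<in> carrier Gn" shows "Psi (g x) = Psi x"
proof -
  obtain h where h: "h \<in> carrier Gn" "\<And>x. h (g x) = x" "\<And>x. g (h x) = x"
    using subgroup_BijGroup_inverse[OF subgroup_Gn g] by blast
  have "f (g x) = (f \<circ> g) x" for f by simp
  moreover have "f x = (f \<circ> h) (g x)" for f by (simp add: h(2))
  ultimately show ?thesis unfolding Psi_eq using comp_Gn[OF _ g] comp_Gn[OF _ h(1)] by blast
qed

lemma curve_iso_refl: "elliptic_curve (G, len) \<Longrightarrow> ((G, len), (G, len)) \<in> curve_iso"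
  by (auto simp: curve_iso_def intro!: exI[of _ id])

text \<open>
  Cuts of curves lie in cones by \<open>curve_cut_in_simplex\<close>. Conversely, a point of a cone has
  positive coordinates with respect to some subset of the rays, and these are the edge lengths of
  a curve.
\<close>

lemma Xn_set_polys: "Xn_set = \<Union>(Xn_polys :: 'n::finite vn set set)"
proof (intro equalityI subsetI)
  fix x :: "'n vn" assume "x \<in> Xn_set"
  then obtain c where c: "c \<in> M1" "Psi x \<in> dist_n c" unfolding Xn_set_def by blast
  then obtain C T len where C: "Psi x = Psi (cls (dist_vec T len))" "C \<in> c" "curve_cut C (T, len)"
    unfolding dist_n_def by blast
  obtain D where "c = curve_iso `` {D}" using c(1) unfolding M1_def by (rule quotientE)
  then have "(D, C) \<in> curve_iso" using C(2) by simp
  then have "elliptic_curve C" unfolding curve_iso_def by auto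
  then obtain B where B: "B \<in> simplices" "cls (dist_vec T len) \<in> half_open_cone circ B"
    using curve_cut_in_simplex[of "fst C" "snd C"] C(3) by auto
  have "x \<in> Psi x" unfolding Psi_eq using id_Gn by (metis (mono_tags, lifting) id_apply mem_Collect_eq)
  then have "x \<in> Psi (cls (dist_vec T len))" by (simp only: C(1))
  then obtain g where g: "g \<in> carrier Gn" "x = g (cls (dist_vec T len))" unfolding Psi_eq by blast
  then have "x \<in> half_open_cone circ (g ` B)" using B(2) image_cone[OF g(1), of B] by blast
  then show "x \<in> \<Union>Xn_polys" unfolding Xn_polys_simplices using simplex_image[OF g(1) B(1)] by blast
next
  fix x :: "'n vn" assume "x \<in> \<Union>Xn_polys"
  then obtain B where B: "B \<in> simplices" "x \<in> half_open_cone circ B" unfolding Xn_polys_simplices by blast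
  then obtain S where S: "S \<in> simplices" "positive_on S x"
    using simplices.K_iff_interior[OF B(1)] unfolding simplices.interior_point_def by blast
  obtain h \<F> where h: "h \<in> carrier Gn" "cluster_family \<F>" "S = h ` ray ` \<F>"
    by (rule simplex_some_normal_form[OF S(1)])
  obtain c where c: "\<forall>b\<in>S. 0 < c b" "x = (\<Sum>b\<in>S. c b *\<^sub>R b)" using S(2) unfolding positive_on_def by blast
  define w where "w F = c (h (ray F))" for F
  have w: "\<forall>F\<in>\<F>. 0 < w F" using c(1) unfolding h(3) w_def by blast
  obtain G v T where G: "elliptic_graph G" "vertex_cut G v T"
    "\<forall>c. (\<forall>F\<in>\<F>. 0 < c F) \<longrightarrow>
      (\<exists>len. (\<forall>e\<in>edges G. 0 < len e) \<and> cls (dist_vec T len) = (\<Sum>F\<in>\<F>. c F *\<^sub>R ray F))"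
    using cluster_family_curve[OF h(2)] by blast
  obtain len where len: "\<forall>e\<in>edges G. 0 < len e" "cls (dist_vec T len) = (\<Sum>F\<in>\<F>. w F *\<^sub>R ray F)"
    using G(3)[rule_format, of w] w by blast
  have inj: "inj_on (\<lambda>F. h (ray F)) \<F>"
    using comp_inj_on[OF cluster_rays_independent(1)[OF h(2)] inj_on_subset[OF inj_Gn[OF h(1)] subset_UNIV]]
    by (simp add: comp_def)
  have "x = (\<Sum>F\<in>\<F>. w F *\<^sub>R h (ray F))"
    unfolding c(2) h(3) image_image w_def by (simp add: sum.reindex[OF inj])
  also have "\<dots> = h (cls (dist_vec T len))"
    unfolding len(2) by (simp add: linear_sum[OF linear_Gn[OF h(1)]] linear_scale[OF linear_Gn[OF h(1)]])
  finally have "Psi x = Psi (cls (dist_vec T len))" using Psi_image[OF h(1)] by simp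
  moreover have C: "elliptic_curve (G, len)" using G(1) len(1) by (simp add: elliptic_curve_def)
  moreover have "curve_cut (G, len) (T, len)" unfolding curve_cut_def using G(2) by blast
  ultimately have "Psi x \<in> dist_n (curve_iso `` {(G, len)})"
    unfolding dist_n_def using curve_iso_refl[OF C] by blast
  moreover have "curve_iso `` {(G, len)} \<in> M1" unfolding M1_def using C by (intro quotientI) simp
  ultimately show "x \<in> Xn_set" unfolding Xn_set_def by blast
qed

section \<open>\<open>X\<^sub>n / G\<^sub>n\<close> is a tropical orbit space\<close>

text \<open>
  The sum of the rays lies in no proper face, so that the choice in the definition of the star
  chart succeeds.
\<close>

lemma rel_int_nonempty:
  assumes B: "B \<in> simplices" shows "\<Sum>B \<in> half_open_cone circ B - \<Union>{\<rho> \<in> Xn_polys. \<rho> \<subset> half_open_cone circ B}"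
proof
  have B': "simplices.interior_point B (\<Sum>B)"
    using B positive_on_sum unfolding simplices.interior_point_def by blast
  show "\<Sum>B \<in> half_open_cone circ B" using simplices.sum_in_K[OF B] .
  show "\<Sum>B \<notin> \<Union>{\<rho> \<in> Xn_polys. \<rho> \<subset> half_open_cone circ B}"
  proof
    assume "\<Sum>B \<in> \<Union>{\<rho> \<in> Xn_polys. \<rho> \<subset> half_open_cone circ B}"
    then obtain C where C: "C \<in> simplices" "\<Sum>B \<in> half_open_cone circ C"
      "half_open_cone circ C \<subset> half_open_cone circ B" unfolding Xn_polys_simplices by blast
    then obtain S where S: "S \<subseteq> C" "simplices.interior_point S (\<Sum>B)"
      using simplices.K_iff_interior[OF C(1)] by blast
    have "S = B" using S(2) B' simplices.disjoint_interiors unfolding simplices.interior_point_def by blast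
    then have "half_open_cone circ B \<subseteq> half_open_cone circ C"
      using S(1) simplices.K_subset_iff[OF B C(1)] by simp
    then show False using C(3) by blast
  qed
qed

lemma cone_complex_gpc_Xn: "cone_complex_gpc circ Vlat simplices (Xn :: ('n::finite vn, 'n vn) gpc)"
proof (rule cone_complex_gpc.intro[OF cone_complex_simplices cone_complex_gpc_axioms.intro])
  show "gtop (Xn :: ('n vn, 'n vn) gpc) = subtopology lin_topology (\<Union>(half_open_cone circ ` simplices))"
    by (simp add: Xn_def Xn_set_polys Xn_polys_simplices)
  show "polys (Xn :: ('n vn, 'n vn) gpc) = half_open_cone circ ` simplices"
    by (simp add: Xn_def Xn_polys_simplices)
  show "chart (Xn :: ('n vn, 'n vn) gpc) = (\<lambda>\<sigma> x. x)" by (simp add: Xn_def)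
  show "star_lat (Xn :: ('n vn, 'n vn) gpc) = (\<lambda>\<sigma>. Vlat)" by (simp add: Xn_def Vn_lat_Vlat)
  fix B :: "'n vn set" assume B: "B \<in> simplices"
  show "lat Xn (half_open_cone circ B) = int_span B" using Xn_lat_simplex[OF B] by (simp add: Xn_def)
  let ?b = "SOME b. b \<in> half_open_cone circ B - \<Union>{\<rho> \<in> Xn_polys. \<rho> \<subset> half_open_cone circ B}"
  have "?b \<in> rel_int Xn (half_open_cone circ B)"
    using someI[of "\<lambda>b. b \<in> half_open_cone circ B - \<Union>{\<rho> \<in> Xn_polys. \<rho> \<subset> half_open_cone circ B}", OF rel_int_nonempty[OF B]]
    by (simp add: rel_int_def Xn_def)
  moreover have "star_chart Xn (half_open_cone circ B) = (\<lambda>x. x - ?b)" by (simp add: Xn_def)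
  ultimately show "\<exists>b\<in>rel_int Xn (half_open_cone circ B). star_chart Xn (half_open_cone circ B) = (\<lambda>x. x - b)"
    by (rule bexI[rotated])
qed

lemma cone_complex_action_Xn:
  "cone_complex_action circ Vlat simplices (Xn :: ('n::finite vn, 'n vn) gpc) (carrier Gn) (CARD('n))"
proof (rule cone_complex_action.intro[OF cone_complex_gpc_Xn cone_complex_action_axioms.intro])
  show "subgroup (carrier (Gn :: ('n vn \<Rightarrow> 'n vn) monoid)) (BijGroup UNIV)" by (rule subgroup_Gn)
  show "linear g" "g ` Vlat \<subseteq> Vlat" "circ (g x) = circ x" if "g \<in> carrier Gn" for g and x :: "'n vn"
    using linear_Gn[OF that] image_Vlat[OF that] circ_Gn[OF that] by auto
  show "g ` B \<in> simplices" if "g \<in> carrier Gn" "B \<in> simplices" for g and B :: "'n vn set"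
    using simplex_image[OF that] .
  show "finite {g \<in> carrier Gn. g x = x}" if "0 < circ x" for x :: "'n vn" using finite_stabilizer_Gn[OF that] .
  show "\<exists>\<Delta>0. finite \<Delta>0 \<and> (\<forall>B\<in>simplices. \<exists>g\<in>carrier Gn. \<exists>C\<in>\<Delta>0. C \<in> simplices \<and> B = (g :: 'n vn \<Rightarrow> 'n vn) ` C)"
  proof (intro exI[of _ "(\<lambda>\<F>. ray ` \<F>) ` {\<F>. cluster_family \<F>}"] conjI ballI)
    show "finite ((\<lambda>\<F>. ray ` \<F> :: 'n vn set) ` {\<F>. cluster_family \<F>})" by simp
    fix B :: "'n vn set" assume "B \<in> simplices"
    then obtain h \<F> where h: "h \<in> carrier Gn" "cluster_family \<F>" "B = h ` ray ` \<F>"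
      by (rule simplex_some_normal_form)
    then show "\<exists>g\<in>carrier Gn. \<exists>C\<in>(\<lambda>\<F>. ray ` \<F>) ` {\<F>. cluster_family \<F>}. C \<in> simplices \<and> B = g ` C"
      using cluster_family_simplex[OF h(2)] by blast
  qed
qed (fact card_simplex_le simplex_in_facet balance_codimension_one)+

theorem proposition3p12:
  shows "tropical_orbit_space (Xn :: ('n::finite vn, 'n vn) gpc) Gn Gn_act (\<lambda>\<sigma>. 1)"
proof -
  interpret cone_complex_action circ Vlat simplices "Xn :: ('n vn, 'n vn) gpc" "carrier Gn" "CARD('n)"
    by (rule cone_complex_action_Xn)
  have "G = Gn" unfolding G_def by (simp add: Gn_def)
  moreover have "act = Gn_act"
    by (rule ext) (simp add: act_def Gn_act_def Xn_set_polys Xn_polys_simplices)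
  ultimately show ?thesis using tropical_orbit_space_X by simp
qed

end
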